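(* Assume $X_t\in\mathcal{L}^p$, $p>4$, $\mathbb{E}X_t=0$, and $\Theta_p(m)=O(m^{-\alpha})$ for some $\alpha>0$. Set $c_p=(p+4)e^{p/4}\Theta_4^2$. For any $M>1$, let $x_T=2c_p\sqrt{TMB_T\log B_T}$. Assume that $B_T\to\infty$ and $B_T=O(T^\gamma)$ for some $0<\gamma<1$. Then for any $\gamma<\beta<1$, there exists a constant $C_{p,M,\beta}>0$ such that, for all $T\ge 2$, $$P\left(|\mathbb{E}_0Q_T|\ge x_T\right)\le C_{p,M,\beta}\,x_T^{-p/2}(\log T)\left[(TB_T)^{p/4}T^{-\alpha\beta p/2}+TB_T^{p/2-1-\alpha\beta p/2}+T\right]+C_{p,M,\beta}\,B_T^{-M}.$$
   Context: Let $\varepsilon_t$, $t\in\mathbb{Z}$, be i.i.d. random variables and let $g$ be a measurable real-valued function such that $X_t = g(\varepsilon_t,\varepsilon_{t-1},\ldots)$ is well defined; $(X_t)_{t\in\mathbb{Z}}$ is then a stationary process. Write $\|X\|_p = (\mathbb{E}|X|^p)^{1/p}$ and $X\in\mathcal{L}^p$ if $\|X\|_p<\infty$. Let $(\varepsilon_t')_{t\in\mathbb{Z}}$ be an independent i.i.d. copy of $(\varepsilon_t)_{t\in\mathbb{Z}}$. For $t\ge 0$ let $X_t' = g(\varepsilon_t,\ldots,\varepsilon_1,\varepsilon_0',\varepsilon_{-1},\ldots)$, i.e. $\varepsilon_0$ is replaced by $\varepsilon_0'$. For $p>0$ define $\delta_p(t) = \|X_t-X_t'\|_p$ for $t\ge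 0$, and $\Theta_p(m) = \sum_{t=m}^\infty \delta_p(t)$ for $m\ge 0$, $\Theta_p = \Theta_p(0)$. Standing assumption: $\Theta_p<\infty$. Centering operator: $\mathbb{E}_0(X)=X-\mathbb{E}X$. The quadratic form is $Q_T=\sum_{1\le s\le t\le T}a_{s,t}X_sX_t$, where the real coefficients $a_{s,t}=a_{T,s,t}$ may depend on $T$ and satisfy $\sup_{s,t}|a_{s,t}|\le 1$ and $a_{s,t}=0$ whenever $|s-t|>B_T$; here $(B_T)$ is a sequence of positive integers. The constant $C_{p,M,\beta}$ does not depend on $T$ or on the coefficients $a_{s,t}$ (it may depend on the process and on the rates in the assumptions). If $B_T=1$, so that $x_T=0$, the right-hand side is read as $+\infty$. *)

theory Defs
  imports "HOL-Probability.Probability"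
begin

text \<open>
  An i.i.d. family indexed by the integers, with values in an arbitrary measurable space \<open>N\<close>.
  Measurability of each variable is part of \<^const>\<open>prob_space.indep_vars\<close>.
\<close>

definition iid :: "'a measure \<Rightarrow> 'e measure \<Rightarrow> (int \<Rightarrow> 'a \<Rightarrow> 'e) \<Rightarrow> bool" where
  "iid \<Omega> N \<epsilon> \<longleftrightarrow>
     prob_space.indep_vars \<Omega> (\<lambda>_. N) \<epsilon> UNIV \<and>
     (\<forall>s t. distr \<Omega> N (\<epsilon> s) = distr \<Omega> N (\<epsilon> t))"

definition independent_copy ::
    "'a measure \<Rightarrow> 'e measure \<Rightarrow> (int \<Rightarrow> 'a \<Rightarrow> 'e) \<Rightarrow> (int \<Rightarrow> 'a \<Rightarrow> 'e) \<Rightarrow> bool" where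
  "independent_copy \<Omega> N \<epsilon> \<epsilon>' \<longleftrightarrow>
     (let S = (\<Pi>\<^sub>M t\<in>(UNIV :: int set). N) in
        distr \<Omega> S (\<lambda>\<omega> t. \<epsilon>' t \<omega>) = distr \<Omega> S (\<lambda>\<omega> t. \<epsilon> t \<omega>) \<and>
        prob_space.indep_var \<Omega> S (\<lambda>\<omega> t. \<epsilon> t \<omega>) S (\<lambda>\<omega> t. \<epsilon>' t \<omega>))"

definition causal ::
    "((nat \<Rightarrow> 'e) \<Rightarrow> real) \<Rightarrow> (int \<Rightarrow> 'a \<Rightarrow> 'e) \<Rightarrow> int \<Rightarrow> 'a \<Rightarrow> real" where
  "causal g \<epsilon> t \<omega> = g (\<lambda>i. \<epsilon> (t - int i) \<omega>)"

text \<open>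
  The norm \<open>(E|Y|\<^sup>p)\<^sup>1\<^sup>/\<^sup>p\<close> takes the value \<open>\<infinity>\<close> when the moment is infinite,
  which a Bochner integral would silently replace by 0.
\<close>

definition Lp_norm :: "'a measure \<Rightarrow> real \<Rightarrow> ('a \<Rightarrow> real) \<Rightarrow> ennreal" where
  "Lp_norm \<Omega> p Y =
     (let I = (\<integral>\<^sup>+ \<omega>. ennreal (\<bar>Y \<omega>\<bar> powr p) \<partial>\<Omega>) in
        if I = \<infinity> then \<infinity> else ennreal (enn2real I powr (1 / p)))"

definition in_Lp :: "'a measure \<Rightarrow> real \<Rightarrow> ('a \<Rightarrow> real) \<Rightarrow> bool" where
  "in_Lp \<Omega> p Y \<longleftrightarrow> Y \<in> borel_measurable \<Omega> \<and> Lp_norm \<Omega> p Y < \<infinity>"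

definition dep_delta ::
    "'a measure \<Rightarrow> ((nat \<Rightarrow> 'e) \<Rightarrow> real) \<Rightarrow> (int \<Rightarrow> 'a \<Rightarrow> 'e) \<Rightarrow> (int \<Rightarrow> 'a \<Rightarrow> 'e) \<Rightarrow>
     real \<Rightarrow> nat \<Rightarrow> ennreal" where
  "dep_delta \<Omega> g \<epsilon> \<epsilon>' p t =
     Lp_norm \<Omega> p (\<lambda>\<omega>. causal g \<epsilon> (int t) \<omega> - causal g (\<epsilon>(0 := \<epsilon>' 0)) (int t) \<omega>)"

definition dep_Theta ::
    "'a measure \<Rightarrow> ((nat \<Rightarrow> 'e) \<Rightarrow> real) \<Rightarrow> (int \<Rightarrow> 'a \<Rightarrow> 'e) \<Rightarrow> (int \<Rightarrow> 'a \<Rightarrow> 'e) \<Rightarrow>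
     real \<Rightarrow> nat \<Rightarrow> ennreal" where
  "dep_Theta \<Omega> g \<epsilon> \<epsilon>' p m = (\<Sum>t. dep_delta \<Omega> g \<epsilon> \<epsilon>' p (m + t))"

definition centered :: "'a measure \<Rightarrow> ('a \<Rightarrow> real) \<Rightarrow> 'a \<Rightarrow> real" where
  "centered \<Omega> Y \<omega> = Y \<omega> - prob_space.expectation \<Omega> Y"

definition quad_form ::
    "(nat \<Rightarrow> nat \<Rightarrow> real) \<Rightarrow> (int \<Rightarrow> 'a \<Rightarrow> real) \<Rightarrow> nat \<Rightarrow> 'a \<Rightarrow> real" where
  "quad_form a X T \<omega> = (\<Sum>t=1..T. \<Sum>s=1..t. a s t * X (int s) \<omega> * X (int t) \<omega>)"

definition banded_coeffs :: "(nat \<Rightarrow> nat) \<Rightarrow> (nat \<Rightarrow> nat \<Rightarrow> nat \<Rightarrow> real) \<Rightarrow> bool" where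
  "banded_coeffs B a \<longleftrightarrow>
     (\<forall>T. \<forall>s\<in>{1..T}. \<forall>t\<in>{1..T}.
        \<bar>a T s t\<bar> \<le> 1 \<and> (\<bar>int s - int t\<bar> > int (B T) \<longrightarrow> a T s t = 0))"

text \<open>The argument \<open>\<Theta>\<^sub>4\<close> stands for the value of \<open>dep_Theta\<close> at \<open>p = 4\<close>, \<open>m = 0\<close>.\<close>

definition threshold :: "real \<Rightarrow> real \<Rightarrow> real \<Rightarrow> (nat \<Rightarrow> nat) \<Rightarrow> nat \<Rightarrow> real" where
  "threshold \<Theta>\<^sub>4 p M B T =
     (let c = (p + 4) * exp (p / 4) * \<Theta>\<^sub>4\<^sup>2 in
        2 * c * sqrt (real T * M * real (B T) * ln (real (B T))))"

text \<open>
  The negative power of \<open>x\<close> in the bound is read as \<open>\<infinity>\<close> at \<open>x = 0\<close> (whereas \<open>0 powr q = 0\<close>),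
  so the bound is \<open>\<infinity>\<close> there; its other factors are positive for \<open>T \<ge> 2\<close>.
\<close>

definition tail_bound ::
    "real \<Rightarrow> real \<Rightarrow> real \<Rightarrow> real \<Rightarrow> real \<Rightarrow> (nat \<Rightarrow> nat) \<Rightarrow> real \<Rightarrow> nat \<Rightarrow> ereal" where
  "tail_bound C p M \<alpha> \<beta> B x T =
     (if x = 0 then \<infinity>
      else ereal
        (C * x powr (- p / 2) * ln (real T) *
           ((real T * real (B T)) powr (p / 4) * real T powr (- \<alpha> * \<beta> * p / 2)
            + real T * real (B T) powr (p / 2 - 1 - \<alpha> * \<beta> * p / 2)
            + real T)
         + C * real (B T) powr (- M)))"

end

theory Submission
  imports Defs
begin

text \<open>By distribution the process may be realized on the product space of the innovations, where
 conditional expectations are integrals over resampled coordinates and independence means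
 dependence on disjoint sets of coordinates.  On that space \<open>martingale_le\<close> bounds moments by
 the effect of resampling one innovation at a time.

 Cut \<open>{1..T}\<close> into blocks of dyadic length \<open>L\<close> of order \<open>T powr beta\<close>, which is larger than the
 bandwidth by a power of \<open>T\<close>, and average each block over the innovations that are older than the
 preceding block.  The total error has moment of order \<open>p / 2\<close> at most a constant times
 \<open>sqrt (T * B) * L powr (- alpha)\<close>, since the errors of the blocks are sums of martingale
 differences (\<open>recent_error_le\<close>); Markov's inequality turns this into the first term of the bound.

 After averaging, the even blocks are independent, and so are the odd ones;
 \<open>independent_sum_tail\<close> splits the event.  The sum of the truncated blocks has a Gaussian tail,
 where the variance bound uses only \<open>\<Theta>\<^sub>4\<close> and explicit constants (1 and 4) in the moment
 inequality; the constant in the threshold makes it at most \<open>B powr (- M)\<close>.  Many blocks exceed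
 the truncation level only with a probability that is negligible, being a high power of a small
 one.  What remains is one block that is as large as the threshold up to a constant.

 The level is then larger than the standard deviation of that block by a power of \<open>T\<close>, and
 \<open>block_tail_exists\<close> bounds its tail by a power law.  The lags are sorted by their dyadic order
 \<open>r = 2 ^ i\<close>.  For one order, a sum over a block is built up through dyadic scales from \<open>r\<close> to \<open>L\<close>:
 at every scale the correction is a sum of nearly independent vectors, so that it is large only if
 one summand is (\<open>prob_norm_multiscale\<close>), and a summand has a small moment of order \<open>p / 2\<close>.  At
 the finest scale the two time indices are separated by a gap of length \<open>r\<close>, so that the
 form is nearly bilinear in independent stretches (\<open>qform_decoupling_le\<close>) and, given the first
 stretch, linear in a process with moments of order \<open>p\<close> (\<open>chaos_tail_exists\<close>).  Summed over
 scales and orders, these moments are dominated by the extreme scales (\<open>powr_scales_le\<close>), which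
 gives the first term again and the other two.\<close>

section \<open>Moment bounds\<close>

lemmas LINT_cong = Bochner_Integration.integral_cong and LINT_sum = Bochner_Integration.integral_sum
 and LINT_diff = Bochner_Integration.integral_diff and LINT_add = Bochner_Integration.integral_add

text \<open>An upper bound \<open>c\<close> on the \<open>q\<close>-norm.  Bounds rather than norms are the basic notion because
 they carry measurability and finiteness along in every step.\<close>

definition Lq_le :: "'a measure => real => ('a => real) => real => bool" where
 "Lq_le M q f c \<longleftrightarrow> f : borel_measurable M & 0 <= c &
   (\<integral>\<^sup>+ x. ennreal (\<bar>f x\<bar> powr q) \<partial>M) <= ennreal (c powr q)"

lemma Lq_le_measurable [measurable_dest]: "Lq_le M q f c ==> f : borel_measurable M" by (simp add: Lq_le_def)

lemma Lq_le_nonneg: "Lq_le M q f c ==> 0 <= c" by (simp add: Lq_le_def)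

lemma Lq_le_mono: "Lq_le M q f c ==> c <= d ==> 0 <= q ==> Lq_le M q f d"
 unfolding Lq_le_def by (meson ennreal_leI order_trans powr_mono2)

lemma Lq_le_dominated:
 assumes "Lq_le M q g c" "f : borel_measurable M" "AE x in M. \<bar>f x\<bar> <= \<bar>g x\<bar>" "0 <= q"
 shows "Lq_le M q f c"
proof -
 have "(\<integral>\<^sup>+ x. ennreal (\<bar>f x\<bar> powr q) \<partial>M) <= (\<integral>\<^sup>+ x. ennreal (\<bar>g x\<bar> powr q) \<partial>M)"
 proof (rule nn_integral_mono_AE)
  show "AE x in M. ennreal (\<bar>f x\<bar> powr q) <= ennreal (\<bar>g x\<bar> powr q)"
   using assms(3) by eventually_elim (intro ennreal_leI powr_mono2, use assms in auto)
 qed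
 then show ?thesis using assms unfolding Lq_le_def by auto
qed

lemma Lq_le_cong_AE:
 assumes "Lq_le M q g c" "f : borel_measurable M" "AE x in M. f x = g x" "0 <= q"
 shows "Lq_le M q f c" using assms(3) by (intro Lq_le_dominated[OF assms(1,2) _ assms(4)]) auto

lemma Lq_le_zero: "0 <= c ==> Lq_le M q (%_. 0) c"
 unfolding Lq_le_def by simp

lemma (in prob_space) Lq_le_bounded:
 assumes "f : borel_measurable M" "AE x in M. \<bar>f x\<bar> <= c" "0 <= c" "0 <= q"
 shows "Lq_le M q f c"
proof -
 have "(\<integral>\<^sup>+ x. ennreal (\<bar>f x\<bar> powr q) \<partial>M) <= (\<integral>\<^sup>+ x. ennreal (c powr q) \<partial>M)"
 proof (rule nn_integral_mono_AE)
  show "AE x in M. ennreal (\<bar>f x\<bar> powr q) <= ennreal (c powr q)"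
   using assms(2) by eventually_elim (intro ennreal_leI powr_mono2, use assms in auto)
 qed
 also have "... = ennreal (c powr q)" by (simp add: emeasure_space_1)
 finally show ?thesis using assms unfolding Lq_le_def by auto
qed

lemma Lq_le_cmult:
 assumes "Lq_le M q f c" "0 <= q"
 shows "Lq_le M q (%x. a * f x) (\<bar>a\<bar> * c)"
proof -
 have [measurable]: "f : borel_measurable M" using assms by (auto simp: Lq_le_def)
 have "(\<integral>\<^sup>+ x. ennreal (\<bar>a * f x\<bar> powr q) \<partial>M) = (\<integral>\<^sup>+ x. ennreal (\<bar>a\<bar> powr q) * ennreal (\<bar>f x\<bar> powr q) \<partial>M)"
  by (intro nn_integral_cong) (simp add: abs_mult powr_mult ennreal_mult)
 also have "... = ennreal (\<bar>a\<bar> powr q) * (\<integral>\<^sup>+ x. ennreal (\<bar>f x\<bar> powr q) \<partial>M)"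
  by (rule nn_integral_cmult) measurable
 also have "... <= ennreal (\<bar>a\<bar> powr q) * ennreal (c powr q)" using assms by (intro mult_left_mono) (auto simp: Lq_le_def)
 also have "... = ennreal ((\<bar>a\<bar> * c) powr q)" using assms by (simp add: powr_mult Lq_le_nonneg ennreal_mult)
 finally show ?thesis using assms by (auto simp: Lq_le_def)
qed

lemma Lq_le_uminus: "Lq_le M q f c ==> Lq_le M q (%x. - f x) c" by (auto simp: Lq_le_def)

lemma Lq_le_limit:
 assumes "!!eps. eps > 0 ==> Lq_le M q f (c + eps)" "0 <= c" "0 < q"
 shows "Lq_le M q f c"
proof -
 have m: "f : borel_measurable M" using assms(1)[of 1] by (auto simp: Lq_le_def)
 have lim: "((%eps. ennreal ((c + eps) powr q)) \<longlongrightarrow> ennreal ((c + 0) powr q)) (at_right 0)"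
 proof (intro tendsto_ennrealI tendsto_powr2 tendsto_add tendsto_const tendsto_ident_at)
  show "\<forall>\<^sub>F x in at_right 0. 0 <= c + x" using eventually_at_right_less[of "0::real"] by eventually_elim (use assms in auto)
 qed (use assms in auto)
 have "(\<integral>\<^sup>+ x. ennreal (\<bar>f x\<bar> powr q) \<partial>M) <= ennreal ((c + 0) powr q)"
 proof (rule tendsto_lowerbound[OF lim])
  show "\<forall>\<^sub>F eps in at_right 0. (\<integral>\<^sup>+ x. ennreal (\<bar>f x\<bar> powr q) \<partial>M) <= ennreal ((c + eps) powr q)"
   using eventually_at_right_less[of "0::real"] by eventually_elim (use assms(1) in \<open>simp add: Lq_le_def\<close>)
 qed simp
 then show ?thesis using m assms by (auto simp: Lq_le_def)
qed

lemma convex_powr_nonneg: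
 fixes a b theta :: real
 assumes "1 <= q" "0 <= a" "0 <= b" "0 <= theta" "theta <= 1"
 shows "((1 - theta) * a + theta * b) powr q <= (1 - theta) * a powr q + theta * b powr q"
proof (cases "a = 0 \<or> b = 0")
 case True
 have *: "t powr q <= t" if "0 <= t" "t <= 1" for t :: real using that assms powr_mono'[of 1 q t] by (cases "t = 0") auto
 show ?thesis using True
 proof
  assume "a = 0"
  then show ?thesis using assms *[of theta] by (simp add: powr_mult mult_right_mono)
 next
  assume "b = 0"
  then show ?thesis using assms *[of "1 - theta"] by (simp add: powr_mult mult_right_mono)
 qed
next
 case False
 then show ?thesis using convex_onD[OF powr_convex[OF assms(1)], of theta a b] assms by auto
qed

text \<open>Minkowski's inequality.\<close>

lemma Lq_le_add:
 assumes f: "Lq_le M q f a" and g: "Lq_le M q g b" and q: "1 <= q"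
 shows "Lq_le M q (%x. f x + g x) (a + b)"
proof (rule Lq_le_limit)
 fix eps :: real assume "eps > 0"
 define a' b' where "a' = a + eps / 2" and "b' = b + eps / 2"
 have ab: "a' > 0" "b' > 0" using \<open>eps > 0\<close> Lq_le_nonneg[OF f] Lq_le_nonneg[OF g] by (auto simp: a'_def b'_def)
 have f': "Lq_le M q f a'" and g': "Lq_le M q g b'"
  using \<open>eps > 0\<close> q by (auto intro: Lq_le_mono[OF f] Lq_le_mono[OF g] simp: a'_def b'_def)
 have [measurable]: "f : borel_measurable M" "g : borel_measurable M" using f g by (auto simp: Lq_le_def)
 define A B where "A = (a' + b') powr q * (a' / (a' + b') / a' powr q)"
  and "B = (a' + b') powr q * (b' / (a' + b') / b' powr q)"
 have AB: "0 <= A" "0 <= B" using ab by (auto simp: A_def B_def)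
 have pt: "\<bar>f x + g x\<bar> powr q <= A * \<bar>f x\<bar> powr q + B * \<bar>g x\<bar> powr q" for x
 proof -
  define theta where "theta = b' / (a' + b')"
  have th: "0 <= theta" "theta <= 1" "1 - theta = a' / (a' + b')" using ab by (auto simp: theta_def field_simps)
  have e: "(\<bar>f x\<bar> + \<bar>g x\<bar>) / (a' + b') = (1 - theta) * (\<bar>f x\<bar> / a') + theta * (\<bar>g x\<bar> / b')"
  proof -
   have "(1 - theta) * (\<bar>f x\<bar> / a') = \<bar>f x\<bar> / (a' + b')" unfolding th(3) using ab by simp
   moreover have "theta * (\<bar>g x\<bar> / b') = \<bar>g x\<bar> / (a' + b')" unfolding theta_def using ab by simp
   ultimately show ?thesis by (simp add: add_divide_distrib)
  qed
  have "\<bar>f x + g x\<bar> powr q <= (\<bar>f x\<bar> + \<bar>g x\<bar>) powr q" using q by (intro powr_mono2) auto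
  also have "... = (a' + b') powr q * (((\<bar>f x\<bar> + \<bar>g x\<bar>) / (a' + b')) powr q)" using ab by (subst powr_mult[symmetric]) auto
  also have "... <= (a' + b') powr q * ((1 - theta) * (\<bar>f x\<bar> / a') powr q + theta * (\<bar>g x\<bar> / b') powr q)"
   unfolding e using ab th q by (intro mult_left_mono convex_powr_nonneg) auto
  also have "... = A * \<bar>f x\<bar> powr q + B * \<bar>g x\<bar> powr q"
  proof -
   have "A = (a' + b') powr q * ((1 - theta) / a' powr q)" "B = (a' + b') powr q * (theta / b' powr q)"
    unfolding th(3) by (simp_all add: A_def B_def theta_def)
   moreover have "(\<bar>f x\<bar> / a') powr q = \<bar>f x\<bar> powr q / a' powr q" "(\<bar>g x\<bar> / b') powr q = \<bar>g x\<bar> powr q / b' powr q"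
    using ab by (simp_all add: powr_divide)
   ultimately show ?thesis by (simp add: algebra_simps)
  qed
  finally show ?thesis .
 qed
 have "(\<integral>\<^sup>+ x. ennreal (\<bar>f x + g x\<bar> powr q) \<partial>M)
   <= (\<integral>\<^sup>+ x. ennreal A * ennreal (\<bar>f x\<bar> powr q) + ennreal B * ennreal (\<bar>g x\<bar> powr q) \<partial>M)"
  using pt AB by (intro nn_integral_mono) (auto simp: ennreal_mult[symmetric] ennreal_plus[symmetric] simp del: ennreal_plus)
 also have "... = ennreal A * (\<integral>\<^sup>+ x. ennreal (\<bar>f x\<bar> powr q) \<partial>M) + ennreal B * (\<integral>\<^sup>+ x. ennreal (\<bar>g x\<bar> powr q) \<partial>M)"
  by (simp add: nn_integral_add nn_integral_cmult)
 also have "... <= ennreal A * ennreal (a' powr q) + ennreal B * ennreal (b' powr q)"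
  using f' g' by (intro add_mono mult_left_mono) (auto simp: Lq_le_def)
 also have "... = ennreal (A * a' powr q + B * b' powr q)" using AB by (simp add: ennreal_mult)
 also have "A * a' powr q + B * b' powr q = (a' + b') powr q * (a' / (a' + b') + b' / (a' + b'))"
 proof -
  have "A * a' powr q = (a' + b') powr q * (a' / (a' + b'))" "B * b' powr q = (a' + b') powr q * (b' / (a' + b'))"
   using ab by (simp_all add: A_def B_def)
  then show ?thesis by (simp add: distrib_left)
 qed
 also have "... = (a' + b') powr q" using ab by (simp add: add_divide_distrib[symmetric])
 finally show "Lq_le M q (%x. f x + g x) (a + b + eps)" using ab by (auto simp: Lq_le_def a'_def b'_def algebra_simps)
qed (use Lq_le_nonneg[OF f] Lq_le_nonneg[OF g] q in auto)

lemma Lq_le_diff: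
 "Lq_le M q f a ==> Lq_le M q g b ==> 1 <= q ==> Lq_le M q (%x. f x - g x) (a + b)"
 using Lq_le_add[of M q f a "%x. - g x" b] Lq_le_uminus[of M q g b] by auto

lemma Lq_le_sum:
 assumes "finite I" "!!i. i : I ==> Lq_le M q (f i) (c i)" "1 <= q"
 shows "Lq_le M q (%x. SUM i:I. f i x) (SUM i:I. c i)"
 using assms(1,2) by (induction I rule: finite_induct) (auto simp: Lq_le_zero intro!: Lq_le_add assms(3))

lemma Lq_le_power2: "Lq_le M q f c \<longleftrightarrow> f : borel_measurable M & 0 <= c & Lq_le M (q/2) (%x. (f x)^2) (c^2)"
proof -
 have "\<bar>y^2\<bar> powr (q/2) = \<bar>y\<bar> powr q" for y :: real
  using powr_powr[of "\<bar>y\<bar>" 2 "q/2"] by (simp add: abs_mult power2_eq_square powr_mult powr_add[symmetric])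
 then show ?thesis by (auto simp: Lq_le_def)
qed

lemma Lq_le_L2_set:
 assumes "finite I" "!!i. i : I ==> Lq_le M q (f i) (c i)" "2 <= q"
 shows "Lq_le M q (%x. L2_set (%i. f i x) I) (L2_set c I)"
proof -
 have [measurable]: "f i : borel_measurable M" if "i : I" for i using assms(2)[OF that] by (auto simp: Lq_le_def)
 have "Lq_le M (q/2) (%x. SUM i:I. (f i x)^2) (SUM i:I. (c i)^2)" using assms by (intro Lq_le_sum) (auto simp: Lq_le_power2[of M q])
 then show ?thesis by (subst Lq_le_power2) (auto simp: L2_set_def sum_nonneg)
qed

text \<open>Hoelder's inequality with equal exponents.\<close>

lemma Lq_le_mult:
 assumes f: "Lq_le M (2*q) f a" and g: "Lq_le M (2*q) g b" and q: "0 < q"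
 shows "Lq_le M q (%x. f x * g x) (a * b)"
proof -
 have *: "Lq_le M q (%x. f x * g x) (a * b)"
  if f: "Lq_le M (2*q) f a" and g: "Lq_le M (2*q) g b" and ab: "a > 0" "b > 0" for a b
 proof -
  have [measurable]: "f : borel_measurable M" "g : borel_measurable M" using f g by (auto simp: Lq_le_def)
  define A B where "A = (a * b) powr q / (2 * a powr (2*q))" and "B = (a * b) powr q / (2 * b powr (2*q))"
  have AB: "0 <= A" "0 <= B" using ab by (auto simp: A_def B_def)
  have pt: "\<bar>f x * g x\<bar> powr q <= A * \<bar>f x\<bar> powr (2*q) + B * \<bar>g x\<bar> powr (2*q)" for x
  proof -
   define u v where "u = (\<bar>f x\<bar> / a) powr q" and "v = (\<bar>g x\<bar> / b) powr q"
   have sq: "t powr (2*q) = (t powr q)^2" if "t \<ge> 0" for t :: real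
    using that powr_powr[of t q 2] powr_numeral[of "t powr q" "num.Bit0 num.One"] by (cases "t = 0") (auto simp: mult.commute)
   have "\<bar>f x * g x\<bar> powr q = (a * b) powr q * (u * v)" using ab by (simp add: u_def v_def abs_mult powr_mult powr_divide)
   also have "... <= (a * b) powr q * (u^2 / 2 + v^2 / 2)" using sum_squares_bound[of u v] by (intro mult_left_mono) auto
   also have "... = A * \<bar>f x\<bar> powr (2*q) + B * \<bar>g x\<bar> powr (2*q)"
   proof -
    have "u = \<bar>f x\<bar> powr q / a powr q" "v = \<bar>g x\<bar> powr q / b powr q" using ab by (simp_all add: u_def v_def powr_divide)
    moreover have "A = (a * b) powr q / (2 * (a powr q)^2)" "B = (a * b) powr q / (2 * (b powr q)^2)"
     using ab sq[of a] sq[of b] by (simp_all add: A_def B_def)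
    moreover have "\<bar>f x\<bar> powr (2*q) = (\<bar>f x\<bar> powr q)^2" "\<bar>g x\<bar> powr (2*q) = (\<bar>g x\<bar> powr q)^2"
     by (simp_all add: sq)
    ultimately show ?thesis by (simp add: power_divide algebra_simps)
   qed
   finally show ?thesis .
  qed
  have "(\<integral>\<^sup>+ x. ennreal (\<bar>f x * g x\<bar> powr q) \<partial>M)
   <= (\<integral>\<^sup>+ x. ennreal A * ennreal (\<bar>f x\<bar> powr (2*q)) + ennreal B * ennreal (\<bar>g x\<bar> powr (2*q)) \<partial>M)"
   using pt AB by (intro nn_integral_mono) (auto simp: ennreal_mult[symmetric] ennreal_plus[symmetric] simp del: ennreal_plus)
  also have "... = ennreal A * (\<integral>\<^sup>+ x. ennreal (\<bar>f x\<bar> powr (2*q)) \<partial>M) + ennreal B * (\<integral>\<^sup>+ x. ennreal (\<bar>g x\<bar> powr (2*q)) \<partial>M)"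
   by (simp add: nn_integral_add nn_integral_cmult)
  also have "... <= ennreal A * ennreal (a powr (2*q)) + ennreal B * ennreal (b powr (2*q))"
   using f g by (intro add_mono mult_left_mono) (auto simp: Lq_le_def)
  also have "... = ennreal (A * a powr (2*q) + B * b powr (2*q))" using AB by (simp add: ennreal_mult)
  also have "A * a powr (2*q) + B * b powr (2*q) = (a * b) powr q" using ab unfolding A_def B_def by simp
  finally show ?thesis using ab by (auto simp: Lq_le_def)
 qed
 have nn: "0 <= a" "0 <= b" using f g Lq_le_nonneg by auto
 have step: "Lq_le M q (%x. f x * g x) ((a + eps) * (b + eps))" if "eps > 0" for eps
  using that nn q by (intro * Lq_le_mono[OF f] Lq_le_mono[OF g]) auto
 show ?thesis
 proof (rule Lq_le_limit)
  fix eps :: real assume e: "eps > 0"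
  define d where "d = min 1 (eps / (a + b + 1))"
  have d: "d > 0" "d <= 1" "d <= eps / (a + b + 1)" using e nn by (auto simp: d_def)
  then have d3: "d * (a + b + 1) <= eps" using nn by (simp add: pos_le_divide_eq)
  have "(a + d) * (b + d) = a * b + d * (a + b + d)" by (simp add: algebra_simps)
  also have "... <= a * b + d * (a + b + 1)" using d by (intro add_left_mono mult_left_mono) auto
  also have "... <= a * b + eps" using d3 by simp
  finally show "Lq_le M q (%x. f x * g x) (a * b + eps)" using Lq_le_mono[OF step[OF d(1)]] q by auto
 qed (use nn q in auto)
qed

text \<open>Lyapunov's inequality.\<close>

lemma (in prob_space) Lq_le_exponent_mono:
 assumes f: "Lq_le M r f c" and q: "0 < q" "q <= r"
 shows "Lq_le M q f c"
proof -
 have *: "Lq_le M q f c" if f: "Lq_le M r f c" and c: "c > 0" for c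
 proof -
  have [measurable]: "f : borel_measurable M" using f by (auto simp: Lq_le_def)
  define theta where "theta = q / r"
  have th: "0 < theta" "theta <= 1" using q by (auto simp: theta_def)
  define B where "B = c powr q * theta / c powr r"
  have B: "B \<ge> 0" using th by (auto simp: B_def)
  have pt: "\<bar>f x\<bar> powr q <= c powr q * (1 - theta) + B * \<bar>f x\<bar> powr r" for x
  proof (cases "f x = 0")
   case True then show ?thesis using th B q by (auto intro!: mult_nonneg_nonneg)
  next
   case False
   have "((\<bar>f x\<bar> / c) powr r) powr theta * 1 powr (1 - theta) <= theta * (\<bar>f x\<bar> / c) powr r + (1 - theta) * 1"
    using th c False by (intro Youngs_inequality_0) auto
   then have "(\<bar>f x\<bar> / c) powr q <= theta * (\<bar>f x\<bar> / c) powr r + (1 - theta)" using q by (simp add: powr_powr theta_def)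
   then have "c powr q * (\<bar>f x\<bar> / c) powr q <= c powr q * (theta * (\<bar>f x\<bar> / c) powr r + (1 - theta))"
    by (intro mult_left_mono) auto
   then show ?thesis using c by (simp add: powr_divide B_def algebra_simps)
  qed
  have "(\<integral>\<^sup>+ x. ennreal (\<bar>f x\<bar> powr q) \<partial>M)
   <= (\<integral>\<^sup>+ x. ennreal (c powr q * (1 - theta)) + ennreal B * ennreal (\<bar>f x\<bar> powr r) \<partial>M)"
   using pt B th by (intro nn_integral_mono) (auto simp: ennreal_mult[symmetric] ennreal_plus[symmetric] simp del: ennreal_plus)
  also have "... = ennreal (c powr q * (1 - theta)) + ennreal B * (\<integral>\<^sup>+ x. ennreal (\<bar>f x\<bar> powr r) \<partial>M)"
   by (simp add: nn_integral_add nn_integral_cmult emeasure_space_1)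
  also have "... <= ennreal (c powr q * (1 - theta)) + ennreal B * ennreal (c powr r)"
   using f by (intro add_mono mult_left_mono) (auto simp: Lq_le_def)
  also have "... = ennreal (c powr q * (1 - theta) + B * c powr r)" using B th by (simp add: ennreal_mult)
  also have "c powr q * (1 - theta) + B * c powr r = c powr q" using c by (simp add: B_def algebra_simps)
  finally show ?thesis using c by (auto simp: Lq_le_def)
 qed
 show ?thesis
 proof (rule Lq_le_limit)
  fix eps :: real assume "eps > 0"
  then show "Lq_le M q f (c + eps)" using Lq_le_nonneg[OF f] q by (intro * Lq_le_mono[OF f]) auto
 qed (use Lq_le_nonneg[OF f] q in auto)
qed

lemma (in prob_space) Lq_le_integrable:
 assumes f: "Lq_le M q f c" and q: "1 <= q"
 shows "integrable M f" "\<bar>LINT x|M. f x\<bar> <= c" "(LINT x|M. \<bar>f x\<bar>) <= c"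
proof -
 have 1: "Lq_le M 1 f c" using Lq_le_exponent_mono[OF f] q by auto
 have [measurable]: "f : borel_measurable M" using f by (auto simp: Lq_le_def)
 have c: "0 <= c" using f by (auto simp: Lq_le_def)
 have le: "(\<integral>\<^sup>+ x. ennreal (norm (f x)) \<partial>M) <= ennreal c" using 1 c by (auto simp: Lq_le_def)
 then show i: "integrable M f" by (intro integrableI_bounded) (auto intro: le_less_trans)
 show 2: "(LINT x|M. \<bar>f x\<bar>) <= c" using le i c by (subst (asm) nn_integral_eq_integral) auto
 then show "\<bar>LINT x|M. f x\<bar> <= c" by (rule order_trans[OF integral_abs_bound])
qed

lemma Lq_le_integrable_powr:
 assumes f: "Lq_le M q f c"
 shows "integrable M (%x. \<bar>f x\<bar> powr q)" "(LINT x|M. \<bar>f x\<bar> powr q) <= c powr q"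
proof -
 have [measurable]: "f : borel_measurable M" using f by (auto simp: Lq_le_def)
 have le: "(\<integral>\<^sup>+ x. ennreal (norm (\<bar>f x\<bar> powr q)) \<partial>M) <= ennreal (c powr q)" using f by (auto simp: Lq_le_def)
 then show i: "integrable M (%x. \<bar>f x\<bar> powr q)" by (intro integrableI_bounded) (auto intro: le_less_trans)
 show "(LINT x|M. \<bar>f x\<bar> powr q) <= c powr q" using le i by (subst (asm) nn_integral_eq_integral) auto
qed

lemma Lq_leI_integrable_powr:
 assumes "f : borel_measurable M" "integrable M (%x. \<bar>f x\<bar> powr q)"
  "(LINT x|M. \<bar>f x\<bar> powr q) <= c powr q" "0 <= c"
 shows "Lq_le M q f c" using assms unfolding Lq_le_def by (auto simp: nn_integral_eq_integral)

lemma (in prob_space) Lq_le_Markov: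
 assumes f: "Lq_le M q f c" and q: "0 < q" and z: "z > 0"
 shows "prob {x:space M. z <= \<bar>f x\<bar>} <= (c / z) powr q"
proof -
 have [measurable]: "f : borel_measurable M" using f by (auto simp: Lq_le_def)
 have i: "integrable M (%x. \<bar>f x\<bar> powr q)" "(LINT x|M. \<bar>f x\<bar> powr q) <= c powr q" using Lq_le_integrable_powr[OF f] by auto
 have "{x:space M. z <= \<bar>f x\<bar>} \<subseteq> {x:space M. z powr q <= \<bar>f x\<bar> powr q}" using z q by (auto intro!: powr_mono2)
 then have "prob {x:space M. z <= \<bar>f x\<bar>} <= prob {x:space M. z powr q <= \<bar>f x\<bar> powr q}" by (intro finite_measure_mono) auto
 also have "... <= (LINT x|M. \<bar>f x\<bar> powr q) / z powr q" using i z by (intro integral_Markov_inequality_measure[where A="{}"]) auto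
 also have "... <= c powr q / z powr q" using i by (intro divide_right_mono) auto
 also have "... = (c / z) powr q" using z Lq_le_nonneg[OF f] by (simp add: powr_divide)
 finally show ?thesis .
qed

lemma Lq_le_distr:
 assumes [measurable]: "h : M \<rightarrow>\<^sub>M N" "f : borel_measurable N"
 shows "Lq_le (distr M N h) q f c \<longleftrightarrow> Lq_le M q (%x. f (h x)) c" by (simp add: Lq_le_def nn_integral_distr)

text \<open>Fatou's lemma.\<close>

lemma Lq_le_Fatou:
 assumes u: "!!n. Lq_le M q (u n) c" and f: "f : borel_measurable M"
  and lim: "AE x in M. (%n. u n x) \<longlonglongrightarrow> f x" and q: "0 < q"
 shows "Lq_le M q f c"
proof -
 have [measurable]: "!!n. u n : borel_measurable M" using u by (auto simp: Lq_le_def)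
 have "(\<integral>\<^sup>+ x. ennreal (\<bar>f x\<bar> powr q) \<partial>M) = (\<integral>\<^sup>+ x. liminf (%n. ennreal (\<bar>u n x\<bar> powr q)) \<partial>M)"
 proof (rule nn_integral_cong_AE)
  show "AE x in M. ennreal (\<bar>f x\<bar> powr q) = liminf (%n. ennreal (\<bar>u n x\<bar> powr q))" using lim
  proof eventually_elim
   case (elim x)
   have "(%n. ennreal (\<bar>u n x\<bar> powr q)) \<longlonglongrightarrow> ennreal (\<bar>f x\<bar> powr q)"
    using q elim by (intro tendsto_ennrealI tendsto_powr2 tendsto_rabs tendsto_const) auto
   then show ?case by (intro lim_imp_Liminf[symmetric]) auto
  qed
 qed
 also have "... <= liminf (%n. \<integral>\<^sup>+ x. ennreal (\<bar>u n x\<bar> powr q) \<partial>M)" by (intro nn_integral_liminf) measurable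
 also have "... <= liminf (%n. ennreal (c powr q))" using u by (intro Liminf_mono eventuallyI) (auto simp: Lq_le_def)
 also have "... = ennreal (c powr q)" by (simp add: Liminf_const)
 finally show ?thesis using u[of 0] f by (auto simp: Lq_le_def)
qed

section \<open>The moment inequality for one martingale step\<close>

lemma abs_powr_two: "\<bar>x::real\<bar> powr 2 = x^2" by simp

lemma (in prob_space) Lq_le_Hoelder:
 assumes U: "Lq_le M q U u" and D: "Lq_le M q D d" and pos: "u > 0" "d > 0" and s: "0 < s" "s < q"
 shows "integrable M (%x. \<bar>U x\<bar> powr s * \<bar>D x\<bar> powr (q - s))"
  and "(LINT x|M. \<bar>U x\<bar> powr s * \<bar>D x\<bar> powr (q - s)) <= u powr s * d powr (q - s)"
proof -
 have [measurable]: "U : borel_measurable M" "D : borel_measurable M" using U D by (auto simp: Lq_le_def)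
 define theta where "theta = s / q"
 have th: "0 < theta" "theta < 1" "1 - theta = (q - s) / q" using s by (auto simp: theta_def field_simps)
 define c where "c = u powr s * d powr (q - s)"
 have c: "c > 0" using pos by (simp add: c_def)
 have pt: "\<bar>U x\<bar> powr s * \<bar>D x\<bar> powr (q - s)
   <= c * (theta * (\<bar>U x\<bar> powr q / u powr q) + (1 - theta) * (\<bar>D x\<bar> powr q / d powr q))" for x
 proof (cases "U x = 0 \<or> D x = 0")
  case True
  then show ?thesis using c th s by (auto intro!: mult_nonneg_nonneg add_nonneg_nonneg)
 next
  case False
  have "((\<bar>U x\<bar> / u) powr q) powr theta * ((\<bar>D x\<bar> / d) powr q) powr (1 - theta)
    <= theta * (\<bar>U x\<bar> / u) powr q + (1 - theta) * (\<bar>D x\<bar> / d) powr q"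
   using th False pos by (intro Youngs_inequality_0) auto
  also have "((\<bar>U x\<bar> / u) powr q) powr theta = \<bar>U x\<bar> powr s / u powr s" using s pos by (simp add: powr_powr theta_def powr_divide)
  also have "((\<bar>D x\<bar> / d) powr q) powr (1 - theta) = \<bar>D x\<bar> powr (q - s) / d powr (q - s)"
   using s pos unfolding th(3) by (simp add: powr_powr powr_divide)
  finally have "c * (\<bar>U x\<bar> powr s / u powr s * (\<bar>D x\<bar> powr (q - s) / d powr (q - s)))
    <= c * (theta * (\<bar>U x\<bar> / u) powr q + (1 - theta) * (\<bar>D x\<bar> / d) powr q)"
   using c by (intro mult_left_mono) auto
  then show ?thesis using pos by (simp add: c_def powr_divide)
 qed
 let ?R = "%x. c * (theta * (\<bar>U x\<bar> powr q / u powr q) + (1 - theta) * (\<bar>D x\<bar> powr q / d powr q))"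
 note iU = Lq_le_integrable_powr[OF U] and iD = Lq_le_integrable_powr[OF D]
 have iR: "integrable M ?R" using iU iD by (intro integrable_mult_right Bochner_Integration.integrable_add integrable_divide) auto
 show i: "integrable M (%x. \<bar>U x\<bar> powr s * \<bar>D x\<bar> powr (q - s))"
  by (rule Bochner_Integration.integrable_bound[OF iR]) (use pt in \<open>auto intro: order_trans[OF _ abs_ge_self]\<close>)
 have "(LINT x|M. \<bar>U x\<bar> powr s * \<bar>D x\<bar> powr (q - s)) <= (LINT x|M. ?R x)" using i iR pt by (intro integral_mono) auto
 also have "... = c * (theta * ((LINT x|M. \<bar>U x\<bar> powr q) / u powr q) + (1 - theta) * ((LINT x|M. \<bar>D x\<bar> powr q) / d powr q))"
  using iU iD by (simp add: LINT_add)
 also have "... <= c * (theta * 1 + (1 - theta) * 1)" using iU iD c th pos by (intro mult_left_mono add_mono) (auto simp: divide_le_eq)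
 finally show "(LINT x|M. \<bar>U x\<bar> powr s * \<bar>D x\<bar> powr (q - s)) <= u powr s * d powr (q - s)" by (simp add: c_def)
qed

text \<open>The step of an induction over martingale differences: if \<open>U\<close> has squared norm at most \<open>K * a\<close> and
 \<open>D\<close> is orthogonal to the derivative of \<open>\<bar>U\<bar> powr q\<close>, then adding \<open>D\<close> costs \<open>K * d\<^sup>2\<close> in the squared
 norm.  A martingale difference satisfies the orthogonality, so that \<open>sqrt K\<close> is the constant of
 the resulting inequality of Burkholder type.\<close>

definition mart_step :: "'a measure => real => real => bool" where
 "mart_step M q K \<longleftrightarrow> 0 < K & (ALL U D a d. Lq_le M q U (sqrt (K * a)) --> Lq_le M q D d --> 0 <= a -->
   (LINT x|M. sgn (U x) * \<bar>U x\<bar> powr (q - 1) * D x) = 0 -->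
   Lq_le M q (%x. U x + D x) (sqrt (K * (a + d^2))))"

text \<open>Integrating the pointwise expansion kills its linear term, Hoelder's inequality bounds the
 second-order term, and the last assumption is what remains to be checked for numbers.\<close>

lemma (in prob_space) mart_stepI:
 assumes q: "2 <= q" and K: "0 < K" and c: "0 <= c1" "0 <= c2" "2 < q \<or> c1 = 0"
  and pt: "!!a b :: real. \<bar>a + b\<bar> powr q <= \<bar>a\<bar> powr q + q * (sgn a * \<bar>a\<bar> powr (q - 1) * b)
    + c1 * (\<bar>a\<bar> powr (q - 2) * b^2) + c2 * \<bar>b\<bar> powr q"
  and kk: "!!x t :: real. 0 < x ==> 0 < t ==>
    (K * x) powr (q/2) + c1 * ((K * x) powr ((q - 2)/2) * t) + c2 * t powr (q/2) <= (K * (x + t)) powr (q/2)"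
 shows "mart_step M q K"
 unfolding mart_step_def
proof (intro conjI allI impI K)
 fix U D :: "'a => real" and a d :: real
 assume U: "Lq_le M q U (sqrt (K * a))" and D: "Lq_le M q D d" and a: "0 <= a"
  and orth: "(LINT x|M. sgn (U x) * \<bar>U x\<bar> powr (q - 1) * D x) = 0"
 have [measurable]: "U : borel_measurable M" "D : borel_measurable M" using U D by (auto simp: Lq_le_def)
 have pos: "Lq_le M q (%x. U x + D x) (sqrt (K * (a + d^2)))"
  if U: "Lq_le M q U (sqrt (K * a))" and D: "Lq_le M q D d" and a: "0 < a" and d: "0 < d" for a d
 proof -
  define u where "u = sqrt (K * a)"
  have u: "u > 0" using K a by (simp add: u_def)
  have upow: "u powr s = (K * a) powr (s/2)" for s
   unfolding u_def using K a by (subst powr_half_sqrt[symmetric]) (auto simp: powr_powr)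
  note iU = Lq_le_integrable_powr[OF U] and iD = Lq_le_integrable_powr[OF D]
  have i1: "integrable M (%x. sgn (U x) * \<bar>U x\<bar> powr (q - 1) * D x)"
  proof (rule Bochner_Integration.integrable_bound)
   show "integrable M (%x. \<bar>U x\<bar> powr (q - 1) * \<bar>D x\<bar> powr (q - (q - 1)))"
    using q by (intro Lq_le_Hoelder[OF U D]) (use u d in \<open>auto simp: u_def\<close>)
   show "AE x in M. norm (sgn (U x) * \<bar>U x\<bar> powr (q - 1) * D x) <= norm (\<bar>U x\<bar> powr (q - 1) * \<bar>D x\<bar> powr (q - (q - 1)))"
    by (auto simp: abs_mult abs_sgn_eq)
  qed measurable
  have i2: "integrable M (%x. c1 * (\<bar>U x\<bar> powr (q - 2) * (D x)^2))"
   and le2: "(LINT x|M. c1 * (\<bar>U x\<bar> powr (q - 2) * (D x)^2)) <= c1 * (u powr (q - 2) * d^2)"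
  proof -
   have "integrable M (%x. \<bar>U x\<bar> powr (q - 2) * (D x)^2) &
     (LINT x|M. \<bar>U x\<bar> powr (q - 2) * (D x)^2) <= u powr (q - 2) * d^2" if "2 < q"
    using Lq_le_Hoelder[OF U D, of "q - 2"] u d that by (auto simp: abs_powr_two u_def)
   then show "integrable M (%x. c1 * (\<bar>U x\<bar> powr (q - 2) * (D x)^2))"
    and "(LINT x|M. c1 * (\<bar>U x\<bar> powr (q - 2) * (D x)^2)) <= c1 * (u powr (q - 2) * d^2)"
    using c by (auto intro: mult_left_mono)
  qed
  let ?R = "%x. \<bar>U x\<bar> powr q + q * (sgn (U x) * \<bar>U x\<bar> powr (q - 1) * D x)
    + c1 * (\<bar>U x\<bar> powr (q - 2) * (D x)^2) + c2 * \<bar>D x\<bar> powr q"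
  have iR: "integrable M ?R" using iU iD i1 i2 by (intro Bochner_Integration.integrable_add integrable_mult_right) auto
  have i: "integrable M (%x. \<bar>U x + D x\<bar> powr q)"
   by (rule Bochner_Integration.integrable_bound[OF iR]) (use pt in \<open>auto intro: order_trans[OF _ abs_ge_self]\<close>)
  show ?thesis
  proof (rule Lq_leI_integrable_powr[OF _ i])
   have "(LINT x|M. \<bar>U x + D x\<bar> powr q) <= (LINT x|M. ?R x)" using i iR pt by (intro integral_mono) auto
   also have "... = (LINT x|M. \<bar>U x\<bar> powr q) + q * (LINT x|M. sgn (U x) * \<bar>U x\<bar> powr (q - 1) * D x)
    + (LINT x|M. c1 * (\<bar>U x\<bar> powr (q - 2) * (D x)^2)) + c2 * (LINT x|M. \<bar>D x\<bar> powr q)"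
    using iU iD i1 i2 by (simp add: LINT_add)
   also have "... <= u powr q + 0 + c1 * (u powr (q - 2) * d^2) + c2 * d powr q"
    using iU iD orth le2 c by (intro add_mono) (auto intro: mult_left_mono simp: u_def)
   also have "... = (K * a) powr (q/2) + c1 * ((K * a) powr ((q - 2)/2) * d^2) + c2 * (d^2) powr (q/2)"
    using d by (simp add: upow powr_powr flip: powr_numeral)
   also have "... <= (K * (a + d^2)) powr (q/2)" using a d by (intro kk) auto
   also have "... = (sqrt (K * (a + d^2))) powr q" using K a by (subst powr_half_sqrt[symmetric]) (auto simp: powr_powr)
   finally show "(LINT x|M. \<bar>U x + D x\<bar> powr q) <= (sqrt (K * (a + d^2))) powr q" .
  qed (use K a in auto)
 qed
 have d: "0 <= d" using D by (auto simp: Lq_le_def)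
 show "Lq_le M q (%x. U x + D x) (sqrt (K * (a + d^2)))"
 proof (rule Lq_le_limit)
  fix eps :: real assume e: "eps > 0"
  define eta where "eta = eps^2 / (2 * K)"
  have eta: "eta > 0" using e K by (simp add: eta_def)
  have "Lq_le M q (%x. U x + D x) (sqrt (K * ((a + eta) + (sqrt (d^2 + eta))^2)))"
  proof (rule pos)
   show "Lq_le M q U (sqrt (K * (a + eta)))" using K eta q by (intro Lq_le_mono[OF U]) auto
   show "Lq_le M q D (sqrt (d^2 + eta))" using d eta q by (intro Lq_le_mono[OF D]) (auto intro!: real_le_rsqrt)
   show "0 < sqrt (d^2 + eta)" using eta by (simp add: add_nonneg_pos)
  qed (use a eta in auto)
  moreover have "sqrt (K * ((a + eta) + (sqrt (d^2 + eta))^2)) <= sqrt (K * (a + d^2)) + eps"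
  proof -
   have "K * ((a + eta) + (sqrt (d^2 + eta))^2) = K * (a + d^2) + eps^2" using eta K by (simp add: eta_def field_simps)
   also have "sqrt ... <= sqrt (K * (a + d^2)) + sqrt (eps^2)" using K a by (intro sqrt_add_le_add_sqrt) auto
   finally show ?thesis using e by simp
  qed
  ultimately show "Lq_le M q (%x. U x + D x) (sqrt (K * (a + d^2)) + eps)" using q by (auto intro: Lq_le_mono)
 qed (use K a q in auto)
qed

lemma (in prob_space) mart_step_2: "mart_step M 2 1"
proof (rule mart_stepI[where ?c1.0 = 0 and ?c2.0 = 1])
 fix a b :: real
 have "sgn a * \<bar>a\<bar> powr (2 - 1) = a" by (cases "a = 0") (auto simp: sgn_mult_abs)
 then show "\<bar>a + b\<bar> powr 2 <= \<bar>a\<bar> powr 2 + 2 * (sgn a * \<bar>a\<bar> powr (2 - 1) * b) + 0 * (\<bar>a\<bar> powr (2 - 2) * b^2) + 1 * \<bar>b\<bar> powr 2"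
  by (simp only: abs_powr_two) (simp add: power2_sum)
qed auto

text \<open>The constants for \<open>q = 2\<close> and \<open>q = 4\<close> enter the variance of a block and so must be explicit.\<close>

lemma (in prob_space) mart_step_4: "mart_step M 4 4"
proof (rule mart_stepI[where ?c1.0 = 8 and ?c2.0 = 3])
 fix a b :: real
 have p4: "\<bar>x\<bar> powr 4 = x^4" for x :: real using powr_numeral[of "\<bar>x\<bar>" "num.Bit0 (num.Bit0 num.One)"] by simp
 have p3: "sgn a * \<bar>a\<bar> powr (4 - 1) = a^3" by (cases "a = 0") (auto simp: sgn_if power_minus_odd abs_if)
 have "0 <= 2 * b^2 * (a - b)^2" by simp
 then have "(a + b)^4 <= a^4 + 4 * (a^3 * b) + 8 * (a^2 * b^2) + 3 * b^4" by (simp add: power2_eq_square power3_eq_cube power4_eq_xxxx algebra_simps)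
 then show "\<bar>a + b\<bar> powr 4 <= \<bar>a\<bar> powr 4 + 4 * (sgn a * \<bar>a\<bar> powr (4 - 1) * b) + 8 * (\<bar>a\<bar> powr (4 - 2) * b^2) + 3 * \<bar>b\<bar> powr 4"
  unfolding p3 p4 by simp
next
 fix x t :: real assume "0 < x" "0 < t"
 then show "(4 * x) powr (4 / 2) + 8 * ((4 * x) powr ((4 - 2) / 2) * t) + 3 * t powr (4 / 2) <= (4 * (x + t)) powr (4 / 2)"
  by (simp add: power2_eq_square algebra_simps)
qed auto

lemma powr_superadd:
 fixes x y :: real
 assumes "0 <= x" "0 <= y" "1 <= r"
 shows "x powr r + y powr r <= (x + y) powr r"
proof (cases "x + y = 0")
 case True
 then have "x = 0" "y = 0" using assms by auto
 then show ?thesis by simp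
next
 case False
 then have p: "x + y > 0" using assms by auto
 have *: "t powr r <= t" if "0 <= t" "t <= 1" for t :: real using that assms powr_mono'[of 1 r t] by (cases "t = 0") auto
 have "(x / (x + y)) powr r + (y / (x + y)) powr r <= x / (x + y) + y / (x + y)" using assms p by (intro add_mono *) auto
 also have "... = 1" using p by (simp add: add_divide_distrib[symmetric])
 finally show ?thesis using p assms by (simp add: powr_divide field_simps)
qed

lemma powr_tangent:
 fixes x y :: real
 assumes "0 < x" "0 <= y" "1 <= r"
 shows "x powr r + r * x powr (r - 1) * y <= (x + y) powr r"
proof -
 have "r * x powr (r - 1) * ((x + y) - x) <= (x + y) powr r - x powr r"
 proof (rule convex_on_imp_above_tangent[OF powr_convex[OF assms(3)]])
  show "((%x. x powr r) has_real_derivative r * x powr (r - 1)) (at x within {0<..})" using assms by (auto intro!: derivative_eq_intros)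
 qed (use assms in \<open>auto simp: interior_open\<close>)
 then show ?thesis by simp
qed

lemma powr_expand_bound:
 fixes q :: real
 assumes q: "2 < q"
 obtains c where "c \<ge> 1"
  "!!x :: real. \<bar>1 + x\<bar> powr q <= 1 + q * x + c * (x^2 + \<bar>x\<bar> powr q)"
proof
 define C where "C = q * (q - 1) / 2 * 2 powr (q - 2)"
 have C: "C \<ge> 0" using q by (simp add: C_def)
 have 3: "3 powr q \<ge> 1" using q by (simp add: ge_one_powr_ge_zero)
 show "3 powr q + 2 * q + C \<ge> 1" using 3 C q by auto
 fix x :: real
 show "\<bar>1 + x\<bar> powr q <= 1 + q * x + (3 powr q + 2 * q + C) * (x^2 + \<bar>x\<bar> powr q)"
 proof (cases "\<bar>x\<bar> <= 1/2")
  case True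
  have "(1 + x) powr q <= 1 + q * x + C * x^2"
  proof (cases "x = 0")
   case False
   define diff where "diff = (%m::nat. %t::real. if m = 0 then (1 + t) powr q else if m = 1 then q * (1 + t) powr (q - 1)
     else q * (q - 1) * (1 + t) powr (q - 2))"
   have "EX t. (if x < 0 then x < t & t < 0 else 0 < t & t < x) &
    (1 + x) powr q = (SUM m<2. (diff m 0 / fact m) * (x - 0) ^ m) + (diff 2 t / fact 2) * (x - 0) ^ 2"
   proof (rule Taylor[where a = "-1/2" and b = "1/2"])
    show "ALL m t. m < 2 & - 1 / 2 <= t & t <= 1 / 2 --> (diff m has_real_derivative diff (Suc m) t) (at t)"
    proof (intro allI impI)
     fix m :: nat and t :: real assume *: "m < 2 & - 1 / 2 <= t & t <= 1 / 2"
     then have "m = 0 \<or> m = 1" by auto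
     then show "(diff m has_real_derivative diff (Suc m) t) (at t)" using * by (auto simp: diff_def[abs_def] intro!: derivative_eq_intros)
    qed
   qed (use True False in \<open>auto simp: diff_def\<close>)
   then obtain t where t0: "if x < 0 then x < t & t < 0 else 0 < t & t < x"
    "(1 + x) powr q = (SUM m<2. (diff m 0 / fact m) * (x - 0) ^ m) + (diff 2 t / fact 2) * (x - 0) ^ 2"
    by blast
   have t: "(1 + x) powr q = 1 + q * x + q * (q - 1) / 2 * (1 + t) powr (q - 2) * x^2" "\<bar>t\<bar> <= 1/2"
    using t0 True by (auto simp: diff_def lessThan_Suc numeral_2_eq_2 split: if_splits)
   have "(1 + t) powr (q - 2) <= 2 powr (q - 2)" using t q by (intro powr_mono2) auto
   then have "q * (q - 1) / 2 * (1 + t) powr (q - 2) * x^2 <= C * x^2"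
    unfolding C_def using q by (intro mult_right_mono mult_left_mono) auto
   then show ?thesis using t by simp
  qed (use q in simp)
  also have "C * x^2 <= (3 powr q + 2 * q + C) * (x^2 + \<bar>x\<bar> powr q)" using 3 C q by (intro mult_mono) auto
  finally show ?thesis using True by (simp add: abs_of_nonneg)
 next
  case False
  have "\<bar>1 + x\<bar> powr q <= (3 * \<bar>x\<bar>) powr q" using False q by (intro powr_mono2) auto
  also have "... = 3 powr q * \<bar>x\<bar> powr q" by (simp add: powr_mult)
  finally have 1: "\<bar>1 + x\<bar> powr q <= 3 powr q * \<bar>x\<bar> powr q" .
  have "\<bar>x\<bar> * 1 <= \<bar>x\<bar> * (2 * \<bar>x\<bar>)" using False by (intro mult_left_mono) auto
  then have "q * \<bar>x\<bar> <= q * (2 * x^2)" using q by (intro mult_left_mono) (auto simp: power2_eq_square)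
  moreover have "- (q * x) <= q * \<bar>x\<bar>" using q by (simp add: abs_if)
  ultimately have 2: "0 <= q * x + 2 * q * x^2" by (simp add: algebra_simps)
  have 3: "0 <= 3 powr q * x^2" "0 <= 2 * q * \<bar>x\<bar> powr q" "0 <= C * (x^2 + \<bar>x\<bar> powr q)" using q C by auto
  have "(3 powr q + 2 * q + C) * (x^2 + \<bar>x\<bar> powr q) = 3 powr q * \<bar>x\<bar> powr q + 2 * q * x^2
   + 3 powr q * x^2 + 2 * q * \<bar>x\<bar> powr q + C * (x^2 + \<bar>x\<bar> powr q)"
   by (simp add: algebra_simps)
  then show ?thesis using 1 2 3 by linarith
 qed
qed

text \<open>For large \<open>K\<close> the second-order remainder is absorbed by the growth of the convex function
 \<open>\<lambda>x. x powr (q / 2)\<close>.\<close>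

lemma (in prob_space) mart_step_exists:
 assumes q: "2 < q"
 obtains K where "mart_step M q K"
proof -
 obtain c where c: "c \<ge> 1" and cx: "!!x :: real. \<bar>1 + x\<bar> powr q <= 1 + q * x + c * (x^2 + \<bar>x\<bar> powr q)"
  using powr_expand_bound[OF q] by blast
 define K where "K = 2 * c"
 have K: "K \<ge> 2" using c by (simp add: K_def)
 have "mart_step M q K"
 proof (rule mart_stepI[where ?c1.0 = c and ?c2.0 = c])
  fix a b :: real
  show "\<bar>a + b\<bar> powr q <= \<bar>a\<bar> powr q + q * (sgn a * \<bar>a\<bar> powr (q - 1) * b)
    + c * (\<bar>a\<bar> powr (q - 2) * b^2) + c * \<bar>b\<bar> powr q"
  proof (cases "a = 0")
   case True
   have "1 * \<bar>b\<bar> powr q <= c * \<bar>b\<bar> powr q" using c by (intro mult_right_mono) auto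
   then show ?thesis using True by simp
  next
   case False
   define x where "x = b / a"
   have b: "b = a * x" using False by (simp add: x_def)
   have "\<bar>a + b\<bar> powr q = \<bar>a\<bar> powr q * \<bar>1 + x\<bar> powr q"
    by (simp add: b powr_mult[symmetric] abs_mult[symmetric] distrib_left)
   also have "... <= \<bar>a\<bar> powr q * (1 + q * x + c * (x^2 + \<bar>x\<bar> powr q))" using cx by (intro mult_left_mono) auto
   also have "... = \<bar>a\<bar> powr q + q * (\<bar>a\<bar> powr q * x) + c * (\<bar>a\<bar> powr q * x^2) + c * (\<bar>a\<bar> powr q * \<bar>x\<bar> powr q)"
    by (simp add: algebra_simps)
   also have "\<bar>a\<bar> powr q * x = sgn a * \<bar>a\<bar> powr (q - 1) * b" using False by (simp add: b powr_diff sgn_mult_abs abs_sgn)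
     (simp add: sgn_if abs_if)
   also have "\<bar>a\<bar> powr q * x^2 = \<bar>a\<bar> powr (q - 2) * b^2" using False by (simp add: b powr_diff power_mult_distrib)
   also have "\<bar>a\<bar> powr q * \<bar>x\<bar> powr q = \<bar>b\<bar> powr q" by (simp add: b abs_mult powr_mult)
   finally show ?thesis by simp
  qed
 next
  fix x t :: real assume x: "0 < x" "0 < t"
  define r where "r = q / 2"
  have r: "r > 1" using q by (simp add: r_def)
  have 1: "(K * x) powr r + r * (K * x) powr (r - 1) * (K * t) <= (K * x + K * t) powr r" using x K r by (intro powr_tangent) auto
  have 2: "(K * x) powr r + (K * t) powr r <= (K * x + K * t) powr r" using x K r by (intro powr_superadd) auto
  have "2 * c <= r * K" using r K mult_right_mono[of 1 r K] by (simp add: K_def)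
  then have "2 * (c * ((K * x) powr (r - 1) * t)) <= r * (K * x) powr (r - 1) * (K * t)"
   using x mult_right_mono[of "2 * c" "r * K" "(K * x) powr (r - 1) * t"] by (simp add: algebra_simps)
  moreover have "2 * (c * t powr r) <= (K * t) powr r"
  proof -
   have "K powr 1 <= K powr r" using K r by (intro powr_mono) auto
   then have "2 * c <= K powr r" using K by (simp add: K_def)
   then show ?thesis using x K mult_right_mono[of "2 * c" "K powr r" "t powr r"] by (simp add: powr_mult)
  qed
  moreover have e: "(q - 2) / 2 = r - 1" by (simp add: r_def field_simps)
  ultimately show "(K * x) powr (q / 2) + c * ((K * x) powr ((q - 2) / 2) * t) + c * t powr (q / 2) <= (K * (x + t)) powr (q / 2)"
   using 1 2 unfolding e r_def[symmetric] distrib_left by linarith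
 qed (use q K c in auto)
 then show thesis by (rule that)
qed

section \<open>Averaging over independent coordinates\<close>

text \<open>Resampling: the coordinates outside \<open>A\<close> are taken from the second sequence.\<close>

definition mix :: "int set => (int => 'e) => (int => 'e) => int => 'e" where
 "mix A e e' = (%i. if i : A then e i else e' i)"

lemma mix_in [simp]: "i : A ==> mix A e e' i = e i"
 and mix_out [simp]: "i ~: A ==> mix A e e' i = e' i"
 by (simp_all add: mix_def)

locale innovations =
 fixes D :: "'e measure"
 assumes prob_space_D: "prob_space D"
begin

definition S :: "(int => 'e) measure" where
 "S = (\<Pi>\<^sub>M i\<in>UNIV. D)"

abbreviation SxS :: "((int => 'e) \<times> (int => 'e)) measure" where "SxS \<equiv> S \<Otimes>\<^sub>M S"

sublocale S: prob_space S
 unfolding S_def by (intro prob_space_PiM prob_space_D)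

sublocale SS: pair_prob_space S S ..

definition depends_on :: "int set => ((int => 'e) => 'b) => bool" where
 "depends_on A f \<longleftrightarrow> (ALL e:space S. ALL e':space S. (ALL i:A. e i = e' i) --> f e = f e')"

lemma depends_onD: "depends_on A f ==> e : space S ==> e' : space S ==> (!!i. i : A ==> e i = e' i) ==> f e = f e'"
 unfolding depends_on_def by blast

lemma depends_on_mono: "depends_on A f ==> A \<subseteq> B ==> depends_on B f"
 unfolding depends_on_def by blast

lemma depends_on_compose: "depends_on A f ==> depends_on A (%e. h (f e))"
 unfolding depends_on_def by (intro ballI impI arg_cong[where f=h]) blast

lemma depends_on_compose2: "depends_on A f ==> depends_on A g ==> depends_on A (%e. h (f e) (g e))"
 unfolding depends_on_def by (intro ballI impI arg_cong2[where f=h]) blast+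

lemma depends_on_sum: "(!!k. k : I ==> depends_on A (f k)) ==> depends_on A (%e. SUM k:I. f k e)"
 unfolding depends_on_def by (intro ballI impI sum.cong refl) blast

lemma depends_on_const: "depends_on A (%_. c)" by (simp add: depends_on_def)

lemma space_S: "e : space S \<longleftrightarrow> (ALL i. e i : space D)" by (auto simp: S_def space_PiM PiE_iff)

lemma mix_space [simp]: "e : space S ==> e' : space S ==> mix A e e' : space S" by (auto simp: space_S mix_def)

lemma measurable_mix [measurable (raw)]:
 assumes [measurable]: "f : M \<rightarrow>\<^sub>M S" "g : M \<rightarrow>\<^sub>M S"
 shows "(%x. mix A (f x) (g x)) : M \<rightarrow>\<^sub>M S"
proof -
 have [measurable]: "f : M \<rightarrow>\<^sub>M (\<Pi>\<^sub>M i\<in>UNIV. D)" "g : M \<rightarrow>\<^sub>M (\<Pi>\<^sub>M i\<in>UNIV. D)"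
  using assms by (auto simp: S_def)
 have sp: "f x i : space D" "g x i : space D" if "x : space M" for x i
  using measurable_space[OF assms(1) that] measurable_space[OF assms(2) that] by (auto simp: space_S)
 have c: "(%x. mix A (f x) (g x) i) : M \<rightarrow>\<^sub>M D" for i by (cases "i : A") simp_all
 show ?thesis unfolding S_def by (rule measurable_PiM_single'[OF c]) (auto simp: mix_def sp)
qed

lemma distr_mix: "distr SxS S (%x. mix A (fst x) (snd x)) = S"
proof -
 interpret D: prob_space D by (rule prob_space_D)
 interpret P: product_prob_space "%_. D" "UNIV :: int set" by unfold_locales
 have "distr SxS S (%x. mix A (fst x) (snd x)) = PiM UNIV (%_. D)"
 proof (rule P.PiM_eq)
  fix J :: "int set" and F :: "int => 'e set"
  assume J: "finite J" "J \<subseteq> UNIV" and F: "!!j. j : J ==> F j : sets D"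
  let ?C = "%J. {x:space S. ALL i:J. x i : F i}"
  have C: "emeasure S (?C J') = (\<Prod>j\<in>J'. emeasure D (F j))" if "J' \<subseteq> J" for J'
   unfolding S_def using that F J by (intro P.emeasure_PiM_Collect) (auto intro: finite_subset)
  have Cs: "?C J' : sets S" if "J' \<subseteq> J" for J'
   unfolding S_def using that F J finite_subset[OF that J(1)]
   by (intro sets.sets_Collect_finite_All) (auto intro!: sets_Collect_single')
  have emb: "prod_emb UNIV (%_. D) J (\<Pi>\<^sub>E j\<in>J. F j) = ?C J"
   unfolding prod_emb_def S_def by (auto simp: space_PiM PiE_iff)
  have "(%x. mix A (fst x) (snd x)) -` ?C J Int space SxS = ?C (J Int A) \<times> ?C (J - A)"
   by (auto simp: space_pair_measure mix_def space_S split: if_splits)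
  then have "emeasure (distr SxS S (%x. mix A (fst x) (snd x))) (?C J)
    = emeasure SxS (?C (J Int A) \<times> ?C (J - A))"
   by (subst emeasure_distr) (auto intro: Cs)
  also have "... = emeasure S (?C (J Int A)) * emeasure S (?C (J - A))" by (intro S.emeasure_pair_measure_Times Cs) auto
  also have "... = (\<Prod>j\<in>J. emeasure D (F j))" using prod.Int_Diff[OF J(1), of "%j. emeasure D (F j)" A] C[of "J Int A"] C[of "J - A"] by simp
  finally show "emeasure (distr SxS S (%x. mix A (fst x) (snd x)))
    (prod_emb UNIV (%_. D) J (\<Pi>\<^sub>E j\<in>J. F j)) = (\<Prod>j\<in>J. emeasure D (F j))"
   by (simp add: emb)
 qed (simp add: S_def)
 then show ?thesis by (simp add: S_def)
qed

lemma nn_integral_mix: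
 assumes [measurable]: "f : borel_measurable S"
 shows "(\<integral>\<^sup>+ e. \<integral>\<^sup>+ e'. f (mix A e e') \<partial>S \<partial>S) = (\<integral>\<^sup>+ e. f e \<partial>S)"
proof -
 have "(\<integral>\<^sup>+ e. f e \<partial>S) = (\<integral>\<^sup>+ x. f (mix A (fst x) (snd x)) \<partial>SxS)"
  by (subst distr_mix[of A, symmetric], subst nn_integral_distr) auto
 also have "... = (\<integral>\<^sup>+ e. \<integral>\<^sup>+ e'. f (mix A e e') \<partial>S \<partial>S)" by (subst S.nn_integral_fst[symmetric]) auto
 finally show ?thesis ..
qed

lemma mix_depends: "depends_on A f ==> e : space S ==> e' : space S ==> f (mix A e e') = f e" by (erule depends_onD) auto

lemma mix_depends_compl: "depends_on B f ==> A Int B = {} ==> e : space S ==> e' : space S ==> f (mix A e e') = f e'"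
 by (erule depends_onD) (simp_all, metis disjoint_iff mix_out)

text \<open>Independence by resampling: \<open>mix A e e'\<close> has the law of \<open>e\<close>, and under it \<open>f\<close> sees only \<open>e\<close> and \<open>g\<close>
 only \<open>e'\<close>.\<close>

lemma nn_integral_mult_indep:
 fixes f g :: "(int => 'e) => ennreal"
 assumes [measurable]: "f : borel_measurable S" "g : borel_measurable S"
  and dep: "depends_on A f" "depends_on B g" "A Int B = {}"
 shows "(\<integral>\<^sup>+ e. f e * g e \<partial>S) = (\<integral>\<^sup>+ e. f e \<partial>S) * (\<integral>\<^sup>+ e. g e \<partial>S)"
proof -
 have "(\<integral>\<^sup>+ e. f e * g e \<partial>S) = (\<integral>\<^sup>+ e. \<integral>\<^sup>+ e'. f (mix A e e') * g (mix A e e') \<partial>S \<partial>S)"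
  by (rule nn_integral_mix[symmetric]) measurable
 also have "... = (\<integral>\<^sup>+ e. \<integral>\<^sup>+ e'. f e * g e' \<partial>S \<partial>S)"
  using dep by (intro nn_integral_cong) (simp add: mix_depends mix_depends_compl)
 also have "... = (\<integral>\<^sup>+ e. f e * (\<integral>\<^sup>+ e'. g e' \<partial>S) \<partial>S)"
  by (intro nn_integral_cong nn_integral_cmult) auto
 also have "... = (\<integral>\<^sup>+ e. f e \<partial>S) * (\<integral>\<^sup>+ e. g e \<partial>S)" by (intro nn_integral_multc) auto
 finally show ?thesis .
qed

lemma prob_inter_indep:
 assumes [measurable]: "Measurable.pred S P" "Measurable.pred S Q"
  and dep: "depends_on A P" "depends_on B Q" "A Int B = {}"
 shows "\<P>(e in S. P e & Q e) = \<P>(e in S. P e) * \<P>(e in S. Q e)"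
proof -
 have m: "emeasure S {e:space S. R e} = (\<integral>\<^sup>+ e. (if R e then 1 else 0) \<partial>S)" if [measurable]: "Measurable.pred S R" for R
 proof -
  have "(\<integral>\<^sup>+ e. (if R e then 1 else 0) \<partial>S) = (\<integral>\<^sup>+ e. indicator {e:space S. R e} e \<partial>S)"
   by (intro nn_integral_cong) (auto simp: indicator_def)
  then show ?thesis by simp
 qed
 have "emeasure S {e:space S. P e & Q e} = (\<integral>\<^sup>+ e. (if P e then 1 else 0) * (if Q e then 1 else 0) \<partial>S)"
  by (subst m) (auto intro!: nn_integral_cong)
 also have "... = (\<integral>\<^sup>+ e. (if P e then 1 else 0) \<partial>S) * (\<integral>\<^sup>+ e. (if Q e then 1 else 0) \<partial>S)"
  using dep by (intro nn_integral_mult_indep[where A=A and B=B])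
   (auto intro: depends_on_compose[where h="%b. if b then 1 else 0"])
 finally show ?thesis by (simp add: m[symmetric] S.emeasure_eq_measure ennreal_mult[symmetric])
qed

text \<open>The conditional expectation given the coordinates in \<open>A\<close>, as an everywhere defined function.\<close>

definition cexp :: "int set => ((int => 'e) => real) => (int => 'e) => real" where
 "cexp A f e = (LINT e'|S. f (mix A e e'))"

lemma measurable_cexp [measurable]:
 assumes [measurable]: "f : borel_measurable S"
 shows "cexp A f : borel_measurable S"
 unfolding cexp_def by measurable

lemma cexp_depends: "depends_on A (cexp A f)"
 unfolding depends_on_def cexp_def
proof (intro ballI impI LINT_cong refl arg_cong[of _ _ f])
 fix e e' e'' :: "int => 'e" assume "ALL i:A. e i = e' i"
 then show "mix A e e'' = mix A e' e''" by (auto simp: mix_def)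
qed

lemma cexp_depends_inherit: "depends_on B f ==> depends_on B (cexp A f)"
 unfolding depends_on_def[of B "cexp A f"] cexp_def
 by (intro ballI impI LINT_cong refl depends_onD[of B f])
  (simp_all, metis mix_in mix_out)

lemma depends_on_Int:
 assumes "depends_on A f" "depends_on B f" shows "depends_on (A Int B) f"
 unfolding depends_on_def
proof (intro ballI impI)
 fix e e' assume e: "e : space S" "e' : space S" "ALL i:A Int B. e i = e' i"
 have "f e = f (mix A e e')" using e by (intro depends_onD[OF assms(1)]) auto
 also have "... = f e'" using e by (intro depends_onD[OF assms(2)]) (simp_all, metis IntI mix_in mix_out)
 finally show "f e = f e'" .
qed

lemma cexp_of_depends: "depends_on A f ==> e : space S ==> cexp A f e = f e"
proof -
 assume *: "depends_on A f" "e : space S"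
 have "cexp A f e = (LINT e'|S. f e)"
  unfolding cexp_def using * by (intro LINT_cong refl mix_depends) auto
 then show ?thesis by (simp add: S.prob_space)
qed

lemma cexp_mult: "depends_on A g ==> e : space S ==> cexp A (%e. g e * f e) e = g e * cexp A f e"
proof -
 assume *: "depends_on A g" "e : space S"
 have "cexp A (%e. g e * f e) e = (LINT e'|S. g e * f (mix A e e'))"
  unfolding cexp_def using * by (intro LINT_cong refl) (auto simp: mix_depends)
 then show ?thesis by (simp add: cexp_def)
qed

lemma cexp_indep: "depends_on B f ==> A Int B = {} ==> e : space S ==> cexp A f e = (LINT e|S. f e)"
 unfolding cexp_def by (intro LINT_cong refl mix_depends_compl) auto

lemma integrable_mix:
 fixes f :: "(int => 'e) => real"
 assumes "integrable S f"
 shows "integrable SxS (%x. f (mix A (fst x) (snd x)))"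
  "(\<integral>x. f (mix A (fst x) (snd x)) \<partial>SxS) = (LINT e|S. f e)"
proof -
 have [measurable]: "f : borel_measurable S" using assms by auto
 show "integrable SxS (%x. f (mix A (fst x) (snd x)))"
 proof (rule integrable_distr[of "%x. mix A (fst x) (snd x)" "SxS" S f])
  show "integrable (distr SxS S (%x. mix A (fst x) (snd x))) f"
   unfolding distr_mix by (rule assms)
 qed measurable
 show "(\<integral>x. f (mix A (fst x) (snd x)) \<partial>SxS) = (LINT e|S. f e)"
  using integral_distr[of "%x. mix A (fst x) (snd x)" "SxS" S f] by (simp add: distr_mix)
qed

lemma AE_integrable_mix:
 fixes f :: "(int => 'e) => real"
 assumes "integrable S f"
 shows "AE e in S. integrable S (%e'. f (mix A e e'))" using SS.AE_integrable_fst'[OF integrable_mix(1)[OF assms, of A]] by simp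

lemma integrable_cexp:
 assumes "integrable S f"
 shows "integrable S (cexp A f)" using SS.integrable_fst'[OF integrable_mix(1)[OF assms, of A]] by (simp add: cexp_def[abs_def])

lemma integral_cexp:
 assumes "integrable S f"
 shows "(LINT e|S. cexp A f e) = (LINT e|S. f e)" using SS.integral_fst'[OF integrable_mix(1)[OF assms, of A]] integrable_mix(2)[OF assms, of A]
 by (simp add: cexp_def)

lemma cexp_add:
 assumes "integrable S f" "integrable S g"
 shows "AE e in S. cexp A (%e. f e + g e) e = cexp A f e + cexp A g e" using AE_integrable_mix[OF assms(1), of A] AE_integrable_mix[OF assms(2), of A]
 by eventually_elim (simp add: cexp_def LINT_add)

lemma cexp_diff:
 assumes "integrable S f" "integrable S g"
 shows "AE e in S. cexp A (%e. f e - g e) e = cexp A f e - cexp A g e" using AE_integrable_mix[OF assms(1), of A] AE_integrable_mix[OF assms(2), of A]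
 by eventually_elim (simp add: cexp_def LINT_diff)

lemma cexp_cmult: "cexp A (%e. c * f e) e = c * cexp A f e" by (simp add: cexp_def)

lemma cexp_sum:
 assumes "finite I" "!!k. k : I ==> integrable S (f k)"
 shows "AE e in S. cexp A (%e. SUM k:I. f k e) e = (SUM k:I. cexp A (f k) e)"
proof -
 have "AE e in S. ALL k:I. integrable S (%e'. f k (mix A e e'))" using assms by (intro AE_finite_allI AE_integrable_mix)
 then show ?thesis by eventually_elim (simp add: cexp_def LINT_sum)
qed

text \<open>Averaging over an outer set of coordinates and then over an inner one.\<close>

lemma cexp_cexp:
 assumes f: "integrable S f"
 shows "AE e in S. cexp A (cexp B f) e = cexp (A Int B) f e"
proof -
 have [measurable]: "f : borel_measurable S" using f by auto
 show ?thesis using AE_integrable_mix[OF f, of "A Int B"] AE_space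
 proof eventually_elim
  case (elim e)
  have mm: "mix B (mix A e e') e'' = mix (A Int B) e (mix B e' e'')" for e' e'' by (auto simp: mix_def fun_eq_iff)
  note i = integrable_mix[OF elim(1), of B]
  have "cexp A (cexp B f) e = (LINT e'|S. LINT e''|S. f (mix (A Int B) e (mix B e' e'')))" by (simp add: cexp_def mm)
  also have "... = (\<integral>x. f (mix (A Int B) e (mix B (fst x) (snd x))) \<partial>SxS)" using SS.integral_fst'[OF i(1)] by simp
  also have "... = cexp (A Int B) f e" using i(2) by (simp add: cexp_def)
  finally show ?case .
 qed
qed

lemma (in prob_space) abs_integral_powr_le:
 assumes [measurable]: "h : borel_measurable M" and q: "1 <= q"
 shows "ennreal (\<bar>LINT x|M. h x\<bar> powr q) <= (\<integral>\<^sup>+ x. ennreal (\<bar>h x\<bar> powr q) \<partial>M)"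
proof (cases "(\<integral>\<^sup>+ x. ennreal (\<bar>h x\<bar> powr q) \<partial>M)")
 case (real r)
 have "Lq_le M q h (r powr (1/q))" using real q by (auto simp: Lq_le_def powr_powr)
 then have "\<bar>LINT x|M. h x\<bar> <= r powr (1/q)" using Lq_le_integrable(2) q by blast
 then have "\<bar>LINT x|M. h x\<bar> powr q <= (r powr (1/q)) powr q" using q by (intro powr_mono2) auto
 then show ?thesis using real q by (simp add: powr_powr)
qed auto

lemma Lq_le_cexp:
 assumes f: "Lq_le S q f c" and q: "1 <= q"
 shows "Lq_le S q (cexp A f) c"
proof -
 have [measurable]: "f : borel_measurable S" using f by (auto simp: Lq_le_def)
 have "(\<integral>\<^sup>+ e. ennreal (\<bar>cexp A f e\<bar> powr q) \<partial>S) <= (\<integral>\<^sup>+ e. \<integral>\<^sup>+ e'. ennreal (\<bar>f (mix A e e')\<bar> powr q) \<partial>S \<partial>S)"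
  unfolding cexp_def by (intro nn_integral_mono S.abs_integral_powr_le q) measurable
 also have "... = (\<integral>\<^sup>+ e. ennreal (\<bar>f e\<bar> powr q) \<partial>S)" by (rule nn_integral_mix) measurable
 finally show ?thesis using f by (auto simp: Lq_le_def)
qed

lemma cexp_L1_le:
 assumes "integrable S f"
 shows "(LINT e|S. \<bar>cexp A f e\<bar>) <= (LINT e|S. \<bar>f e\<bar>)"
proof -
 have "Lq_le S 1 f (LINT e|S. \<bar>f e\<bar>)" using assms by (intro Lq_leI_integrable_powr) auto
 from S.Lq_le_integrable(3)[OF Lq_le_cexp[OF this, of A]] show ?thesis by simp
qed

lemma integrable_indicator_S [simp]: "A : sets S ==> integrable S (indicat_real A)"
 by (intro integrable_real_indicator) (auto simp: S.emeasure_eq_measure)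

text \<open>Averaging over the coordinates before \<open>c - n\<close> does nothing in the limit.  This holds for functions
 of finitely many past coordinates, and it passes to limits in \<open>L\<^sup>1\<close>.\<close>

definition tail_conv :: "int => ((int => 'e) => real) => bool" where
 "tail_conv c f \<longleftrightarrow> (%n. LINT e|S. \<bar>cexp {c - int n..} f e - f e\<bar>) \<longlonglongrightarrow> 0"

lemma tail_conv_closure:
 assumes f: "integrable S f"
  and approx: "!!eps. eps > 0 ==> EX g. integrable S g & tail_conv c g & (LINT e|S. \<bar>f e - g e\<bar>) <= eps"
 shows "tail_conv c f"
 unfolding tail_conv_def
proof (rule LIMSEQ_I)
 fix eps :: real assume "eps > 0"
 then have "eps / 3 > 0" by simp
 from approx[OF this] obtain g where g: "integrable S g" "tail_conv c g" "(LINT e|S. \<bar>f e - g e\<bar>) <= eps / 3" by blast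
 from LIMSEQ_D[OF g(2)[unfolded tail_conv_def] \<open>eps / 3 > 0\<close>]
 obtain n0 where n0: "!!n. n \<ge> n0 ==> (LINT e|S. \<bar>cexp {c - int n..} g e - g e\<bar>) < eps / 3" by auto
 have "(LINT e|S. \<bar>cexp {c - int n..} f e - f e\<bar>) < eps" if "n \<ge> n0" for n
 proof -
  let ?A = "{c - int n..}"
  have i: "integrable S (%e. f e - g e)" using f g by auto
  have "(LINT e|S. \<bar>cexp ?A f e - f e\<bar>)
    <= (LINT e|S. \<bar>cexp ?A (%e. f e - g e) e\<bar> + \<bar>cexp ?A g e - g e\<bar> + \<bar>f e - g e\<bar>)"
  proof (rule integral_mono_AE)
   show "AE e in S. \<bar>cexp ?A f e - f e\<bar> <= \<bar>cexp ?A (%e. f e - g e) e\<bar> + \<bar>cexp ?A g e - g e\<bar> + \<bar>f e - g e\<bar>"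
    using cexp_diff[OF f g(1), of ?A] by eventually_elim linarith
  qed (use f g i in \<open>auto intro!: integrable_cexp Bochner_Integration.integrable_add\<close>)
  also have "... = (LINT e|S. \<bar>cexp ?A (%e. f e - g e) e\<bar>) + (LINT e|S. \<bar>cexp ?A g e - g e\<bar>) + (LINT e|S. \<bar>f e - g e\<bar>)"
   using f g i by (simp add: LINT_add integrable_cexp)
  also have "... < eps / 3 + eps / 3 + eps / 3" using cexp_L1_le[OF i, of ?A] g(3) n0[OF that] by linarith
  finally show ?thesis by simp
 qed
 then show "EX n0. \<forall>n\<ge>n0. norm ((LINT e|S. \<bar>cexp {c - int n..} f e - f e\<bar>) - 0) < eps" by auto
qed

lemma tail_conv_add:
 assumes f: "integrable S f" "tail_conv c f" and g: "integrable S g" "tail_conv c g"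
 shows "tail_conv c (%e. f e + g e)"
 unfolding tail_conv_def
proof (rule tendsto_sandwich[OF _ _ tendsto_const])
 show "(%n. (LINT e|S. \<bar>cexp {c - int n..} f e - f e\<bar>) + (LINT e|S. \<bar>cexp {c - int n..} g e - g e\<bar>)) \<longlonglongrightarrow> 0"
  using tendsto_add[OF f(2)[unfolded tail_conv_def] g(2)[unfolded tail_conv_def]] by simp
 show "\<forall>\<^sub>F n in sequentially. (LINT e|S. \<bar>cexp {c - int n..} (%e. f e + g e) e - (f e + g e)\<bar>)
   <= (LINT e|S. \<bar>cexp {c - int n..} f e - f e\<bar>) + (LINT e|S. \<bar>cexp {c - int n..} g e - g e\<bar>)"
 proof (intro always_eventually allI)
  fix n
  let ?A = "{c - int n..}"
  have "(LINT e|S. \<bar>cexp ?A (%e. f e + g e) e - (f e + g e)\<bar>) <= (LINT e|S. \<bar>cexp ?A f e - f e\<bar> + \<bar>cexp ?A g e - g e\<bar>)"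
  proof (rule integral_mono_AE)
   show "AE e in S. \<bar>cexp ?A (%e. f e + g e) e - (f e + g e)\<bar> <= \<bar>cexp ?A f e - f e\<bar> + \<bar>cexp ?A g e - g e\<bar>"
    using cexp_add[OF f(1) g(1), of ?A] by eventually_elim linarith
  qed (use f g in \<open>auto intro!: integrable_cexp Bochner_Integration.integrable_add\<close>)
  then show "(LINT e|S. \<bar>cexp ?A (%e. f e + g e) e - (f e + g e)\<bar>)
   <= (LINT e|S. \<bar>cexp ?A f e - f e\<bar>) + (LINT e|S. \<bar>cexp ?A g e - g e\<bar>)"
   using f g by (simp add: LINT_add integrable_cexp)
 qed
qed auto

lemma tail_conv_cmult:
 assumes "tail_conv c f" shows "tail_conv c (%e. a * f e)"
proof -
 have "\<bar>cexp A (%e. a * f e) e - a * f e\<bar> = \<bar>a\<bar> * \<bar>cexp A f e - f e\<bar>" for A e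
  by (simp add: cexp_cmult abs_mult[symmetric] right_diff_distrib)
 then show ?thesis using tendsto_mult_left[OF assms[unfolded tail_conv_def], of "\<bar>a\<bar>"] by (simp add: tail_conv_def)
qed

lemma tail_conv_depends:
 assumes "depends_on J f" "finite J"
 shows "tail_conv c f"
proof -
 obtain n0 :: nat where n0: "J \<subseteq> {c - int n0..}"
 proof
  show "J \<subseteq> {c - int (nat (c - Min (insert c J)))..}"
  proof
   fix j assume "j : J"
   then have "Min (insert c J) <= j" "Min (insert c J) <= c" using assms(2) by auto
   then show "j : {c - int (nat (c - Min (insert c J)))..}" by auto
  qed
 qed
 have "(LINT e|S. \<bar>cexp {c - int n..} f e - f e\<bar>) = 0" if "n \<ge> n0" for n
 proof -
  have "depends_on {c - int n..} f" using that n0 by (intro depends_on_mono[OF assms(1)]) auto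
  then have "(LINT e|S. \<bar>cexp {c - int n..} f e - f e\<bar>) = (LINT e|S. 0)" by (intro LINT_cong refl) (simp add: cexp_of_depends)
  then show ?thesis by simp
 qed
 then have "\<forall>\<^sub>F n in sequentially. (LINT e|S. \<bar>cexp {c - int n..} f e - f e\<bar>) = 0" by (auto simp: eventually_sequentially)
 then show ?thesis unfolding tail_conv_def by (simp add: tendsto_eventually)
qed

lemma tail_conv_indicator:
 assumes A: "A : sets S"
 shows "tail_conv c (indicator A)"
proof -
 have sS: "sets S = sigma_sets (space S) (prod_algebra UNIV (%_. D))"
  unfolding S_def by (simp add: sets_PiM space_PiM)
 have pS: "prod_algebra UNIV (%_::int. D) \<subseteq> Pow (space S)"
  unfolding S_def space_PiM by (rule prod_algebra_sets_into_space)
 have A': "A : sigma_sets (space S) (prod_algebra UNIV (%_. D))" using A sS by simp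
 show ?thesis using Int_stable_prod_algebra pS A'
 proof (induction rule: sigma_sets_induct_disjoint)
  case (basic A)
  then obtain J X where J: "A = prod_emb UNIV (%_. D) J (\<Pi>\<^sub>E j\<in>J. X j)" "finite J" by (auto elim!: prod_algebraE)
  have "depends_on J (indicator A :: _ => real)"
   unfolding depends_on_def J(1) by (auto simp: indicator_def prod_emb_def PiE_iff space_S)
  then show ?case using J by (intro tail_conv_depends)
 next
  case empty
  show ?case by (rule tail_conv_depends[of "{}"]) (auto simp: depends_on_def)
 next
  case (compl A)
  then have [measurable]: "A : sets S" by (simp add: sS)
  have "tail_conv c (%e. 1 + (-1) * indicator A e)" using compl by (intro tail_conv_add tail_conv_cmult tail_conv_depends[of "{}" "%_. 1"])
     (auto simp: depends_on_const intro!: integrable_real_indicator simp: S.emeasure_eq_measure)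
  moreover have "cexp B (%e. 1 + (-1) * indicator A e) e = cexp B (indicator (space S - A)) e" if "e : space S" for B e
   using that unfolding cexp_def by (intro LINT_cong refl) (auto simp: indicator_def)
  then have "(LINT e|S. \<bar>cexp B (%e. 1 + (-1) * indicator A e) e - (1 + (-1) * indicator A e)\<bar>) =
    (LINT e|S. \<bar>cexp B (indicator (space S - A)) e - indicator (space S - A) e\<bar>)" for B
   by (intro LINT_cong refl) (auto simp: indicator_def)
  ultimately show ?case by (simp add: tail_conv_def)
 next
  case (union A)
  have [measurable]: "A i : sets S" for i using union by (auto simp: sS)
  have int: "integrable S (indicat_real (A i))" for i by simp
  show ?case
  proof (rule tail_conv_closure)
   fix eps :: real assume "eps > 0"
   have "(%n. S.prob (\<Union>i<n. A i)) \<longlonglongrightarrow> S.prob (\<Union>n. \<Union>i<n. A i)"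
    by (intro S.finite_Lim_measure_incseq) (auto intro!: incseq_SucI simp: lessThan_Suc)
   moreover have "(\<Union>n. \<Union>i<n. A i) = (\<Union>i. A i)" by auto
   ultimately have "(%n. S.prob (\<Union>i<n. A i)) \<longlonglongrightarrow> S.prob (\<Union>i. A i)" by simp
   from LIMSEQ_D[OF this \<open>eps > 0\<close>] obtain n where n: "\<bar>S.prob (\<Union>i<n. A i) - S.prob (\<Union>i. A i)\<bar> < eps" by auto
   have tc: "tail_conv c (%e. SUM i<m. indicator (A i) e)" for m
   proof (induction m)
    case 0 show ?case by (rule tail_conv_depends[of "{}"]) (auto simp: depends_on_def)
   next
    case (Suc m) then show ?case
     using union(3) int by (simp, intro tail_conv_add) (auto intro!: Bochner_Integration.integrable_sum)
   qed
   have e: "(SUM i<n. indicator (A i) e) = (indicator (\<Union>i<n. A i) e :: real)" for e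
    using union(1) by (subst indicator_UN_disjoint) (auto simp: disjoint_family_on_def)
   have "(LINT e|S. \<bar>indicator (\<Union>i. A i) e - indicator (\<Union>i<n. A i) e :: real\<bar>) = (LINT e|S. indicator (\<Union>i. A i) e - indicator (\<Union>i<n. A i) e)"
    by (intro LINT_cong refl) (auto simp: indicator_def)
   also have "... = S.prob (\<Union>i. A i) - S.prob (\<Union>i<n. A i)" by (subst LINT_diff) auto
   also have "... <= eps" using n by auto
   finally have "(LINT e|S. \<bar>indicator (\<Union>i. A i) e - (SUM i<n. indicator (A i) e)\<bar>) <= eps" by (simp add: e)
   then show "EX g. integrable S g & tail_conv c g & (LINT e|S. \<bar>indicator (\<Union>i. A i) e - g e\<bar>) <= eps"
    using tc[of n] by (intro exI[of _ "%e. SUM i<n. indicator (A i) e"]) auto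
  qed auto
 qed
qed

lemma cexp_tail_tendsto_L1:
 assumes "integrable S f"
 shows "tail_conv c f" using assms
proof (induction rule: integrable_induct)
 case (base A a)
 have "tail_conv c (%e. a * indicator A e)" using base by (intro tail_conv_cmult tail_conv_indicator) auto
 then show ?case by (simp add: mult.commute)
next
 case (add f g) then show ?case by (intro tail_conv_add)
next
 case (lim f s)
 show ?case
 proof (rule tail_conv_closure[OF lim(4)])
  fix eps :: real assume e: "eps > 0"
  have [measurable]: "f : borel_measurable S" "!!i. s i : borel_measurable S" using lim(1,4) by auto
  have "(%i. LINT e|S. \<bar>f e - s i e\<bar>) \<longlonglongrightarrow> (LINT e|S. 0)"
  proof (rule integral_dominated_convergence[where w="%e. 3 * norm (f e)"])
   show "AE x in S. (%i. \<bar>f x - s i x\<bar>) \<longlonglongrightarrow> 0"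
   proof (rule AE_I2)
    fix x assume "x : space S"
    from tendsto_diff[OF tendsto_const[of "f x"] lim(2)[OF this]]
    have "(%i. f x - s i x) \<longlonglongrightarrow> 0" by simp
    then show "(%i. \<bar>f x - s i x\<bar>) \<longlonglongrightarrow> 0" by (rule tendsto_rabs_zero)
   qed
   show "AE x in S. norm \<bar>f x - s i x\<bar> <= 3 * norm (f x)" for i using lim(3) by (intro AE_I2) (smt (verit) real_norm_def)
  qed (use lim(4) in auto)
  from LIMSEQ_D[OF this e] obtain i where "\<bar>LINT e|S. \<bar>f e - s i e\<bar>\<bar> < eps" by auto
  then show "EX g. integrable S g & tail_conv c g & (LINT e|S. \<bar>f e - g e\<bar>) <= eps" using lim(1,5)[of i] by (intro exI[of _ "s i"]) auto
 qed
qed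

end

section \<open>Martingale inequality along the past\<close>

context innovations
begin

text \<open>The filtration grows into the past, \<open>{i..}\<close> being larger for smaller \<open>i\<close>; \<open>proj i F\<close> is the
 martingale difference that reveals coordinate \<open>i\<close>.\<close>

definition proj :: "int => ((int => 'e) => real) => (int => 'e) => real" where
 "proj i F e = cexp {i..} F e - cexp {i + 1..} F e"

definition resample_le :: "real => ((int => 'e) => real) => int => real => bool" where
 "resample_le q F i d \<longleftrightarrow> F : borel_measurable S &
   Lq_le SxS q (%x. F (fst x) - F (mix (- {i}) (fst x) (snd x))) d"

lemma measurable_proj [measurable]: "F : borel_measurable S ==> proj i F : borel_measurable S"
 unfolding proj_def by (intro borel_measurable_diff measurable_cexp)

lemma Lq_le_mix:
 assumes "Lq_le S q F c"
 shows "Lq_le SxS q (%x. F (mix A (fst x) (snd x))) c"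
proof -
 have [measurable]: "F : borel_measurable S" using assms by (auto simp: Lq_le_def)
 have "Lq_le (distr SxS S (%x. mix A (fst x) (snd x))) q F c" using assms by (simp add: distr_mix)
 then show ?thesis by (subst (asm) Lq_le_distr) auto
qed

lemma mix_UNIV [simp]: "mix UNIV e e' = e" by (auto simp: mix_def)

lemma Lq_le_fst: "Lq_le S q F c ==> Lq_le SxS q (%x. F (fst x)) c" using Lq_le_mix[of q F c UNIV] by simp

lemma resample_le_nonneg: "resample_le q F i d ==> 0 <= d" by (auto simp: resample_le_def Lq_le_def)

lemma resample_le_mono: "resample_le q F i c ==> c <= d ==> 0 <= q ==> resample_le q F i d" by (auto simp: resample_le_def intro: Lq_le_mono)

lemma resample_le_depends:
 assumes [measurable]: "F : borel_measurable S" and "depends_on A F" "i ~: A"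
 shows "resample_le q F i 0"
proof -
 have "F (mix (- {i}) e e') = F e" if "e : space S" "e' : space S" for e e'
 proof (rule depends_onD[OF assms(2)])
  fix j assume "j : A"
  then have "j : - {i}" using assms(3) by auto
  then show "mix (- {i}) e e' j = e j" by (rule mix_in)
 qed (use that in auto)
 then have "(\<integral>\<^sup>+ x. ennreal (\<bar>F (fst x) - F (mix (- {i}) (fst x) (snd x))\<bar> powr q) \<partial>SxS)
   = (\<integral>\<^sup>+ x. 0 \<partial>SxS)"
  by (intro nn_integral_cong) (auto simp: space_pair_measure)
 then show ?thesis by (auto simp: resample_le_def Lq_le_def)
qed

lemma resample_le_cmult:
 assumes "resample_le q F i d" "0 <= q"
 shows "resample_le q (%e. a * F e) i (\<bar>a\<bar> * d)" using Lq_le_cmult[of "SxS" q _ d a] assms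
 by (auto simp: resample_le_def right_diff_distrib[symmetric])

lemma resample_le_sum:
 assumes "finite I" "!!k. k : I ==> resample_le q (F k) i (d k)" "1 <= q"
 shows "resample_le q (%e. SUM k:I. F k e) i (SUM k:I. d k)"
proof -
 have "Lq_le SxS q (%x. SUM k:I. F k (fst x) - F k (mix (- {i}) (fst x) (snd x))) (SUM k:I. d k)"
  using assms by (intro Lq_le_sum) (auto simp: resample_le_def)
 then show ?thesis using assms by (auto simp: resample_le_def sum_subtractf intro!: borel_measurable_sum)
qed

text \<open>Resampling one coordinate commutes with averaging over others.\<close>

lemma resample_le_cexp:
 assumes F: "resample_le q F i d" and int: "integrable S F" and q: "1 <= q"
 shows "resample_le q (cexp A F) i d"
proof (cases "i : A")
 case False
 have [measurable]: "F : borel_measurable S" using int by auto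
 show ?thesis using resample_le_depends[OF measurable_cexp cexp_depends False, of F q] resample_le_nonneg[OF F] q by (auto intro: resample_le_mono)
next
 case True
 have [measurable]: "F : borel_measurable S" using int by auto
 define \<Phi> where "\<Phi> = (%e u. F e - F (mix (- {i}) e u))"
 have [measurable]: "(%x. \<Phi> (f x) (g x)) : borel_measurable M"
  if [measurable]: "f : M \<rightarrow>\<^sub>M S" "g : M \<rightarrow>\<^sub>M S" for f g and M :: "'x measure"
  unfolding \<Phi>_def by measurable
 have ae1: "AE e in S. integrable S (%e'. F (mix A e e'))" by (rule AE_integrable_mix[OF int])
 have ae2: "AE x in S \<Otimes>\<^sub>M S. integrable S (%e'. F (mix A (mix B (fst x) (snd x)) e'))" for B
 proof -
  have "AE e in distr SxS S (%x. mix B (fst x) (snd x)). integrable S (%e'. F (mix A e e'))"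
   unfolding distr_mix by (rule ae1)
  from AE_distrD[OF _ this] show ?thesis by simp
 qed
 have "(\<integral>\<^sup>+ x. ennreal (\<bar>cexp A F (fst x) - cexp A F (mix (- {i}) (fst x) (snd x))\<bar> powr q) \<partial>SxS)
   <= (\<integral>\<^sup>+ x. (\<integral>\<^sup>+ e'. ennreal (\<bar>\<Phi> (mix A (fst x) e') (snd x)\<bar> powr q) \<partial>S) \<partial>SxS)"
 proof (rule nn_integral_mono_AE)
  show "AE x in S \<Otimes>\<^sub>M S. ennreal (\<bar>cexp A F (fst x) - cexp A F (mix (- {i}) (fst x) (snd x))\<bar> powr q)
    <= (\<integral>\<^sup>+ e'. ennreal (\<bar>\<Phi> (mix A (fst x) e') (snd x)\<bar> powr q) \<partial>S)"
   using ae2[of UNIV] ae2[of "- {i}"] AE_space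
  proof eventually_elim
   case (elim x)
   have sp: "fst x : space S" "snd x : space S" using elim(3) by (auto simp: space_pair_measure)
   have mm: "mix A (mix (- {i}) (fst x) (snd x)) e' = mix (- {i}) (mix A (fst x) e') (snd x)" for e' using True by (auto simp: mix_def fun_eq_iff)
   have "cexp A F (fst x) - cexp A F (mix (- {i}) (fst x) (snd x)) = (LINT e'|S. \<Phi> (mix A (fst x) e') (snd x))"
    unfolding cexp_def \<Phi>_def mm[symmetric]
    using elim by (subst LINT_diff) auto
   then show ?case using sp q by (simp, intro S.abs_integral_powr_le) measurable
  qed
 qed
 also have "... = (\<integral>\<^sup>+ u. \<integral>\<^sup>+ e. (\<integral>\<^sup>+ e'. ennreal (\<bar>\<Phi> (mix A e e') u\<bar> powr q) \<partial>S) \<partial>S \<partial>S)"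
  by (subst SS.nn_integral_snd[symmetric]) auto
 also have "... = (\<integral>\<^sup>+ u. \<integral>\<^sup>+ e. ennreal (\<bar>\<Phi> e u\<bar> powr q) \<partial>S \<partial>S)"
  by (intro nn_integral_cong nn_integral_mix) measurable
 also have "... = (\<integral>\<^sup>+ x. ennreal (\<bar>\<Phi> (fst x) (snd x)\<bar> powr q) \<partial>SxS)"
  by (subst SS.nn_integral_snd[symmetric]) auto
 finally show ?thesis using F by (auto simp: resample_le_def Lq_le_def \<Phi>_def)
qed

lemma Lq_le_integral_snd:
 assumes f: "Lq_le SxS q (%x. f (fst x) (snd x)) c" and q: "1 <= q"
  and [measurable]: "(%x. f (fst x) (snd x)) : borel_measurable SxS"
 shows "Lq_le S q (%e. LINT u|S. f e u) c"
proof -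
 have m: "case_prod f : borel_measurable SxS" using assms(3) by (simp add: case_prod_beta')
 have [measurable]: "(%e. LINT u|S. f e u) : borel_measurable S" by (intro S.borel_measurable_lebesgue_integral m)
 have "(\<integral>\<^sup>+ e. ennreal (\<bar>LINT u|S. f e u\<bar> powr q) \<partial>S) <= (\<integral>\<^sup>+ e. \<integral>\<^sup>+ u. ennreal (\<bar>f e u\<bar> powr q) \<partial>S \<partial>S)"
 proof (intro nn_integral_mono S.abs_integral_powr_le q)
  fix e assume e: "e : space S"
  show "f e : borel_measurable S" using measurable_Pair2[OF m e] by simp
 qed
 also have "... = (\<integral>\<^sup>+ x. ennreal (\<bar>f (fst x) (snd x)\<bar> powr q) \<partial>SxS)" by (subst S.nn_integral_fst[symmetric]) auto
 finally show ?thesis using f by (auto simp: Lq_le_def)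
qed

lemma diff_cexp_compl_le:
 assumes F: "resample_le q F i d" and int: "integrable S F" and q: "1 <= q"
 shows "Lq_le S q (%e. F e - cexp (- {i}) F e) d"
proof -
 have [measurable]: "F : borel_measurable S" using F by (auto simp: resample_le_def)
 have "Lq_le S q (%e. LINT u|S. F e - F (mix (- {i}) e u)) d" using F q by (intro Lq_le_integral_snd) (auto simp: resample_le_def)
 then show ?thesis
 proof (rule Lq_le_cong_AE)
  show "AE e in S. F e - cexp (- {i}) F e = (LINT u|S. F e - F (mix (- {i}) e u))" using AE_integrable_mix[OF int, of "- {i}"]
   by eventually_elim (simp add: cexp_def LINT_diff S.prob_space)
 qed (use q in auto)
qed

text \<open>The martingale difference at \<open>i\<close> is an average of the effect of resampling coordinate \<open>i\<close>.\<close>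

lemma proj_le:
 assumes F: "resample_le q F i d" and int: "integrable S F" and q: "1 <= q"
 shows "Lq_le S q (proj i F) d"
proof -
 have [measurable]: "F : borel_measurable S" using int by auto
 have "Lq_le S q (cexp {i..} (%e. F e - cexp (- {i}) F e)) d" by (intro Lq_le_cexp diff_cexp_compl_le F int q)
 then show ?thesis
 proof (rule Lq_le_cong_AE)
  have eq: "{i..} Int - {i} = {i + 1..}" by auto
  show "AE e in S. proj i F e = cexp {i..} (%e. F e - cexp (- {i}) F e) e" using cexp_diff[OF int integrable_cexp[OF int, of "- {i}"], of "{i..}"]
    cexp_cexp[OF int, of "{i..}" "- {i}", unfolded eq]
   by eventually_elim (simp add: proj_def)
 qed (use q in auto)
qed

lemma integral_mult_cexp:
 assumes \<psi>: "depends_on A \<psi>" and int: "integrable S (%e. \<psi> e * F e)"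
 shows "integrable S (%e. \<psi> e * cexp A F e)" "(LINT e|S. \<psi> e * cexp A F e) = (LINT e|S. \<psi> e * F e)"
proof -
 have e: "cexp A (%e. \<psi> e * F e) e = \<psi> e * cexp A F e" if "e : space S" for e by (rule cexp_mult[OF \<psi> that])
 show "integrable S (%e. \<psi> e * cexp A F e)" using integrable_cexp[OF int, of A] by (simp add: e cong: Bochner_Integration.integrable_cong)
 show "(LINT e|S. \<psi> e * cexp A F e) = (LINT e|S. \<psi> e * F e)" using integral_cexp[OF int, of A] by (simp add: e cong: LINT_cong)
qed

lemma (in prob_space) integrable_sgn_powr_mult:
 assumes U: "Lq_le M q U u" and F: "Lq_le M q F b" and q: "2 <= q"
 shows "integrable M (%x. sgn (U x) * \<bar>U x\<bar> powr (q - 1) * F x)"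
proof (rule Bochner_Integration.integrable_bound)
 have U': "Lq_le M q U (u + 1)" and F': "Lq_le M q F (b + 1)" using q by (auto intro: Lq_le_mono[OF U] Lq_le_mono[OF F])
 show "integrable M (%x. \<bar>U x\<bar> powr (q - 1) * \<bar>F x\<bar> powr (q - (q - 1)))"
  using q Lq_le_nonneg[OF U] Lq_le_nonneg[OF F] by (intro Lq_le_Hoelder[OF U' F']) auto
 show "AE x in M. norm (sgn (U x) * \<bar>U x\<bar> powr (q - 1) * F x) <= norm (\<bar>U x\<bar> powr (q - 1) * \<bar>F x\<bar> powr (q - (q - 1)))"
  by (auto simp: abs_mult abs_sgn_eq)
 have [measurable]: "U : borel_measurable M" "F : borel_measurable M" using U F by (auto simp: Lq_le_def)
 show "(%x. sgn (U x) * \<bar>U x\<bar> powr (q - 1) * F x) : borel_measurable M" by measurable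
qed

lemma proj_orthogonal:
 assumes U: "Lq_le S q U u" and F: "Lq_le S q F b" and q: "2 <= q" and dep: "depends_on {i + 1..} U"
 shows "(LINT e|S. sgn (U e) * \<bar>U e\<bar> powr (q - 1) * proj i F e) = 0"
proof -
 let ?\<psi> = "%e. sgn (U e) * \<bar>U e\<bar> powr (q - 1)"
 have dep1: "depends_on {i + 1..} ?\<psi>" by (rule depends_on_compose[OF dep])
 have dep0: "depends_on {i..} ?\<psi>" by (rule depends_on_mono[OF dep1]) auto
 have int: "integrable S (%e. ?\<psi> e * F e)" by (rule S.integrable_sgn_powr_mult[OF U F q])
 have "(LINT e|S. ?\<psi> e * proj i F e) = (LINT e|S. ?\<psi> e * cexp {i..} F e - ?\<psi> e * cexp {i + 1..} F e)"
  by (simp add: proj_def right_diff_distrib)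
 also have "... = 0" using integral_mult_cexp[OF dep0 int] integral_mult_cexp[OF dep1 int] by (subst LINT_diff) auto
 finally show ?thesis .
qed

text \<open>The martingale inequality along the filtration that reveals the coordinates from the
 present into the past.\<close>

theorem martingale_le:
 assumes q: "2 <= q" and K: "mart_step S q K" and F: "Lq_le S q F b"
  and d: "!!i. i < c ==> Lq_le S q (proj i F) (d i)"
  and s: "!!n. (SUM i:{c - int n..<c}. (d i)^2) <= s"
 shows "Lq_le S q (%e. F e - cexp {c..} F e) (sqrt (K * s))"
proof -
 have int: "integrable S F" by (rule S.Lq_le_integrable(1)[OF F]) (use q in auto)
 have [measurable]: "F : borel_measurable S" using int by auto
 have K0: "0 < K" using K by (simp add: mart_step_def)
 have fin: "Lq_le S q (%e. cexp {c - int n..} F e - cexp {c..} F e) (sqrt (K * (SUM i:{c - int n..<c}. (d i)^2)))" for n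
 proof (induction n)
  case 0 then show ?case by (simp add: Lq_le_zero)
 next
  case (Suc n)
  define i where "i = c - int n - 1"
  let ?U = "%e. cexp {c - int n..} F e - cexp {c..} F e"
  have i: "i + 1 = c - int n" "i = c - int (Suc n)" by (auto simp: i_def)
  have dep: "depends_on {i + 1..} ?U"
   unfolding i(1)
  proof (rule depends_on_compose2[where h="(-)"])
   show "depends_on {c - int n..} (cexp {c..} F)" by (rule depends_on_mono[OF cexp_depends]) auto
  qed (rule cexp_depends)
  have "Lq_le S q (%e. ?U e + proj i F e) (sqrt (K * ((SUM i:{c - int n..<c}. (d i)^2) + (d i)^2)))"
   using K[unfolded mart_step_def] Suc d[of i] proj_orthogonal[OF Suc F q dep] by (auto simp: i_def sum_nonneg)
  moreover have "?U e + proj i F e = cexp {c - int (Suc n)..} F e - cexp {c..} F e" for e by (simp add: proj_def i)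
  moreover have "(SUM i:{c - int (Suc n)..<c}. (d i)^2) = (SUM i:{c - int n..<c}. (d i)^2) + (d i)^2"
  proof -
   have "{c - int (Suc n)..<c} = insert i {c - int n..<c}" "i ~: {c - int n..<c}" by (auto simp: i_def)
   then show ?thesis by simp
  qed
  ultimately show ?case by simp
 qed
 have le: "Lq_le S q (%e. cexp {c - int n..} F e - cexp {c..} F e) (sqrt (K * s))" for n using K0 s[of n] q by (intro Lq_le_mono[OF fin]) auto
 have "EX r. strict_mono r & (AE e in S. (%n. cexp {c - int (r n)..} F e - F e) \<longlonglongrightarrow> 0)"
  using cexp_tail_tendsto_L1[OF int, of c] int by (intro tendsto_L1_AE_subseq) (auto simp: tail_conv_def intro: integrable_cexp)
 then obtain r where r: "AE e in S. (%n. cexp {c - int (r n)..} F e - F e) \<longlonglongrightarrow> 0" by blast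
 show ?thesis
 proof (rule Lq_le_Fatou[of S q "%n e. cexp {c - int (r n)..} F e - cexp {c..} F e"])
  show "AE e in S. (%n. cexp {c - int (r n)..} F e - cexp {c..} F e) \<longlonglongrightarrow> F e - cexp {c..} F e" using r
  proof eventually_elim
   case (elim e)
   from tendsto_add[OF elim tendsto_const[of "F e - cexp {c..} F e"]] show ?case by simp
  qed
 qed (use le q in auto)
qed

corollary martingale_resample_le:
 assumes q: "2 <= q" and K: "mart_step S q K" and F: "Lq_le S q F b"
  and d: "!!i. i < c ==> resample_le q F i (d i)"
  and s: "!!n. (SUM i:{c - int n..<c}. (d i)^2) <= s"
 shows "Lq_le S q (%e. F e - cexp {c..} F e) (sqrt (K * s))" using S.Lq_le_integrable(1)[OF F] q
 by (intro martingale_le[OF q K F proj_le s]) (auto intro: d)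

corollary centered_resample_le:
 assumes q: "2 <= q" and K: "mart_step S q K" and F: "Lq_le S q F b" and dep: "depends_on {..<c} F"
  and d: "!!i. i < c ==> resample_le q F i (d i)"
  and s: "!!n. (SUM i:{c - int n..<c}. (d i)^2) <= s"
 shows "Lq_le S q (%e. F e - (LINT e|S. F e)) (sqrt (K * s))"
proof (rule Lq_le_cong_AE[OF martingale_resample_le[OF q K F d s]])
 have [measurable]: "F : borel_measurable S" using F by (auto simp: Lq_le_def)
 have "{c..} Int {..<c} = {}" by auto
 from cexp_indep[OF dep this] show "AE e in S. F e - (LINT e|S. F e) = F e - cexp {c..} F e" by (intro AE_I2) metis
 show "(%e. F e - (LINT e|S. F e)) : borel_measurable S" by measurable
qed (use q in auto)

text \<open>A martingale difference at \<open>i\<close> correlates with \<open>Y\<close> only through the dependence of \<open>Y\<close> on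
 coordinate \<open>i\<close>.\<close>

lemma cexp_proj_mult_le:
 assumes D: "Lq_le S (2*q) (proj i F) a" and F: "integrable S F"
  and Y: "resample_le (2*q) Y i b" "Lq_le S (2*q) Y b'" and q: "1 <= q" and A: "i ~: A"
 shows "Lq_le S q (cexp A (%e. proj i F e * Y e)) (a * b)"
proof -
 have iY: "integrable S Y" by (rule S.Lq_le_integrable(1)[OF Y(2)]) (use q in auto)
 have [measurable]: "F : borel_measurable S" "Y : borel_measurable S" using F iY by auto
 let ?Y1 = "cexp (- {i}) Y"
 have Y1: "Lq_le S (2*q) ?Y1 b'" by (intro Lq_le_cexp Y) (use q in auto)
 have YY: "Lq_le S (2*q) (%e. Y e - ?Y1 e) b" by (intro diff_cexp_compl_le Y iY) (use q in auto)
 have i1: "integrable S (%e. proj i F e * Y e)" "integrable S (%e. proj i F e * ?Y1 e)"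
  using Lq_le_mult[OF D Y(2)] Lq_le_mult[OF D Y1] q by (auto intro: S.Lq_le_integrable(1))
 have "Lq_le S q (cexp A (%e. proj i F e * (Y e - ?Y1 e))) (a * b)" by (intro Lq_le_cexp Lq_le_mult D YY) (use q in auto)
 then show ?thesis
 proof (rule Lq_le_cong_AE)
  have z1: "AE e in S. cexp (- {i}) (proj i F) e = 0"
  proof -
   have eq: "- {i} Int {i..} = {i + 1..}" "- {i} Int {i + 1..} = {i + 1..}" by auto
   show ?thesis using cexp_diff[OF integrable_cexp[OF F, of "{i..}"] integrable_cexp[OF F, of "{i + 1..}"], of "- {i}"]
     cexp_cexp[OF F, of "- {i}" "{i..}"] cexp_cexp[OF F, of "- {i}" "{i + 1..}"]
    unfolding eq by (eventually_elim) (simp add: proj_def[abs_def])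
  qed
  have z2: "AE e in S. cexp (- {i}) (%e. proj i F e * ?Y1 e) e = 0" using z1 AE_space
  proof eventually_elim
   case (elim e)
   then show ?case using cexp_mult[OF cexp_depends[of "- {i}" Y], of e "proj i F"] by (simp add: mult.commute)
  qed
  have z3: "AE e in S. cexp A (cexp (- {i}) (%e. proj i F e * ?Y1 e)) e = 0"
  proof -
   have "Lq_le S 1 (cexp (- {i}) (%e. proj i F e * ?Y1 e)) 0" by (rule Lq_le_cong_AE[OF Lq_le_zero _ z2]) auto
   from Lq_le_cexp[OF this, of A]
   have "(\<integral>\<^sup>+ e. ennreal (\<bar>cexp A (cexp (- {i}) (%e. proj i F e * ?Y1 e)) e\<bar> powr 1) \<partial>S) = 0"
    by (simp add: Lq_le_def)
   then show ?thesis by (subst (asm) nn_integral_0_iff_AE) auto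
  qed
  have eq: "A Int - {i} = A" using A by auto
  show "AE e in S. cexp A (%e. proj i F e * Y e) e = cexp A (%e. proj i F e * (Y e - ?Y1 e)) e"
   using cexp_cexp[OF i1(2), of A "- {i}", unfolded eq] z3 cexp_diff[OF i1, of A] by eventually_elim (simp add: right_diff_distrib)
 qed (use q in auto)
qed

end

section \<open>Dependence coefficients, linear and quadratic forms\<close>

definition tail_sum :: "(nat => real) => nat => real" where
 "tail_sum delta m = (\<Sum>k. delta (k + m))"

definition lag_coeff :: "(nat => real) => int => int => real" where
 "lag_coeff delta t i = (if i <= t then delta (nat (t - i)) else 0)"

lemma tail_sum_nonneg: "(!!k. 0 <= delta k) ==> summable delta ==> 0 <= tail_sum delta m"
 unfolding tail_sum_def by (intro suminf_nonneg) (auto simp: summable_iff_shift)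

lemma sum_le_tail_sum:
 assumes nn: "!!k. 0 <= delta k" and sm: "summable delta" and N: "finite N" "N \<subseteq> {m..}"
 shows "(SUM k:N. delta k) <= tail_sum delta m"
proof -
 have "(SUM k:N. delta k) = (SUM k:(%k. k - m) ` N. delta (k + m))"
 proof (subst sum.reindex)
  show "inj_on (%k. k - m) N" using N(2) by (auto simp: inj_on_def) (metis N(2) atLeast_iff le_add_diff_inverse2 subsetD)
  show "(SUM k:N. delta k) = sum ((%k. delta (k + m)) \<circ> (%k. k - m)) N" using N(2) by (intro sum.cong refl) (auto simp: subset_eq)
 qed
 also have "... <= tail_sum delta m"
  unfolding tail_sum_def using nn sm N(1) by (intro sum_le_suminf) (auto simp: summable_iff_shift)
 finally show ?thesis .
qed

lemma tail_sum_antimono: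
 assumes nn: "!!k. 0 <= delta k" and sm: "summable delta" and mn: "m <= n"
 shows "tail_sum delta n <= tail_sum delta m"
proof -
 have "tail_sum delta m = (SUM k<n-m. delta (k + m)) + tail_sum delta n" using suminf_split_initial_segment[of "%k. delta (k + m)" "n - m"] mn sm
  by (simp add: tail_sum_def summable_iff_shift add.assoc)
 then show ?thesis using nn by (simp add: sum_nonneg)
qed

lemma lag_coeff_nonneg: "(!!k. 0 <= delta k) ==> 0 <= lag_coeff delta t i" by (simp add: lag_coeff_def)

lemma sum_lag_coeff_time:
 assumes nn: "!!k. 0 <= delta k" and sm: "summable delta" and J: "finite J" "!!t. t : J ==> i <= t ==> i + int m <= t"
 shows "(SUM t:J. lag_coeff delta t i) <= tail_sum delta m"
proof -
 let ?J = "{t:J. i <= t}"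
 have "(SUM t:J. lag_coeff delta t i) = (SUM t:?J. delta (nat (t - i)))"
  unfolding lag_coeff_def using J(1) by (simp add: sum.inter_filter)
 also have "... = (SUM k:(%t. nat (t - i)) ` ?J. delta k)" by (subst sum.reindex) (auto simp: inj_on_def)
 also have "... <= tail_sum delta m"
 proof (intro sum_le_tail_sum nn sm)
  show "(%t. nat (t - i)) ` ?J \<subseteq> {m..}" using J(2) by fastforce
 qed (use J(1) in auto)
 finally show ?thesis .
qed

lemma sum_lag_coeff_coord:
 assumes nn: "!!k. 0 <= delta k" and sm: "summable delta" and I: "finite I" "!!i. i : I ==> i <= t ==> i + int m <= t"
 shows "(SUM i:I. lag_coeff delta t i) <= tail_sum delta m"
proof -
 let ?I = "{i:I. i <= t}"
 have "(SUM i:I. lag_coeff delta t i) = (SUM i:?I. delta (nat (t - i)))"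
  unfolding lag_coeff_def using I(1) by (simp add: sum.inter_filter)
 also have "... = (SUM k:(%i. nat (t - i)) ` ?I. delta k)" by (subst sum.reindex) (auto simp: inj_on_def)
 also have "... <= tail_sum delta m"
 proof (intro sum_le_tail_sum nn sm)
  show "(%i. nat (t - i)) ` ?I \<subseteq> {m..}" using I(2) by fastforce
 qed (use I(1) in auto)
 finally show ?thesis .
qed

text \<open>Young's inequality for the convolution with \<open>delta\<close>.\<close>

lemma sum_convolution_le:
 assumes nn: "!!k. 0 <= delta k" and sm: "summable delta" and fin: "finite I" "finite J"
  and gap: "!!i t. i : I ==> t : J ==> i <= t ==> i + int m <= t"
 shows "(SUM i:I. (SUM t:J. \<bar>a t\<bar> * lag_coeff delta t i)^2) <= (tail_sum delta m)^2 * (SUM t:J. (a t)^2)"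
proof -
 note lc = lag_coeff_nonneg[OF nn]
 have "(SUM t:J. \<bar>a t\<bar> * lag_coeff delta t i)^2 <= tail_sum delta m * (SUM t:J. (a t)^2 * lag_coeff delta t i)" if "i : I" for i
 proof -
  have "(SUM t:J. \<bar>a t\<bar> * lag_coeff delta t i)^2
    = (SUM t:J. sqrt (lag_coeff delta t i) * (\<bar>a t\<bar> * sqrt (lag_coeff delta t i)))^2"
   using lc by (intro arg_cong[where f="%x. x^2"] sum.cong refl) (simp add: mult.left_commute flip: power2_eq_square)
  also have "... <= (SUM t:J. (sqrt (lag_coeff delta t i))^2) * (SUM t:J. (\<bar>a t\<bar> * sqrt (lag_coeff delta t i))^2)"
   by (rule Cauchy_Schwarz_ineq_sum)
  also have "... = (SUM t:J. lag_coeff delta t i) * (SUM t:J. (a t)^2 * lag_coeff delta t i)" using lc by (simp add: power_mult_distrib)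
  also have "... <= tail_sum delta m * (SUM t:J. (a t)^2 * lag_coeff delta t i)"
   using gap[OF that] fin lc by (intro mult_right_mono sum_lag_coeff_time nn sm sum_nonneg mult_nonneg_nonneg) auto
  finally show ?thesis .
 qed
 then have "(SUM i:I. (SUM t:J. \<bar>a t\<bar> * lag_coeff delta t i)^2)
   <= (SUM i:I. tail_sum delta m * (SUM t:J. (a t)^2 * lag_coeff delta t i))"
  by (rule sum_mono)
 also have "... = tail_sum delta m * (SUM t:J. (a t)^2 * (SUM i:I. lag_coeff delta t i))" by (simp add: sum_distrib_left sum.swap[of _ I J])
 also have "... <= tail_sum delta m * (SUM t:J. (a t)^2 * tail_sum delta m)"
  using gap fin by (intro mult_left_mono sum_mono sum_lag_coeff_coord nn sm tail_sum_nonneg) auto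
 also have "... = (tail_sum delta m)^2 * (SUM t:J. (a t)^2)" by (simp add: sum_distrib_right[symmetric] power2_eq_square)
 finally show ?thesis .
qed

context innovations
begin

text \<open>A family with innovations-adapted members and dependence coefficients \<open>delta\<close> in \<open>L\<^sup>q\<close>.\<close>

definition causal_family :: "real => (int => (int => 'e) => real) => (nat => real) => bool" where
 "causal_family q Z delta \<longleftrightarrow> (ALL k. 0 <= delta k) & summable delta &
   (ALL t. (EX b. Lq_le S q (Z t) b) & depends_on {..t} (Z t) & (LINT e|S. Z t e) = 0 &
    (\<forall>i\<le>t. resample_le q (Z t) i (delta (nat (t - i)))))"

lemma causal_family_measurable: "causal_family q Z delta ==> Z t : borel_measurable S"
 unfolding causal_family_def by (meson Lq_le_measurable)

lemma causal_family_delta: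
 assumes "causal_family q Z delta" shows "0 <= delta k" "summable delta"
 using assms by (auto simp: causal_family_def)

lemma causal_family_ex: "causal_family q Z delta ==> EX b. Lq_le S q (Z t) b" by (simp add: causal_family_def)

lemma causal_family_depends: "causal_family q Z delta ==> depends_on {..t} (Z t)" by (simp add: causal_family_def)

lemma causal_family_mean: "causal_family q Z delta ==> (LINT e|S. Z t e) = 0" by (simp add: causal_family_def)

lemma causal_family_integrable: "causal_family q Z delta ==> 1 <= q ==> integrable S (Z t)" using causal_family_ex S.Lq_le_integrable(1) by blast

lemma causal_family_resample:
 assumes "causal_family q Z delta"
 shows "resample_le q (Z t) i (lag_coeff delta t i)"
proof (cases "i <= t")
 case True then show ?thesis using assms by (auto simp: causal_family_def lag_coeff_def)
next
 case False
 then show ?thesis using resample_le_depends[of "Z t" "{..t}" i q] assms causal_family_measurable[OF assms]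
  by (auto simp: causal_family_def lag_coeff_def)
qed

lemma Lq_le_sum_ex:
 assumes "finite J" "!!t. t : J ==> EX b. Lq_le M q (f t) b" "1 <= q"
 shows "EX b. Lq_le M q (%x. SUM t:J. f t x) b"
proof -
 from assms(2) obtain b where "!!t. t : J ==> Lq_le M q (f t) (b t)" by metis
 then have "Lq_le M q (%x. SUM t:J. f t x) (SUM t:J. b t)" by (intro Lq_le_sum assms)
 then show ?thesis by blast
qed

lemma linear_resample:
 assumes Z: "causal_family q Z delta" and J: "finite J" and q: "1 <= q"
 shows "resample_le q (%e. SUM t:J. a t * Z t e) i (SUM t:J. \<bar>a t\<bar> * lag_coeff delta t i)"
 using q by (intro resample_le_sum resample_le_cmult J causal_family_resample[OF Z]) auto

lemma linear_ex:
 assumes Z: "causal_family q Z delta" and J: "finite J" and q: "1 <= q"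
 shows "EX b. Lq_le S q (%e. SUM t:J. a t * Z t e) b"
proof (intro Lq_le_sum_ex J q)
 fix t
 obtain b where "Lq_le S q (Z t) b" using causal_family_ex[OF Z] by blast
 from Lq_le_cmult[OF this, of "a t"] show "EX b. Lq_le S q (%e. a t * Z t e) b" using q by auto
qed

lemma linear_error_le:
 assumes Z: "causal_family q Z delta" and J: "finite J" and q: "2 <= q" and K: "mart_step S q K"
  and gap: "!!t. t : J ==> c + int m <= t"
 shows "Lq_le S q (%e. (SUM t:J. a t * Z t e) - cexp {c..} (%e. SUM t:J. a t * Z t e) e)
   (sqrt K * L2_set a J * tail_sum delta m)"
proof -
 note nn = causal_family_delta(1)[OF Z] and sm = causal_family_delta(2)[OF Z]
 obtain b where b: "Lq_le S q (%e. SUM t:J. a t * Z t e) b" using linear_ex[OF Z J, of a] q by auto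
 have "Lq_le S q (%e. (SUM t:J. a t * Z t e) - cexp {c..} (%e. SUM t:J. a t * Z t e) e)
   (sqrt (K * ((tail_sum delta m)^2 * (SUM t:J. (a t)^2))))"
 proof (rule martingale_resample_le[OF q K b])
  show "resample_le q (%e. SUM t:J. a t * Z t e) i (SUM t:J. \<bar>a t\<bar> * lag_coeff delta t i)" for i
   using q by (intro linear_resample[OF Z J]) auto
  show "(SUM i:{c - int n..<c}. (SUM t:J. \<bar>a t\<bar> * lag_coeff delta t i)^2) <= (tail_sum delta m)^2 * (SUM t:J. (a t)^2)" for n
   using gap J by (intro sum_convolution_le nn sm) force+
 qed
 also have "sqrt (K * ((tail_sum delta m)^2 * (SUM t:J. (a t)^2))) = sqrt K * L2_set a J * tail_sum delta m"
  using tail_sum_nonneg[of delta m, OF nn sm] by (simp add: real_sqrt_mult L2_set_def)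
 finally show ?thesis .
qed

lemma linear_le:
 assumes Z: "causal_family q Z delta" and J: "finite J" and q: "2 <= q" and K: "mart_step S q K"
 shows "Lq_le S q (%e. SUM t:J. a t * Z t e) (sqrt K * L2_set a J * tail_sum delta 0)"
proof -
 note nn = causal_family_delta(1)[OF Z] and sm = causal_family_delta(2)[OF Z]
 obtain b where b: "Lq_le S q (%e. SUM t:J. a t * Z t e) b" using linear_ex[OF Z J, of a] q by auto
 define c where "c = Max (insert 0 J) + 1"
 have c: "t < c" if "t : J" for t using Max_ge[of "insert 0 J" t] that J by (auto simp: c_def)
 have int: "integrable S (Z t)" for t using causal_family_integrable[OF Z] q by auto
 have mean: "(LINT e|S. (SUM t:J. a t * Z t e)) = 0" using int by (subst LINT_sum) (auto simp: causal_family_mean[OF Z])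
 have dep: "depends_on {..<c} (%e. SUM t:J. a t * Z t e)"
 proof (intro depends_on_sum)
  fix t assume "t : J"
  have "depends_on {..t} (%e. a t * Z t e)" by (rule depends_on_compose[where h="%x. a t * x", OF causal_family_depends[OF Z]])
  then show "depends_on {..<c} (%e. a t * Z t e)" using c[OF \<open>t \<in> J\<close>] by (auto intro: depends_on_mono)
 qed
 have "Lq_le S q (%e. (SUM t:J. a t * Z t e) - (LINT e|S. (SUM t:J. a t * Z t e)))
   (sqrt (K * ((tail_sum delta 0)^2 * (SUM t:J. (a t)^2))))"
 proof (rule centered_resample_le[OF q K b dep])
  show "resample_le q (%e. SUM t:J. a t * Z t e) i (SUM t:J. \<bar>a t\<bar> * lag_coeff delta t i)" for i
   using q by (intro linear_resample[OF Z J]) auto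
  show "(SUM i:{c - int n..<c}. (SUM t:J. \<bar>a t\<bar> * lag_coeff delta t i)^2) <= (tail_sum delta 0)^2 * (SUM t:J. (a t)^2)" for n
   using J by (intro sum_convolution_le nn sm) auto
 qed
 also have "sqrt (K * ((tail_sum delta 0)^2 * (SUM t:J. (a t)^2))) = sqrt K * L2_set a J * tail_sum delta 0"
  using tail_sum_nonneg[of delta 0, OF nn sm] by (simp add: real_sqrt_mult L2_set_def)
 finally show ?thesis by (simp add: mean)
qed

definition qform :: "(int => (int => 'e) => real) => (int => int => real) => int set => int set => (int => 'e) => real" where
 "qform X a I J e = (SUM t:J. SUM s:I. a s t * X s e * X t e)"

definition sparse_coeffs :: "(int => int => real) => int set => int set => real => bool" where
 "sparse_coeffs a I J H \<longleftrightarrow> finite I & finite J & 0 <= H &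
   (ALL s:I. (SUM t:J. (a s t)^2) <= H) & (ALL t:J. (SUM s:I. (a s t)^2) <= H)"

lemma qform_ex:
 assumes X: "causal_family (2 * q) X delta" and fin: "finite I" "finite J" and q: "1 <= q"
 shows "EX b. Lq_le S q (qform X a I J) b"
 unfolding qform_def[abs_def]
proof (intro Lq_le_sum_ex fin q)
 fix s t
 obtain b b' where b: "Lq_le S (2*q) (X s) b" "Lq_le S (2*q) (X t) b'" using causal_family_ex[OF X] by blast
 have "Lq_le S q (%e. a s t * (X s e * X t e)) (\<bar>a s t\<bar> * (b * b'))" using q b by (intro Lq_le_cmult Lq_le_mult) auto
 then show "EX b. Lq_le S q (%e. a s t * X s e * X t e) b" by (auto simp: mult.assoc)
qed

lemma qform_measurable:
 assumes X: "causal_family q X delta" shows "qform X a I J : borel_measurable S"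
proof -
 have [measurable]: "X t : borel_measurable S" for t by (rule causal_family_measurable[OF X])
 show ?thesis unfolding qform_def[abs_def] by measurable
qed

text \<open>The product rule for the effect of resampling one coordinate.\<close>

lemma bilinear_resample:
 assumes fin: "finite I" "finite J" and q: "1 <= q"
  and U: "!!s. s : I ==> resample_le (2 * q) (U s) i (u s)" and V: "!!t. t : J ==> resample_le (2 * q) (V t) i (v t)"
  and row: "!!s. s : I ==> Lq_le S (2 * q) (%e. SUM t:J. a s t * V t e) c"
  and col: "!!t. t : J ==> Lq_le S (2 * q) (%e. SUM s:I. a s t * U s e) d"
 shows "resample_le q (%e. SUM t:J. SUM s:I. a s t * U s e * V t e) i ((SUM s:I. u s * c) + (SUM t:J. v t * d))"
proof -
 have [measurable]: "s : I ==> U s : borel_measurable S" "t : J ==> V t : borel_measurable S" for s t using U V by (auto simp: resample_le_def)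
 define \<Delta> where "\<Delta> = (%(F :: (int => 'e) => real) x. F (fst x) - F (mix (- {i}) (fst x) (snd x)))"
 have dU: "Lq_le SxS (2 * q) (\<Delta> (U s)) (u s)" if "s : I" for s using U[OF that] by (simp add: resample_le_def \<Delta>_def)
 have dV: "Lq_le SxS (2 * q) (\<Delta> (V t)) (v t)" if "t : J" for t using V[OF that] by (simp add: resample_le_def \<Delta>_def)
 have "Lq_le SxS q (%x. (SUM s:I. \<Delta> (U s) x * (SUM t:J. a s t * V t (fst x)))
    + (SUM t:J. \<Delta> (V t) x * (SUM s:I. a s t * U s (mix (- {i}) (fst x) (snd x)))))
   ((SUM s:I. u s * c) + (SUM t:J. v t * d))"
  using q by (intro Lq_le_add Lq_le_sum fin Lq_le_mult dU dV Lq_le_fst[OF row] Lq_le_mix[OF col]) auto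
 moreover have "(SUM s:I. \<Delta> (U s) x * (SUM t:J. a s t * V t (fst x)))
    + (SUM t:J. \<Delta> (V t) x * (SUM s:I. a s t * U s (mix (- {i}) (fst x) (snd x))))
   = \<Delta> (%e. SUM t:J. SUM s:I. a s t * U s e * V t e) x" for x
 proof -
  have "(SUM s:I. \<Delta> (U s) x * (SUM t:J. a s t * V t (fst x))) = (SUM t:J. SUM s:I. \<Delta> (U s) x * (a s t * V t (fst x)))"
   by (simp add: sum_distrib_left) (rule sum.swap)
  then show ?thesis by (simp add: sum_distrib_left sum.distrib[symmetric] sum_subtractf[symmetric] \<Delta>_def algebra_simps)
 qed
 ultimately show ?thesis by (simp add: resample_le_def \<Delta>_def)
qed

lemma qform_resample:
 assumes X: "causal_family (2 * q) X delta" and a: "sparse_coeffs a I J H" and q: "1 <= q" and K: "mart_step S (2 * q) K"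
 shows "resample_le q (qform X a I J) i
   (sqrt K * sqrt H * tail_sum delta 0 * ((SUM s:I. lag_coeff delta s i) + (SUM t:J. lag_coeff delta t i)))"
proof -
 note nn = causal_family_delta(1)[OF X] and sm = causal_family_delta(2)[OF X]
 have K0: "0 < K" using K by (simp add: mart_step_def)
 have fin: "finite I" "finite J" using a by (auto simp: sparse_coeffs_def)
 define C where "C = sqrt K * sqrt H * tail_sum delta 0"
 have le: "Lq_le S (2 * q) (%e. SUM t:N. w t * X t e) C" if N: "finite N" and w: "(SUM t:N. (w t)^2) <= H" for w N
 proof -
  have "Lq_le S (2 * q) (%e. SUM t:N. w t * X t e) (sqrt K * L2_set w N * tail_sum delta 0)" using q by (intro linear_le[OF X N _ K]) auto
  moreover have "sqrt K * L2_set w N * tail_sum delta 0 <= C"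
   unfolding C_def using w K0 tail_sum_nonneg[OF nn sm]
   by (intro mult_right_mono mult_left_mono) (auto simp: L2_set_def)
  ultimately show ?thesis using q by (auto intro: Lq_le_mono)
 qed
 have "resample_le q (%e. SUM t:J. SUM s:I. a s t * X s e * X t e) i ((SUM s:I. lag_coeff delta s i * C) + (SUM t:J. lag_coeff delta t i * C))"
  using a by (intro bilinear_resample fin q causal_family_resample[OF X] le) (auto simp: sparse_coeffs_def)
 then show ?thesis by (simp add: qform_def[abs_def] C_def sum_distrib_right[symmetric] distrib_left mult.commute)
qed

lemma sum_square_add_le:
 fixes u v :: "'i => real"
 assumes "(SUM i:A. (u i)^2) <= a^2" "(SUM i:A. (v i)^2) <= b^2" "0 <= a" "0 <= b"
 shows "(SUM i:A. (u i + v i)^2) <= (a + b)^2"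
proof -
 have "L2_set (%i. u i + v i) A <= L2_set u A + L2_set v A" by (rule L2_set_triangle_ineq)
 also have "... <= a + b" unfolding L2_set_def using assms by (intro add_mono real_le_lsqrt sum_nonneg) auto
 finally have "(L2_set (%i. u i + v i) A)^2 <= (a + b)^2" by (intro power_mono) auto
 then show ?thesis by (simp add: L2_set_def sum_nonneg)
qed

lemma qform_resample_square_sum:
 assumes nn: "!!k. 0 <= delta k" and sm: "summable delta" and fin: "finite A" "finite I" "finite J" and C: "0 <= C"
  and gap: "!!i t. i : A ==> t : I Un J ==> i <= t ==> i + int m <= t"
 shows "(SUM i:A. (C * ((SUM s:I. lag_coeff delta s i) + (SUM t:J. lag_coeff delta t i)))^2)
   <= (C * (tail_sum delta m * (sqrt (real (card I)) + sqrt (real (card J)))))^2"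
proof -
 have th: "0 <= tail_sum delta m" by (rule tail_sum_nonneg[OF nn sm])
 have I: "(SUM i:A. (SUM s:I. lag_coeff delta s i)^2) <= (tail_sum delta m * sqrt (real (card I)))^2"
  using sum_convolution_le[OF nn sm fin(1,2), of m "%_. 1"] gap by (simp add: power_mult_distrib)
 have J: "(SUM i:A. (SUM s:J. lag_coeff delta s i)^2) <= (tail_sum delta m * sqrt (real (card J)))^2"
  using sum_convolution_le[OF nn sm fin(1,3), of m "%_. 1"] gap by (simp add: power_mult_distrib)
 have "(SUM i:A. ((SUM s:I. lag_coeff delta s i) + (SUM t:J. lag_coeff delta t i))^2)
   <= (tail_sum delta m * sqrt (real (card I)) + tail_sum delta m * sqrt (real (card J)))^2"
  by (rule sum_square_add_le[OF I J]) (use th in auto)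
 then show ?thesis by (simp add: power_mult_distrib sum_distrib_left[symmetric] distrib_left[symmetric] mult_left_mono)
qed

lemma qform_error_le:
 assumes X: "causal_family (2 * q) X delta" and a: "sparse_coeffs a I J H" and q: "2 <= q"
  and K: "mart_step S (2 * q) K" and K': "mart_step S q K'"
  and gap: "!!t. t : I Un J ==> c + int m <= t"
 shows "Lq_le S q (%e. qform X a I J e - cexp {c..} (qform X a I J) e)
   (sqrt K' * (sqrt K * sqrt H * tail_sum delta 0 * (tail_sum delta m * (sqrt (real (card I)) + sqrt (real (card J))))))"
proof -
 note nn = causal_family_delta(1)[OF X] and sm = causal_family_delta(2)[OF X]
 have fin: "finite I" "finite J" "0 <= H" using a by (auto simp: sparse_coeffs_def)
 have K0: "0 < K" using K by (simp add: mart_step_def)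
 let ?C = "sqrt K * sqrt H * tail_sum delta 0"
 have C: "0 <= ?C" using K0 fin tail_sum_nonneg[OF nn sm] by auto
 obtain b where b: "Lq_le S q (qform X a I J) b" using qform_ex[OF X fin(1,2), of a] q by auto
 have "Lq_le S q (%e. qform X a I J e - cexp {c..} (qform X a I J) e)
   (sqrt (K' * (?C * (tail_sum delta m * (sqrt (real (card I)) + sqrt (real (card J)))))^2))"
 proof (rule martingale_resample_le[OF q K' b])
  show "resample_le q (qform X a I J) i (?C * ((SUM s:I. lag_coeff delta s i) + (SUM t:J. lag_coeff delta t i)))" for i
   using q by (intro qform_resample[OF X a _ K]) auto
  show "(SUM i:{c - int n..<c}. (?C * ((SUM s:I. lag_coeff delta s i) + (SUM t:J. lag_coeff delta t i)))^2)
    <= (?C * (tail_sum delta m * (sqrt (real (card I)) + sqrt (real (card J)))))^2" for n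
   using gap fin by (intro qform_resample_square_sum nn sm C) force+
 qed
 then show ?thesis using C tail_sum_nonneg[of delta m, OF nn sm] by (simp add: real_sqrt_mult)
qed

lemma qform_depends:
 assumes X: "causal_family q X delta" and "!!t. t : I Un J ==> t < c"
 shows "depends_on {..<c} (qform X a I J)"
 unfolding qform_def[abs_def]
proof (intro depends_on_sum)
 fix s t assume st: "t : J" "s : I"
 have *: "depends_on {..<c} (X u)" if "u : I Un J" for u using assms(2)[OF that] by (intro depends_on_mono[OF causal_family_depends[OF X]]) auto
 show "depends_on {..<c} (%e. a s t * X s e * X t e)" using st by (intro depends_on_compose2[where h="%x y. a s t * x * y"] *) auto
qed

lemma qform_centered_le:
 assumes X: "causal_family (2 * q) X delta" and a: "sparse_coeffs a I J H" and q: "2 <= q"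
  and K: "mart_step S (2 * q) K" and K': "mart_step S q K'"
 shows "Lq_le S q (%e. qform X a I J e - (LINT e|S. qform X a I J e))
   (sqrt K' * (sqrt K * sqrt H * tail_sum delta 0 * (tail_sum delta 0 * (sqrt (real (card I)) + sqrt (real (card J))))))"
proof -
 note nn = causal_family_delta(1)[OF X] and sm = causal_family_delta(2)[OF X]
 have fin: "finite I" "finite J" "0 <= H" using a by (auto simp: sparse_coeffs_def)
 have K0: "0 < K" using K by (simp add: mart_step_def)
 let ?C = "sqrt K * sqrt H * tail_sum delta 0"
 have C: "0 <= ?C" using K0 fin tail_sum_nonneg[OF nn sm] by auto
 obtain b where b: "Lq_le S q (qform X a I J) b" using qform_ex[OF X fin(1,2), of a] q by auto
 define c where "c = Max (insert 0 (I Un J)) + 1"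
 have c: "t < c" if "t : I Un J" for t using Max_ge[of "insert 0 (I Un J)" t] that fin by (auto simp: c_def)
 have "Lq_le S q (%e. qform X a I J e - (LINT e|S. qform X a I J e))
   (sqrt (K' * (?C * (tail_sum delta 0 * (sqrt (real (card I)) + sqrt (real (card J)))))^2))"
 proof (rule centered_resample_le[OF q K' b qform_depends[OF X c]])
  show "resample_le q (qform X a I J) i (?C * ((SUM s:I. lag_coeff delta s i) + (SUM t:J. lag_coeff delta t i)))" for i
   using q by (intro qform_resample[OF X a _ K]) auto
  show "(SUM i:{c - int n..<c}. (?C * ((SUM s:I. lag_coeff delta s i) + (SUM t:J. lag_coeff delta t i)))^2)
    <= (?C * (tail_sum delta 0 * (sqrt (real (card I)) + sqrt (real (card J)))))^2" for n
   using fin by (intro qform_resample_square_sum nn sm C) auto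
 qed
 then show ?thesis using C tail_sum_nonneg[of delta 0, OF nn sm] by (simp add: real_sqrt_mult)
qed

text \<open>Independent centered variables are orthogonal to every function of the partial sums before them.\<close>

lemma indep_sum_le:
 assumes q: "2 <= q" and K: "mart_step S q K" and A: "finite A"
  and G: "!!k. k : A ==> Lq_le S q (G k) (b k)" "!!k. k : A ==> (LINT e|S. G k e) = 0"
   "!!k. k : A ==> depends_on (W k) (G k)" and W: "disjoint_family_on W A"
 shows "Lq_le S q (%e. SUM k:A. G k e) (sqrt (K * (SUM k:A. (b k)^2)))" using A G W
proof (induction A rule: finite_induct)
 case empty then show ?case by (simp add: Lq_le_zero)
next
 case (insert k A)
 let ?U = "%e. SUM k:A. G k e"
 have W': "disjoint_family_on W A" using insert.prems(4) by (rule disjoint_family_on_mono[rotated]) auto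
 have U: "Lq_le S q ?U (sqrt (K * (SUM k:A. (b k)^2)))" using insert.prems W' by (intro insert.IH) auto
 have dep: "depends_on (UN j:A. W j) (%e. sgn (?U e) * \<bar>?U e\<bar> powr (q - 1))"
  using insert.prems(3) by (intro depends_on_compose[where h="%x. sgn x * \<bar>x\<bar> powr (q - 1)"] depends_on_sum)
   (auto intro: depends_on_mono)
 have disj: "(UN j:A. W j) Int W k = {}" using insert.prems(4) insert.hyps by (auto simp: disjoint_family_on_def)
 have i: "integrable S (%e. sgn (?U e) * \<bar>?U e\<bar> powr (q - 1) * G k e)"
  by (rule S.integrable_sgn_powr_mult[OF U _ q]) (use insert.prems(1) in auto)
 have "(LINT e|S. sgn (?U e) * \<bar>?U e\<bar> powr (q - 1) * G k e)
   = (LINT e|S. sgn (?U e) * \<bar>?U e\<bar> powr (q - 1) * cexp (UN j:A. W j) (G k) e)"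
  using integral_mult_cexp(2)[OF dep i] by simp
 also have "... = (LINT e|S. 0)" using cexp_indep[OF insert.prems(3)[of k] disj] insert.prems(2)[of k] by (intro LINT_cong refl) auto
 finally have orth: "(LINT e|S. sgn (?U e) * \<bar>?U e\<bar> powr (q - 1) * G k e) = 0" by simp
 have "Lq_le S q (%e. ?U e + G k e) (sqrt (K * ((SUM k:A. (b k)^2) + (b k)^2)))"
  using K[unfolded mart_step_def] U insert.prems(1)[of k] orth by (auto simp: sum_nonneg)
 then show ?case using insert.hyps by (simp add: add.commute)
qed

end

section \<open>Large values of sums of independent vectors\<close>

lemma L2_set_sum_le:
 assumes "finite A"
 shows "L2_set (%d. SUM k:A. f k d) D <= (SUM k:A. L2_set (f k) D)" using assms
proof (induction A rule: finite_induct)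
 case empty then show ?case by (simp add: L2_set_def)
next
 case (insert k A)
 have "L2_set (%d. f k d + (SUM k:A. f k d)) D <= L2_set (f k) D + L2_set (%d. SUM k:A. f k d) D" by (rule L2_set_triangle_ineq)
 then show ?case using insert by simp
qed

lemma disjoint_family_blocks:
 assumes I: "disjoint_family I" and W: "disjoint_family W"
 shows "disjoint_family (%j. UN k:I j. W k)"
 unfolding disjoint_family_on_def
proof (intro ballI impI)
 fix i j :: 'a assume ij: "i ~= j"
 have "W k Int W k' = {}" if "k : I i" "k' : I j" for k k'
 proof -
  have "I i Int I j = {}" using I ij by (simp add: disjoint_family_on_def)
  then have "k ~= k'" using that by auto
  then show ?thesis using W by (simp add: disjoint_family_on_def)
 qed
 then show "(UN k:I i. W k) Int (UN k:I j. W k) = {}" by auto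
qed

text \<open>If no term reaches \<open>z / (2 * J)\<close>, fewer than \<open>J\<close> terms above \<open>z / (2 * K)\<close> contribute less than
 half of \<open>z\<close>, and so do all the terms below \<open>z / (2 * K)\<close>.\<close>

lemma few_large_or_one_very_large:
 fixes h :: "nat => real"
 assumes h: "!!j. 0 <= h j" and z: "z <= (SUM j<K. h j)" "0 < z" and J: "0 < J" and K: "0 < K"
 shows "(EX j<K. z / (2 * real J) <= h j) \<or> real J <= (SUM j<K. of_bool (z / (2 * real K) <= h j))"
proof (rule ccontr)
 assume "\<not> ?thesis"
 then have small: "!!j. j < K ==> h j < z / (2 * real J)"
  and few: "(SUM j<K. of_bool (z / (2 * real K) <= h j)) < real J" by (auto simp: not_le)
 have "h j <= of_bool (z / (2 * real K) <= h j) * (z / (2 * real J)) + z / (2 * real K)" if "j < K" for j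
 proof -
  have "0 <= z / (2 * real K)" using z(2) K by simp
  then show ?thesis using small[OF that] by (auto simp: of_bool_def)
 qed
 then have "(SUM j<K. h j) <= (SUM j<K. of_bool (z / (2 * real K) <= h j) * (z / (2 * real J)) + z / (2 * real K))" by (intro sum_mono) auto
 also have "... = (SUM j<K. of_bool (z / (2 * real K) <= h j)) * (z / (2 * real J)) + z / 2"
  unfolding sum.distrib sum_distrib_right[symmetric] using K by simp
 also have "... < real J * (z / (2 * real J)) + z / 2" using few z(2) J by (intro add_strict_right_mono mult_strict_right_mono) auto
 also have "... = z" using J by simp
 finally show False using z(1) by simp
qed

context innovations
begin

lemma depends_on_L2_set: "(!!d. d : D' ==> depends_on A (f d)) ==> depends_on A (%e. L2_set (%d. f d e) D')"
 unfolding depends_on_def by (intro ballI impI L2_set_cong refl) blast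

lemma measurable_L2_set:
 "(!!d. d : D' ==> f d : borel_measurable M) ==> (%e. L2_set (%d. f d e) D') : borel_measurable M"
 unfolding L2_set_def by measurable

text \<open>A union bound over the \<open>J\<close>-tuples of distinct indices, each contributing a product by
 independence.\<close>

lemma prob_many_le:
 fixes A :: "nat => (int => 'e) => bool"
 assumes [measurable]: "!!k. Measurable.pred S (A k)"
  and dep: "!!k. k < N ==> depends_on (W k) (A k)" and W: "disjoint_family_on W {..<N}"
 shows "\<P>(e in S. real J <= (SUM k<N. of_bool (A k e))) <= (SUM k<N. \<P>(e in S. A k e)) ^ J" using dep W
proof (induction N arbitrary: J)
 case 0
 then show ?case by (cases J) auto
next
 case (Suc N)
 show ?case
 proof (cases J)
  case 0 then show ?thesis by simp
 next
  case J: (Suc J')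
  let ?c = "%e. (SUM k<N. of_bool (A k e)) :: real"
  let ?s = "SUM k<N. \<P>(e in S. A k e)" and ?p = "\<P>(e in S. A N e)"
  have W': "disjoint_family_on W {..<N}" using Suc.prems(2) by (rule disjoint_family_on_mono[rotated]) auto
  have [measurable]: "?c : borel_measurable S" by measurable
  have "depends_on (\<Union>k<N. W k) ?c"
  proof (rule depends_on_sum)
   fix k assume "k : {..<N}"
   then have "depends_on (W k) (%e. of_bool (A k e) :: real)" using Suc.prems(1)[of k] by (intro depends_on_compose[where h=of_bool]) auto
   then show "depends_on (\<Union>k<N. W k) (%e. of_bool (A k e) :: real)" using \<open>k \<in> {..<N}\<close> by (auto intro: depends_on_mono)
  qed
  then have dep2: "depends_on (\<Union>k<N. W k) (%e. real J' <= ?c e)" by (rule depends_on_compose[where h="%x. real J' <= x"])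
  have disj: "W N Int (\<Union>k<N. W k) = {}"
  proof -
   have "W N Int W k = {}" if "k < N" for k using Suc.prems(2)[unfolded disjoint_family_on_def, rule_format, of N k] that by auto
   then show ?thesis by auto
  qed
  have "{e:space S. real J <= (SUM k<Suc N. of_bool (A k e))}
    \<subseteq> {e:space S. real J <= ?c e} Un {e:space S. A N e & real J' <= ?c e}"
   using J by auto
  then have "\<P>(e in S. real J <= (SUM k<Suc N. of_bool (A k e)))
    <= S.prob ({e:space S. real J <= ?c e} Un {e:space S. A N e & real J' <= ?c e})"
   by (intro S.finite_measure_mono) auto
  also have "... <= \<P>(e in S. real J <= ?c e) + \<P>(e in S. A N e & real J' <= ?c e)" by (intro measure_Un_le) auto
  also have "\<P>(e in S. A N e & real J' <= ?c e) = ?p * \<P>(e in S. real J' <= ?c e)"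
   by (rule prob_inter_indep[OF _ _ Suc.prems(1)[of N] dep2 disj]) auto
  also have "\<P>(e in S. real J <= ?c e) + ?p * \<P>(e in S. real J' <= ?c e) <= ?s ^ J + ?p * ?s ^ J'"
   using Suc.prems(1) W' by (intro add_mono mult_left_mono Suc.IH) auto
  also have "... = ?s ^ J' * (?s + ?p)" by (simp add: J algebra_simps)
  also have "... <= (?s + ?p) ^ J' * (?s + ?p)" by (intro mult_right_mono power_mono add_nonneg_nonneg sum_nonneg) (auto simp: sum_nonneg)
  finally show ?thesis by (simp add: J mult.commute)
 qed
qed

lemma prob_norm_sum_split:
 fixes H :: "nat => int => (int => 'e) => real"
 assumes H: "!!j d. H j d : borel_measurable S" and dep: "!!j d. j < K ==> depends_on (W j) (H j d)"
  and W: "disjoint_family_on W {..<K}" and pos: "0 < z" "0 < J" "0 < K"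
 shows "\<P>(e in S. z <= L2_set (%d. SUM j<K. H j d e) D')
  <= (SUM j<K. \<P>(e in S. z / (2 * real J) <= L2_set (%d. H j d e) D'))
   + (SUM j<K. \<P>(e in S. z / (2 * real K) <= L2_set (%d. H j d e) D')) ^ J"
proof -
 let ?n = "%j e. L2_set (%d. H j d e) D'"
 have m [measurable]: "?n j : borel_measurable S" for j by (intro measurable_L2_set H)
 have m2 [measurable]: "(%e. L2_set (%d. SUM j<K. H j d e) D') : borel_measurable S" by (intro measurable_L2_set borel_measurable_sum H)
 have dep': "depends_on (W j) (%e. z / (2 * real K) <= ?n j e)" if "j < K" for j
  using that by (intro depends_on_compose[where h="%x. z / (2 * real K) <= x"] depends_on_L2_set dep)
 have "{e:space S. z <= L2_set (%d. SUM j<K. H j d e) D'}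
   \<subseteq> (\<Union>j<K. {e:space S. z / (2 * real J) <= ?n j e}) Un {e:space S. real J <= (SUM j<K. of_bool (z / (2 * real K) <= ?n j e))}"
 proof
  fix e assume "e : {e:space S. z <= L2_set (%d. SUM j<K. H j d e) D'}"
  then have e: "e : space S" "z <= (SUM j<K. ?n j e)" using L2_set_sum_le[of "{..<K}" "%j d. H j d e" D'] by auto
  then show "e : (\<Union>j<K. {e:space S. z / (2 * real J) <= ?n j e}) Un {e:space S. real J <= (SUM j<K. of_bool (z / (2 * real K) <= ?n j e))}"
   using few_large_or_one_very_large[of "%j. ?n j e" z K J] pos by (auto simp: L2_set_nonneg)
 qed
 then have "\<P>(e in S. z <= L2_set (%d. SUM j<K. H j d e) D')
  <= S.prob ((\<Union>j<K. {e:space S. z / (2 * real J) <= ?n j e}) Un {e:space S. real J <= (SUM j<K. of_bool (z / (2 * real K) <= ?n j e))})"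
  by (intro S.finite_measure_mono) auto
 also have "... <= S.prob (\<Union>j<K. {e:space S. z / (2 * real J) <= ?n j e}) + \<P>(e in S. real J <= (SUM j<K. of_bool (z / (2 * real K) <= ?n j e)))"
  by (intro measure_Un_le) auto
 also have "... <= (SUM j<K. \<P>(e in S. z / (2 * real J) <= ?n j e)) + (SUM j<K. \<P>(e in S. z / (2 * real K) <= ?n j e)) ^ J"
  using dep' W by (intro add_mono S.finite_measure_subadditive_finite prob_many_le) auto
 finally show ?thesis .
qed

text \<open>The sum is arranged as a \<open>K\<close>-ary tree of depth \<open>n\<close> and split at every node.  Each level costs a
 factor \<open>2 * J\<close> in the threshold; that \<open>J\<close> children exceed their threshold at the same time has the
 small probability \<open>(K * rho) ^ J\<close>.\<close>

lemma prob_norm_sum_tree: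
 fixes G :: "nat => int => (int => 'e) => real"
 assumes G: "!!k d. G k d : borel_measurable S" and dep: "!!k d. depends_on (W k) (G k d)"
  and W: "disjoint_family W" and pos: "0 < z0" "0 < J" "0 < K"
  and rho: "!!A. finite A ==> \<P>(e in S. z0 * (2 * real J) / (2 * real K) <= L2_set (%d. SUM k:A. G k d e) D') <= rho"
  and z: "z0 * (2 * real J) ^ n <= z"
 shows "\<P>(e in S. z <= L2_set (%d. SUM k:{m..<m + K ^ n}. G k d e) D')
  <= (SUM k:{m..<m + K ^ n}. \<P>(e in S. z / (2 * real J) ^ n <= L2_set (%d. G k d e) D'))
   + real n * real K ^ n * (real K * rho) ^ J"
 using z
proof (induction n arbitrary: m z)
 case 0 then show ?case by simp
next
 case (Suc n)
 have rho0: "0 <= rho" using rho[of "{}"] measure_nonneg order_trans by blast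
 have zp: "0 < z" using Suc.prems pos by (meson less_le_trans mult_pos_pos of_nat_0_less_iff zero_less_numeral zero_less_power)
 define I where "I = (%j. {m + j * K ^ n..<m + j * K ^ n + K ^ n})"
 have I: "disjoint_family I"
  unfolding disjoint_family_on_def
 proof (intro ballI impI)
  fix i j :: nat assume "i ~= j"
  have "I i Int I j = {}" if "i < j" for i j
  proof -
   have "(i + 1) * K ^ n <= j * K ^ n" using that by (intro mult_right_mono) auto
   then show ?thesis by (auto simp: I_def)
  qed
  from this[of i j] this[of j i] show "I i Int I j = {}" using \<open>i \<noteq> j\<close> by (metis Int_commute nat_neq_iff)
 qed
 have grp: "sum f {m..<m + K ^ Suc n} = (SUM j<K. sum f (I j))" for f :: "nat => real"
 proof -
  have "(SUM j<K. sum f (I j)) = (SUM j<K. SUM k:{j * K ^ n..<j * K ^ n + K ^ n}. f (m + k))"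
  proof (rule sum.cong[OF refl])
   fix j
   have "I j = {j * K ^ n + m..<(j * K ^ n + K ^ n) + m}" by (auto simp: I_def)
   then show "sum f (I j) = (SUM k:{j * K ^ n..<j * K ^ n + K ^ n}. f (m + k))" by (simp only: sum.shift_bounds_nat_ivl add.commute[of m])
  qed
  also have "... = (SUM k<K * K ^ n. f (m + k))" by (rule sum.nat_group)
  also have "... = sum f {m..<m + K ^ Suc n}" using sum.shift_bounds_nat_ivl[of f 0 m "K * K ^ n"] by (simp add: atLeast0LessThan add.commute)
  finally show ?thesis ..
 qed
 let ?H = "%j d e. SUM k:I j. G k d e"
 have z1: "z0 * (2 * real J) ^ n <= z / (2 * real J)" using Suc.prems pos by (simp add: field_simps)
 have "\<P>(e in S. z <= L2_set (%d. SUM k:{m..<m + K ^ Suc n}. G k d e) D')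
   = \<P>(e in S. z <= L2_set (%d. SUM j<K. ?H j d e) D')"
  unfolding grp ..
 also have "... <= (SUM j<K. \<P>(e in S. z / (2 * real J) <= L2_set (%d. ?H j d e) D'))
   + (SUM j<K. \<P>(e in S. z / (2 * real K) <= L2_set (%d. ?H j d e) D')) ^ J"
 proof (rule prob_norm_sum_split[where W="%j. UN k:I j. W k"])
  show "depends_on (UN k:I j. W k) (?H j d)" for j d by (intro depends_on_sum depends_on_mono[OF dep]) auto
  show "disjoint_family_on (%j. UN k:I j. W k) {..<K}" by (rule disjoint_family_on_mono[OF subset_UNIV disjoint_family_blocks[OF I W]])
 qed (use G zp pos in \<open>auto intro: borel_measurable_sum\<close>)
 also have "... <= (SUM j<K. (SUM k:I j. \<P>(e in S. z / (2 * real J) / (2 * real J) ^ n <= L2_set (%d. G k d e) D'))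
   + real n * real K ^ n * (real K * rho) ^ J) + (real K * rho) ^ J"
 proof (rule add_mono)
  show "(SUM j<K. \<P>(e in S. z / (2 * real J) <= L2_set (%d. ?H j d e) D')) <= (SUM j<K. (SUM k:I j. \<P>(e in S. z / (2 * real J) / (2 * real J) ^ n <= L2_set (%d. G k d e) D'))
   + real n * real K ^ n * (real K * rho) ^ J)"
   unfolding I_def by (intro sum_mono Suc.IH z1)
  have "\<P>(e in S. z / (2 * real K) <= L2_set (%d. ?H j d e) D') <= rho" for j
  proof -
   have "z0 * (2 * real J) * 1 <= z0 * (2 * real J) * (2 * real J) ^ n" using pos by (intro mult_left_mono one_le_power) auto
   also have "... <= z" using Suc.prems by (simp add: mult.assoc)
   finally have le: "z0 * (2 * real J) / (2 * real K) <= z / (2 * real K)" using pos by (intro divide_right_mono) auto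
   have "\<P>(e in S. z / (2 * real K) <= L2_set (%d. ?H j d e) D')
    <= \<P>(e in S. z0 * (2 * real J) / (2 * real K) <= L2_set (%d. ?H j d e) D')"
    using le measurable_L2_set[of D' "%d. ?H j d" S] G by (intro S.finite_measure_mono) (auto intro: borel_measurable_sum)
   also have "... <= rho" by (rule rho) (simp add: I_def)
   finally show ?thesis .
  qed
  then have "(SUM j<K. \<P>(e in S. z / (2 * real K) <= L2_set (%d. ?H j d e) D')) <= (SUM j<K. rho)" by (intro sum_mono)
  then show "(SUM j<K. \<P>(e in S. z / (2 * real K) <= L2_set (%d. ?H j d e) D')) ^ J <= (real K * rho) ^ J"
   by (intro power_mono) (auto intro: sum_nonneg)
 qed
 also have "... = (SUM k:{m..<m + K ^ Suc n}. \<P>(e in S. z / (2 * real J) ^ Suc n <= L2_set (%d. G k d e) D'))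
   + (real n * real K ^ Suc n + 1) * (real K * rho) ^ J"
  unfolding grp by (simp add: sum.distrib algebra_simps)
 also have "... <= (SUM k:{m..<m + K ^ Suc n}. \<P>(e in S. z / (2 * real J) ^ Suc n <= L2_set (%d. G k d e) D'))
   + real (Suc n) * real K ^ Suc n * (real K * rho) ^ J"
 proof (intro add_left_mono mult_right_mono)
  have "1 <= real K ^ Suc n" using pos by (intro one_le_power) auto
  then show "real n * real K ^ Suc n + 1 <= real (Suc n) * real K ^ Suc n" by (simp add: algebra_simps)
 qed (use rho0 in auto)
 finally show ?case .
qed

text \<open>For independent centered vectors whose total size is smaller than the threshold by a power
 of \<open>T\<close>, the sum is large essentially only if one summand is.\<close>

lemma prob_norm_indep_sum:
 fixes q eta kappa :: real
 assumes q: "2 <= q" and Kq: "mart_step S q Kq" and eta: "0 < eta" and kappa: "0 < kappa"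
 obtains c C where "0 < c" "0 <= C"
  "!!T N D' W (G :: nat => int => (int => 'e) => real) b v z. 1 <= T ==> real N <= T^2 ==> finite D' ==>
   (!!k d. k < N ==> d : D' ==> Lq_le S q (G k d) (b k d)) ==>
   (!!k d. k < N ==> d : D' ==> (LINT e|S. G k d e) = 0) ==>
   (!!k d. k < N ==> d : D' ==> depends_on (W k) (G k d)) ==> disjoint_family_on W {..<N} ==>
   (SUM k<N. SUM d:D'. (b k d)^2) <= v^2 ==> 0 <= v ==> 0 < z ==> v * T powr eta <= z ==>
   \<P>(e in S. z <= L2_set (%d. SUM k<N. G k d e) D')
    <= (SUM k<N. \<P>(e in S. c * z <= L2_set (%d. G k d e) D')) + C * T powr (- kappa)"
proof -
 \<comment> \<open>The branching number is \<open>K = T powr theta\<close>: small enough that \<open>K * rho\<close> is a negative power of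
  \<open>T\<close>, and \<open>n\<close> levels reach \<open>T\<^sup>2\<close> leaves.\<close>
 define theta where "theta = q * eta / (2 * (1 + q))"
 have theta: "0 < theta" using q eta by (simp add: theta_def)
 have th2: "theta * (1 + q) = q * eta / 2" using q unfolding theta_def by (simp add: field_simps)
 have Kq0: "0 < Kq" using Kq by (simp add: mart_step_def)
 define n where "n = nat \<lceil>2 / theta\<rceil>"
 have n: "2 <= theta * real n" using theta mult_left_mono[OF real_nat_ceiling_ge[of "2 / theta"], of theta] by (simp add: n_def)
 obtain J0 :: nat where J0: "(kappa + theta * real n) / (q * eta / 2) <= real J0" using real_arch_simple by blast
 define J where "J = Suc J0"
 have J: "0 < J" "kappa + theta * real n <= real J * (q * eta / 2)"
 proof -
  have "(kappa + theta * real n) / (q * eta / 2) <= real J" using J0 by (simp add: J_def)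
  then show "kappa + theta * real n <= real J * (q * eta / 2)" using q eta by (subst (asm) pos_divide_le_eq) auto
 qed (simp add: J_def)
 define c where "c = 1 / (2 * real J) ^ n"
 have c: "0 < c" using J by (simp add: c_def)
 define C1 where "C1 = sqrt Kq * (2 * real J) ^ n * 2 * 2"
 have C1: "0 <= C1" using Kq0 by (simp add: C1_def)
 define C where "C = real n * 2 ^ n * (2 * C1 powr q) ^ J"
 show thesis
 proof (rule that[of c C])
  show "0 <= C" by (simp add: C_def)
  fix T N D' W and G :: "nat => int => (int => 'e) => real" and b v z
  assume T: "1 <= T" and N: "real N <= T^2" and D': "finite D'"
   and G: "!!k d. k < N ==> d : D' ==> Lq_le S q (G k d) (b k d)"
    "!!k d. k < N ==> d : D' ==> (LINT e|S. G k d e) = 0"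
    "!!k d. k < N ==> d : D' ==> depends_on (W k) (G k d)"
   and W: "disjoint_family_on W {..<N}" and v: "(SUM k<N. SUM d:D'. (b k d)^2) <= v^2" "0 <= v"
   and z: "0 < z" "v * T powr eta <= z"
  define K where "K = nat \<lceil>T powr theta\<rceil>"
  have T1: "1 <= T powr theta" using T theta by (simp add: ge_one_powr_ge_zero)
  have K: "T powr theta <= real K" "real K <= 2 * T powr theta" "0 < K"
  proof -
   show "T powr theta <= real K" unfolding K_def by (rule real_nat_ceiling_ge)
   then show "0 < K" using T1 by linarith
   have "real K < T powr theta + 1" unfolding K_def using T1 by linarith
   then show "real K <= 2 * T powr theta" using T1 by linarith
  qed
  have KN: "N <= K ^ n"
  proof -
   have "T^2 <= T powr (theta * real n)" using powr_mono[OF n T] T by simp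
   also have "... = (T powr theta) ^ n" using T1 T by (simp add: powr_powr[symmetric] powr_realpow del: powr_powr)
   also have "... <= real K ^ n" using K by (intro power_mono) auto
   finally have "real N <= real K ^ n" using N by linarith
   then show ?thesis by (metis of_nat_le_iff of_nat_power)
  qed
  define G' where "G' = (%k d. if k < N & d : D' then G k d else (%_. 0))"
  define b' where "b' = (%k d. if k < N & d : D' then b k d else 0)"
  define W' where "W' = (%k. if k < N then W k else {})"
  have G': "Lq_le S q (G' k d) (b' k d)" "(LINT e|S. G' k d e) = 0" "depends_on (W' k) (G' k d)" for k d
   using G by (auto simp: G'_def b'_def W'_def Lq_le_zero depends_on_const)
  have W': "disjoint_family W'" using W by (auto simp: W'_def disjoint_family_on_def)
  define z0 where "z0 = z / (2 * real J) ^ n"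
  have z0: "0 < z0" using z J by (simp add: z0_def)
  define rho where "rho = (C1 * T powr (theta - eta)) powr q"
  have rho: "\<P>(e in S. z0 * (2 * real J) / (2 * real K) <= L2_set (%d. SUM k:A. G' k d e) D') <= rho"
   if A: "finite A" for A
  proof -
   let ?y = "z0 * (2 * real J) / (2 * real K)"
   have y: "0 < ?y" using z0 J K by auto
   have "Lq_le S q (%e. L2_set (%d. SUM k:A. G' k d e) D') (L2_set (%d. sqrt (Kq * (SUM k:A. (b' k d)^2))) D')"
    using G' W' q by (intro Lq_le_L2_set D' indep_sum_le[OF q Kq A]) (auto intro: disjoint_family_on_mono[of A UNIV])
   moreover have "L2_set (%d. sqrt (Kq * (SUM k:A. (b' k d)^2))) D' <= sqrt Kq * v"
   proof -
    have "(SUM k:A. (b' k d)^2) <= (SUM k<N. (b k d)^2)" if "d : D'" for d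
    proof -
     have "(SUM k:A. (b' k d)^2) = (SUM k:A Int {..<N}. (b k d)^2)"
      unfolding b'_def using A that by (intro sum.mono_neutral_cong_right) auto
     also have "... <= (SUM k<N. (b k d)^2)" by (intro sum_mono2) auto
     finally show ?thesis .
    qed
    then have "(SUM d:D'. Kq * (SUM k:A. (b' k d)^2)) <= (SUM d:D'. Kq * (SUM k<N. (b k d)^2))" using Kq0 by (intro sum_mono mult_left_mono) auto
    also have "... = Kq * (SUM k<N. SUM d:D'. (b k d)^2)" by (simp add: sum_distrib_left sum.swap[of _ _ D'])
    also have "... <= Kq * v^2" using v Kq0 by (intro mult_left_mono) auto
    finally have le: "(SUM d:D'. Kq * (SUM k:A. (b' k d)^2)) <= Kq * v^2" .
    have "L2_set (%d. sqrt (Kq * (SUM k:A. (b' k d)^2))) D' = sqrt (SUM d:D'. Kq * (SUM k:A. (b' k d)^2))"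
     using Kq0 by (simp add: L2_set_def sum_nonneg)
    also have "... <= sqrt (Kq * v^2)" using le by (rule real_sqrt_le_mono)
    finally show ?thesis using v Kq0 by (simp add: real_sqrt_mult)
   qed
   ultimately have "Lq_le S q (%e. L2_set (%d. SUM k:A. G' k d e) D') (sqrt Kq * v)" using q by (auto intro: Lq_le_mono)
   from S.Lq_le_Markov[OF this _ y] have "\<P>(e in S. ?y <= L2_set (%d. SUM k:A. G' k d e) D') <= (sqrt Kq * v / ?y) powr q"
    using q by (simp add: L2_set_nonneg)
   also have "... <= rho" unfolding rho_def
   proof (rule powr_mono2)
    have v': "v <= z * T powr (- eta)" using z T by (simp add: powr_minus field_simps)
    have J1: "1 / (2 * real J) <= 1" using J(1) by simp
    have "sqrt Kq * v / ?y = (sqrt Kq * (2 * real J) ^ n * 2) * real K * (v / z) * (1 / (2 * real J))" using z J K by (simp add: z0_def field_simps)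
    also have "... <= (sqrt Kq * (2 * real J) ^ n * 2) * (2 * T powr theta) * (T powr (- eta)) * 1"
     using K v' z v Kq0 J1 by (intro mult_mono mult_nonneg_nonneg) (auto simp: divide_le_eq mult.commute)
    also have "... = C1 * T powr (theta - eta)" by (simp add: C1_def powr_add[symmetric])
    finally show "sqrt Kq * v / ?y <= C1 * T powr (theta - eta)" .
    show "0 <= sqrt Kq * v / ?y" using Kq0 v y by (intro divide_nonneg_pos mult_nonneg_nonneg) auto
   qed (use q in auto)
   finally show ?thesis .
  qed
  have "\<P>(e in S. z <= L2_set (%d. SUM k:{0..<0 + K ^ n}. G' k d e) D')
   <= (SUM k:{0..<0 + K ^ n}. \<P>(e in S. z / (2 * real J) ^ n <= L2_set (%d. G' k d e) D'))
    + real n * real K ^ n * (real K * rho) ^ J"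
   using G' W' z0 J K rho by (intro prob_norm_sum_tree[where W=W' and ?z0.0=z0]) (auto simp: z0_def)
  moreover have "{0..<0 + K ^ n} = {..<K ^ n}" by auto
  moreover have "(SUM k<K ^ n. G' k d e) = (SUM k<N. G k d e)" if "d : D'" for d e
   using KN that by (intro sum.mono_neutral_cong_right) (auto simp: G'_def)
  then have "L2_set (%d. SUM k<K ^ n. G' k d e) D' = L2_set (%d. SUM k<N. G k d e) D'" for e by (intro L2_set_cong) auto
  moreover have "(SUM k<K ^ n. \<P>(e in S. z / (2 * real J) ^ n <= L2_set (%d. G' k d e) D'))
    = (SUM k<N. \<P>(e in S. c * z <= L2_set (%d. G k d e) D'))"
  proof (rule sum.mono_neutral_cong_right)
   show "ALL k:{..<K ^ n} - {..<N}. \<P>(e in S. z / (2 * real J) ^ n <= L2_set (%d. G' k d e) D') = 0"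
   proof
    fix k assume "k : {..<K ^ n} - {..<N}"
    then have "L2_set (%d. G' k d e) D' = 0" for e by (simp add: G'_def L2_set_def)
    moreover have "0 < z / (2 * real J) ^ n" using z J by simp
    ultimately have "{e:space S. z / (2 * real J) ^ n <= L2_set (%d. G' k d e) D'} = {}" by auto
    then show "\<P>(e in S. z / (2 * real J) ^ n <= L2_set (%d. G' k d e) D') = 0" by (simp only: measure_empty)
   qed
   show "\<P>(e in S. z / (2 * real J) ^ n <= L2_set (%d. G' k d e) D') = \<P>(e in S. c * z <= L2_set (%d. G k d e) D')"
    if "k : {..<N}" for k
   proof -
    have "L2_set (%d. G' k d e) D' = L2_set (%d. G k d e) D'" for e using that by (intro L2_set_cong) (auto simp: G'_def)
    then show ?thesis by (simp add: c_def)
   qed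
  qed (use KN in auto)
  moreover have "real n * real K ^ n * (real K * rho) ^ J <= C * T powr (- kappa)"
  proof -
   have "real K * rho <= 2 * T powr theta * rho" using K by (intro mult_right_mono) (auto simp: rho_def)
   also have "... = 2 * C1 powr q * T powr (theta + (theta - eta) * q)" using C1 T by (simp add: rho_def powr_mult powr_powr powr_add)
   also have "theta + (theta - eta) * q = - (q * eta / 2)" using th2 by (simp add: algebra_simps)
   finally have "(real K * rho) ^ J <= (2 * C1 powr q * T powr (- (q * eta / 2))) ^ J" by (intro power_mono) (auto simp: rho_def)
   also have "... = (2 * C1 powr q) ^ J * T powr (- (real J * (q * eta / 2)))"
    using T by (simp add: power_mult_distrib powr_realpow[symmetric] powr_powr mult.commute)
   also have "... <= (2 * C1 powr q) ^ J * T powr (- (kappa + theta * real n))" using J T by (intro mult_left_mono powr_mono) auto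
   finally have 1: "(real K * rho) ^ J <= (2 * C1 powr q) ^ J * T powr (- (kappa + theta * real n))" .
   have "real K ^ n <= (2 * T powr theta) ^ n" using K by (intro power_mono) auto
   also have "... = 2 ^ n * T powr (theta * real n)" using T by (simp add: power_mult_distrib powr_realpow[symmetric] powr_powr)
   finally have 2: "real K ^ n <= 2 ^ n * T powr (theta * real n)" .
   have "real n * real K ^ n * (real K * rho) ^ J
     <= real n * (2 ^ n * T powr (theta * real n)) * ((2 * C1 powr q) ^ J * T powr (- (kappa + theta * real n)))"
    using 1 2 by (intro mult_mono mult_left_mono mult_nonneg_nonneg zero_le_power) (auto simp: rho_def)
   also have "... = C * (T powr (theta * real n) * T powr (- (kappa + theta * real n)))" by (simp add: C_def mult_ac)
   also have "T powr (theta * real n) * T powr (- (kappa + theta * real n)) = T powr (- kappa)" by (simp add: powr_add[symmetric])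
   finally show ?thesis .
  qed
  ultimately show "\<P>(e in S. z <= L2_set (%d. SUM k<N. G k d e) D')
    <= (SUM k<N. \<P>(e in S. c * z <= L2_set (%d. G k d e) D')) + C * T powr (- kappa)"
   by simp
 qed (rule c)
qed

end

section \<open>Sums over blocks through dyadic scales\<close>

lemma sum_lessThan_double: "(SUM k<2 * n. f k) = (SUM k<n. f (2 * k) + f (Suc (2 * k)) :: 'a::comm_monoid_add)"
 by (induction n) (simp_all add: add.assoc)

lemma sum_colour_classes:
 fixes f :: "nat => real"
 shows "(SUM k<N. f k) = (SUM c<6. SUM m<N. if 6 * m + c < N then f (6 * m + c) else 0)"
proof -
 let ?g = "%k. if k < N then f k else 0"
 have "(SUM k<N. f k) = (SUM k<N * 6. ?g k)" by (rule sum.mono_neutral_cong_left) auto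
 also have "... = (SUM m<N. SUM k:{m * 6..<m * 6 + 6}. ?g k)" by (rule sum.nat_group[symmetric])
 also have "... = (SUM m<N. SUM c<6. ?g (6 * m + c))"
 proof (rule sum.cong[OF refl])
  fix m :: nat
  have "{m * 6..<m * 6 + 6} = {0 + 6 * m..<6 + 6 * m}" by auto
  then have "(SUM k:{m * 6..<m * 6 + 6}. ?g k) = (SUM c:{0..<6}. ?g (c + 6 * m))" by (simp only: sum.shift_bounds_nat_ivl)
  also have "... = (SUM c<6. ?g (6 * m + c))" by (intro sum.cong) (auto simp: add.commute)
  finally show "(SUM k:{m * 6..<m * 6 + 6}. ?g k) = (SUM c<6. ?g (6 * m + c))" .
 qed
 also have "... = (SUM c<6. SUM m<N. ?g (6 * m + c))" by (rule sum.swap)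
 finally show ?thesis .
qed

context innovations
begin

text \<open>In every residue class modulo \<open>6\<close> the vectors are independent.\<close>

lemma prob_norm_dependent_sum:
 fixes q eta kappa :: real
 assumes q: "2 <= q" and Kq: "mart_step S q Kq" and eta: "0 < eta" and kappa: "0 < kappa"
 obtains c C where "0 < c" "c <= 1" "0 <= C"
  "!!T N D' W (G :: nat => int => (int => 'e) => real) b v z. 1 <= T ==> real N <= T^2 ==> finite D' ==>
   (!!k d. k < N ==> d : D' ==> Lq_le S q (G k d) (b k d)) ==>
   (!!k d. k < N ==> d : D' ==> (LINT e|S. G k d e) = 0) ==>
   (!!k d. k < N ==> d : D' ==> depends_on (W k) (G k d)) ==>
   (!!k k'. k + 6 <= k' ==> W k Int W k' = {}) ==>
   (SUM k<N. SUM d:D'. (b k d)^2) <= v^2 ==> 0 <= v ==> 0 < z ==> 6 * v * T powr eta <= z ==>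
   \<P>(e in S. z <= L2_set (%d. SUM k<N. G k d e) D')
    <= (SUM k<N. \<P>(e in S. c * z <= L2_set (%d. G k d e) D')) + C * T powr (- kappa)"
proof (rule prob_norm_indep_sum[OF q Kq eta kappa])
 fix c0 C0 :: real assume c0: "0 < c0" "0 <= C0"
  and main: "!!T N D' W (G :: nat => int => (int => 'e) => real) b v z. 1 <= T ==> real N <= T^2 ==> finite D' ==>
   (!!k d. k < N ==> d : D' ==> Lq_le S q (G k d) (b k d)) ==>
   (!!k d. k < N ==> d : D' ==> (LINT e|S. G k d e) = 0) ==>
   (!!k d. k < N ==> d : D' ==> depends_on (W k) (G k d)) ==> disjoint_family_on W {..<N} ==>
   (SUM k<N. SUM d:D'. (b k d)^2) <= v^2 ==> 0 <= v ==> 0 < z ==> v * T powr eta <= z ==>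
   \<P>(e in S. z <= L2_set (%d. SUM k<N. G k d e) D')
    <= (SUM k<N. \<P>(e in S. c0 * z <= L2_set (%d. G k d e) D')) + C0 * T powr (- kappa)"
 define c where "c = min 1 (c0 / 6)"
 have c: "0 < c" "c <= 1" "c * 6 <= c0" using c0 by (auto simp: c_def min_def)
 show thesis
 proof (rule that[of c "6 * C0"])
  fix T N D' W and G :: "nat => int => (int => 'e) => real" and b v z
  assume T: "1 <= T" and N: "real N <= T^2" and D': "finite D'"
   and G: "!!k d. k < N ==> d : D' ==> Lq_le S q (G k d) (b k d)"
    "!!k d. k < N ==> d : D' ==> (LINT e|S. G k d e) = 0"
    "!!k d. k < N ==> d : D' ==> depends_on (W k) (G k d)"
   and W: "!!k k'. k + 6 <= k' ==> W k Int W k' = {}" and v: "(SUM k<N. SUM d:D'. (b k d)^2) <= v^2" "0 <= v"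
   and z: "0 < z" "6 * v * T powr eta <= z"
  define G' where "G' = (%r m d. if 6 * m + r < N then G (6 * m + r) d else (%_. 0))"
  define b' where "b' = (%r m d. if 6 * m + r < N then b (6 * m + r) d else 0)"
  have [measurable]: "G k d : borel_measurable S" if "k < N" "d : D'" for k d using G(1)[OF that] by (auto simp: Lq_le_def)
  have Gm: "G' r m d : borel_measurable S" if "d : D'" for r m d using that by (auto simp: G'_def)
  have nm: "(%e. L2_set (%d. SUM m<N. G' r m d e) D') : borel_measurable S" for r using Gm by (intro measurable_L2_set borel_measurable_sum) auto
  have nm1: "(%e. L2_set (%d. G k d e) D') : borel_measurable S" if "k < N" for k using that by (intro measurable_L2_set) auto
  have split: "(SUM k<N. G k d e) = (SUM r<6. SUM m<N. G' r m d e)" for d e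
   unfolding sum_colour_classes[of "%k. G k d e" N] G'_def by (intro sum.cong refl) auto
  have one: "\<P>(e in S. z / 6 <= L2_set (%d. SUM m<N. G' r m d e) D')
    <= (SUM m<N. if 6 * m + r < N then \<P>(e in S. c * z <= L2_set (%d. G (6 * m + r) d e) D') else 0) + C0 * T powr (- kappa)" (is "?l <= ?s + _")
   if r: "r < 6" for r
  proof -
   have "?l <= (SUM m<N. \<P>(e in S. c0 * (z / 6) <= L2_set (%d. G' r m d e) D')) + C0 * T powr (- kappa)"
   proof (rule main[OF T N D', of "G' r" "b' r" "%m. W (6 * m + r)" v])
    show "disjoint_family_on (%m. W (6 * m + r)) {..<N}"
     unfolding disjoint_family_on_def
    proof (intro ballI impI)
     fix i j :: nat assume "i ~= j"
     then show "W (6 * i + r) Int W (6 * j + r) = {}"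
     proof (cases "i < j")
      case True then show ?thesis by (intro W) auto
     next
      case False
      then have "W (6 * j + r) Int W (6 * i + r) = {}" using \<open>i \<noteq> j\<close> by (intro W) auto
      then show ?thesis by auto
     qed
    qed
    have "(SUM m<N. SUM d:D'. (b' r m d)^2) = (SUM m<N. if 6 * m + r < N then (SUM d:D'. (b (6 * m + r) d)^2) else 0)"
     by (intro sum.cong refl) (auto simp: b'_def)
    also have "... <= (SUM r<6. SUM m<N. if 6 * m + r < N then (SUM d:D'. (b (6 * m + r) d)^2) else 0)"
     using r by (intro member_le_sum) (auto intro!: sum_nonneg)
    also have "... = (SUM k<N. SUM d:D'. (b k d)^2)" by (rule sum_colour_classes[symmetric])
    finally show "(SUM m<N. SUM d:D'. (b' r m d)^2) <= v^2" using v by simp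
   qed (use G v z in \<open>auto simp: G'_def b'_def Lq_le_zero depends_on_const\<close>)
   also have "(SUM m<N. \<P>(e in S. c0 * (z / 6) <= L2_set (%d. G' r m d e) D')) <= ?s"
   proof (rule sum_mono)
    fix m
    show "\<P>(e in S. c0 * (z / 6) <= L2_set (%d. G' r m d e) D')
     <= (if 6 * m + r < N then \<P>(e in S. c * z <= L2_set (%d. G (6 * m + r) d e) D') else 0)"
    proof (cases "6 * m + r < N")
     case True
     have "c * z <= c0 * (z / 6)" using c z mult_right_mono[of "c * 6" c0 "z / 6"] by simp
     then show ?thesis using True nm1[OF True] by (auto simp: G'_def intro!: S.finite_measure_mono)
    next
     case False
     have "0 < c0 * (z / 6)" using c0 z by simp
     then have "{e:space S. c0 * (z / 6) <= L2_set (%d. G' r m d e) D'} = {}" using False by (auto simp: G'_def L2_set_def)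
     then show ?thesis using False by (simp only: measure_empty if_False order_refl)
    qed
   qed
   finally show ?thesis by simp
  qed
  have "{e:space S. z <= L2_set (%d. SUM k<N. G k d e) D'}
    \<subseteq> (\<Union>r<6. {e:space S. z / 6 <= L2_set (%d. SUM m<N. G' r m d e) D'})"
  proof
   fix e assume "e : {e:space S. z <= L2_set (%d. SUM k<N. G k d e) D'}"
   then have e: "e : space S" "z <= (SUM r<6. L2_set (%d. SUM m<N. G' r m d e) D')"
    using L2_set_sum_le[of "{..<6::nat}" "%r d. SUM m<N. G' r m d e" D'] by (auto simp: split)
   show "e : (\<Union>r<6. {e:space S. z / 6 <= L2_set (%d. SUM m<N. G' r m d e) D'})"
   proof (rule ccontr)
    assume "e ~: (\<Union>r<6. {e:space S. z / 6 <= L2_set (%d. SUM m<N. G' r m d e) D'})"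
    then have "(SUM r<6::nat. L2_set (%d. SUM m<N. G' r m d e) D') < (SUM r<6::nat. z / 6)"
     using e(1) by (intro sum_strict_mono) (auto simp: not_le lessThan_empty_iff)
    then show False using e(2) by simp
   qed
  qed
  then have "\<P>(e in S. z <= L2_set (%d. SUM k<N. G k d e) D')
    <= S.prob (\<Union>r<6. {e:space S. z / 6 <= L2_set (%d. SUM m<N. G' r m d e) D'})"
   using nm by (intro S.finite_measure_mono) auto
  also have "... <= (SUM r<6. \<P>(e in S. z / 6 <= L2_set (%d. SUM m<N. G' r m d e) D'))" using nm by (intro S.finite_measure_subadditive_finite) auto
  also have "... <= (SUM r<6. (SUM m<N. if 6 * m + r < N then \<P>(e in S. c * z <= L2_set (%d. G (6 * m + r) d e) D') else 0) + C0 * T powr (- kappa))"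
   using one by (intro sum_mono) auto
  also have "... = (SUM k<N. \<P>(e in S. c * z <= L2_set (%d. G k d e) D')) + 6 * C0 * T powr (- kappa)"
   unfolding sum.distrib by (simp add: sum_colour_classes[of "%k. \<P>(e in S. c * z <= L2_set (%d. G k d e) D')" N])
  finally show "\<P>(e in S. z <= L2_set (%d. SUM k<N. G k d e) D')
    <= (SUM k<N. \<P>(e in S. c * z <= L2_set (%d. G k d e) D')) + 6 * C0 * T powr (- kappa)" .
 qed (use c c0 in auto)
qed

definition blk :: "(int => int => (int => 'e) => real) => int => nat => int => (int => 'e) => real" where
 "blk W tau j d e = (SUM t:{tau..<tau + 2 ^ j}. W t d e)"

text \<open>A block with the innovations more than five block lengths before it averaged out.  The parameter
 five leaves room for quadratic forms whose lags reach up to four block lengths back.\<close>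

definition blkE :: "(int => int => (int => 'e) => real) => int => nat => int => (int => 'e) => real" where
 "blkE W tau j d = cexp {tau - 5 * 2 ^ j..} (blk W tau j d)"

definition blkincr :: "(int => int => (int => 'e) => real) => int => nat => int => (int => 'e) => real" where
 "blkincr W tau j d e = blkE W tau (Suc j) d e - blkE W tau j d e - blkE W (tau + 2 ^ j) j d e"

lemma blk_Suc: "blk W tau (Suc j) d e = blk W tau j d e + blk W (tau + 2 ^ j) j d e"
proof -
 have "{tau..<tau + 2 ^ Suc j} = {tau..<tau + 2 ^ j} Un {tau + 2 ^ j..<tau + 2 ^ j + 2 ^ j}" by (auto simp: add.assoc)
 moreover have "{tau..<tau + 2 ^ j} Int {tau + 2 ^ j..<tau + 2 ^ j + 2 ^ j} = {}" by auto
 ultimately show ?thesis unfolding blk_def by (simp add: sum.union_disjoint)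
qed

lemma blk_levels:
 assumes "j0 <= l"
 shows "blkE W tau l d e = (SUM j:{j0..<l}. SUM k<2 ^ (l - Suc j). blkincr W (tau + int k * 2 ^ Suc j) j d e)
   + (SUM k<2 ^ (l - j0). blkE W (tau + int k * 2 ^ j0) j0 d e)"
proof -
 define L where "L = (%j. SUM k<2 ^ (l - j). blkE W (tau + int k * 2 ^ j) j d e)"
 have "L (Suc j) - L j = (SUM k<2 ^ (l - Suc j). blkincr W (tau + int k * 2 ^ Suc j) j d e)" if "j < l" for j
 proof -
  have "(2::nat) ^ (l - j) = 2 * 2 ^ (l - Suc j)" using that by (simp add: Suc_diff_Suc flip: power_Suc)
  then have "L j = (SUM k<2 ^ (l - Suc j). blkE W (tau + int (2 * k) * 2 ^ j) j d e + blkE W (tau + int (Suc (2 * k)) * 2 ^ j) j d e)"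
   unfolding L_def by (simp only: sum_lessThan_double)
  moreover have "tau + int (Suc (2 * k)) * 2 ^ j = tau + int k * 2 ^ Suc j + 2 ^ j"
   "tau + int (2 * k) * 2 ^ j = tau + int k * 2 ^ Suc j" for k
   by (simp_all add: algebra_simps)
  ultimately have "L j = (SUM k<2 ^ (l - Suc j). blkE W (tau + int k * 2 ^ Suc j) j d e + blkE W (tau + int k * 2 ^ Suc j + 2 ^ j) j d e)"
   by presburger
  then show ?thesis unfolding L_def by (simp add: blkincr_def sum_subtractf sum.distrib)
 qed
 then have "(SUM j:{j0..<l}. SUM k<2 ^ (l - Suc j). blkincr W (tau + int k * 2 ^ Suc j) j d e) = (SUM j:{j0..<l}. L (Suc j) - L j)"
  by (intro sum.cong) auto
 also have "... = L l - L j0" by (rule sum_Suc_diff'[OF assms])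
 finally show ?thesis by (simp add: L_def)
qed

text \<open>The assumptions on a family of vectors indexed by time under which a sum over a block is
 controlled by its behaviour at all dyadic scales.  Here \<open>b j k d\<close> bounds the error made on
 the \<open>k\<close>-th block of length \<open>2 ^ j\<close> by forgetting the coordinates more than five block lengths
 before that block.\<close>

definition multiscale_family where
 "multiscale_family q W D' tau0 j0 l b f v \<longleftrightarrow> finite D' & j0 <= l & 0 <= v &
   (ALL t. ALL d:D'. integrable S (W t d) & depends_on {..t} (W t d) & (LINT e|S. W t d e) = 0) &
   (ALL j:{j0..l}. ALL k<2 ^ (l - j). ALL d:D'. Lq_le S q
    (%e. blk W (tau0 + int k * 2 ^ j) j d e - blkE W (tau0 + int k * 2 ^ j) j d e) (b j k d)) &
   (ALL k<2 ^ (l - j0). ALL d:D'. Lq_le S q (blk W (tau0 + int k * 2 ^ j0) j0 d) (f k d)) &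
   (ALL j:{j0..l}. (SUM k<2 ^ (l - j). SUM d:D'. (b j k d)^2) <= v^2) &
   (SUM k<2 ^ (l - j0). SUM d:D'. (f k d)^2) <= v^2"

lemma sum_three_powr_le:
 fixes x y w :: real
 assumes "0 <= x" "0 <= y" "0 <= w" "0 <= q"
 shows "(x + y + w) powr q <= 3 powr q * (x powr q + y powr q + w powr q)"
proof -
 define m where "m = max x (max y w)"
 have "(x + y + w) powr q <= (3 * m) powr q" using assms by (intro powr_mono2) (auto simp: m_def)
 also have "... = 3 powr q * m powr q" by (simp add: powr_mult)
 also have "m powr q <= x powr q + y powr q + w powr q" by (auto simp: m_def max_def)
 finally show ?thesis by simp
qed

text \<open>The block is the sum of its increments over the dyadic scales and of its parts at the finest scale.
 At every scale the increments have finite range, so that \<open>prob_norm_dependent_sum\<close> replaces the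
 sum by single summands, to which Markov's inequality is applied; \<open>omega\<close> distributes the level among
 the scales.\<close>

theorem prob_norm_multiscale:
 fixes q eta kappa :: real
 assumes q: "2 <= q" and Kq: "mart_step S q Kq" and eta: "0 < eta" and kappa: "0 < kappa"
 obtains c C where "0 < c" "c <= 1" "0 <= C"
  "!!T D' W b f omega l j0 tau0 v z. 1 <= T ==> 2 ^ l <= T^2 ==> multiscale_family q W D' tau0 j0 l b f v ==>
   (!!j. j : {j0..l} ==> 0 < omega j) ==> (!!j. j : {j0..<l} ==> omega (Suc j) <= omega j) ==> (SUM j:{j0..l}. omega j) <= 1 / 4 ==>
   0 < z ==> (!!j. j : {j0..l} ==> 18 * v * T powr eta <= omega j * z) ==>
   \<P>(e in S. z <= L2_set (%d. blk W tau0 l d e) D')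
    <= C * (SUM j:{j0..l}. SUM k<2 ^ (l - j). (L2_set (b j k) D' / (omega j * z)) powr q)
     + (SUM k<2 ^ (l - j0). \<P>(e in S. c * z <= L2_set (%d. blk W (tau0 + int k * 2 ^ j0) j0 d e) D'))
     + C * T powr (- kappa)"
proof (rule prob_norm_dependent_sum[OF q Kq eta, of "kappa + 2"])
 show "0 < kappa + 2" using kappa by simp
 fix c0 C0 :: real assume c0: "0 < c0" "c0 <= 1" "0 <= C0"
  and main: "!!T N D' W (G :: nat => int => (int => 'e) => real) b v z. 1 <= T ==> real N <= T^2 ==> finite D' ==>
   (!!k d. k < N ==> d : D' ==> Lq_le S q (G k d) (b k d)) ==>
   (!!k d. k < N ==> d : D' ==> (LINT e|S. G k d e) = 0) ==>
   (!!k d. k < N ==> d : D' ==> depends_on (W k) (G k d)) ==>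
   (!!k k'. k + 6 <= k' ==> W k Int W k' = {}) ==>
   (SUM k<N. SUM d:D'. (b k d)^2) <= v^2 ==> 0 <= v ==> 0 < z ==> 6 * v * T powr eta <= z ==>
   \<P>(e in S. z <= L2_set (%d. SUM k<N. G k d e) D')
    <= (SUM k<N. \<P>(e in S. c0 * z <= L2_set (%d. G k d e) D')) + C0 * T powr (- (kappa + 2))"
 define C where "C = 4 * (3 / c0) powr q + C0"
 have Cp: "(1::real) <= (3 / c0) powr q" using c0 q by (intro ge_one_powr_ge_zero) auto
 have C: "0 <= C" using c0 by (simp add: C_def)
 show thesis
 proof (rule that[of "c0 / 4" C])
  fix T D' W b f omega l j0 tau0 v z
  assume T: "1 <= T" and l: "2 ^ l <= T^2" and fam: "multiscale_family q W D' tau0 j0 l b f v"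
   and omega: "!!j. j : {j0..l} ==> 0 < omega j" "!!j. j : {j0..<l} ==> omega (Suc j) <= omega j" "(SUM j:{j0..l}. omega j) <= 1 / 4"
   and z: "0 < z" and gap: "!!j. j : {j0..l} ==> 18 * v * T powr eta <= omega j * z"
  have D': "finite D'" and jl: "j0 <= l" and v: "0 <= v"
   and W: "!!t d. d : D' ==> integrable S (W t d)" "!!t d. d : D' ==> depends_on {..t} (W t d)"
     "!!t d. d : D' ==> (LINT e|S. W t d e) = 0"
   and b: "!!j k d. j : {j0..l} ==> k < 2 ^ (l - j) ==> d : D' ==> Lq_le S q
    (%e. blk W (tau0 + int k * 2 ^ j) j d e - blkE W (tau0 + int k * 2 ^ j) j d e) (b j k d)"
   and f: "!!k d. k < 2 ^ (l - j0) ==> d : D' ==> Lq_le S q (blk W (tau0 + int k * 2 ^ j0) j0 d) (f k d)"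
   and bv: "!!j. j : {j0..l} ==> (SUM k<2 ^ (l - j). SUM d:D'. (b j k d)^2) <= v^2"
   and fv: "(SUM k<2 ^ (l - j0). SUM d:D'. (f k d)^2) <= v^2"
   using fam unfolding multiscale_family_def by blast+
  let ?n = "%j k. L2_set (b j k) D'"
  let ?I = "%j k d. blkincr W (tau0 + int k * 2 ^ Suc j) j d" and ?e0 = "%k d. blkE W (tau0 + int k * 2 ^ j0) j0 d" and ?b0 = "%k d. blk W (tau0 + int k * 2 ^ j0) j0 d"
  let ?err = "%j k d e. blk W (tau0 + int k * 2 ^ j) j d e - blkE W (tau0 + int k * 2 ^ j) j d e"
  have iW: "integrable S (blk W tau j d)" if "d : D'" for tau j d
   unfolding blk_def[abs_def] using that by (intro Bochner_Integration.integrable_sum W)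
  have mW: "blk W tau j d : borel_measurable S" if "d : D'" for tau j d using iW[OF that] by auto
  have mE: "blkE W tau j d : borel_measurable S" if "d : D'" for tau j d
   unfolding blkE_def by (intro measurable_cexp mW that)
  have iE: "integrable S (blkE W tau j d)" if "d : D'" for tau j d
   unfolding blkE_def by (intro integrable_cexp iW that)
  have mI: "blkincr W tau j d : borel_measurable S" if "d : D'" for tau j d
   unfolding blkincr_def[abs_def] by (intro borel_measurable_diff mE that)
  have zero: "(LINT e|S. blk W tau j d e) = 0" if "d : D'" for tau j d
   unfolding blk_def using that W by (subst LINT_sum) auto
  have zeroE: "(LINT e|S. blkE W tau j d e) = 0" if "d : D'" for tau j d
   unfolding blkE_def using zero[OF that] iW[OF that] by (simp add: integral_cexp)
  have zeroI: "(LINT e|S. blkincr W tau j d e) = 0" if "d : D'" for tau j d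
   unfolding blkincr_def using iE[OF that] zeroE[OF that] by (simp add: LINT_diff)
  have depE: "depends_on {tau - 5 * 2 ^ j..<tau + 2 ^ j} (blkE W tau j d)" if "d : D'" for tau j d
  proof -
   have "depends_on {..<tau + 2 ^ j} (blk W tau j d)"
    unfolding blk_def[abs_def]
    by (intro depends_on_sum depends_on_mono[OF W(2)[OF that]]) auto
   then have "depends_on ({tau - 5 * 2 ^ j..} Int {..<tau + 2 ^ j}) (blkE W tau j d)"
    unfolding blkE_def by (intro depends_on_Int cexp_depends cexp_depends_inherit)
   then show ?thesis by (rule depends_on_mono) auto
  qed
  have depI: "depends_on {tau - 5 * 2 ^ Suc j..<tau + 2 ^ Suc j} (blkincr W tau j d)" if "d : D'" for tau j d
  proof -
   have p: "(0::int) < 2 ^ j" by simp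
   show ?thesis
    unfolding blkincr_def[abs_def]
    by (intro depends_on_compose2[where h="(-)"] depends_on_mono[OF depE[OF that]]) (use p in \<open>auto simp: algebra_simps\<close>)
  qed
  have errn: "\<P>(e in S. y <= L2_set (%d. ?err j k d e) D') <= (?n j k / y) powr q"
   if "j : {j0..l}" "k < 2 ^ (l - j)" "0 < y" for j k y
  proof -
   have "Lq_le S q (%e. L2_set (%d. ?err j k d e) D') (?n j k)" using that q b by (intro Lq_le_L2_set D') auto
   from S.Lq_le_Markov[OF this _ \<open>0 < y\<close>] show ?thesis using q by (simp add: L2_set_nonneg)
  qed
  have incr_err: "?I j k d e = ?err j (2 * k) d e + ?err j (Suc (2 * k)) d e - ?err (Suc j) k d e" for j k d e
  proof -
   have "tau0 + int (2 * k) * 2 ^ j = tau0 + int k * 2 ^ Suc j" "tau0 + int (Suc (2 * k)) * 2 ^ j = tau0 + int k * 2 ^ Suc j + 2 ^ j"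
    by (simp_all add: algebra_simps)
   then show ?thesis by (simp only: blkincr_def blk_Suc)
  qed
  have kk: "2 * k < 2 ^ (l - j)" "Suc (2 * k) < 2 ^ (l - j)" if "j < l" "k < 2 ^ (l - Suc j)" for j k :: nat
  proof -
   have "(2::nat) ^ (l - j) = 2 * 2 ^ (l - Suc j)" using that(1) by (simp add: Suc_diff_Suc flip: power_Suc)
   then show "2 * k < 2 ^ (l - j)" "Suc (2 * k) < 2 ^ (l - j)" using that(2) by auto
  qed
  let ?bb = "%j k d. b j (2 * k) d + b j (Suc (2 * k)) d + b (Suc j) k d"
  have incr_bound: "Lq_le S q (?I j k d) (?bb j k d)"
   if "j : {j0..<l}" "k < 2 ^ (l - Suc j)" "d : D'" for j k d
  proof -
   have "Lq_le S q (%e. ?err j (2 * k) d e + ?err j (Suc (2 * k)) d e - ?err (Suc j) k d e) (?bb j k d)"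
    using that kk[of j k] q by (intro Lq_le_diff Lq_le_add b) auto
   then show ?thesis by (simp only: incr_err[symmetric])
  qed
  define R where "R = (%j k. (?n j k / (omega j * z)) powr q)"
  define Q where "Q = (%j. SUM k<2 ^ (l - j). R j k)"
  have R0: "0 <= R j k" for j k by (simp add: R_def)
  have Q0: "0 <= Q j" for j by (simp add: Q_def R0 sum_nonneg)
  have om4: "omega j <= 1 / 4" if "j : {j0..l}" for j
  proof -
   have "omega j <= (SUM j:{j0..l}. omega j)" using omega(1) that by (intro member_le_sum) (auto intro: less_imp_le)
   then show ?thesis using omega(3) by linarith
  qed
  have N: "real (2 ^ (l - j)) <= T^2" for j
  proof -
   have "(2::real) ^ (l - j) <= 2 ^ l" by (intro power_increasing) auto
   from order_trans[OF this l] show ?thesis by simp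
  qed
  have nI: "(%e. L2_set (%d. blkincr W tau j d e) D') : borel_measurable S" for tau j by (intro measurable_L2_set mI)
  have level: "\<P>(e in S. omega j * z <= L2_set (%d. SUM k<2 ^ (l - Suc j). ?I j k d e) D')
    <= (3 / c0) powr q * (Q (Suc j) + Q j) + C0 * T powr (- (kappa + 2))" (is "?l <= _")
   if j: "j : {j0..<l}" for j
  proof -
   have oz: "0 < omega j * z" using omega(1)[of j] j z by auto
   have "?l <= (SUM k<2 ^ (l - Suc j). \<P>(e in S. c0 * (omega j * z) <= L2_set (%d. ?I j k d e) D'))
     + C0 * T powr (- (kappa + 2))"
   proof (rule main[OF T N[of "Suc j"] D', of "%k d. ?I j k d" "?bb j"
      "%k. {tau0 + int k * 2 ^ Suc j - 5 * 2 ^ Suc j..<tau0 + int k * 2 ^ Suc j + 2 ^ Suc j}" "3 * v"])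
    show "{tau0 + int k * 2 ^ Suc j - 5 * 2 ^ Suc j..<tau0 + int k * 2 ^ Suc j + 2 ^ Suc j} \<inter>
      {tau0 + int k' * 2 ^ Suc j - 5 * 2 ^ Suc j..<tau0 + int k' * 2 ^ Suc j + 2 ^ Suc j} = {}" if "k + 6 <= k'" for k k'
    proof -
     have "(int k + 6) * 2 ^ Suc j <= int k' * 2 ^ Suc j" using that by (intro mult_right_mono) auto
     then show ?thesis by (auto simp: algebra_simps)
    qed
    have "(SUM k<2 ^ (l - Suc j). SUM d:D'. (?bb j k d)^2)
      <= (SUM k<2 ^ (l - Suc j). SUM d:D'. 3 * ((b j (2 * k) d)^2 + (b j (Suc (2 * k)) d)^2 + (b (Suc j) k d)^2))"
    proof (intro sum_mono)
     fix k d
     have *: "(x + y + w)^2 <= 3 * (x^2 + y^2 + w^2)" for x y w :: real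
     proof -
      have "0 <= (x - y)^2 + (y - w)^2 + (x - w)^2" by simp
      then show ?thesis by (simp add: power2_eq_square algebra_simps)
     qed
     show "(?bb j k d)^2 <= 3 * ((b j (2 * k) d)^2 + (b j (Suc (2 * k)) d)^2 + (b (Suc j) k d)^2)" by (rule *)
    qed
    also have "... = 3 * ((SUM k<2 ^ (l - Suc j). (SUM d:D'. (b j (2 * k) d)^2) + (SUM d:D'. (b j (Suc (2 * k)) d)^2))
      + (SUM k<2 ^ (l - Suc j). SUM d:D'. (b (Suc j) k d)^2))"
     by (simp only: sum.distrib sum_distrib_left[symmetric])
    also have "(SUM k<2 ^ (l - Suc j). (SUM d:D'. (b j (2 * k) d)^2) + (SUM d:D'. (b j (Suc (2 * k)) d)^2)) = (SUM k<2 ^ (l - j). SUM d:D'. (b j k d)^2)"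
    proof -
     have "(2::nat) ^ (l - j) = 2 * 2 ^ (l - Suc j)" using j by (simp add: Suc_diff_Suc flip: power_Suc)
     then show ?thesis by (simp only: sum_lessThan_double)
    qed
    also have "3 * ((SUM k<2 ^ (l - j). SUM d:D'. (b j k d)^2) + (SUM k<2 ^ (l - Suc j). SUM d:D'. (b (Suc j) k d)^2)) <= 3 * (v^2 + v^2)"
     using bv[of j] bv[of "Suc j"] j by (intro mult_left_mono add_mono) auto
    also have "... <= (3 * v)^2" by (simp add: power_mult_distrib)
    finally show "(SUM k<2 ^ (l - Suc j). SUM d:D'. (?bb j k d)^2) <= (3 * v)^2" .
    show "6 * (3 * v) * T powr eta <= omega j * z" using gap[of j] j by simp
    show "Lq_le S q (?I j k d) (?bb j k d)" if "k < 2 ^ (l - Suc j)" "d : D'" for k d by (rule incr_bound[OF j that])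
    show "depends_on {tau0 + int k * 2 ^ Suc j - 5 * 2 ^ Suc j..<tau0 + int k * 2 ^ Suc j + 2 ^ Suc j}
      (?I j k d)" if "d : D'" for k d
     by (rule depI[OF that])
    show "(LINT e|S. ?I j k d e) = 0" if "d : D'" for k d by (rule zeroI[OF that])
   qed (use oz v in auto)
   also have "(SUM k<2 ^ (l - Suc j). \<P>(e in S. c0 * (omega j * z) <= L2_set (%d. ?I j k d e) D'))
     <= (SUM k<2 ^ (l - Suc j). (3 / c0) powr q * ((R j (2 * k) + R j (Suc (2 * k))) + R (Suc j) k))"
   proof (rule sum_mono)
    fix k :: nat assume "k : {..<2 ^ (l - Suc j)}"
    then have k: "k < 2 ^ (l - Suc j)" by simp
    have y: "0 < c0 * (omega j * z)" using oz c0 by simp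
    have "Lq_le S q (%e. L2_set (%d. ?I j k d e) D') (L2_set (?bb j k) D')" using j k q by (intro Lq_le_L2_set D' incr_bound) auto
    from S.Lq_le_Markov[OF this _ y]
    have "\<P>(e in S. c0 * (omega j * z) <= L2_set (%d. ?I j k d e) D')
      <= (L2_set (?bb j k) D' / (c0 * (omega j * z))) powr q"
     using q by (simp add: L2_set_nonneg)
    also have "... <= ((1 / c0) * (?n j (2 * k) / (omega j * z) + ?n j (Suc (2 * k)) / (omega j * z) + ?n (Suc j) k / (omega (Suc j) * z))) powr q"
    proof (rule powr_mono2)
     have "L2_set (?bb j k) D' <= ?n j (2 * k) + ?n j (Suc (2 * k)) + ?n (Suc j) k"
      using L2_set_triangle_ineq[of "%d. b j (2 * k) d + b j (Suc (2 * k)) d" "b (Suc j) k" D']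
       L2_set_triangle_ineq[of "b j (2 * k)" "b j (Suc (2 * k))" D'] by linarith
     then have "L2_set (?bb j k) D' / (c0 * (omega j * z)) <= (?n j (2 * k) + ?n j (Suc (2 * k)) + ?n (Suc j) k) / (c0 * (omega j * z))"
      using y by (intro divide_right_mono) auto
     also have "... = (1 / c0) * (?n j (2 * k) / (omega j * z) + ?n j (Suc (2 * k)) / (omega j * z) + ?n (Suc j) k / (omega j * z))"
      by (simp add: add_divide_distrib mult_ac)
     also have "... <= (1 / c0) * (?n j (2 * k) / (omega j * z) + ?n j (Suc (2 * k)) / (omega j * z) + ?n (Suc j) k / (omega (Suc j) * z))"
      using omega(1)[of "Suc j"] omega(1)[of j] omega(2)[of j] j z c0
      by (intro mult_left_mono add_left_mono divide_left_mono mult_right_mono) (auto simp: L2_set_nonneg)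
     finally show "L2_set (?bb j k) D' / (c0 * (omega j * z)) <= (1 / c0) * (?n j (2 * k) / (omega j * z) + ?n j (Suc (2 * k)) / (omega j * z) + ?n (Suc j) k / (omega (Suc j) * z))" .
     show "0 <= L2_set (?bb j k) D' / (c0 * (omega j * z))" using y by (intro divide_nonneg_pos) (auto simp: L2_set_nonneg)
    qed (use q in auto)
    also have "... = (1 / c0) powr q * (?n j (2 * k) / (omega j * z) + ?n j (Suc (2 * k)) / (omega j * z) + ?n (Suc j) k / (omega (Suc j) * z)) powr q"
     by (rule powr_mult)
    also have "... <= (1 / c0) powr q * (3 powr q * (R j (2 * k) + R j (Suc (2 * k)) + R (Suc j) k))"
     unfolding R_def using omega(1)[of "Suc j"] omega(1)[of j] j z q
     by (intro mult_left_mono sum_three_powr_le divide_nonneg_pos mult_pos_pos) (auto simp: L2_set_nonneg)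
    also have "... = (3 / c0) powr q * ((R j (2 * k) + R j (Suc (2 * k))) + R (Suc j) k)" using c0 by (simp add: powr_divide)
    finally show "\<P>(e in S. c0 * (omega j * z) <= L2_set (%d. ?I j k d e) D')
     <= (3 / c0) powr q * ((R j (2 * k) + R j (Suc (2 * k))) + R (Suc j) k)" .
   qed
   also have "... = (3 / c0) powr q * (Q (Suc j) + Q j)"
   proof -
    have "(2::nat) ^ (l - j) = 2 * 2 ^ (l - Suc j)" using j by (simp add: Suc_diff_Suc flip: power_Suc)
    then have "Q j = (SUM k<2 ^ (l - Suc j). R j (2 * k) + R j (Suc (2 * k)))"
     unfolding Q_def by (simp only: sum_lessThan_double)
    then show ?thesis unfolding sum_distrib_left[symmetric] by (simp only: sum.distrib Q_def) simp
   qed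
   finally show ?thesis by simp
  qed
  have bottom: "\<P>(e in S. z / 2 <= L2_set (%d. SUM k<2 ^ (l - j0). ?e0 k d e) D')
    <= (SUM k<2 ^ (l - j0). \<P>(e in S. c0 / 4 * z <= L2_set (%d. ?b0 k d e) D'))
     + (3 / c0) powr q * Q j0 + C0 * T powr (- (kappa + 2))" (is "?l <= _")
  proof -
   have "?l <= (SUM k<2 ^ (l - j0). \<P>(e in S. c0 * (z / 2) <= L2_set (%d. ?e0 k d e) D'))
     + C0 * T powr (- (kappa + 2))"
   proof (rule main[OF T N[of j0] D', of "%k d. ?e0 k d" f
      "%k. {tau0 + int k * 2 ^ j0 - 5 * 2 ^ j0..<tau0 + int k * 2 ^ j0 + 2 ^ j0}" v])
    show "{tau0 + int k * 2 ^ j0 - 5 * 2 ^ j0..<tau0 + int k * 2 ^ j0 + 2 ^ j0} \<inter>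
      {tau0 + int k' * 2 ^ j0 - 5 * 2 ^ j0..<tau0 + int k' * 2 ^ j0 + 2 ^ j0} = {}" if "k + 6 <= k'" for k k'
    proof -
     have "(int k + 6) * 2 ^ j0 <= int k' * 2 ^ j0" using that by (intro mult_right_mono) auto
     then show ?thesis by (auto simp: algebra_simps)
    qed
    have "18 * v * T powr eta <= 1 / 4 * z" by (rule order_trans[OF gap mult_right_mono[OF om4]]) (use jl z in auto)
    moreover have "0 <= v * T powr eta" using v by simp
    ultimately show "6 * v * T powr eta <= z / 2" using z by linarith
    show "Lq_le S q (?e0 k d) (f k d)" if "k < 2 ^ (l - j0)" "d : D'" for k d
     unfolding blkE_def using that q by (intro Lq_le_cexp f) auto
   qed (use z v fv in \<open>auto intro: depE zeroE\<close>)
   also have "(SUM k<2 ^ (l - j0). \<P>(e in S. c0 * (z / 2) <= L2_set (%d. ?e0 k d e) D'))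
     <= (SUM k<2 ^ (l - j0). \<P>(e in S. c0 / 4 * z <= L2_set (%d. ?b0 k d e) D') + (3 / c0) powr q * R j0 k)"
   proof (rule sum_mono)
    fix k :: nat assume "k : {..<2 ^ (l - j0)}"
    then have k: "k < 2 ^ (l - j0)" by simp
    let ?A = "{e:space S. c0 / 4 * z <= L2_set (%d. ?b0 k d e) D'}"
    let ?B = "{e:space S. c0 / 4 * z <= L2_set (%d. ?err j0 k d e) D'}"
    have mA: "?A : sets S" and mB: "?B : sets S" using measurable_L2_set[of D' "%d. ?b0 k d" S, OF mW]
      measurable_L2_set[of D' "%d e. ?err j0 k d e" S, OF borel_measurable_diff[OF mW mE]] by auto
    have "{e:space S. c0 * (z / 2) <= L2_set (%d. ?e0 k d e) D'} \<subseteq> ?A Un ?B"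
    proof
     fix e assume e: "e : {e:space S. c0 * (z / 2) <= L2_set (%d. ?e0 k d e) D'}"
     have neg: "L2_set (%d. - u d) D' = L2_set u D'" for u by (simp add: L2_set_def)
     have "L2_set (%d. ?e0 k d e) D' <= L2_set (%d. ?b0 k d e) D' + L2_set (%d. ?err j0 k d e) D'"
      using L2_set_triangle_ineq[of "%d. ?b0 k d e" "%d. - ?err j0 k d e" D']
      unfolding neg by simp
     then show "e : ?A Un ?B" using e by auto
    qed
    then have "\<P>(e in S. c0 * (z / 2) <= L2_set (%d. ?e0 k d e) D') <= S.prob (?A Un ?B)" using mA mB by (intro S.finite_measure_mono) auto
    also have "... <= S.prob ?A + S.prob ?B" using mA mB by (intro measure_Un_le)
    also have "S.prob ?B <= (?n j0 k / (c0 / 4 * z)) powr q" using jl k c0 z by (intro errn) auto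
    also have "... <= (3 / c0 * (?n j0 k / (omega j0 * z))) powr q"
    proof (rule powr_mono2)
     have oz: "0 < omega j0 * z" using omega(1)[of j0] jl z by auto
     have "?n j0 k / (c0 / 4 * z) = 1 / c0 * (?n j0 k / (1 / 4 * z))" by simp
     also have "... <= 3 / c0 * (?n j0 k / (omega j0 * z))"
      using om4[of j0] jl z oz c0 by (intro mult_mono divide_left_mono mult_right_mono divide_right_mono) (auto simp: L2_set_nonneg)
     finally show "?n j0 k / (c0 / 4 * z) <= 3 / c0 * (?n j0 k / (omega j0 * z))" .
    qed (use q c0 z in \<open>auto simp: L2_set_nonneg\<close>)
    also have "... = (3 / c0) powr q * R j0 k" by (simp only: R_def powr_mult)
    finally show "\<P>(e in S. c0 * (z / 2) <= L2_set (%d. ?e0 k d e) D') <= S.prob ?A + (3 / c0) powr q * R j0 k" by simp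
   qed
   finally show ?thesis by (simp add: sum.distrib sum_distrib_left Q_def)
  qed
  have top: "\<P>(e in S. z / 4 <= L2_set (%d. ?err l 0 d e) D') <= (3 / c0) powr q * Q l"
  proof -
   have oz: "0 < omega l * z" using omega(1)[of l] jl z by auto
   have "\<P>(e in S. z / 4 <= L2_set (%d. ?err l 0 d e) D') <= (?n l 0 / (z / 4)) powr q" using jl z by (intro errn) auto
   also have "... <= R l 0"
    unfolding R_def using q om4[of l] jl z oz mult_right_mono[OF om4[of l], of z]
    by (intro powr_mono2 divide_left_mono) (auto simp: L2_set_nonneg)
   also have "... = 1 * Q l" by (simp add: Q_def)
   also have "... <= (3 / c0) powr q * Q l" by (intro mult_right_mono Cp Q0)
   finally show ?thesis .
  qed
  let ?E1 = "{e:space S. z / 4 <= L2_set (%d. ?err l 0 d e) D'}"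
  let ?E2 = "%j. {e:space S. omega j * z <= L2_set (%d. SUM k<2 ^ (l - Suc j). ?I j k d e) D'}"
  let ?E3 = "{e:space S. z / 2 <= L2_set (%d. SUM k<2 ^ (l - j0). ?e0 k d e) D'}"
  have m1: "?E1 : sets S" using measurable_L2_set[of D' "%d e. ?err l 0 d e" S, OF borel_measurable_diff[OF mW mE]] by auto
  have m2: "?E2 j : sets S" for j using measurable_L2_set[of D' "%d e. SUM k<2 ^ (l - Suc j). ?I j k d e" S, OF borel_measurable_sum[OF mI]] by auto
  have m3: "?E3 : sets S" using measurable_L2_set[of D' "%d e. SUM k<2 ^ (l - j0). ?e0 k d e" S, OF borel_measurable_sum[OF mE]] by auto
  have "{e:space S. z <= L2_set (%d. blk W tau0 l d e) D'} \<subseteq> ?E1 Un (UN j:{j0..<l}. ?E2 j) Un ?E3"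
  proof
   fix e assume "e : {e:space S. z <= L2_set (%d. blk W tau0 l d e) D'}"
   then have e: "e : space S" "z <= L2_set (%d. blk W tau0 l d e) D'" by auto
   show "e : ?E1 Un (UN j:{j0..<l}. ?E2 j) Un ?E3"
   proof (rule ccontr)
    assume "e ~: ?E1 Un (UN j:{j0..<l}. ?E2 j) Un ?E3"
    then have s1: "L2_set (%d. ?err l 0 d e) D' < z / 4"
     and s2: "!!j. j : {j0..<l} ==> L2_set (%d. SUM k<2 ^ (l - Suc j). ?I j k d e) D' <= omega j * z"
     and s3: "L2_set (%d. SUM k<2 ^ (l - j0). ?e0 k d e) D' < z / 2"
     using e(1) by (auto simp: not_le intro: less_imp_le)
    let ?lv = "%j d. SUM k<2 ^ (l - Suc j). ?I j k d e"
    let ?bt = "%d. SUM k<2 ^ (l - j0). ?e0 k d e"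
    have "blk W tau0 l d e = ?err l 0 d e + ((SUM j:{j0..<l}. ?lv j d) + ?bt d)" for d using blk_levels[OF jl, of W tau0 d e] by simp
    then have "L2_set (%d. blk W tau0 l d e) D' = L2_set (%d. ?err l 0 d e + ((SUM j:{j0..<l}. ?lv j d) + ?bt d)) D'" by presburger
    also have "... <= L2_set (%d. ?err l 0 d e) D' + L2_set (%d. (SUM j:{j0..<l}. ?lv j d) + ?bt d) D'" by (rule L2_set_triangle_ineq)
    also have "L2_set (%d. (SUM j:{j0..<l}. ?lv j d) + ?bt d) D' <= L2_set (%d. SUM j:{j0..<l}. ?lv j d) D' + L2_set ?bt D'"
     by (rule L2_set_triangle_ineq)
    also have "L2_set (%d. SUM j:{j0..<l}. ?lv j d) D' <= (SUM j:{j0..<l}. L2_set (?lv j) D')" by (rule L2_set_sum_le) simp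
    also have "... <= (SUM j:{j0..<l}. omega j * z)" using s2 by (rule sum_mono)
    also have "... <= (SUM j:{j0..l}. omega j) * z"
     unfolding sum_distrib_right using omega(1) z by (intro sum_mono2) (auto intro: less_imp_le)
    also have "... <= 1 / 4 * z" using omega(3) z by (intro mult_right_mono) auto
    finally show False using e(2) s1 s3 z by linarith
   qed
  qed
  then have "\<P>(e in S. z <= L2_set (%d. blk W tau0 l d e) D') <= S.prob (?E1 Un (UN j:{j0..<l}. ?E2 j) Un ?E3)"
   using m1 m2 m3 by (intro S.finite_measure_mono) auto
  also have "... <= S.prob (?E1 Un (UN j:{j0..<l}. ?E2 j)) + S.prob ?E3" using m1 m2 m3 by (intro measure_Un_le) auto
  also have "S.prob (?E1 Un (UN j:{j0..<l}. ?E2 j)) <= S.prob ?E1 + S.prob (UN j:{j0..<l}. ?E2 j)" using m1 m2 by (intro measure_Un_le) auto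
  also have "S.prob (UN j:{j0..<l}. ?E2 j) <= (SUM j:{j0..<l}. S.prob (?E2 j))" using m2 by (intro S.finite_measure_subadditive_finite) auto
  also have "... <= (SUM j:{j0..<l}. (3 / c0) powr q * (Q (Suc j) + Q j) + C0 * T powr (- (kappa + 2)))" using level by (rule sum_mono)
  also have "... = (3 / c0) powr q * ((SUM j:{j0..<l}. Q (Suc j)) + (SUM j:{j0..<l}. Q j)) + real (l - j0) * (C0 * T powr (- (kappa + 2)))"
   by (simp add: sum.distrib sum_distrib_left[symmetric] distrib_left)
  finally have tot: "\<P>(e in S. z <= L2_set (%d. blk W tau0 l d e) D')
    <= (3 / c0) powr q * (Q l + (SUM j:{j0..<l}. Q (Suc j)) + (SUM j:{j0..<l}. Q j) + Q j0)
     + (SUM k<2 ^ (l - j0). \<P>(e in S. c0 / 4 * z <= L2_set (%d. ?b0 k d e) D'))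
     + (real (l - j0) + 1) * (C0 * T powr (- (kappa + 2)))"
   using top bottom by (simp add: algebra_simps)
  define Z where "Z = (SUM j:{j0..l}. Q j)"
  have Z0: "0 <= Z" by (simp add: Z_def Q0 sum_nonneg)
  have "Q l <= Z" "Q j0 <= Z" unfolding Z_def using jl Q0 by (auto intro!: member_le_sum)
  moreover have "(SUM j:{j0..<l}. Q j) <= Z" unfolding Z_def using Q0 by (intro sum_mono2) auto
  moreover have "(SUM j:{j0..<l}. Q (Suc j)) <= Z"
  proof -
   have "(SUM j:{j0..<l}. Q (Suc j)) = (SUM j:{Suc j0..<Suc l}. Q j)" by (rule sum.shift_bounds_Suc_ivl[symmetric])
   also have "... <= Z" unfolding Z_def using Q0 by (intro sum_mono2) auto
   finally show ?thesis .
  qed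
  ultimately have "(3 / c0) powr q * (Q l + (SUM j:{j0..<l}. Q (Suc j)) + (SUM j:{j0..<l}. Q j) + Q j0) <= (3 / c0) powr q * (4 * Z)"
   by (intro mult_left_mono) auto
  also have "... <= C * Z" using c0 Z0 by (simp add: C_def distrib_right)
  finally have a: "(3 / c0) powr q * (Q l + (SUM j:{j0..<l}. Q (Suc j)) + (SUM j:{j0..<l}. Q j) + Q j0) <= C * Z" .
  have "(real (l - j0) + 1) * (C0 * T powr (- (kappa + 2))) <= T^2 * (C0 * T powr (- (kappa + 2)))"
  proof (rule mult_right_mono)
   have "real l < real (2 ^ l)" by (simp only: of_nat_less_iff) (rule less_exp)
   then have "real l + 1 <= 2 ^ l" by (metis Suc_leI less_exp of_nat_Suc of_nat_le_iff of_nat_numeral of_nat_power add.commute)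
   then show "real (l - j0) + 1 <= T^2" using l by linarith
  qed (use c0 in auto)
  also have "... = C0 * T powr (- kappa)"
  proof -
   have "T^2 * T powr (- (kappa + 2)) = T powr 2 * T powr (- (kappa + 2))" using T by simp
   also have "... = T powr (- kappa)" by (simp only: powr_add[symmetric]) simp
   finally show ?thesis by (simp add: mult.left_commute)
  qed
  also have "... <= C * T powr (- kappa)" by (intro mult_right_mono) (auto simp: C_def)
  finally have t: "(real (l - j0) + 1) * (C0 * T powr (- (kappa + 2))) <= C * T powr (- kappa)" .
  show "\<P>(e in S. z <= L2_set (%d. blk W tau0 l d e) D')
    <= C * (SUM j:{j0..l}. SUM k<2 ^ (l - j). (L2_set (b j k) D' / (omega j * z)) powr q)
     + (SUM k<2 ^ (l - j0). \<P>(e in S. c0 / 4 * z <= L2_set (%d. ?b0 k d e) D'))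
     + C * T powr (- kappa)"
   using tot a t by (simp add: Z_def Q_def R_def)
 qed (use c0 C in auto)
qed

end

section \<open>Linear forms and decoupled bilinear forms\<close>

lemma sum_int_block:
 fixes f :: "int => 'b::comm_monoid_add"
 shows "(SUM t:{a..<a + int m}. f t) = (SUM n<m. f (a + int n))" by (rule sum.reindex_bij_witness[of _ "%n. a + int n" "%t. nat (t - a)"]) auto

lemma sum_dyadic_blocks:
 fixes f :: "int => 'b::comm_monoid_add"
 assumes "j <= l"
 shows "(SUM k<2 ^ (l - j). SUM t:{a + int k * 2 ^ j..<a + int k * 2 ^ j + 2 ^ j}. f t) = (SUM t:{a..<a + 2 ^ l}. f t)"
proof -
 have "(SUM k<2 ^ (l - j). SUM t:{a + int k * 2 ^ j..<a + int k * 2 ^ j + 2 ^ j}. f t)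
   = (SUM k<2 ^ (l - j). SUM n:{k * 2 ^ j..<k * 2 ^ j + 2 ^ j}. f (a + int n))"
 proof (rule sum.cong[OF refl])
  fix k :: nat
  have "(SUM t:{a + int k * 2 ^ j..<a + int k * 2 ^ j + 2 ^ j}. f t) = (SUM n<2 ^ j. f (a + int k * 2 ^ j + int n))"
   using sum_int_block[of f "a + int k * 2 ^ j" "2 ^ j"] by simp
  also have "... = (SUM n<2 ^ j. f (a + int (n + k * 2 ^ j)))" by (simp add: add_ac)
  also have "... = (SUM n:{k * 2 ^ j..<k * 2 ^ j + 2 ^ j}. f (a + int n))"
   using sum.shift_bounds_nat_ivl[of "%n. f (a + int n)" 0 "k * 2 ^ j" "2 ^ j"] by (simp add: atLeast0LessThan add.commute)
  finally show "(SUM t:{a + int k * 2 ^ j..<a + int k * 2 ^ j + 2 ^ j}. f t) = (SUM n:{k * 2 ^ j..<k * 2 ^ j + 2 ^ j}. f (a + int n))" .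
 qed
 also have "... = (SUM n<2 ^ (l - j) * 2 ^ j. f (a + int n))" by (rule sum.nat_group)
 also have "(2::nat) ^ (l - j) * 2 ^ j = 2 ^ l" using assms by (simp add: power_add[symmetric])
 also have "(SUM n<2 ^ l. f (a + int n)) = (SUM t:{a..<a + 2 ^ l}. f t)" using sum_int_block[of f a "2 ^ l"] by simp
 finally show ?thesis .
qed

definition block_norm :: "(int => int => real) => int set => int => nat => real" where
 "block_norm u D' tau j = sqrt (SUM t:{tau..<tau + 2 ^ j}. SUM d:D'. (u t d)^2)"

lemma block_norm_eq: "block_norm u D' tau j = L2_set (%d. L2_set (%t. u t d) {tau..<tau + 2 ^ j}) D'"
 unfolding block_norm_def L2_set_def by (simp add: sum_nonneg) (subst sum.swap, rule refl)

lemma block_norm_nonneg: "0 <= block_norm u D' tau j" by (simp add: block_norm_def sum_nonneg)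

lemma power2_block_norm: "(block_norm u D' tau j)^2 = (SUM t:{tau..<tau + 2 ^ j}. SUM d:D'. (u t d)^2)" by (simp add: block_norm_def sum_nonneg)

text \<open>The process on the space of innovations.  The tail of the dependence coefficients is required to
 satisfy its bound at every \<open>m\<close>, not only for large ones, which a larger \<open>A\<close> achieves.\<close>

locale dependent_process = innovations D for D :: "'e measure" +
 fixes X :: "int => (int => 'e) => real" and delta :: "nat => real" and p alpha A Kp Kq :: real
 assumes p: "4 < p" and alpha: "0 < alpha" and A: "1 <= A"
  and X: "causal_family p X delta"
  and tail_le: "!!m. 1 <= m ==> tail_sum delta m <= A * real m powr (- alpha)" and tail0: "tail_sum delta 0 <= A"
  and Kp: "mart_step S p Kp" and Kq: "mart_step S (p / 2) Kq"
begin

lemma Kp_pos: "0 < Kp" and Kq_pos: "0 < Kq" using Kp Kq by (auto simp: mart_step_def)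

lemma delta_nonneg: "0 <= delta k" and delta_summable: "summable delta" using causal_family_delta[OF X] by auto

lemma tail_pow2: "tail_sum delta (2 ^ j) <= A * (2 ^ j) powr (- alpha)" using tail_le[of "2 ^ j"] by simp

definition C2 where "C2 = sqrt Kp * A"

lemma C2_pos: "0 < C2" using Kp_pos A by (simp add: C2_def)

lemma linear_family:
 assumes Z: "causal_family p Z delta" and D': "finite D'"
 shows "multiscale_family p (%t d e. u t d * Z t e) D' tau0 0 l
  (%j k d. C2 * (2 ^ j) powr (- alpha) * L2_set (%t. u t d) {tau0 + int k * 2 ^ j..<tau0 + int k * 2 ^ j + 2 ^ j})
  (%k d. C2 * L2_set (%t. u t d) {tau0 + int k * 2 ^ 0..<tau0 + int k * 2 ^ 0 + 2 ^ 0})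
  (C2 * block_norm u D' tau0 l)"
  (is "multiscale_family p ?W D' tau0 0 l ?b ?f ?v")
proof -
 let ?L = "%tau j d. L2_set (%t. u t d) {tau..<tau + 2 ^ j}"
 have p2: "2 <= p" using p by simp
 have err: "Lq_le S p (%e. blk ?W tau j d e - blkE ?W tau j d e) (C2 * (2 ^ j) powr (- alpha) * ?L tau j d)"
  for tau j d
 proof -
  have "Lq_le S p (%e. (SUM t:{tau..<tau + 2 ^ j}. u t d * Z t e) - cexp {tau - 5 * 2 ^ j..} (%e. SUM t:{tau..<tau + 2 ^ j}. u t d * Z t e) e)
   (sqrt Kp * ?L tau j d * tail_sum delta (2 ^ j))"
   by (rule linear_error_le[OF Z _ p2 Kp]) auto
  moreover have "sqrt Kp * ?L tau j d * tail_sum delta (2 ^ j)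
    <= C2 * (2 ^ j) powr (- alpha) * ?L tau j d"
   using mult_left_mono[OF tail_pow2[of j], of "sqrt Kp * ?L tau j d"] Kp_pos by (simp add: C2_def L2_set_nonneg mult_ac)
  ultimately show ?thesis
   unfolding blk_def[abs_def] blkE_def using p2 by (auto intro: Lq_le_mono)
 qed
 have bot: "Lq_le S p (blk ?W tau j d) (C2 * ?L tau j d)" for tau j d
 proof -
  have "Lq_le S p (%e. SUM t:{tau..<tau + 2 ^ j}. u t d * Z t e) (sqrt Kp * ?L tau j d * tail_sum delta 0)" by (rule linear_le[OF Z _ p2 Kp]) auto
  moreover have "sqrt Kp * ?L tau j d * tail_sum delta 0 <= C2 * ?L tau j d" using mult_left_mono[OF tail0, of "sqrt Kp * ?L tau j d"] Kp_pos
   by (simp add: C2_def L2_set_nonneg mult_ac)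
  ultimately show ?thesis
   unfolding blk_def[abs_def] using p2 by (auto intro: Lq_le_mono)
 qed
 have sq: "(SUM k<2 ^ (l - j). SUM d:D'. (?L (tau0 + int k * 2 ^ j) j d)^2) = (block_norm u D' tau0 l)^2"
  if "j <= l" for j
 proof -
  have "(SUM k<2 ^ (l - j). SUM d:D'. (?L (tau0 + int k * 2 ^ j) j d)^2)
   = (SUM k<2 ^ (l - j). SUM t:{tau0 + int k * 2 ^ j..<tau0 + int k * 2 ^ j + 2 ^ j}. SUM d:D'. (u t d)^2)"
   by (rule sum.cong[OF refl], subst sum.swap) (simp add: L2_set_def sum_nonneg)
  also have "... = (SUM t:{tau0..<tau0 + 2 ^ l}. SUM d:D'. (u t d)^2)" by (rule sum_dyadic_blocks[OF that])
  finally show ?thesis by (simp add: power2_block_norm)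
 qed
 have pw1: "(2 ^ j :: real) powr (- alpha) <= 1" for j
 proof -
  have "(2 ^ j :: real) powr (- alpha) <= (2 ^ j) powr 0" using alpha by (intro powr_mono) auto
  then show ?thesis by simp
 qed
 have b2: "(SUM k<2 ^ (l - j). SUM d:D'. (?b j k d)^2) <= ?v^2" if "j <= l" for j
 proof -
  have "(SUM k<2 ^ (l - j). SUM d:D'. (?b j k d)^2) = (C2 * (2 ^ j) powr (- alpha))^2 * (block_norm u D' tau0 l)^2"
   unfolding sq[OF that, symmetric] sum_distrib_left by (simp add: power_mult_distrib)
  also have "... <= (C2 * 1)^2 * (block_norm u D' tau0 l)^2" using C2_pos pw1[of j] by (intro mult_right_mono power_mono mult_left_mono) auto
  finally show ?thesis by (simp add: power_mult_distrib)
 qed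
 have f2: "(SUM k<2 ^ (l - 0). SUM d:D'. (?f k d)^2) <= ?v^2"
 proof -
  have "(SUM k<2 ^ (l - 0). SUM d:D'. (?f k d)^2) = C2^2 * (block_norm u D' tau0 l)^2"
   unfolding sq[of 0, OF le0, symmetric] sum_distrib_left by (simp only: power_mult_distrib)
  then show ?thesis by (simp add: power_mult_distrib)
 qed
 have iZ: "integrable S (Z t)" for t using causal_family_integrable[OF Z] p by auto
 have "ALL t. ALL d:D'. integrable S (?W t d) & depends_on {..t} (?W t d) & (LINT e|S. ?W t d e) = 0"
  using iZ causal_family_mean[OF Z] by (auto intro!: depends_on_compose[where h="%x. c * x" for c] causal_family_depends[OF Z])
 then show ?thesis
  unfolding multiscale_family_def using D' err bot b2 f2 C2_pos by (auto simp: block_norm_nonneg simp del: power_0)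
qed

text \<open>The sum over all dyadic subblocks of the \<open>p\<close>-th powers of their error bounds: the power-law part
 of the tail of a weighted sum whose level exceeds the standard deviation by a power of \<open>T\<close>.\<close>

definition scale_sum :: "(int => int => real) => int set => int => nat => real" where
 "scale_sum u D' tau l = (\<Sum>j\<le>l. SUM k<2 ^ (l - j). ((2 ^ j) powr (- alpha) * block_norm u D' (tau + int k * 2 ^ j) j) powr p)"

lemma scale_sum_nonneg: "0 <= scale_sum u D' tau l"
 unfolding scale_sum_def by (intro sum_nonneg) auto

definition linear_tail :: "real => real => real => bool" where
 "linear_tail eta kappa C \<longleftrightarrow> 0 <= C & (ALL T Z u D' tau l z. 1 <= T --> 2 ^ l <= T^2 --> causal_family p Z delta --> finite D' --> 0 < z -->
   72 * real (l + 1) * (C2 * block_norm u D' tau l) * T powr eta <= z -->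
   \<P>(e in S. z <= L2_set (%d. SUM t:{tau..<tau + 2 ^ l}. u t d * Z t e) D')
    <= C * (real (l + 1) / z) powr p * scale_sum u D' tau l + C * T powr (- kappa))"

lemma linear_tail_exists:
 assumes eta: "0 < eta" and kappa: "0 < kappa"
 shows "EX C. linear_tail eta kappa C"
proof (rule prob_norm_multiscale[OF _ Kp eta kappa])
 show p2: "2 <= p" using p by simp
 fix c C0 :: real assume c: "0 < c" "c <= 1" "0 <= C0"
  and main: "!!T D' W b f omega l j0 tau0 v z. 1 <= T ==> 2 ^ l <= T^2 ==> multiscale_family p W D' tau0 j0 l b f v ==>
   (!!j. j : {j0..l} ==> 0 < omega j) ==> (!!j. j : {j0..<l} ==> omega (Suc j) <= omega j) ==> (SUM j:{j0..l}. omega j) <= 1 / 4 ==>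
   0 < z ==> (!!j. j : {j0..l} ==> 18 * v * T powr eta <= omega j * z) ==>
   \<P>(e in S. z <= L2_set (%d. blk W tau0 l d e) D')
    <= C0 * (SUM j:{j0..l}. SUM k<2 ^ (l - j). (L2_set (b j k) D' / (omega j * z)) powr p)
     + (SUM k<2 ^ (l - j0). \<P>(e in S. c * z <= L2_set (%d. blk W (tau0 + int k * 2 ^ j0) j0 d e) D'))
     + C0 * T powr (- kappa)"
 define C1 where "C1 = (4 * C2) powr p"
 have C1: "0 <= C1" by (simp add: C1_def)
 define C where "C = C0 * C1 + (C2 / c) powr p + C0"
 have C: "0 <= C" using c C1 by (auto simp: C_def)
 have "linear_tail eta kappa C"
  unfolding linear_tail_def
 proof (intro conjI allI impI C)
  fix T :: real and Z u D' tau l z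
  assume T: "1 <= T" and l: "2 ^ l <= T^2" and Z: "causal_family p Z delta" and D': "finite D'" and z: "0 < z"
   and gap: "72 * real (l + 1) * (C2 * block_norm u D' tau l) * T powr eta <= z"
  let ?W = "%t d e. u t d * Z t e"
  let ?f = "%k d. C2 * L2_set (%t. u t d) {tau + int k * 2 ^ 0..<tau + int k * 2 ^ 0 + 2 ^ 0}"
  let ?b = "%j k d. C2 * (2 ^ j) powr (- alpha) * L2_set (%t. u t d) {tau + int k * 2 ^ j..<tau + int k * 2 ^ j + 2 ^ j}"
  let ?omega = "%j::nat. 1 / (4 * real (l + 1))"
  let ?s = "%j k. (2 ^ j) powr (- alpha) * block_norm u D' (tau + int k * 2 ^ j) j"
  let ?R = "(real (l + 1) / z) powr p" and ?S = "scale_sum u D' tau l" and ?P = "%k::nat. \<P>(e in S. c * z <= L2_set (%d. blk ?W (tau + int k * 2 ^ 0) 0 d e) D')"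
  have s0: "0 <= ?s j k" for j k by (simp add: block_norm_nonneg)
  note fam = linear_family[OF Z D', of u tau l]
  have m1: "\<P>(e in S. z <= L2_set (%d. blk ?W tau l d e) D')
    <= C0 * (SUM j:{0..l}. SUM k<2 ^ (l - j). (L2_set (?b j k) D' / (?omega j * z)) powr p)
     + (SUM k<2 ^ (l - 0). ?P k)
     + C0 * T powr (- kappa)"
  proof (rule main[OF T l fam])
   show "(SUM j:{0..l}. ?omega j) <= 1 / 4" by (simp add: field_simps)
   show "18 * (C2 * block_norm u D' tau l) * T powr eta <= ?omega j * z" if "j : {0..l}" for j using gap by (simp add: field_simps)
  qed (use z in auto)
  have m2: "blk ?W tau l d e = (SUM t:{tau..<tau + 2 ^ l}. u t d * Z t e)" for d e by (simp add: blk_def)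
  have m3: "(SUM j:{0..l}. SUM k<2 ^ (l - j). (L2_set (?b j k) D' / (?omega j * z)) powr p) = C1 * ?R * ?S"
  proof -
   have "L2_set (?b j k) D' / (?omega j * z) = (4 * C2) * (real (l + 1) / z) * ?s j k" for j k
   proof -
    have "L2_set (?b j k) D' = C2 * (2 ^ j) powr (- alpha) * block_norm u D' (tau + int k * 2 ^ j) j"
     using C2_pos unfolding block_norm_eq by (subst L2_set_right_distrib) auto
    then show ?thesis by (simp add: field_simps)
   qed
   then have e: "(L2_set (?b j k) D' / (?omega j * z)) powr p = C1 * ?R * (?s j k) powr p" for j k
    unfolding C1_def powr_mult[symmetric] mult.assoc[symmetric] by (simp only:)
   show ?thesis unfolding e scale_sum_def atLeast0AtMost by (simp add: sum_distrib_left)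
  qed
  have m4: "(SUM k<2 ^ (l - 0). ?P k)
    <= (C2 / c) powr p * ?R * ?S"
  proof -
   have "?P k
     <= (C2 / c) powr p * ?R * (?s 0 k) powr p" if k: "k < 2 ^ (l - 0)" for k
   proof -
    have cz: "0 < c * z" using c z by simp
    have "Lq_le S p (blk ?W (tau + int k * 2 ^ 0) 0 d) (?f k d)" if "d : D'" for d using fam that k unfolding multiscale_family_def by blast
    then have "Lq_le S p (%e. L2_set (%d. blk ?W (tau + int k * 2 ^ 0) 0 d e) D') (L2_set (?f k) D')" by (rule Lq_le_L2_set[OF D' _ p2])
    from S.Lq_le_Markov[OF this _ cz] have "?P k
      <= (L2_set (?f k) D' / (c * z)) powr p" using p by (simp add: L2_set_nonneg)
    also have "L2_set (?f k) D' = C2 * ?s 0 k" using C2_pos by (simp add: block_norm_eq L2_set_right_distrib)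
    also have "(C2 * ?s 0 k / (c * z)) powr p <= (C2 / c * (real (l + 1) / z * ?s 0 k)) powr p"
    proof (rule powr_mono2)
     have "C2 * ?s 0 k / (c * z) = C2 / c * (1 / z * ?s 0 k)" by simp
     also have "... <= C2 / c * (real (l + 1) / z * ?s 0 k)"
      using C2_pos c z s0[of 0 k] by (intro mult_left_mono mult_right_mono divide_right_mono) auto
     finally show "C2 * ?s 0 k / (c * z) <= C2 / c * (real (l + 1) / z * ?s 0 k)" .
    qed (use p C2_pos c z s0[of 0 k] in auto)
    also have "... = (C2 / c) powr p * ?R * (?s 0 k) powr p" by (simp only: powr_mult mult.assoc)
    finally show ?thesis .
   qed
   then have "(SUM k<2 ^ (l - 0). ?P k)
    <= (SUM k<2 ^ (l - 0). (C2 / c) powr p * ?R * (?s 0 k) powr p)" by (intro sum_mono) auto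
   also have "... = (C2 / c) powr p * ?R * (SUM k<2 ^ (l - 0). (?s 0 k) powr p)" by (simp only: sum_distrib_left)
   also have "... <= (C2 / c) powr p * ?R * ?S"
    unfolding scale_sum_def
    by (intro mult_left_mono member_le_sum[of 0 "{..l}" "%j. SUM k<2 ^ (l - j). (?s j k) powr p"] sum_nonneg) auto
   finally show ?thesis .
  qed
  have "\<P>(e in S. z <= L2_set (%d. SUM t:{tau..<tau + 2 ^ l}. u t d * Z t e) D')
    <= C0 * (C1 * ?R * ?S) + (C2 / c) powr p * ?R * ?S + C0 * T powr (- kappa)"
   using m1 m4 unfolding m2 m3 by linarith
  also have "... = (C0 * C1 + (C2 / c) powr p) * (?R * ?S) + C0 * T powr (- kappa)" by (simp only: distrib_right mult.assoc)
  also have "... <= C * (?R * ?S) + C * T powr (- kappa)"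
  proof -
   have "C0 * C1 + (C2 / c) powr p <= C" "C0 <= C" using c C1 by (auto simp: C_def)
   then show ?thesis using scale_sum_nonneg[of u D' tau l] by (intro add_mono mult_right_mono mult_nonneg_nonneg) auto
  qed
  finally show "\<P>(e in S. z <= L2_set (%d. SUM t:{tau..<tau + 2 ^ l}. u t d * Z t e) D')
    <= C * ?R * ?S + C * T powr (- kappa)"
   by (simp only: mult.assoc)
 qed
 then show ?thesis by blast
qed

lemma cutoff_family: "causal_family p (%t. cexp {c..} (X t)) delta"
proof -
 have p1: "1 <= p" using p by simp
 have int: "integrable S (X t)" for t using causal_family_integrable[OF X p1] .
 show ?thesis
  unfolding causal_family_def
 proof (intro conjI allI impI)
  fix t
  obtain b where "Lq_le S p (X t) b" using causal_family_ex[OF X] by blast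
  from Lq_le_cexp[OF this p1] show "EX b. Lq_le S p (cexp {c..} (X t)) b" by blast
  show "depends_on {..t} (cexp {c..} (X t))" by (rule cexp_depends_inherit[OF causal_family_depends[OF X]])
  show "(LINT e|S. cexp {c..} (X t) e) = 0" using integral_cexp[OF int] causal_family_mean[OF X] by simp
  fix i assume "i <= t"
  then show "resample_le p (cexp {c..} (X t)) i (delta (nat (t - i)))" using X by (intro resample_le_cexp int p1) (auto simp: causal_family_def)
 qed (use delta_nonneg delta_summable in auto)
qed

text \<open>The two factors depend on disjoint sets of innovations when the gap between the time indices is at
 least \<open>2 ^ i\<close>, as \<open>t\<close> sees only the innovations from \<open>tau - 2 ^ i\<close> on and \<open>b s t\<close> vanishes for \<open>s\<close>
 beyond.\<close>

definition chaos :: "(int => int => real) => int => nat => (int => 'e) => real" where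
 "chaos b tau i e = (SUM t:{tau..<tau + 2 ^ i}. (SUM s:{tau - 4 * 2 ^ i..<tau}. b s t * X s e) * cexp {tau - 2 ^ i..} (X t) e)"

definition chaos_scale :: "nat => real" where
 "chaos_scale i = (\<Sum>j\<le>i + 2. 2 ^ (i + 2 - j) * ((2 ^ j) powr (- alpha) * sqrt (2 ^ (i + j))) powr p)"

lemma chaos_scale_nonneg: "0 <= chaos_scale i"
 unfolding chaos_scale_def by (intro sum_nonneg) auto

lemma block_norm_bounded_le:
 assumes "!!s t. \<bar>b s t\<bar> <= 1" "finite J" "card J = n"
 shows "block_norm b J tau j <= sqrt (2 ^ j * real n)"
proof -
 have "(b s t)^2 <= 1" for s t using assms(1)[of s t] by (simp add: abs_square_le_1)
 then have "(SUM t:{tau..<tau + 2 ^ j}. SUM d:J. (b t d)^2) <= (SUM t:{tau..<tau + 2 ^ j}. SUM d:J. 1)" by (intro sum_mono) auto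
 also have "... = 2 ^ j * real n" using assms(3) by simp
 finally show ?thesis unfolding block_norm_def by (rule real_sqrt_le_mono)
qed

lemma chaos_coeff_le:
 assumes b: "!!s t. \<bar>b s t\<bar> <= 1"
 shows "Lq_le S p (%e. SUM s:{tau - 4 * 2 ^ i..<tau}. b s t * X s e) (C2 * sqrt (4 * 2 ^ i))"
proof -
 let ?I = "{tau - 4 * 2 ^ i..<tau}"
 have "Lq_le S p (%e. SUM s:?I. b s t * X s e) (sqrt Kp * L2_set (%s. b s t) ?I * tail_sum delta 0)" using p by (intro linear_le[OF X _ _ Kp]) auto
 moreover have "sqrt Kp * L2_set (%s. b s t) ?I * tail_sum delta 0 <= sqrt Kp * sqrt (4 * 2 ^ i) * A"
 proof (intro mult_mono mult_left_mono tail0)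
  have "(b s t)^2 <= 1" for s using b[of s t] by (simp add: abs_square_le_1)
  then have "(SUM s:?I. (b s t)^2) <= (SUM s:?I. 1)" by (intro sum_mono) auto
  then show "L2_set (%s. b s t) ?I <= sqrt (4 * 2 ^ i)" unfolding L2_set_def by simp
 qed (use Kp_pos tail_sum_nonneg[OF delta_nonneg delta_summable] in auto)
 moreover have "sqrt Kp * sqrt (4 * 2 ^ i) * A = C2 * sqrt (4 * 2 ^ i)" by (simp add: C2_def)
 ultimately show ?thesis using p by (auto intro: Lq_le_mono)
qed

lemma chaos_conditional:
 assumes b: "!!s t. tau - 2 ^ i <= s ==> t < tau + 2 ^ i ==> b s t = 0" and z: "0 < z"
 shows "emeasure S {e:space S. z <= \<bar>chaos b tau i e\<bar>} = (\<integral>\<^sup>+ e. emeasure S {e':space S. z <=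
   \<bar>SUM t:{tau..<tau + 2 ^ i}. (SUM s:{tau - 4 * 2 ^ i..<tau}. b s t * X s e) * cexp {tau - 2 ^ i..} (X t) e'\<bar>} \<partial>S)"
proof -
 let ?c = "tau - 2 ^ i"
 have Xm [measurable]: "X t : borel_measurable S" for t by (rule causal_family_measurable[OF X])
 have [measurable]: "chaos b tau i : borel_measurable S" unfolding chaos_def[abs_def] by measurable
 have mx: "chaos b tau i (mix {..<?c} e e') = (SUM t:{tau..<tau + 2 ^ i}. (SUM s:{tau - 4 * 2 ^ i..<tau}. b s t * X s e) * cexp {?c..} (X t) e')"
  if e: "e : space S" "e' : space S" for e e'
  unfolding chaos_def
 proof (rule sum.cong[OF refl])
  fix t assume t: "t : {tau..<tau + 2 ^ i}"
  have "(SUM s:{tau - 4 * 2 ^ i..<tau}. b s t * X s (mix {..<?c} e e')) = (SUM s:{tau - 4 * 2 ^ i..<tau}. b s t * X s e)"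
  proof (rule sum.cong[OF refl])
   fix s
   show "b s t * X s (mix {..<?c} e e') = b s t * X s e"
   proof (cases "s < ?c")
    case True
    have "depends_on {..<?c} (X s)" using True by (intro depends_on_mono[OF causal_family_depends[OF X]]) auto
    from mix_depends[OF this e] show ?thesis by simp
   next
    case False then show ?thesis using b[of s t] t by simp
   qed
  qed
  moreover have "cexp {?c..} (X t) (mix {..<?c} e e') = cexp {?c..} (X t) e'" by (rule mix_depends_compl[OF cexp_depends _ e]) auto
  ultimately show "(SUM s:{tau - 4 * 2 ^ i..<tau}. b s t * X s (mix {..<?c} e e')) * cexp {?c..} (X t) (mix {..<?c} e e')
   = (SUM s:{tau - 4 * 2 ^ i..<tau}. b s t * X s e) * cexp {?c..} (X t) e'" by simp
 qed
 have "emeasure S {e:space S. z <= \<bar>chaos b tau i e\<bar>} = (\<integral>\<^sup>+ e. indicator {e:space S. z <= \<bar>chaos b tau i e\<bar>} e \<partial>S)"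
  by simp
 also have "... = (\<integral>\<^sup>+ e. \<integral>\<^sup>+ e'. indicator {e:space S. z <= \<bar>chaos b tau i e\<bar>} (mix {..<?c} e e') \<partial>S \<partial>S)"
  by (rule nn_integral_mix[symmetric]) measurable
 also have "... = (\<integral>\<^sup>+ e. \<integral>\<^sup>+ e'. indicator {e':space S. z <=
   \<bar>SUM t:{tau..<tau + 2 ^ i}. (SUM s:{tau - 4 * 2 ^ i..<tau}. b s t * X s e) * cexp {tau - 2 ^ i..} (X t) e'\<bar>} e' \<partial>S \<partial>S)"
  by (intro nn_integral_cong) (simp add: indicator_def mx)
 also have "... = (\<integral>\<^sup>+ e. emeasure S {e':space S. z <=
   \<bar>SUM t:{tau..<tau + 2 ^ i}. (SUM s:{tau - 4 * 2 ^ i..<tau}. b s t * X s e) * cexp {tau - 2 ^ i..} (X t) e'\<bar>} \<partial>S)"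
  by (intro nn_integral_cong nn_integral_indicator) measurable
 finally show ?thesis .
qed

lemma scale_sum_coeff_le:
 assumes b: "!!s t. \<bar>b s t\<bar> <= 1"
 shows "(\<integral>\<^sup>+ e. ennreal (scale_sum (%t d. SUM s:{tau - 4 * 2 ^ i..<tau}. b s t * X s e) {0} tau i) \<partial>S)
   <= ennreal ((2 * C2) powr p * chaos_scale i)"
proof -
 have Xm [measurable]: "X t : borel_measurable S" for t by (rule causal_family_measurable[OF X])
 let ?c = "%e t (d::int). SUM s:{tau - 4 * 2 ^ i..<tau}. b s t * X s e"
 let ?M = "%j. (2 ^ j) powr (- alpha) * sqrt (2 ^ (i + j))"
 have p2: "2 <= p" using p by simp
 have one: "(\<integral>\<^sup>+ e. ennreal (((2 ^ j) powr (- alpha) * block_norm (?c e) {0} tau' j) powr p) \<partial>S) <= ennreal ((2 * C2 * ?M j) powr p)" for tau' j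
 proof -
  have "Lq_le S p (%e. L2_set (%t. ?c e t 0) {tau'..<tau' + 2 ^ j}) (L2_set (%t. C2 * sqrt (4 * 2 ^ i)) {tau'..<tau' + 2 ^ j})"
   by (intro Lq_le_L2_set p2 chaos_coeff_le b) auto
  from Lq_le_cmult[OF this, of "(2 ^ j) powr (- alpha)"]
  have b1: "Lq_le S p (%e. (2 ^ j) powr (- alpha) * L2_set (%t. ?c e t 0) {tau'..<tau' + 2 ^ j}) ((2 ^ j) powr (- alpha) * L2_set (%t. C2 * sqrt (4 * 2 ^ i)) {tau'..<tau' + 2 ^ j})"
   using p by simp
  have b2: "L2_set (%t. C2 * sqrt (4 * 2 ^ i)) {tau'..<tau' + 2 ^ j} = 2 * C2 * sqrt (2 ^ (i + j))"
   using C2_pos by (simp add: L2_set_def real_sqrt_mult power_add mult_ac)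
  have b3: "L2_set (%t. ?c e t 0) {tau'..<tau' + 2 ^ j} = block_norm (?c e) {0} tau' j" for e by (simp add: block_norm_def L2_set_def)
  have "(\<integral>\<^sup>+ e. ennreal (\<bar>(2 ^ j) powr (- alpha) * block_norm (?c e) {0} tau' j\<bar> powr p) \<partial>S)
    <= ennreal (((2 ^ j) powr (- alpha) * (2 * C2 * sqrt (2 ^ (i + j)))) powr p)"
   using b1 unfolding b2 b3 Lq_le_def by blast
  moreover have "\<bar>(2 ^ j) powr (- alpha) * block_norm (?c e) {0} tau' j\<bar> = (2 ^ j) powr (- alpha) * block_norm (?c e) {0} tau' j" for e
   by (rule abs_of_nonneg) (simp add: block_norm_nonneg)
  moreover have "(2 ^ j) powr (- alpha) * (2 * C2 * sqrt (2 ^ (i + j))) = 2 * C2 * ?M j" by (simp only: mult_ac)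
  ultimately show ?thesis by (simp only:)
 qed
 have meas: "(%e. ((2 ^ j) powr (- alpha) * block_norm (?c e) {0} tau' j) powr p) : borel_measurable S" for tau' j
  unfolding block_norm_def by measurable
 have "(\<integral>\<^sup>+ e. ennreal (scale_sum (?c e) {0} tau i) \<partial>S)
   = (\<integral>\<^sup>+ e. (\<Sum>j\<le>i. SUM k<2 ^ (i - j). ennreal (((2 ^ j) powr (- alpha) * block_norm (?c e) {0} (tau + int k * 2 ^ j) j) powr p)) \<partial>S)"
  unfolding scale_sum_def by (intro nn_integral_cong) (simp add: sum_nonneg)
 also have "... = (\<Sum>j\<le>i. SUM k<2 ^ (i - j). (\<integral>\<^sup>+ e. ennreal (((2 ^ j) powr (- alpha) * block_norm (?c e) {0} (tau + int k * 2 ^ j) j) powr p) \<partial>S))"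
 proof -
  have meas': "(%e. ennreal (((2 ^ j) powr (- alpha) * block_norm (?c e) {0} tau' j) powr p)) : borel_measurable S" for tau' j
   by (rule measurable_compose[OF meas measurable_ennreal])
  show ?thesis by (subst nn_integral_sum, rule borel_measurable_sum, rule meas') (rule sum.cong[OF refl], rule nn_integral_sum, rule meas')
 qed
 also have "... <= (\<Sum>j\<le>i. SUM k<(2::nat) ^ (i - j). ennreal ((2 * C2 * ?M j) powr p))" by (intro sum_mono one)
 also have "... = ennreal (\<Sum>j\<le>i. 2 ^ (i - j) * (2 * C2 * ?M j) powr p)"
  by (simp add: ennreal_mult ennreal_of_nat_eq_real_of_nat ennreal_power[symmetric] flip: sum_ennreal)
 also have "... <= ennreal ((2 * C2) powr p * chaos_scale i)"
 proof (rule ennreal_leI)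
  have "(\<Sum>j\<le>i. 2 ^ (i - j) * (2 * C2 * ?M j) powr p) = (2 * C2) powr p * (\<Sum>j\<le>i. 2 ^ (i - j) * ?M j powr p)"
   unfolding sum_distrib_left powr_mult[of "2 * C2"] by (intro sum.cong refl) simp
  also have "(\<Sum>j\<le>i. 2 ^ (i - j) * ?M j powr p) <= (\<Sum>j\<le>i. 2 ^ (i + 2 - j) * ?M j powr p)"
   by (intro sum_mono mult_right_mono power_increasing) auto
  also have "... <= chaos_scale i" unfolding chaos_scale_def by (intro sum_mono2) auto
  finally show "(\<Sum>j\<le>i. 2 ^ (i - j) * (2 * C2 * ?M j) powr p) <= (2 * C2) powr p * chaos_scale i" by (simp add: mult_left_mono)
 qed
 finally show ?thesis .
qed

lemma scale_sum_bounded_le: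
 assumes b: "!!s t. \<bar>b s t\<bar> <= 1"
 shows "scale_sum b {tau..<tau + 2 ^ i} tau' (i + 2) <= chaos_scale i"
 unfolding scale_sum_def chaos_scale_def
proof (rule sum_mono)
 fix j
 have le: "block_norm b {tau..<tau + 2 ^ i} tau'' j <= sqrt (2 ^ (i + j))" for tau''
  using block_norm_bounded_le[of b "{tau..<tau + 2 ^ i}" "2 ^ i" tau'' j, OF b] by (simp add: power_add mult.commute)
 have "(SUM k<2 ^ (i + 2 - j). ((2 ^ j) powr (- alpha) * block_norm b {tau..<tau + 2 ^ i} (tau' + int k * 2 ^ j) j) powr p)
   <= (SUM k<(2::nat) ^ (i + 2 - j). ((2 ^ j) powr (- alpha) * sqrt (2 ^ (i + j))) powr p)"
  using le p by (intro sum_mono powr_mono2 mult_left_mono mult_nonneg_nonneg) (auto simp: block_norm_nonneg)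
 then show "(SUM k<2 ^ (i + 2 - j). ((2 ^ j) powr (- alpha) * block_norm b {tau..<tau + 2 ^ i} (tau' + int k * 2 ^ j) j) powr p)
   <= 2 ^ (i + 2 - j) * ((2 ^ j) powr (- alpha) * sqrt (2 ^ (i + j))) powr p" by simp
qed

text \<open>A bilinear form in two independent stretches is large only if, conditionally on the first,
 the second makes it large at one scale, or if the vector of random coefficients produced by the
 first is itself large.\<close>

definition chaos_tail :: "real => real => real => bool" where
 "chaos_tail eta kappa C \<longleftrightarrow> 0 <= C & (ALL T b tau i z. 1 <= T --> 2 ^ (i + 2) <= T^2 --> (ALL s t. \<bar>b s t\<bar> <= 1) -->
   (ALL s t. tau - 2 ^ i <= s --> t < tau + 2 ^ i --> b s t = 0) --> 0 < z -->
   C * (real (i + 3))^2 * 2 ^ i * T powr (2 * eta) <= z -->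
   \<P>(e in S. z <= \<bar>chaos b tau i e\<bar>) <= C * ((real (i + 3))^2 * T powr eta / z) powr p * chaos_scale i + C * T powr (- kappa))"

lemma chaos_tail_exists:
 assumes eta: "0 < eta" and kappa: "0 < kappa"
 shows "EX C. chaos_tail eta kappa C"
proof -
 obtain C0 where L: "linear_tail eta kappa C0" using linear_tail_exists[OF eta kappa] by blast
 have C0: "0 <= C0" using L by (simp add: linear_tail_def)
 note lin = L[unfolded linear_tail_def, THEN conjunct2, rule_format]
 define C1 where "C1 = (72 * C2) powr p + (2 * C2) powr p"
 have C1: "0 <= C1" by (simp add: C1_def)
 define C where "C = 2 * (72 * C2)^2 + C0 * C1 + 2 * C0"
 have C: "0 <= C" "2 * (72 * C2)^2 <= C" "C0 * C1 <= C" "2 * C0 <= C" using C0 C1 by (auto simp: C_def)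
 have "chaos_tail eta kappa C"
  unfolding chaos_tail_def
 proof (intro conjI allI impI C(1))
  fix T z :: real and b :: "int => int => real" and tau :: int and i :: nat
  assume T: "1 <= T" and iT: "2 ^ (i + 2) <= T^2" and b1: "ALL s t. \<bar>b s t\<bar> <= 1"
   and b0: "ALL s t. tau - 2 ^ i <= s --> t < tau + 2 ^ i --> b s t = 0" and z: "0 < z"
   and gap: "C * (real (i + 3))^2 * 2 ^ i * T powr (2 * eta) <= z"
  have Xm [measurable]: "X t : borel_measurable S" for t by (rule causal_family_measurable[OF X])
  let ?J = "{tau..<tau + 2 ^ i}" and ?I = "{tau - 4 * 2 ^ i..<tau}"
  let ?c = "%e t (d::int). SUM s:?I. b s t * X s e"
  let ?Y = "%t. cexp {tau - 2 ^ i..} (X t)"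
  let ?t = "C0 * T powr (- kappa)" and ?r = "(real (i + 3))^2 * T powr eta / z"
  define w where "w = 72 * real (i + 1) * C2 * T powr eta"
  have w: "0 < w" using C2_pos T by (simp add: w_def)
  define z' where "z' = z / w"
  have z': "0 < z'" using z w by (simp add: z'_def)
  have Tn: "0 < T powr eta" using T by simp
  have i3: "0 <= real (i + 1)" "real (i + 1) <= real (i + 3)" "1 <= real (i + 3)" by auto
  have coef: "\<P>(e in S. z' <= L2_set (%t. ?c e t 0) ?J)
    <= C0 * (72 * C2) powr p * (?r powr p * chaos_scale i) + ?t"
  proof -
   let ?tau = "tau - 4 * 2 ^ i"
   have I: "{?tau..<?tau + 2 ^ (i + 2)} = ?I" by (simp add: power_add)
   have g: "72 * real (i + 2 + 1) * (C2 * block_norm b ?J ?tau (i + 2)) * T powr eta <= z'"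
   proof -
    have "block_norm b ?J ?tau (i + 2) <= sqrt (2 ^ (i + 2) * real (2 ^ i))" using b1 by (intro block_norm_bounded_le) auto
    also have "... = 2 * 2 ^ i" by (simp add: power_add real_sqrt_mult)
    finally have h1: "72 * real (i + 2 + 1) * (C2 * block_norm b ?J ?tau (i + 2)) * T powr eta <= 72 * real (i + 2 + 1) * (C2 * (2 * 2 ^ i)) * T powr eta"
     using C2_pos Tn by (intro mult_right_mono mult_left_mono) auto
    have h2: "72 * real (i + 2 + 1) * (C2 * (2 * 2 ^ i)) * T powr eta * w <= z"
    proof -
     have "72 * real (i + 2 + 1) * (C2 * (2 * 2 ^ i)) * T powr eta * w = 2 * (72 * C2)^2 * (real (i + 3) * real (i + 1)) * 2 ^ i * (T powr eta * T powr eta)"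
      by (simp add: w_def power2_eq_square algebra_simps)
     also have "... <= C * (real (i + 3) * real (i + 3)) * 2 ^ i * (T powr eta * T powr eta)"
      using C i3 by (intro mult_right_mono mult_mono mult_left_mono) auto
     also have "T powr eta * T powr eta = T powr (2 * eta)" by (simp add: powr_add[symmetric])
     also have "C * (real (i + 3) * real (i + 3)) * 2 ^ i * T powr (2 * eta) <= z" using gap by (simp only: power2_eq_square)
     finally show ?thesis .
    qed
    show ?thesis unfolding z'_def using order_trans[OF mult_right_mono[OF h1 less_imp_le[OF w]] h2] w by (simp only: pos_le_divide_eq)
   qed
   have "\<P>(e in S. z' <= L2_set (%d. SUM t:{?tau..<?tau + 2 ^ (i + 2)}. b t d * X t e) ?J)
     <= C0 * (real (i + 2 + 1) / z') powr p * scale_sum b ?J ?tau (i + 2) + ?t"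
    by (rule lin[OF T iT X _ z' g]) simp
   then have "\<P>(e in S. z' <= L2_set (%t. ?c e t 0) ?J) <= C0 * (real (i + 2 + 1) / z') powr p * scale_sum b ?J ?tau (i + 2) + ?t"
    unfolding I .
   also have "C0 * (real (i + 2 + 1) / z') powr p * scale_sum b ?J ?tau (i + 2)
     <= C0 * (72 * C2 * ?r) powr p * chaos_scale i"
   proof (intro mult_mono mult_left_mono powr_mono2 scale_sum_bounded_le)
    have "real (i + 2 + 1) / z' = 72 * C2 * (real (i + 3) * real (i + 1) * T powr eta / z)"
     using w by (simp add: z'_def w_def) (simp add: algebra_simps)
    also have "... <= 72 * C2 * (real (i + 3) * real (i + 3) * T powr eta / z)"
     using C2_pos z by (intro mult_left_mono divide_right_mono mult_right_mono) auto
    finally show "real (i + 2 + 1) / z' <= 72 * C2 * ?r" by (simp only: power2_eq_square)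
   qed (use p C0 z' b1 scale_sum_nonneg in auto)
   also have "... = C0 * (72 * C2) powr p * (?r powr p * chaos_scale i)" by (simp only: powr_mult mult.assoc)
   finally show ?thesis by simp
  qed
  have cond: "S.prob {e':space S. z <= \<bar>SUM t:?J. ?c e t 0 * ?Y t e'\<bar>}
    <= C0 * (real (i + 1) / z) powr p * scale_sum (?c e) {0} tau i + ?t"
   if e: "\<not> z' <= L2_set (%t. ?c e t 0) ?J" for e
  proof -
   have bn: "block_norm (?c e) {0} tau i = L2_set (%t. ?c e t 0) ?J" by (simp add: block_norm_def L2_set_def)
   have g: "72 * real (i + 1) * (C2 * block_norm (?c e) {0} tau i) * T powr eta <= z"
   proof -
    have "72 * real (i + 1) * (C2 * block_norm (?c e) {0} tau i) * T powr eta = w * L2_set (%t. ?c e t 0) ?J"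
     unfolding bn w_def by (simp only: mult_ac)
    also have "... <= w * z'" using e w by (intro mult_left_mono) auto
    also have "... = z" using w by (simp add: z'_def)
    finally show ?thesis .
   qed
   have iT': "2 ^ i <= T^2" using iT by (rule order_trans[rotated]) (simp add: power_increasing)
   have "S.prob {e':space S. z <= L2_set (%d. SUM t:?J. ?c e t d * ?Y t e') {0}}
    <= C0 * (real (i + 1) / z) powr p * scale_sum (?c e) {0} tau i + ?t"
    by (rule lin[OF T iT' cutoff_family _ z g]) simp
   then show ?thesis by (simp add: L2_set_def)
  qed
  let ?E = "{e:space S. z' <= L2_set (%t. ?c e t 0) ?J}"
  have E: "?E : sets S" unfolding L2_set_def by measurable
  define Q where "Q = C0 * (real (i + 1) / z) powr p"
  have Q: "0 <= Q" using C0 by (simp add: Q_def)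
  have ms: "(%e. scale_sum (?c e) {0} tau i) : borel_measurable S"
   unfolding scale_sum_def block_norm_def by measurable
  have "emeasure S {e:space S. z <= \<bar>chaos b tau i e\<bar>} = (\<integral>\<^sup>+ e. emeasure S {e':space S. z <= \<bar>SUM t:?J. ?c e t 0 * ?Y t e'\<bar>} \<partial>S)"
   using b0 by (intro chaos_conditional z) auto
  also have "... <= (\<integral>\<^sup>+ e. indicator ?E e + (ennreal Q * ennreal (scale_sum (?c e) {0} tau i) + ennreal (?t)) \<partial>S)"
  proof (rule nn_integral_mono)
   fix e assume e: "e : space S"
   show "emeasure S {e':space S. z <= \<bar>SUM t:?J. ?c e t 0 * ?Y t e'\<bar>} <= indicator ?E e + (ennreal Q * ennreal (scale_sum (?c e) {0} tau i) + ennreal (?t))"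
   proof (cases "z' <= L2_set (%t. ?c e t 0) ?J")
    case True
    then have ind: "indicator ?E e = (1::ennreal)" using e by simp
    show ?thesis unfolding ind by (rule order_trans[OF S.emeasure_le_1]) (rule add_increasing2, auto)
   next
    case False
    have "emeasure S {e':space S. z <= \<bar>SUM t:?J. ?c e t 0 * ?Y t e'\<bar>} <= ennreal (Q * scale_sum (?c e) {0} tau i + ?t)"
     unfolding S.emeasure_eq_measure Q_def by (rule ennreal_leI[OF cond[OF False]])
    also have "... = ennreal Q * ennreal (scale_sum (?c e) {0} tau i) + ennreal (?t)" using Q C0 by (simp add: ennreal_mult scale_sum_nonneg)
    finally show ?thesis by (rule order_trans) simp
   qed
  qed
  also have "... = emeasure S ?E + (ennreal Q * (\<integral>\<^sup>+ e. ennreal (scale_sum (?c e) {0} tau i) \<partial>S) + ennreal (?t))"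
  proof -
   have ms': "(%e. ennreal (scale_sum (?c e) {0} tau i)) : borel_measurable S" by (rule measurable_compose[OF ms measurable_ennreal])
   have ms2: "(%e. ennreal Q * ennreal (scale_sum (?c e) {0} tau i)) : borel_measurable S" by (rule borel_measurable_times_ennreal[OF borel_measurable_const ms'])
   have i1: "(\<integral>\<^sup>+ e. indicator ?E e \<partial>S) = emeasure S ?E" by (rule nn_integral_indicator[OF E])
   have i2: "(\<integral>\<^sup>+ e. ennreal (?t) \<partial>S) = ennreal (?t)" by (simp only: nn_integral_const S.emeasure_space_1 mult_1_right)
   show ?thesis
    unfolding nn_integral_add[OF borel_measurable_indicator[OF E] borel_measurable_add[OF ms2 borel_measurable_const]]
     nn_integral_add[OF ms2 borel_measurable_const] nn_integral_cmult[OF ms'] i1 i2 ..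
  qed
  also have "... <= emeasure S ?E + (ennreal Q * ennreal ((2 * C2) powr p * chaos_scale i) + ennreal (?t))"
   using b1 by (intro add_left_mono add_right_mono mult_left_mono scale_sum_coeff_le) auto
  also have "... = ennreal (S.prob ?E + (Q * ((2 * C2) powr p * chaos_scale i) + ?t))"
   using Q C0 chaos_scale_nonneg[of i] by (simp add: S.emeasure_eq_measure ennreal_mult)
  finally have 1: "\<P>(e in S. z <= \<bar>chaos b tau i e\<bar>) <= S.prob ?E + (Q * ((2 * C2) powr p * chaos_scale i) + ?t)"
   unfolding S.emeasure_eq_measure using Q C0 chaos_scale_nonneg[of i] by (subst (asm) ennreal_le_iff) auto
  let ?R = "?r powr p * chaos_scale i"
  have R0: "0 <= ?R" using chaos_scale_nonneg[of i] by simp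
  have "Q * ((2 * C2) powr p * chaos_scale i) <= C0 * (2 * C2) powr p * ?R"
  proof -
   have "real (i + 1) * 1 <= (real (i + 3))^2 * T powr eta"
   proof (rule mult_mono)
    show "real (i + 1) <= (real (i + 3))^2" using i3 mult_mono[of "real (i + 1)" "real (i + 3)" 1 "real (i + 3)"] by (simp add: power2_eq_square)
    show "1 <= T powr eta" using T eta by (simp add: ge_one_powr_ge_zero)
   qed auto
   then have "real (i + 1) / z <= ?r" using z by (simp add: divide_right_mono)
   then have "(real (i + 1) / z) powr p <= ?r powr p" using p z by (intro powr_mono2) auto
   then have "Q <= C0 * ?r powr p" unfolding Q_def using C0 by (intro mult_left_mono)
   then have "Q * ((2 * C2) powr p * chaos_scale i) <= C0 * ?r powr p * ((2 * C2) powr p * chaos_scale i)"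
    using chaos_scale_nonneg[of i] by (intro mult_right_mono) auto
   then show ?thesis by (simp only: mult_ac)
  qed
  with 1 coef have "\<P>(e in S. z <= \<bar>chaos b tau i e\<bar>) <= C0 * C1 * ?R + 2 * C0 * T powr (- kappa)" by (simp add: C1_def algebra_simps)
  also have "... <= C * ?R + C * T powr (- kappa)" using C R0 by (intro add_mono mult_right_mono) auto
  finally show "\<P>(e in S. z <= \<bar>chaos b tau i e\<bar>) <= C * ?r powr p * chaos_scale i + C * T powr (- kappa)" by (simp only: mult.assoc)
 qed
 then show ?thesis by blast
qed

end

section \<open>Decoupling past and present\<close>

context innovations
begin

lemma cexp_cong: "(!!e. e : space S ==> f e = g e) ==> e : space S ==> cexp A f e = cexp A g e"
 unfolding cexp_def by (intro LINT_cong) auto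

lemma sum_proj: "(SUM i:{c - int n..<c}. proj i F e) = cexp {c - int n..} F e - cexp {c..} F e"
proof (induction n)
 case (Suc n)
 have "{c - int (Suc n)..<c} = insert (c - int (Suc n)) {c - int n..<c}" by auto
 moreover have "c - int (Suc n) + 1 = c - int n" by simp
 ultimately show ?case using Suc by (simp add: proj_def)
qed simp

lemma resample_le_diff_depends:
 assumes F: "resample_le q F i d" and G: "G : borel_measurable S" "depends_on B G" "i ~: B" and q: "0 <= q"
 shows "resample_le q (%e. F e - G e) i d"
proof -
 have [measurable]: "F : borel_measurable S" "G : borel_measurable S" using F G by (auto simp: resample_le_def)
 have "G (fst x) = G (mix (- {i}) (fst x) (snd x))" if "x : space SxS" for x
 proof (rule depends_onD[OF G(2)])
  fix j assume "j : B"
  then have "j : - {i}" using G(3) by auto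
  then show "fst x j = mix (- {i}) (fst x) (snd x) j" by simp
 qed (use that in \<open>auto simp: space_pair_measure\<close>)
 then have ae: "AE x in S \<Otimes>\<^sub>M S. (F (fst x) - G (fst x)) - (F (mix (- {i}) (fst x) (snd x)) - G (mix (- {i}) (fst x) (snd x)))
   = F (fst x) - F (mix (- {i}) (fst x) (snd x))" by (intro AE_I2) simp
 have "Lq_le SxS q (%x. (F (fst x) - G (fst x)) - (F (mix (- {i}) (fst x) (snd x)) - G (mix (- {i}) (fst x) (snd x)))) d"
  by (rule Lq_le_cong_AE[OF F[unfolded resample_le_def, THEN conjunct2] _ ae q]) measurable
 then show ?thesis by (simp add: resample_le_def)
qed

lemma tail_sum_small:
 assumes nn: "!!k. 0 <= delta k" and sm: "summable delta" and eps: "0 < eps"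
 shows "EX n. tail_sum delta n < eps" using suminf_exist_split[OF eps sm] tail_sum_nonneg[OF nn sm] unfolding tail_sum_def by force

text \<open>A causal variable correlates with \<open>Y\<close> only through the innovations they share: expand it
 into its martingale differences.\<close>

lemma cexp_causal_mult_le:
 assumes X: "causal_family (2 * q) X delta" and K: "mart_step S (2 * q) K" and q: "1 <= q" and s: "s < c"
  and Y: "!!i. i <= s ==> resample_le (2 * q) Y i theta" "Lq_le S (2 * q) Y y"
 shows "Lq_le S q (cexp {c..} (%e. X s e * Y e)) (tail_sum delta 0 * theta)"
proof -
 note nn = causal_family_delta(1)[OF X] and sm = causal_family_delta(2)[OF X]
 have K0: "0 < K" using K by (simp add: mart_step_def)
 have theta: "0 <= theta" by (rule resample_le_nonneg[OF Y(1)[OF order_refl]])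
 have y: "0 <= y" by (rule Lq_le_nonneg[OF Y(2)])
 have q0: "0 < q" "0 <= q" "1 <= 2 * q" "0 <= 2 * q" "2 <= 2 * q" using q by auto
 have iX: "integrable S (X s)" by (rule causal_family_integrable[OF X q0(3)])
 have [measurable]: "X s : borel_measurable S" "Y : borel_measurable S" using iX Lq_le_measurable[OF Y(2)] by auto
 obtain b where b: "Lq_le S (2 * q) (X s) b" using causal_family_ex[OF X] by blast
 show ?thesis
 proof (rule Lq_le_limit)
  fix eps :: real assume eps: "0 < eps"
  have "0 < eps / (sqrt K * (y + 1))" using eps K0 y by simp
  from tail_sum_small[OF nn sm this] obtain n where n: "tail_sum delta n < eps / (sqrt K * (y + 1))" by blast
  have "sqrt K * tail_sum delta n * y <= sqrt K * tail_sum delta n * (y + 1)" using tail_sum_nonneg[OF nn sm, of n] K0 by (intro mult_left_mono) auto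
  also have "... <= eps" using n K0 y by (simp add: pos_less_divide_eq mult_ac)
  finally have small: "sqrt K * tail_sum delta n * y <= eps" .
  let ?c = "s + 1 - int (Suc n)"
  let ?D = "%e. X s e - cexp {?c..} (X s) e"
  have "Lq_le S (2 * q) (%e. (SUM t:{s}. 1 * X t e) - cexp {?c..} (%e. SUM t:{s}. 1 * X t e) e)
    (sqrt K * L2_set (%_. 1) {s} * tail_sum delta n)"
   by (rule linear_error_le[OF X _ q0(5) K]) auto
  then have D: "Lq_le S (2 * q) ?D (sqrt K * tail_sum delta n)" by (simp add: L2_set_def)
  have DY: "Lq_le S q (%e. ?D e * Y e) (sqrt K * tail_sum delta n * y)" by (rule Lq_le_mult[OF D Y(2) q0(1)])
  have P: "Lq_le S (2 * q) (proj i (X s)) (lag_coeff delta s i)" for i by (rule proj_le[OF causal_family_resample[OF X] iX q0(3)])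
  have PY: "Lq_le S q (%e. proj i (X s) e * Y e) (lag_coeff delta s i * y)" for i by (rule Lq_le_mult[OF P Y(2) q0(1)])
  have eq: "X s e * Y e = ?D e * Y e + (SUM i:{?c..<s + 1}. proj i (X s) e * Y e)" if e: "e : space S" for e
  proof -
   have "cexp {s + 1..} (X s) e = 0" by (subst cexp_indep[OF causal_family_depends[OF X] _ e]) (auto simp: causal_family_mean[OF X])
   then have "(SUM i:{?c..<s + 1}. proj i (X s) e) = cexp {?c..} (X s) e" using sum_proj[where c="s + 1" and n="Suc n" and F="X s" and e=e] by simp
   then show ?thesis unfolding sum_distrib_right[symmetric] by (simp add: algebra_simps)
  qed
  have iDY: "integrable S (%e. ?D e * Y e)" by (rule S.Lq_le_integrable(1)[OF DY q])
  have iPY: "integrable S (%e. proj i (X s) e * Y e)" for i by (rule S.Lq_le_integrable(1)[OF PY q])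
  have ae: "AE e in S. cexp {c..} (%e. X s e * Y e) e
    = cexp {c..} (%e. ?D e * Y e) e + (SUM i:{?c..<s + 1}. cexp {c..} (%e. proj i (X s) e * Y e) e)"
  proof -
   have "AE e in S. cexp {c..} (%e. ?D e * Y e + (SUM i:{?c..<s + 1}. proj i (X s) e * Y e)) e
     = cexp {c..} (%e. ?D e * Y e) e + cexp {c..} (%e. SUM i:{?c..<s + 1}. proj i (X s) e * Y e) e"
    by (rule cexp_add[OF iDY]) (rule Bochner_Integration.integrable_sum, rule iPY)
   moreover have "AE e in S. cexp {c..} (%e. SUM i:{?c..<s + 1}. proj i (X s) e * Y e) e
     = (SUM i:{?c..<s + 1}. cexp {c..} (%e. proj i (X s) e * Y e) e)"
    by (rule cexp_sum) (auto simp: iPY)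
   moreover have "AE e in S. cexp {c..} (%e. X s e * Y e) e
     = cexp {c..} (%e. ?D e * Y e + (SUM i:{?c..<s + 1}. proj i (X s) e * Y e)) e"
    by (intro AE_I2 cexp_cong eq)
   ultimately show ?thesis by eventually_elim simp
  qed
  have "Lq_le S q (%e. cexp {c..} (%e. ?D e * Y e) e + (SUM i:{?c..<s + 1}. cexp {c..} (%e. proj i (X s) e * Y e) e))
    (sqrt K * tail_sum delta n * y + (SUM i:{?c..<s + 1}. lag_coeff delta s i * theta))"
  proof (intro Lq_le_add Lq_le_sum q Lq_le_cexp[OF DY q])
   fix i assume i: "i : {?c..<s + 1}"
   show "Lq_le S q (cexp {c..} (%e. proj i (X s) e * Y e)) (lag_coeff delta s i * theta)"
    using i s by (intro cexp_proj_mult_le[OF P iX Y(1) Y(2) q]) auto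
  qed auto
  then have "Lq_le S q (cexp {c..} (%e. X s e * Y e))
    (sqrt K * tail_sum delta n * y + (SUM i:{?c..<s + 1}. lag_coeff delta s i * theta))"
   by (rule Lq_le_cong_AE[OF _ _ ae q0(2)]) measurable
  moreover have "(SUM i:{?c..<s + 1}. lag_coeff delta s i * theta) <= tail_sum delta 0 * theta"
   unfolding sum_distrib_right[symmetric] using sum_lag_coeff_coord[OF nn sm, of "{?c..<s + 1}" s 0] theta
   by (intro mult_right_mono) auto
  ultimately show "Lq_le S q (cexp {c..} (%e. X s e * Y e)) (tail_sum delta 0 * theta + eps)" using small by (elim Lq_le_mono[OF _ _ q0(2)]) linarith
 qed (use tail_sum_nonneg[OF nn sm] theta q in auto)
qed

text \<open>Given the innovations from \<open>c\<close> on, the mean of \<open>X s * X t\<close> is due only to the innovations before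
 \<open>c\<close> that both factors share, and these affect \<open>X t\<close> little because they lie \<open>m\<close> units of time
 back.\<close>

lemma qform_cexp_le:
 assumes X: "causal_family (2 * q) X delta" and K: "mart_step S (2 * q) K" and q: "1 <= q"
  and fin: "finite I" "finite J" and b: "!!s t. \<bar>b s t\<bar> <= 1"
  and I: "!!s. s : I ==> s < c" and J: "!!t. t : J ==> c + int m <= t"
 shows "Lq_le S q (cexp {c..} (qform X b I J)) (real (card I) * (tail_sum delta 0 * tail_sum delta m))"
proof -
 note nn = causal_family_delta(1)[OF X] and sm = causal_family_delta(2)[OF X]
 have q0: "0 < q" "0 <= q" "1 <= 2 * q" "0 <= 2 * q" using q by auto
 have [measurable]: "X t : borel_measurable S" for t by (rule causal_family_measurable[OF X])
 let ?Y = "%s e. SUM t:J. b s t * X t e"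
 have Yex: "EX y. Lq_le S (2 * q) (?Y s) y" for s by (rule linear_ex[OF X fin(2) q0(3)])
 have Yr: "resample_le (2 * q) (?Y s) i (tail_sum delta m)" if "i < c" for s i
 proof (rule resample_le_mono[OF linear_resample[OF X fin(2) q0(3)] _ q0(4)])
  have "(SUM t:J. \<bar>b s t\<bar> * lag_coeff delta t i) <= (SUM t:J. lag_coeff delta t i)"
   using mult_right_mono[OF b lag_coeff_nonneg[OF nn]] by (intro sum_mono) simp
  also have "... <= tail_sum delta m" using J that by (intro sum_lag_coeff_time[OF nn sm fin(2)]) force
  finally show "(SUM t:J. \<bar>b s t\<bar> * lag_coeff delta t i) <= tail_sum delta m" .
 qed
 have le: "Lq_le S q (cexp {c..} (%e. X s e * ?Y s e)) (tail_sum delta 0 * tail_sum delta m)" if s: "s : I" for s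
 proof -
  obtain y where y: "Lq_le S (2 * q) (?Y s) y" using Yex by blast
  show ?thesis using I[OF s] by (intro cexp_causal_mult_le[OF X K q I[OF s] Yr y]) auto
 qed
 have int: "integrable S (%e. X s e * ?Y s e)" for s
 proof -
  obtain y b' where "Lq_le S (2 * q) (?Y s) y" "Lq_le S (2 * q) (X s) b'" using Yex causal_family_ex[OF X] by blast
  from S.Lq_le_integrable(1)[OF Lq_le_mult[OF this(2,1) q0(1)] q] show ?thesis .
 qed
 have eq: "qform X b I J = (%e. SUM s:I. X s e * ?Y s e)"
  unfolding qform_def[abs_def] by (subst sum.swap) (simp add: sum_distrib_left mult_ac)
 have ae: "AE e in S. cexp {c..} (qform X b I J) e = (SUM s:I. cexp {c..} (%e. X s e * ?Y s e) e)"
  unfolding eq by (rule cexp_sum[OF fin(1) int])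
 have "Lq_le S q (%e. SUM s:I. cexp {c..} (%e. X s e * ?Y s e) e) (SUM s:I. tail_sum delta 0 * tail_sum delta m)" by (rule Lq_le_sum[OF fin(1) le q])
 from Lq_le_cong_AE[OF this measurable_cexp[OF qform_measurable[OF X]] ae q0(2)] show ?thesis by simp
qed

text \<open>The part of a bilinear form between a past stretch and a later one that is not a bilinear
 form of independent stretches.\<close>

lemma qform_decoupling_le:
 assumes X: "causal_family (2 * q) X delta" and q: "2 <= q" and K: "mart_step S (2 * q) K" and K': "mart_step S q K'"
  and fin: "finite I" "finite J" and b: "!!s t. \<bar>b s t\<bar> <= 1"
  and I: "!!s. s : I ==> s < c" and J: "!!t. t : J ==> c + int m <= t"
 shows "Lq_le S q (%e. qform X b I J e - (SUM t:J. (SUM s:I. b s t * X s e) * cexp {c..} (X t) e) - cexp {c..} (qform X b I J) e)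
   (sqrt K' * (2 * sqrt K * sqrt (real (card I)) * sqrt (real (card J)) * (tail_sum delta 0 * tail_sum delta m)))"
proof -
 note nn = causal_family_delta(1)[OF X] and sm = causal_family_delta(2)[OF X]
 have K0: "0 < K" "0 < K'" using K K' by (auto simp: mart_step_def)
 have q0: "0 < q" "0 <= q" "1 <= q" "1 <= 2 * q" "0 <= 2 * q" "2 <= 2 * q" using q by auto
 have Xm [measurable]: "X t : borel_measurable S" for t by (rule causal_family_measurable[OF X])
 have iX: "integrable S (X t)" for t by (rule causal_family_integrable[OF X q0(4)])
 have th: "0 <= tail_sum delta k" for k by (rule tail_sum_nonneg[OF nn sm])
 let ?Z = "%t e. X t e - cexp {c..} (X t) e"
 let ?X = "%t e. SUM s:I. b s t * X s e"
 let ?F = "%e. SUM t:J. SUM s:I. b s t * X s e * ?Z t e"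
 define R where "R = (%e. SUM t:J. ?X t e * cexp {c..} (X t) e)"
 define v u where "v = sqrt K * sqrt (real (card J)) * tail_sum delta m" and "u = sqrt K * sqrt (real (card I)) * tail_sum delta 0"
 have vu: "0 <= v" "0 <= u" using K0 th by (auto simp: v_def u_def)
 have L2: "L2_set f N <= sqrt (real (card N))" if "!!t. \<bar>f t\<bar> <= 1" for f :: "int => real" and N
 proof -
  have "(SUM t:N. (f t)^2) <= (SUM t:N. 1)" using that by (intro sum_mono) (simp add: abs_square_le_1)
  then show ?thesis by (simp add: L2_set_def)
 qed
 have row: "Lq_le S (2 * q) (%e. SUM t:J. b s t * ?Z t e) v" for s
 proof -
  have err: "Lq_le S (2 * q) (%e. (SUM t:J. b s t * X t e) - cexp {c..} (%e. SUM t:J. b s t * X t e) e)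
    (sqrt K * L2_set (b s) J * tail_sum delta m)"
   by (rule linear_error_le[OF X fin(2) q0(6) K J])
  have ae: "AE e in S. (SUM t:J. b s t * ?Z t e) = (SUM t:J. b s t * X t e) - cexp {c..} (%e. SUM t:J. b s t * X t e) e"
  proof -
   have "AE e in S. cexp {c..} (%e. SUM t:J. b s t * X t e) e = (SUM t:J. cexp {c..} (%e. b s t * X t e) e)"
    by (rule cexp_sum[OF fin(2)]) (simp add: iX)
   then show ?thesis by eventually_elim (simp add: cexp_cmult sum_subtractf right_diff_distrib)
  qed
  have "Lq_le S (2 * q) (%e. SUM t:J. b s t * ?Z t e) (sqrt K * L2_set (b s) J * tail_sum delta m)"
   by (rule Lq_le_cong_AE[OF err _ ae q0(5)]) measurable
  moreover have "sqrt K * L2_set (b s) J * tail_sum delta m <= v"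
   unfolding v_def using L2[of "b s" J, OF b] K0 th by (intro mult_right_mono mult_left_mono) auto
  ultimately show ?thesis using q0 by (auto intro: Lq_le_mono)
 qed
 have col: "Lq_le S (2 * q) (?X t) u" for t
 proof -
  have "Lq_le S (2 * q) (?X t) (sqrt K * L2_set (%s. b s t) I * tail_sum delta 0)" by (rule linear_le[OF X fin(1) q0(6) K])
  moreover have "sqrt K * L2_set (%s. b s t) I * tail_sum delta 0 <= u"
   unfolding u_def using L2[of "%s. b s t" I, OF b] K0 th by (intro mult_right_mono mult_left_mono) auto
  ultimately show ?thesis using q0 by (auto intro: Lq_le_mono)
 qed
 have ZL: "EX a. Lq_le S (2 * q) (?Z t) a" for t using causal_family_ex[OF X, of t] Lq_le_diff[OF _ Lq_le_cexp[OF _ q0(4)] q0(4)] by blast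
 have colex: "EX a. Lq_le S q (%e. ?X t e * ?Z t e) a" for t using ZL[of t] Lq_le_mult[OF col _ q0(1)] by blast
 have F2: "?F = (%e. SUM t:J. ?X t e * ?Z t e)" by (simp add: sum_distrib_right)
 have "EX a. Lq_le S q ?F a" unfolding F2 by (rule Lq_le_sum_ex[OF fin(2) colex q0(3)])
 then obtain a where a: "Lq_le S q ?F a" ..
 have "Lq_le S q (%e. ?F e - cexp {c..} ?F e) (sqrt (K' * (v * (tail_sum delta 0 * sqrt (real (card I))) + u * (tail_sum delta m * sqrt (real (card J))))^2))"
 proof (rule martingale_le[OF q K' a])
  fix i assume i: "i < c"
  have Zr: "resample_le (2 * q) (?Z t) i (lag_coeff delta t i)" for t
   using i by (intro resample_le_diff_depends[OF causal_family_resample[OF X] _ cexp_depends _ q0(5)]) auto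
  have "resample_le q ?F i ((SUM s:I. lag_coeff delta s i * v) + (SUM t:J. lag_coeff delta t i * u))"
   by (rule bilinear_resample[OF fin q0(3) causal_family_resample[OF X] Zr row col])
  then show "Lq_le S q (proj i ?F) (v * (SUM s:I. lag_coeff delta s i) + u * (SUM t:J. lag_coeff delta t i))"
   using S.Lq_le_integrable(1)[OF a q0(3)] q0(3) unfolding sum_distrib_right[symmetric] by (intro proj_le) (simp_all add: mult.commute)
 next
  fix n
  let ?A = "{c - int n..<c}"
  have 1: "(SUM i:?A. (v * (SUM s:I. lag_coeff delta s i))^2) <= (v * (tail_sum delta 0 * sqrt (real (card I))))^2"
   using sum_convolution_le[OF nn sm _ fin(1), of ?A 0 "%_. 1"] by (simp add: power_mult_distrib sum_distrib_left[symmetric] mult_left_mono)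
  have 2: "(SUM i:?A. (u * (SUM s:J. lag_coeff delta s i))^2) <= (u * (tail_sum delta m * sqrt (real (card J))))^2"
  proof -
   have "(SUM i:?A. (SUM t:J. \<bar>1\<bar> * lag_coeff delta t i)^2) <= (tail_sum delta m)^2 * (SUM t:J. 1^2)"
   proof (rule sum_convolution_le[OF nn sm _ fin(2)])
    fix i t assume "i : ?A" "t : J"
    then show "i + int m <= t" using J[of t] by simp
   qed simp
   then show ?thesis by (simp add: power_mult_distrib sum_distrib_left[symmetric] mult_left_mono)
  qed
  show "(SUM i:?A. (v * (SUM s:I. lag_coeff delta s i) + u * (SUM t:J. lag_coeff delta t i))^2)
    <= (v * (tail_sum delta 0 * sqrt (real (card I))) + u * (tail_sum delta m * sqrt (real (card J))))^2"
   by (rule sum_square_add_le[OF 1 2]) (use vu th in auto)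
 qed
 also have "sqrt (K' * (v * (tail_sum delta 0 * sqrt (real (card I))) + u * (tail_sum delta m * sqrt (real (card J))))^2)
   = sqrt K' * (2 * sqrt K * sqrt (real (card I)) * sqrt (real (card J)) * (tail_sum delta 0 * tail_sum delta m))"
 proof -
  have "v * (tail_sum delta 0 * sqrt (real (card I))) + u * (tail_sum delta m * sqrt (real (card J)))
    = 2 * sqrt K * sqrt (real (card I)) * sqrt (real (card J)) * (tail_sum delta 0 * tail_sum delta m)" by (simp add: v_def u_def algebra_simps)
  then show ?thesis using K0 th by (simp add: real_sqrt_mult)
 qed
 finally have main: "Lq_le S q (%e. ?F e - cexp {c..} ?F e)
   (sqrt K' * (2 * sqrt K * sqrt (real (card I)) * sqrt (real (card J)) * (tail_sum delta 0 * tail_sum delta m)))" .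
 have FR: "?F e = qform X b I J e - R e" for e
  unfolding R_def qform_def by (simp add: sum_subtractf right_diff_distrib sum_distrib_right)
 have qi: "integrable S (qform X b I J)" using qform_ex[OF X fin q0(3), of b] S.Lq_le_integrable(1)[OF _ q0(3)] by blast
 have ti: "integrable S (%e. cexp {c..} (X t) e * ?X t e)" for t
 proof -
  obtain x where "Lq_le S (2 * q) (X t) x" using causal_family_ex[OF X] by blast
  from Lq_le_mult[OF Lq_le_cexp[OF this q0(4)] col q0(1)] S.Lq_le_integrable(1)[OF _ q0(3)] show ?thesis by blast
 qed
 have R0: "AE e in S. cexp {c..} R e = 0"
 proof -
  have a1: "AE e in S. cexp {c..} (%e. SUM t:J. cexp {c..} (X t) e * ?X t e) e
    = (SUM t:J. cexp {c..} (%e. cexp {c..} (X t) e * ?X t e) e)"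
   by (rule cexp_sum[OF fin(2) ti])
  have a2: "AE e in S. (SUM t:J. cexp {c..} (%e. cexp {c..} (X t) e * ?X t e) e) = 0"
  proof (rule AE_I2, rule sum.neutral, rule ballI)
   fix e t assume e: "e : space S"
   have dep: "depends_on {..<c} (?X t)"
   proof (rule depends_on_sum)
    fix s assume "s : I"
    from I[OF this] show "depends_on {..<c} (%e. b s t * X s e)"
     by (intro depends_on_compose[where h="%x. b s t * x"] depends_on_mono[OF causal_family_depends[OF X]]) auto
   qed
   have "(LINT e|S. ?X t e) = 0" using iX by (subst LINT_sum) (auto simp: causal_family_mean[OF X])
   then have "cexp {c..} (?X t) e = 0" by (subst cexp_indep[OF dep _ e]) auto
   then show "cexp {c..} (%e. cexp {c..} (X t) e * ?X t e) e = 0" by (subst cexp_mult[OF cexp_depends e]) simp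
  qed
  have R: "R = (%e. SUM t:J. cexp {c..} (X t) e * ?X t e)" unfolding R_def by (simp only: mult.commute)
  show ?thesis unfolding R using a1 a2 by eventually_elim (simp only:)
 qed
 have Ri: "integrable S R" unfolding R_def using ti by (simp add: mult.commute)
 have ae: "AE e in S. qform X b I J e - R e - cexp {c..} (qform X b I J) e = ?F e - cexp {c..} ?F e"
  using R0 cexp_diff[OF qi Ri, of "{c..}"] unfolding FR by eventually_elim simp
 show ?thesis using Lq_le_cong_AE[OF main _ ae q0(2)] qi Ri unfolding R_def by auto
qed

end

section \<open>Quadratic forms with lags of one order\<close>

lemma pow2_powr: "((2::real) ^ j) powr a = (2 powr a) ^ j" by (simp add: powr_power powr_realpow[symmetric] powr_powr mult.commute)

lemma sum_pow2_powr_le: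
 assumes "0 < (theta::real)" "finite N"
 shows "(SUM j:N. (2 ^ j) powr (- theta)) <= 1 / (1 - 2 powr (- theta))"
proof -
 have x: "0 < (2::real) powr (- theta)" "(2::real) powr (- theta) < 1" using assms by (auto simp: powr_less_one)
 have "(SUM j:N. (2 powr (- theta)) ^ j) <= (\<Sum>j. (2 powr (- theta)) ^ j)" using x assms by (intro sum_le_suminf summable_geometric) auto
 then show ?thesis using x by (simp add: pow2_powr suminf_geometric)
qed

context innovations
begin

lemma prob_le_sum_weighted:
 fixes w :: "'i => real"
 assumes I: "finite I" and Y: "!!i. i : I ==> Y i : borel_measurable S" and w: "(SUM i:I. w i) <= 1" and z: "0 < z"
 shows "\<P>(e in S. z <= \<bar>SUM i:I. Y i e\<bar>) <= (SUM i:I. \<P>(e in S. w i * z <= \<bar>Y i e\<bar>))"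
proof -
 have [measurable]: "i : I ==> Y i : borel_measurable S" for i by (rule Y)
 have sub: "{e:space S. z <= \<bar>SUM i:I. Y i e\<bar>} \<subseteq> (UN i:I. {e:space S. w i * z <= \<bar>Y i e\<bar>})"
 proof
  fix e assume e: "e : {e:space S. z <= \<bar>SUM i:I. Y i e\<bar>}"
  show "e : (UN i:I. {e:space S. w i * z <= \<bar>Y i e\<bar>})"
  proof (rule ccontr)
   assume no: "\<not> ?thesis"
   have ne: "I ~= {}" using e z by auto
   have "z <= (SUM i:I. \<bar>Y i e\<bar>)" using e by (auto intro: order_trans[OF _ sum_abs])
   also have "... < (SUM i:I. w i * z)" using no e I ne by (intro sum_strict_mono) auto
   also have "... <= z" unfolding sum_distrib_right[symmetric] using w z by (simp add: mult_left_le_one_le)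
   finally show False by simp
  qed
 qed
 have "\<P>(e in S. z <= \<bar>SUM i:I. Y i e\<bar>) <= S.prob (UN i:I. {e:space S. w i * z <= \<bar>Y i e\<bar>})"
  using I by (intro S.finite_measure_mono[OF sub] sets.finite_UN) auto
 also have "... <= (SUM i:I. \<P>(e in S. w i * z <= \<bar>Y i e\<bar>))" using I by (intro S.finite_measure_subadditive_finite) auto
 finally show ?thesis .
qed

end

context dependent_process
begin

lemma X2: "causal_family (2 * (p / 2)) X delta" and Kp2: "mart_step S (2 * (p / 2)) Kp" using X Kp by simp_all

text \<open>The half-open window \<open>{t - 4 * 2 ^ i<..t}\<close> of lags is four blocks of length \<open>2 ^ i\<close> long, less than the
 five block lengths of memory kept in \<open>blkE\<close>.\<close>

definition band :: "(int => int => real) => nat => bool" where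
 "band b i \<longleftrightarrow> (ALL s t. \<bar>b s t\<bar> <= 1 & (b s t ~= 0 --> t - 4 * 2 ^ i < s & s <= t))"

text \<open>The centered contribution of time \<open>t\<close>; the index \<open>d\<close> is a dummy that makes it a
 one-dimensional vector.\<close>

definition band_term :: "(int => int => real) => nat => int => int => (int => 'e) => real" where
 "band_term b i t d e = qform X b {t - 4 * 2 ^ i<..t} {t} e - (LINT e|S. qform X b {t - 4 * 2 ^ i<..t} {t} e)"

lemma qform_integrable: "finite I ==> finite J ==> integrable S (qform X b I J)"
 using qform_ex[OF X2, of I J b] S.Lq_le_integrable(1)[of "p / 2"] p by force

lemma blk_band_term:
 assumes b: "band b i" and ij: "i <= j"
 shows "blk (band_term b i) tau j d e
  = qform X b {tau - 4 * 2 ^ j..<tau + 2 ^ j} {tau..<tau + 2 ^ j} e - (LINT e|S. qform X b {tau - 4 * 2 ^ j..<tau + 2 ^ j} {tau..<tau + 2 ^ j} e)"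
proof -
 let ?I = "{tau - 4 * 2 ^ j..<tau + 2 ^ j}" and ?J = "{tau..<tau + 2 ^ j}"
 have r: "(2::int) ^ i <= 2 ^ j" using ij by (rule power_increasing) simp
 have "qform X b {t - 4 * 2 ^ i<..t} {t} e = qform X b ?I {t} e" if t: "t : ?J" for t e
  unfolding qform_def
 proof (rule sum.cong[OF refl], rule sum.mono_neutral_left)
  fix t' assume t': "t' : {t}"
  show "{t - 4 * 2 ^ i<..t} \<subseteq> ?I"
  proof
   fix s assume "s : {t - 4 * 2 ^ i<..t}"
   with t r show "s : ?I" unfolding atLeastLessThan_iff greaterThanAtMost_iff by linarith
  qed
  show "ALL s:?I - {t - 4 * 2 ^ i<..t}. b s t' * X s e * X t' e = 0" using b t' unfolding band_def by fastforce
 qed simp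
 then have "blk (band_term b i) tau j d e = (SUM t:?J. qform X b ?I {t} e - (LINT e|S. qform X b ?I {t} e))"
  unfolding blk_def band_term_def by (intro sum.cong refl) (simp cong: LINT_cong)
 also have "... = (SUM t:?J. qform X b ?I {t} e) - (LINT e|S. (SUM t:?J. qform X b ?I {t} e))"
  by (subst LINT_sum) (auto simp: sum_subtractf intro!: qform_integrable)
 also have "... = qform X b ?I ?J e - (LINT e|S. qform X b ?I ?J e)" by (simp add: qform_def)
 finally show ?thesis .
qed

definition banded :: "(int => int => real) => nat => bool" where
 "banded a B \<longleftrightarrow> (ALL s t. \<bar>a s t\<bar> <= 1 & (a s t ~= 0 --> s <= t & t - s <= int B))"

lemma banded_sparse:
 assumes a: "banded a B" and fin: "finite I" "finite J"
 shows "sparse_coeffs a I J (real B + 1)"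
proof -
 have count: "(SUM t:N. (f t)^2) <= real B + 1" if "finite N" "finite Q" "card Q = B + 1" "!!t. \<bar>f t\<bar> <= 1" "!!t. t ~: Q ==> f t = 0"
  for N Q :: "int set" and f :: "int => real"
 proof -
  have "(SUM t:N. (f t)^2) = (SUM t:N Int Q. (f t)^2)" using that by (intro sum.mono_neutral_right) auto
  also have "... <= (SUM t:N Int Q. 1)" using that(4) by (intro sum_mono) (simp add: abs_square_le_1)
  also have "... <= real (card Q)" using card_mono[OF that(2), of "N Int Q"] by simp
  finally show ?thesis using that(3) by simp
 qed
 have a1: "\<bar>a s t\<bar> <= 1" and a0: "\<not> (s <= t & t - s <= int B) ==> a s t = 0" for s t
  using a[unfolded banded_def, rule_format, of s t] by auto
 have "(SUM t:J. (a s t)^2) <= real B + 1" for s using a1 by (intro count[OF fin(2), of "{s..s + int B}"] a0) auto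
 moreover have "(SUM s:I. (a s t)^2) <= real B + 1" for t using a1 by (intro count[OF fin(1), of "{t - int B..t}"] a0) auto
 ultimately show ?thesis using fin by (simp add: sparse_coeffs_def)
qed

lemma band_sparse:
 assumes b: "band b i" and fin: "finite I" "finite J"
 shows "sparse_coeffs b I J (4 * 2 ^ i)"
proof -
 have e: "int (4 * 2 ^ i - 1) = 4 * 2 ^ i - 1" "real (4 * 2 ^ i - 1) + 1 = 4 * 2 ^ i" by (simp_all add: of_nat_diff)
 have "banded b (4 * 2 ^ i - 1)" unfolding banded_def e
 proof (intro allI)
  fix s t show "\<bar>b s t\<bar> <= 1 & (b s t ~= 0 --> s <= t & t - s <= 4 * 2 ^ i - 1)"
   using b[unfolded band_def, rule_format, of s t] by (cases "b s t = 0") auto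
 qed
 from banded_sparse[OF this fin] show ?thesis by (simp only: e)
qed

definition C3 where "C3 = 8 * sqrt Kq * sqrt Kp * A^2"

lemma C3_pos: "0 < C3" using Kp_pos Kq_pos A by (simp add: C3_def)

lemma band_scale_le:
 assumes t: "0 <= t" "t <= A * rho" "0 <= rho"
 shows "sqrt Kq * (sqrt Kp * sqrt (4 * 2 ^ i) * tail_sum delta 0 *
   (t * (sqrt (real (card {tau - 4 * 2 ^ j..<tau + 2 ^ j :: int})) + sqrt (real (card {tau..<tau + 2 ^ j :: int})))))
  <= C3 * sqrt (2 ^ i * 2 ^ j) * rho"
proof -
 have "card {tau - 4 * 2 ^ j..<tau + 2 ^ j :: int} = 5 * 2 ^ j" "card {tau..<tau + 2 ^ j :: int} = 2 ^ j"
  by (simp_all add: nat_mult_distrib nat_power_eq)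
 then have c: "sqrt (real (card {tau - 4 * 2 ^ j..<tau + 2 ^ j :: int})) + sqrt (real (card {tau..<tau + 2 ^ j :: int})) = (sqrt 5 + 1) * sqrt (2 ^ j)"
  by (simp add: real_sqrt_mult distrib_right)
 have s5: "sqrt 5 + 1 <= (4::real)"
 proof -
  have "sqrt 5 <= (3::real)" by (rule real_le_lsqrt) auto
  then show ?thesis by simp
 qed
 have "tail_sum delta 0 * (t * ((sqrt 5 + 1) * sqrt (2 ^ j))) <= A * ((A * rho) * (4 * sqrt (2 ^ j)))"
  using t s5 tail0 A tail_sum_nonneg[OF delta_nonneg delta_summable] by (intro mult_mono mult_nonneg_nonneg) auto
 then have "sqrt Kq * (sqrt Kp * sqrt (4 * 2 ^ i)) * (tail_sum delta 0 * (t * ((sqrt 5 + 1) * sqrt (2 ^ j))))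
   <= sqrt Kq * (sqrt Kp * sqrt (4 * 2 ^ i)) * (A * ((A * rho) * (4 * sqrt (2 ^ j))))"
  using Kp_pos Kq_pos by (intro mult_left_mono) auto
 then show ?thesis unfolding c C3_def by (simp add: real_sqrt_mult power2_eq_square mult_ac)
qed

lemma tail_pow2_0: "0 <= tail_sum delta m" by (rule tail_sum_nonneg[OF delta_nonneg delta_summable])

lemma band_family:
 assumes b: "band b i" and il: "i <= l"
 shows "multiscale_family (p / 2) (band_term b i) {0} tau0 i l
  (%j k d. C3 * sqrt (2 ^ i * 2 ^ j) * (2 ^ j) powr (- alpha)) (%k d. C3 * 2 ^ i) (C3 * sqrt (2 ^ i * 2 ^ l))"
  (is "multiscale_family _ _ _ _ _ _ ?b ?f ?v")
proof -
 have q: "2 <= p / 2" "1 <= p / 2" "0 <= p / 2" using p by auto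
 have int: "integrable S (qform X b I J)" if "finite I" "finite J" for I J by (rule qform_integrable[OF that])
 have terms: "integrable S (band_term b i t d)" "depends_on {..t} (band_term b i t d)" "(LINT e|S. band_term b i t d e) = 0" for t d
 proof -
  let ?F = "qform X b {t - 4 * 2 ^ i<..t} {t}"
  have i: "integrable S ?F" by (rule int) auto
  have B: "band_term b i t d = (%e. ?F e - (LINT e|S. ?F e))" by (rule ext) (simp add: band_term_def)
  show "integrable S (band_term b i t d)" unfolding B by (intro Bochner_Integration.integrable_diff i S.integrable_const)
  show "(LINT e|S. band_term b i t d e) = 0" unfolding B using i by (subst LINT_diff) (auto simp: S.prob_space)
  have "depends_on {..<t + 1} ?F" by (rule qform_depends[OF X]) auto
  moreover have "{..<t + 1} = {..t}" by auto
  ultimately show "depends_on {..t} (band_term b i t d)"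
   unfolding B by (intro depends_on_compose[where h="%x. x - (LINT e|S. ?F e)"]) simp
 qed
 have err: "Lq_le S (p / 2) (%e. blk (band_term b i) tau j d e - blkE (band_term b i) tau j d e) (C3 * sqrt (2 ^ i * 2 ^ j) * (2 ^ j) powr (- alpha))"
  if j: "i <= j" for tau j d
 proof -
  let ?F = "qform X b {tau - 4 * 2 ^ j..<tau + 2 ^ j} {tau..<tau + 2 ^ j}"
  have i: "integrable S ?F" by (rule int) auto
  have Fm: "?F : borel_measurable S" using i by auto
  have blk: "blk (band_term b i) tau j d = (%e. ?F e - (LINT e|S. ?F e))" by (rule ext) (rule blk_band_term[OF b j])
  have ae: "AE e in S. blk (band_term b i) tau j d e - blkE (band_term b i) tau j d e = ?F e - cexp {tau - 5 * 2 ^ j..} ?F e"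
  proof -
   have c1: "AE e in S. cexp {tau - 5 * 2 ^ j..} (%e. ?F e - (LINT e|S. ?F e)) e
     = cexp {tau - 5 * 2 ^ j..} ?F e - cexp {tau - 5 * 2 ^ j..} (%e. LINT e|S. ?F e) e"
    by (rule cexp_diff[OF i]) simp
   have c2: "cexp {tau - 5 * 2 ^ j..} (%e. LINT e|S. ?F e) e = (LINT e|S. ?F e)" for e by (simp add: cexp_def S.prob_space)
   show ?thesis unfolding blkE_def blk using c1 unfolding c2 by eventually_elim (simp only: diff_diff_eq2 diff_add_cancel)
  qed
  have "Lq_le S (p / 2) (%e. ?F e - cexp {tau - 5 * 2 ^ j..} ?F e) (C3 * sqrt (2 ^ i * 2 ^ j) * (2 ^ j) powr (- alpha))"
  proof (rule Lq_le_mono[OF qform_error_le[OF X2 band_sparse[OF b] q(1) Kp2 Kq, of _ _ _ "2 ^ j"] band_scale_le q(3)])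
   show "tail_sum delta (2 ^ j) <= A * (2 ^ j) powr (- alpha)" by (rule tail_pow2)
  qed (auto simp: tail_pow2_0)
  then show ?thesis
  proof (rule Lq_le_cong_AE[OF _ _ ae q(3)])
   show "(%e. blk (band_term b i) tau j d e - blkE (band_term b i) tau j d e) : borel_measurable S"
    unfolding blkE_def blk by (intro borel_measurable_diff measurable_cexp borel_measurable_const Fm)
  qed
 qed
 have bot: "Lq_le S (p / 2) (blk (band_term b i) tau i d) (C3 * 2 ^ i)" for tau d
 proof -
  let ?F = "qform X b {tau - 4 * 2 ^ i..<tau + 2 ^ i} {tau..<tau + 2 ^ i}"
  have blk: "blk (band_term b i) tau i d = (%e. ?F e - (LINT e|S. ?F e))" by (rule ext) (rule blk_band_term[OF b order_refl])
  have "Lq_le S (p / 2) (%e. ?F e - (LINT e|S. ?F e)) (C3 * sqrt (2 ^ i * 2 ^ i) * 1)"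
  proof (rule Lq_le_mono[OF qform_centered_le[OF X2 band_sparse[OF b] q(1) Kp2 Kq] band_scale_le q(3)])
   show "tail_sum delta 0 <= A * 1" using tail0 by simp
  qed (auto simp: tail_pow2_0)
  then show ?thesis unfolding blk by simp
 qed
 have b2: "(SUM k<2 ^ (l - j). SUM d:{0::int}. (?b j k d)^2) <= ?v^2" if j: "j <= l" for j
 proof -
  have "(2 ^ j :: real) powr (- alpha) <= (2 ^ j) powr 0" using alpha by (intro powr_mono) auto
  then have "((2 ^ j :: real) powr (- alpha))^2 <= 1" by (simp add: power_le_one)
  then have "(C3^2 * (2 ^ i * 2 ^ l)) * ((2 ^ j) powr (- alpha))^2 <= (C3^2 * (2 ^ i * 2 ^ l)) * 1" by (intro mult_left_mono) auto
  moreover have "(2::real) ^ l = 2 ^ (l - j) * 2 ^ j" using j by (simp flip: power_add)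
  ultimately show ?thesis by (simp add: power_mult_distrib mult_ac)
 qed
 have f2: "(SUM k<2 ^ (l - i). SUM d:{0::int}. (?f k d)^2) <= ?v^2"
 proof -
  have "(2::real) ^ l = 2 ^ (l - i) * 2 ^ i" using il by (simp flip: power_add)
  then show ?thesis by (simp add: power_mult_distrib power2_eq_square mult_ac)
 qed
 show ?thesis
  unfolding multiscale_family_def using il terms err bot b2 f2 C3_pos by auto
qed

text \<open>Scale \<open>j\<close> receives a share of the level proportional to \<open>(2 ^ j) powr (- theta)\<close>.  The shares
 are summable, so that no logarithm of the number of scales is lost; the price is the factor
 \<open>(2 ^ j) powr theta\<close> at scale \<open>j\<close>.\<close>

definition band_tail :: "real => real => real => real => real => bool" where
 "band_tail eta theta kappa c C \<longleftrightarrow> 0 < c & c <= 1 & 0 <= C & (ALL T b i l tau z. 1 <= T --> 2 ^ l <= T --> i <= l --> band b i --> 0 < z -->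
   C * sqrt (2 ^ i * 2 ^ l) * T powr (eta + theta) <= z -->
   \<P>(e in S. z <= \<bar>blk (band_term b i) tau l 0 e\<bar>)
    <= C * (SUM j:{i..l}. 2 ^ (l - j) * (sqrt (2 ^ i * 2 ^ j) * (2 ^ j) powr (- alpha) * (2 ^ j) powr theta / z) powr (p / 2))
     + (SUM k<2 ^ (l - i). \<P>(e in S. c * z <= \<bar>blk (band_term b i) (tau + int k * 2 ^ i) i 0 e\<bar>))
     + C * T powr (- kappa))"

lemma band_tail_exists:
 assumes eta: "0 < eta" and theta: "0 < theta" and kappa: "0 < kappa"
 shows "EX c C. band_tail eta theta kappa c C"
proof (rule prob_norm_multiscale[OF _ Kq eta kappa])
 show q: "2 <= p / 2" using p by simp
 fix c C0 :: real assume c: "0 < c" "c <= 1" "0 <= C0"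
  and main: "!!T D' W b f omega l j0 tau0 v z. 1 <= T ==> 2 ^ l <= T^2 ==> multiscale_family (p / 2) W D' tau0 j0 l b f v ==>
   (!!j. j : {j0..l} ==> 0 < omega j) ==> (!!j. j : {j0..<l} ==> omega (Suc j) <= omega j) ==> (SUM j:{j0..l}. omega j) <= 1 / 4 ==>
   0 < z ==> (!!j. j : {j0..l} ==> 18 * v * T powr eta <= omega j * z) ==>
   \<P>(e in S. z <= L2_set (%d. blk W tau0 l d e) D')
    <= C0 * (SUM j:{j0..l}. SUM k<2 ^ (l - j). (L2_set (b j k) D' / (omega j * z)) powr (p / 2))
     + (SUM k<2 ^ (l - j0). \<P>(e in S. c * z <= L2_set (%d. blk W (tau0 + int k * 2 ^ j0) j0 d e) D'))
     + C0 * T powr (- kappa)"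
 define w where "w = (1 - 2 powr (- theta)) / (4::real)"
 have x1: "(2::real) powr (- theta) < 1" using theta by (auto simp: powr_less_one)
 then have w: "0 < w" by (simp add: w_def)
 define C where "C = C0 * (C3 / w) powr (p / 2) + C0 + 18 * C3 / w"
 have C: "0 <= C" "C0 * (C3 / w) powr (p / 2) <= C" "C0 <= C" "18 * C3 / w <= C" using c C3_pos w by (auto simp: C_def)
 have "band_tail eta theta kappa c C"
  unfolding band_tail_def
 proof (intro conjI allI impI c C(1))
  fix T :: real and b :: "int => int => real" and i l :: nat and tau :: int and z :: real
  assume T: "1 <= T" and l: "2 ^ l <= T" and il: "i <= l" and b: "band b i" and z: "0 < z"
   and gap: "C * sqrt (2 ^ i * 2 ^ l) * T powr (eta + theta) <= z"
  let ?A = "%j. (sqrt (2 ^ i * 2 ^ j) * (2 ^ j) powr (- alpha) * (2 ^ j) powr theta / z) powr (p / 2)" and ?P = "\<P>(e in S. z <= \<bar>blk (band_term b i) tau l 0 e\<bar>)" and ?Q = "%k::nat. \<P>(e in S. c * z <= \<bar>blk (band_term b i) (tau + int k * 2 ^ i) i 0 e\<bar>)"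
  let ?omega = "%j::nat. w * (2 ^ j) powr (- theta)"
  let ?b = "%j (k::nat) (d::int). C3 * sqrt (2 ^ i * 2 ^ j) * (2 ^ j) powr (- alpha)"
  have T2: "2 ^ l <= T^2" using order_trans[OF l, of "T^2"] T mult_left_mono[of 1 T T] by (simp add: power2_eq_square)
  have m1: "\<P>(e in S. z <= L2_set (%d. blk (band_term b i) tau l d e) {0})
    <= C0 * (SUM j:{i..l}. SUM k<2 ^ (l - j). (L2_set (?b j k) {0} / (?omega j * z)) powr (p / 2))
     + (SUM k<2 ^ (l - i). \<P>(e in S. c * z <= L2_set (%d. blk (band_term b i) (tau + int k * 2 ^ i) i d e) {0}))
     + C0 * T powr (- kappa)"
  proof (rule main[OF T T2 band_family[OF b il]])
   show "0 < ?omega j" for j using w by simp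
   show "?omega (Suc j) <= ?omega j" for j using w theta by (intro mult_left_mono powr_mono2') auto
   show "(SUM j:{i..l}. ?omega j) <= 1 / 4"
   proof -
    have "w * (SUM j:{i..l}. (2 ^ j) powr (- theta)) <= w * (1 / (1 - 2 powr (- theta)))"
     using w by (intro mult_left_mono sum_pow2_powr_le[OF theta]) auto
    also have "... = 1 / 4"
    proof -
     have "1 - (2::real) powr (- theta) ~= 0" using x1 by linarith
     then show ?thesis unfolding w_def by (simp add: divide_simps)
    qed
    finally show ?thesis by (simp add: sum_distrib_left)
   qed
   show "18 * (C3 * sqrt (2 ^ i * 2 ^ l)) * T powr eta <= ?omega j * z" if j: "j : {i..l}" for j
   proof -
    have "T powr (- theta) <= (2 ^ j) powr (- theta)" using theta j by (intro powr_mono2' order_trans[OF power_increasing l]) auto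
    then have "w * T powr (- theta) * z <= ?omega j * z" using w z by (intro mult_right_mono mult_left_mono) auto
    moreover have "18 * (C3 * sqrt (2 ^ i * 2 ^ l)) * T powr eta <= w * T powr (- theta) * z"
    proof -
     have "(18 * C3 / w) * (sqrt (2 ^ i * 2 ^ l) * T powr (eta + theta)) <= C * (sqrt (2 ^ i * 2 ^ l) * T powr (eta + theta))"
      using C(4) by (intro mult_right_mono) auto
     also have "... <= z" using gap by (simp only: mult.assoc)
     finally have "w * T powr (- theta) * ((18 * C3 / w) * (sqrt (2 ^ i * 2 ^ l) * T powr (eta + theta))) <= w * T powr (- theta) * z"
      using w by (intro mult_left_mono) auto
     moreover have "T powr (- theta) * T powr (eta + theta) = T powr eta" by (simp flip: powr_add)
     moreover have "w * t * ((18 * C3 / w) * (sqrt (2 ^ i * 2 ^ l) * u)) = 18 * (C3 * sqrt (2 ^ i * 2 ^ l)) * (t * u)" for t u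
      using w by (simp add: field_simps)
     ultimately show ?thesis by (simp only:)
    qed
    ultimately show ?thesis by linarith
   qed
  qed (use z in auto)
  have m2: "L2_set (%d. f d) {0} = \<bar>f 0\<bar>" for f :: "int => real" by simp
  have m3: "(SUM k<2 ^ (l - j). (L2_set (?b j (k::nat)) {0} / (?omega j * z)) powr (p / 2))
   = (C3 / w) powr (p / 2) * (2 ^ (l - j) * ?A j)" for j
  proof -
   have "L2_set (?b j k) {0} / (?omega j * z) = (C3 / w) * (sqrt (2 ^ i * 2 ^ j) * (2 ^ j) powr (- alpha) * (2 ^ j) powr theta / z)" for k :: nat
   proof -
    have "L2_set (?b j k) {0} = C3 * sqrt (2 ^ i * 2 ^ j) * (2 ^ j) powr (- alpha)" unfolding m2 using C3_pos by simp
    moreover have "(2 ^ j :: real) powr (- theta) = inverse ((2 ^ j) powr theta)" by (rule powr_minus)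
    ultimately show ?thesis using w z by (simp add: field_simps)
   qed
   then show ?thesis by (simp only: powr_mult) simp
  qed
  have "?P
    <= C0 * (SUM j:{i..l}. (C3 / w) powr (p / 2) * (2 ^ (l - j) * ?A j))
     + (SUM k<2 ^ (l - i). ?Q k)
     + C0 * T powr (- kappa)"
   using m1 unfolding m3 unfolding m2 .
  also have "C0 * (SUM j:{i..l}. (C3 / w) powr (p / 2) * (2 ^ (l - j) * ?A j))
    <= C * (SUM j:{i..l}. 2 ^ (l - j) * ?A j)"
  proof -
   have "C0 * (SUM j:{i..l}. K * s j) <= C * (SUM j:{i..l}. s j)" if "C0 * K <= C" "!!j. 0 <= s j" for K and s :: "nat => real"
    unfolding sum_distrib_left[symmetric] mult.assoc[symmetric] using that by (intro mult_right_mono sum_nonneg) auto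
   then show ?thesis using C(2) by simp
  qed
  also have "C0 * T powr (- kappa) <= C * T powr (- kappa)" using C(3) by (intro mult_right_mono) auto
  finally show "?P
    <= C * (SUM j:{i..l}. 2 ^ (l - j) * ?A j)
     + (SUM k<2 ^ (l - i). ?Q k)
     + C * T powr (- kappa)" by simp
 qed
 then show ?thesis by blast
qed

text \<open>A form with lags between \<open>2 * 2 ^ i\<close> and \<open>4 * 2 ^ i\<close> over a block of length \<open>2 ^ i\<close>: between
 the two groups of time points there is a gap of the same length, which makes the form almost a
 bilinear form in independent stretches.\<close>

definition cell_tail :: "real => real => real => bool" where
 "cell_tail eta kappa C \<longleftrightarrow> 0 <= C & (ALL T b i tau z. 1 <= T --> 2 ^ (i + 2) <= T^2 --> band b i -->
   i = 0 \<or> (ALL s t. b s t ~= 0 --> 2 * 2 ^ i <= t - s) --> 0 < z --> C * (real (i + 3))^2 * 2 ^ i * T powr (2 * eta) <= z -->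
   \<P>(e in S. z <= \<bar>blk (band_term b i) tau i 0 e\<bar>)
    <= C * (2 ^ i * (2 ^ i) powr (- alpha) / z) powr (p / 2)
     + C * ((real (i + 3))^2 * T powr eta / z) powr p * chaos_scale i + C * T powr (- kappa))"

lemma cell_decoupled:
 assumes b: "band b i" and lag: "!!s t. b s t ~= 0 ==> 2 * 2 ^ i <= t - s"
 shows "Lq_le S (p / 2) (%e. blk (band_term b i) tau i 0 e - chaos b tau i e)
  ((4 * sqrt Kq * sqrt Kp + 6) * A^2 * (2 ^ i * (2 ^ i) powr (- alpha)))"
proof -
 have q: "2 <= p / 2" "1 <= p / 2" "0 <= p / 2" using p by auto
 let ?I = "{tau - 4 * 2 ^ i..<tau - 2 ^ i}" and ?J = "{tau..<tau + 2 ^ i}" and ?c = "tau - 2 ^ i"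
 let ?V = "qform X b ?I ?J" and ?t = "tail_sum delta 0 * tail_sum delta (2 ^ i)"
 have b1: "\<bar>b s t\<bar> <= 1" for s t using b by (simp add: band_def)
 have z: "b s t = 0" if "t : ?J" "tau - 2 ^ i <= s" for s t using lag[of s t] that by (cases "b s t = 0") auto
 have V: "qform X b {tau - 4 * 2 ^ i..<tau + 2 ^ i} ?J = ?V"
  unfolding qform_def[abs_def] using z by (intro ext sum.cong refl sum.mono_neutral_right) auto
 have R: "chaos b tau i e = (SUM t:?J. (SUM s:?I. b s t * X s e) * cexp {?c..} (X t) e)" for e
  unfolding chaos_def using z by (intro sum.cong refl arg_cong2[where f="(*)"] sum.mono_neutral_right) auto
 have V1: "Lq_le S (p / 2) (%e. ?V e - (SUM t:?J. (SUM s:?I. b s t * X s e) * cexp {?c..} (X t) e) - cexp {?c..} ?V e)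
   (sqrt Kq * (2 * sqrt Kp * sqrt (real (card ?I)) * sqrt (real (card ?J)) * ?t))"
  by (rule qform_decoupling_le[OF X2 q(1) Kp2 Kq]) (auto simp: b1)
 have V2: "Lq_le S (p / 2) (cexp {?c..} ?V) (real (card ?I) * ?t)" by (rule qform_cexp_le[OF X2 Kp2 q(2)]) (auto simp: b1)
 have "integrable S ?V" by (rule qform_integrable) auto
 from integral_cexp[OF this, of "{?c..}"] have EV: "\<bar>LINT e|S. ?V e\<bar> <= real (card ?I) * ?t" using S.Lq_le_integrable(2)[OF V2 q(2)] by simp
 have V3: "Lq_le S (p / 2) (%e. LINT e|S. ?V e) (real (card ?I) * ?t)" using EV Lq_le_nonneg[OF V2] q by (intro S.Lq_le_bounded) auto
 have c: "real (card ?I) = 3 * 2 ^ i" "real (card ?J) = 2 ^ i" by (simp_all add: nat_mult_distrib nat_power_eq)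
 have t: "0 <= ?t" "?t <= A * (A * (2 ^ i) powr (- alpha))" using tail0 tail_pow2[of i] A tail_pow2_0 by (auto intro!: mult_mono)
 have "sqrt (3 * 2 ^ i) * sqrt (2 ^ i) <= 2 * (2 ^ i :: real)"
 proof -
  have "sqrt 3 <= (2::real)" by (rule real_le_lsqrt) auto
  then show ?thesis by (simp add: real_sqrt_mult mult.assoc)
 qed
 then have "2 * sqrt Kp * (sqrt (3 * 2 ^ i) * sqrt (2 ^ i)) <= 2 * sqrt Kp * (2 * 2 ^ i)" using Kp_pos by (intro mult_left_mono) auto
 from mult_mono[OF this t(2)] have "2 * sqrt Kp * (sqrt (3 * 2 ^ i) * sqrt (2 ^ i)) * ?t <= 2 * sqrt Kp * (2 * 2 ^ i) * (A * (A * (2 ^ i) powr (- alpha)))"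
  using t(1) Kp_pos by simp
 from mult_left_mono[OF this, of "sqrt Kq"]
 have "sqrt Kq * (2 * sqrt Kp * sqrt (real (card ?I)) * sqrt (real (card ?J)) * ?t) <= sqrt Kq * (2 * sqrt Kp * (2 * 2 ^ i) * (A * (A * (2 ^ i) powr (- alpha))))"
  unfolding c using Kq_pos by (simp only: mult.assoc) simp
 moreover have "real (card ?I) * ?t <= 3 * 2 ^ i * (A * (A * (2 ^ i) powr (- alpha)))"
  unfolding c using t by (intro mult_left_mono) auto
 ultimately have "sqrt Kq * (2 * sqrt Kp * sqrt (real (card ?I)) * sqrt (real (card ?J)) * ?t) + (real (card ?I) * ?t + real (card ?I) * ?t)
   <= sqrt Kq * (2 * sqrt Kp * (2 * 2 ^ i) * (A * (A * (2 ^ i) powr (- alpha)))) + 2 * (3 * 2 ^ i * (A * (A * (2 ^ i) powr (- alpha))))" by linarith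
 also have "... = (4 * sqrt Kq * sqrt Kp + 6) * A^2 * (2 ^ i * (2 ^ i) powr (- alpha))" by (simp add: power2_eq_square algebra_simps)
 finally have le: "sqrt Kq * (2 * sqrt Kp * sqrt (real (card ?I)) * sqrt (real (card ?J)) * ?t) + (real (card ?I) * ?t + real (card ?I) * ?t)
   <= (4 * sqrt Kq * sqrt Kp + 6) * A^2 * (2 ^ i * (2 ^ i) powr (- alpha))" .
 have eq: "(%e. blk (band_term b i) tau i 0 e - chaos b tau i e) = (%e. (?V e - (SUM t:?J. (SUM s:?I. b s t * X s e) * cexp {?c..} (X t) e) - cexp {?c..} ?V e)
   + (cexp {?c..} ?V e - (LINT e|S. ?V e)))"
  unfolding blk_band_term[OF b order_refl] V R by (rule ext) simp
 show ?thesis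
  unfolding eq by (rule Lq_le_mono[OF Lq_le_add[OF V1 Lq_le_diff[OF V2 V3 q(2)] q(2)] le q(3)])
qed

lemma cell_tail_exists:
 assumes eta: "0 < eta" and kappa: "0 < kappa"
 shows "EX C. cell_tail eta kappa C"
proof -
 obtain Cc where Cc: "chaos_tail eta kappa Cc" using chaos_tail_exists[OF eta kappa] by blast
 have Cc0: "0 <= Cc" using Cc by (simp add: chaos_tail_def)
 define C4 where "C4 = (4 * sqrt Kq * sqrt Kp + 6) * A^2"
 have C4: "0 <= C4" using Kq_pos Kp_pos by (simp add: C4_def)
 define C where "C = (2 * C4) powr (p / 2) + C3 powr (p / 2) + 2 * Cc + Cc * 2 powr p"
 have C: "0 <= C" "(2 * C4) powr (p / 2) <= C" "C3 powr (p / 2) <= C" "2 * Cc <= C" "Cc <= C" "Cc * 2 powr p <= C" using Cc0 by (auto simp: C_def)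
 have q: "0 < p / 2" using p by simp
 have "cell_tail eta kappa C"
  unfolding cell_tail_def
 proof (intro conjI allI impI C(1))
  fix T :: real and b :: "int => int => real" and i :: nat and tau :: int and z :: real
  assume T: "1 <= T" and i: "2 ^ (i + 2) <= T^2" and b: "band b i" and lag: "i = 0 \<or> (ALL s t. b s t ~= 0 --> 2 * 2 ^ i <= t - s)" and z: "0 < z"
   and gap: "C * (real (i + 3))^2 * 2 ^ i * T powr (2 * eta) <= z"
  let ?u = "2 ^ i * (2 ^ i :: real) powr (- alpha)"
  let ?b = "blk (band_term b i) tau i 0" and ?c = "chaos b tau i"
  let ?r = "((real (i + 3))^2 * T powr eta / z) powr p * chaos_scale i"
  have r0: "0 <= ?r" by (simp add: chaos_scale_nonneg)
  have bm: "?b : borel_measurable S"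
  proof -
   have "qform X b {tau - 4 * 2 ^ i..<tau + 2 ^ i} {tau..<tau + 2 ^ i} : borel_measurable S" by (rule qform_measurable[OF X])
   from borel_measurable_diff[OF this borel_measurable_const] show ?thesis
    by (rule subst[where P="%f. f : borel_measurable S", rotated]) (rule ext, rule blk_band_term[OF b order_refl, symmetric])
  qed
  show "\<P>(e in S. z <= \<bar>?b e\<bar>)
    <= C * (?u / z) powr (p / 2) + C * ((real (i + 3))^2 * T powr eta / z) powr p * chaos_scale i + C * T powr (- kappa)"
  proof (cases "i = 0")
   case True
   have "Lq_le S (p / 2) (blk (band_term b i) (tau + int 0 * 2 ^ i) i 0) (C3 * 2 ^ i)"
    using band_family[OF b order_refl, of tau] by (auto simp: multiscale_family_def)
   then have "Lq_le S (p / 2) (?b) (C3 * ?u)" using True by simp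
   from S.Lq_le_Markov[OF this q z] have "\<P>(e in S. z <= \<bar>?b e\<bar>) <= (C3 * (?u / z)) powr (p / 2)" by simp
   also have "... = C3 powr (p / 2) * (?u / z) powr (p / 2)" by (rule powr_mult)
   also have "... <= C * (?u / z) powr (p / 2)" by (intro mult_right_mono C(3)) auto
   also have "... <= C * (?u / z) powr (p / 2) + (C * ?r + C * T powr (- kappa))" using C(1) r0 by simp
   finally show ?thesis by (simp only: add.assoc mult.assoc)
  next
   case False
   then have lag': "2 * 2 ^ i <= t - s" if "b s t ~= 0" for s t using lag that by blast
   note H = cell_decoupled[OF b lag', folded C4_def, of tau]
   have b1: "\<bar>b s t\<bar> <= 1" for s t using b by (simp add: band_def)
   have cm: "?c : borel_measurable S"
   proof -
    have [measurable]: "X t : borel_measurable S" for t by (rule causal_family_measurable[OF X])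
    show ?thesis unfolding chaos_def[abs_def] by measurable
   qed
   have [measurable]: "?b : borel_measurable S" "?c : borel_measurable S" by (fact bm, fact cm)
   have z2: "0 < z / 2" using z by simp
   have "\<P>(e in S. z <= \<bar>?b e\<bar>)
     <= S.prob ({e:space S. z / 2 <= \<bar>?b e - ?c e\<bar>} Un {e:space S. z / 2 <= \<bar>?c e\<bar>})"
   proof (rule S.finite_measure_mono, rule subsetI)
    fix e assume e: "e : {e:space S. z <= \<bar>?b e\<bar>}"
    have "x <= \<bar>u\<bar> ==> x / 2 <= \<bar>u - v\<bar> \<or> x / 2 <= \<bar>v\<bar>" for x u v :: real by linarith
    from this[of z "?b e" "?c e"] e
    show "e : {e:space S. z / 2 <= \<bar>?b e - ?c e\<bar>} Un {e:space S. z / 2 <= \<bar>?c e\<bar>}" by blast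
   qed measurable
   also have "... <= \<P>(e in S. z / 2 <= \<bar>?b e - ?c e\<bar>) + \<P>(e in S. z / 2 <= \<bar>?c e\<bar>)" by (rule measure_Un_le) measurable
   also have "... <= (C4 * ?u / (z / 2)) powr (p / 2) + (Cc * ((real (i + 3))^2 * T powr eta / (z / 2)) powr p * chaos_scale i + Cc * T powr (- kappa))"
   proof (rule add_mono)
    show "\<P>(e in S. z / 2 <= \<bar>?b e - ?c e\<bar>) <= (C4 * ?u / (z / 2)) powr (p / 2)" by (rule S.Lq_le_Markov[OF H q z2])
    have b0: "ALL s t. tau - 2 ^ i <= s --> t < tau + 2 ^ i --> b s t = 0"
    proof (intro allI impI)
     fix s t assume "tau - 2 ^ i <= s" "t < tau + 2 ^ i"
     then show "b s t = 0" using lag'[of s t] by (cases "b s t = 0") auto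
    qed
    have "2 * Cc * (real (i + 3))^2 * 2 ^ i * T powr (2 * eta) <= C * (real (i + 3))^2 * 2 ^ i * T powr (2 * eta)"
     using C(4) by (intro mult_right_mono) auto
    then have g: "Cc * (real (i + 3))^2 * 2 ^ i * T powr (2 * eta) <= z / 2" using gap by linarith
    show "\<P>(e in S. z / 2 <= \<bar>?c e\<bar>) <= Cc * ((real (i + 3))^2 * T powr eta / (z / 2)) powr p * chaos_scale i + Cc * T powr (- kappa)"
     by (rule Cc[unfolded chaos_tail_def, THEN conjunct2, rule_format, OF T i _ _ z2 g]) (use b1 b0 in auto)
   qed
   also have "(C4 * ?u / (z / 2)) powr (p / 2) = (2 * C4) powr (p / 2) * (?u / z) powr (p / 2)" by (subst powr_mult[symmetric]) (simp add: field_simps)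
   also have "Cc * ((real (i + 3))^2 * T powr eta / (z / 2)) powr p * chaos_scale i = (Cc * 2 powr p) * ?r"
   proof -
    have "(real (i + 3))^2 * T powr eta / (z / 2) = 2 * ((real (i + 3))^2 * T powr eta / z)" by simp
    then show ?thesis by (simp only: powr_mult mult.assoc)
   qed
   also have "(2 * C4) powr (p / 2) * (?u / z) powr (p / 2) + (Cc * 2 powr p * ?r + Cc * T powr (- kappa))
     <= C * (?u / z) powr (p / 2) + (C * ?r + C * T powr (- kappa))"
    using C r0 by (intro add_mono mult_right_mono) auto
   finally show ?thesis by (simp only: add.assoc mult.assoc)
  qed
 qed
 then show ?thesis by blast
qed

end

section \<open>The tail of one block\<close>

lemma index_le_powr:
 assumes "0 < (eta::real)"
 shows "\<exists>K\<ge>1. ALL i T. 2 ^ i <= (T::real) --> real (i + 3) <= K * T powr eta"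
proof -
 define x where "x = 2 powr eta - (1::real)"
 have "(2::real) powr 0 < 2 powr eta" using assms by (intro powr_less_mono) auto
 then have x: "0 < x" by (simp add: x_def)
 show ?thesis
 proof (intro exI[of _ "3 + 1 / x"] conjI allI impI)
  fix i and T :: real assume T: "2 ^ i <= T"
  have "1 + real i * x <= (1 + x) ^ i" using x by (intro Bernoulli_inequality) auto
  also have "... = (2 ^ i) powr eta" by (simp add: pow2_powr x_def)
  also have "... <= T powr eta" using T assms by (intro powr_mono2) auto
  finally have "(3 + 1 / x) * (1 + real i * x) <= (3 + 1 / x) * T powr eta" using x by (intro mult_left_mono) auto
  moreover have "(3 + 1 / x) * (1 + real i * x) = real (i + 3) + 1 / x + 3 * (real i * x)" using x by (simp add: field_simps)
  moreover have "0 <= 1 / x" "0 <= 3 * (real i * x)" using x by auto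
  ultimately show "real (i + 3) <= (3 + 1 / x) * T powr eta" by linarith
 qed (use x in auto)
qed

text \<open>The dependence on \<open>T\<close> and \<open>B\<close> of the final bound, up to the factor \<open>T * x powr (- p / 2)\<close>.\<close>

definition block_factor :: "real => real => real => real => real => real" where
 "block_factor p alpha beta T B = T powr (p / 4 - 1 - alpha * beta * p / 2) * B powr (p / 4) + B powr (p / 2 - 1 - alpha * beta * p / 2) + 1"

lemma block_factor_ge:
 "T powr (p / 4 - 1 - alpha * beta * p / 2) * B powr (p / 4) <= block_factor p alpha beta T B"
 "B powr (p / 2 - 1 - alpha * beta * p / 2) <= block_factor p alpha beta T B"
 "1 <= block_factor p alpha beta T B"
 unfolding block_factor_def by simp_all

text \<open>The exchange of scales behind the shape of the bound.  Divided by the last factor on the right, the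
 left-hand side is a power of the scale \<open>rho\<close> times \<open>r powr (p / 4)\<close>.  If the exponent of \<open>rho\<close> is
 nonnegative, \<open>rho = T\<close> and \<open>r = B\<close> are worst, which gives the first term of \<open>block_factor\<close>;
 otherwise \<open>rho = r\<close> is, and then \<open>r = B\<close> or \<open>r = 1\<close>, which gives the other two.\<close>

lemma powr_scales_le:
 assumes p: "4 < p" and r: "1 <= r" "r <= rho" "rho <= T" "r <= B"
 shows "rho powr (- 1) * (rho * r) powr (p / 4) * rho powr (- alpha * p / 2)
  <= block_factor p alpha beta T B * rho powr (- (alpha * p * (1 - beta) / 2))"
proof -
 let ?e = "p / 4 - 1 - alpha * beta * p / 2"
 have "rho powr (- 1) * (rho * r) powr (p / 4) * rho powr (- alpha * p / 2)
   = (rho powr (- 1) * rho powr (p / 4) * rho powr (- alpha * p / 2)) * r powr (p / 4)"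
  using r by (simp add: powr_mult)
 also have "rho powr (- 1) * rho powr (p / 4) * rho powr (- alpha * p / 2) = rho powr ?e * rho powr (- (alpha * p * (1 - beta) / 2))"
  unfolding powr_add[symmetric] by (rule arg_cong2[where f="(powr)", OF refl]) (simp add: field_simps)
 also have "rho powr ?e * rho powr (- (alpha * p * (1 - beta) / 2)) * r powr (p / 4) = (rho powr ?e * r powr (p / 4)) * rho powr (- (alpha * p * (1 - beta) / 2))"
  by simp
 also have "... <= block_factor p alpha beta T B * rho powr (- (alpha * p * (1 - beta) / 2))"
 proof (rule mult_right_mono)
  show "rho powr ?e * r powr (p / 4) <= block_factor p alpha beta T B"
  proof (cases "0 <= ?e")
   case True
   then have "rho powr ?e * r powr (p / 4) <= T powr ?e * B powr (p / 4)" using r p by (intro mult_mono powr_mono2) auto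
   then show ?thesis using block_factor_ge(1) by (rule order_trans)
  next
   case False
   then have "rho powr ?e * r powr (p / 4) <= r powr ?e * r powr (p / 4)" using r by (intro mult_right_mono powr_mono2') auto
   also have "... = r powr (p / 2 - 1 - alpha * beta * p / 2)"
    unfolding powr_add[symmetric] by (rule arg_cong2[where f="(powr)", OF refl]) simp
   also have "... <= block_factor p alpha beta T B"
   proof (cases "0 <= p / 2 - 1 - alpha * beta * p / 2")
    case True
    then have "r powr (p / 2 - 1 - alpha * beta * p / 2) <= B powr (p / 2 - 1 - alpha * beta * p / 2)" using r by (intro powr_mono2) auto
    then show ?thesis using block_factor_ge(2) by (rule order_trans)
   next
    case False
    then have "r powr (p / 2 - 1 - alpha * beta * p / 2) <= r powr 0" using r by (intro powr_mono) auto
    then show ?thesis using r block_factor_ge(3)[of p alpha beta T B] by simp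
   qed
   finally show ?thesis .
  qed
 qed simp
 finally show ?thesis .
qed

lemma powr_le_block_factor:
 assumes p: "4 < p" and alpha: "0 < alpha" and beta: "0 < beta" "beta < 1" and r: "1 <= rho" "rho <= 4 * B" "1 <= B"
 shows "rho powr (p / 2 - 1 - alpha * p) <= 4 powr (p / 2) * block_factor p alpha beta T B"
proof -
 let ?e = "p / 2 - 1 - alpha * beta * p / 2"
 have "alpha * p * (beta / 2) <= alpha * p * 1" using alpha p beta by (intro mult_left_mono) auto
 then have "p / 2 - 1 - alpha * p <= ?e" by (simp add: mult_ac)
 then have "rho powr (p / 2 - 1 - alpha * p) <= rho powr ?e" using r by (intro powr_mono) auto
 also have "... <= 4 powr (p / 2) * block_factor p alpha beta T B"
 proof (cases "0 <= ?e")
  case True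
  then have "rho powr ?e <= (4 * B) powr ?e" using r by (intro powr_mono2) auto
  also have "... = 4 powr ?e * B powr ?e" by (rule powr_mult)
  also have "... <= 4 powr (p / 2) * block_factor p alpha beta T B"
  proof (intro mult_mono block_factor_ge(2) powr_mono)
   have "0 <= alpha * beta * p" using alpha beta p by simp
   then show "?e <= p / 2" by simp
  qed auto
  finally show ?thesis .
 next
  case False
  then have "rho powr ?e <= rho powr 0" using r by (intro powr_mono) auto
  also have "... = 1 * 1" using r by simp
  also have "... <= 4 powr (p / 2) * block_factor p alpha beta T B" using p by (intro mult_mono block_factor_ge(3) ge_one_powr_ge_zero) auto
  finally show ?thesis .
 qed
 finally show ?thesis .
qed

context dependent_process
begin

text \<open>Proportional to the length of the block, so that the bounds of all blocks add up to that of
 \<open>{1..T}\<close>.\<close>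

definition block_unit :: "real => real => nat => real => real => real" where
 "block_unit beta T l B z = 2 ^ l * z powr (- (p / 2)) * block_factor p alpha beta T B"

lemma block_unit_nonneg: "0 <= block_unit beta T l B z" using block_factor_ge(3)[of p alpha beta T B] by (simp add: block_unit_def)

lemma scale_term_le:
 assumes ij: "i <= j" "j <= l" and T: "2 ^ j <= T" and B: "2 ^ i <= B" and z: "0 < z" "0 < w"
  and theta: "0 <= theta" "theta * p <= alpha * p * (1 - beta) / 4"
 shows "2 ^ (l - j) * (sqrt (2 ^ i * 2 ^ j) * (2 ^ j) powr (- alpha) * (2 ^ j) powr theta / (w * (2 ^ i) powr (- theta) * z)) powr (p / 2)
  <= w powr (- (p / 2)) * block_unit beta T l B z * (2 ^ j) powr (- (alpha * p * (1 - beta) / 4))"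
proof -
 define r rho :: real where "r = 2 ^ i" and "rho = 2 ^ j"
 have r: "1 <= r" "r <= rho" "rho <= T" "r <= B" "1 <= rho" using ij T B by (auto simp: r_def rho_def)
 define s where "s = sqrt (r * rho) * rho powr (- alpha)"
 have s: "0 <= s" using r by (simp add: s_def)
 have inner: "s * rho powr theta / (w * r powr (- theta) * z) <= (1 / w) * (1 / z) * (s * (rho powr theta * rho powr theta))"
 proof -
  have "s * rho powr theta / (w * r powr (- theta) * z) = (1 / w) * (1 / z) * (s * (rho powr theta * r powr theta))"
   using z r by (simp add: powr_minus field_simps)
  also have "... <= (1 / w) * (1 / z) * (s * (rho powr theta * rho powr theta))" using z r s theta by (intro mult_left_mono powr_mono2) auto
  finally show ?thesis .
 qed
 have sp: "s powr (p / 2) = (rho * r) powr (p / 4) * rho powr (- alpha * p / 2)"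
 proof -
  have "sqrt (r * rho) = (rho * r) powr (1 / 2)" using r by (simp add: powr_half_sqrt mult.commute)
  then show ?thesis by (simp add: s_def powr_mult powr_powr)
 qed
 have l: "(2::real) ^ (l - j) = 2 ^ l * rho powr (- 1)" using ij by (simp add: rho_def power_diff powr_minus divide_inverse)
 have "2 ^ (l - j) * (s * rho powr theta / (w * r powr (- theta) * z)) powr (p / 2) <= 2 ^ (l - j) * ((1 / w) * (1 / z) * (s * (rho powr theta * rho powr theta))) powr (p / 2)"
  using z s p by (intro mult_left_mono powr_mono2 inner) auto
 also have "((1 / w) * (1 / z) * (s * (rho powr theta * rho powr theta))) powr (p / 2) = w powr (- (p / 2)) * z powr (- (p / 2)) * (s powr (p / 2) * rho powr (theta * p))"
 proof -
  have "(rho powr theta * rho powr theta) powr (p / 2) = rho powr (theta * p)" by (simp add: powr_powr flip: powr_add)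
  moreover have "(1 / x) powr (p / 2) = x powr (- (p / 2))" if "0 < x" for x using that by (simp add: powr_divide powr_minus_divide)
  ultimately show ?thesis using z by (simp only: powr_mult)
 qed
 also have "2 ^ (l - j) * (w powr (- (p / 2)) * z powr (- (p / 2)) * (s powr (p / 2) * rho powr (theta * p)))
   = w powr (- (p / 2)) * (2 ^ l * z powr (- (p / 2))) * ((rho powr (- 1) * (rho * r) powr (p / 4) * rho powr (- alpha * p / 2)) * rho powr (theta * p))"
  unfolding l sp by (simp only: mult_ac)
 also have "... <= w powr (- (p / 2)) * (2 ^ l * z powr (- (p / 2))) * ((block_factor p alpha beta T B * rho powr (- (alpha * p * (1 - beta) / 2))) * rho powr (theta * p))"
  using powr_scales_le[OF p r(1-4), of alpha beta] by (intro mult_left_mono mult_right_mono) auto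
 also have "... = w powr (- (p / 2)) * block_unit beta T l B z * (rho powr (- (alpha * p * (1 - beta) / 2) + theta * p))"
  by (simp only: block_unit_def powr_add mult_ac)
 also have "... <= w powr (- (p / 2)) * block_unit beta T l B z * rho powr (- (alpha * p * (1 - beta) / 4))"
  using r theta block_unit_nonneg by (intro mult_left_mono powr_mono mult_nonneg_nonneg) auto
 finally show ?thesis by (simp add: s_def r_def rho_def)
qed

lemma chaos_scale_le:
 assumes il: "i <= l" and B: "2 ^ i <= B" and beta: "0 < beta" "beta < 1"
 shows "2 ^ (l - i) * chaos_scale i <= real (i + 3) * (4 * 2 ^ l * (2 ^ i) powr (p / 2) * (4 powr (p / 2) * block_factor p alpha beta T B))"
proof -
 have "2 ^ (l - i) * (2 ^ (i + 2 - j) * ((2 ^ j) powr (- alpha) * sqrt (2 ^ (i + j))) powr p)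
   <= 4 * 2 ^ l * (2 ^ i) powr (p / 2) * (4 powr (p / 2) * block_factor p alpha beta T B)" if j: "j <= i + 2" for j
 proof -
  define rho :: real where "rho = 2 ^ j"
  have rho: "1 <= rho" by (simp add: rho_def)
  have B1: "1 <= B" using B order_trans[OF _ B, of 1] by simp
  have "rho <= 2 ^ (i + 2)" unfolding rho_def using j by (intro power_increasing) auto
  then have rho4: "rho <= 4 * B" using B by (simp add: power_add)
  have l: "(2::real) ^ (l - i) * 2 ^ (i + 2 - j) = 4 * 2 ^ l * rho powr (- 1)"
   using il j by (simp add: rho_def power_diff powr_minus divide_inverse power_add)
  have "((2 ^ j) powr (- alpha) * sqrt (2 ^ (i + j))) powr p = (2 ^ i) powr (p / 2) * (rho powr (- alpha * p) * rho powr (p / 2))"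
  proof -
   have "sqrt (2 ^ (i + j)) = (2 ^ i * rho) powr (1 / 2)" by (simp add: powr_half_sqrt rho_def power_add)
   then show ?thesis by (simp add: powr_mult powr_powr rho_def)
  qed
  then have "2 ^ (l - i) * (2 ^ (i + 2 - j) * ((2 ^ j) powr (- alpha) * sqrt (2 ^ (i + j))) powr p)
    = (4 * 2 ^ l * rho powr (- 1)) * ((2 ^ i) powr (p / 2) * (rho powr (- alpha * p) * rho powr (p / 2)))"
   unfolding l[symmetric] by (simp only: mult.assoc)
  also have "... = 4 * 2 ^ l * (2 ^ i) powr (p / 2) * (rho powr (- 1) * rho powr (- alpha * p) * rho powr (p / 2))" by (simp only: mult_ac)
  also have "rho powr (- 1) * rho powr (- alpha * p) * rho powr (p / 2) = rho powr (p / 2 - 1 - alpha * p)"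
   unfolding powr_add[symmetric] by (simp add: algebra_simps)
  also have "4 * 2 ^ l * (2 ^ i) powr (p / 2) * rho powr (p / 2 - 1 - alpha * p) <= 4 * 2 ^ l * (2 ^ i) powr (p / 2) * (4 powr (p / 2) * block_factor p alpha beta T B)"
   by (intro mult_left_mono powr_le_block_factor[OF p alpha beta rho rho4 B1]) auto
  finally show ?thesis .
 qed
 then have "(\<Sum>j\<le>i + 2. 2 ^ (l - i) * (2 ^ (i + 2 - j) * ((2 ^ j) powr (- alpha) * sqrt (2 ^ (i + j))) powr p))
   <= (\<Sum>j\<le>i + 2. 4 * 2 ^ l * (2 ^ i) powr (p / 2) * (4 powr (p / 2) * block_factor p alpha beta T B))" by (intro sum_mono) auto
 also have "... = real (i + 3) * (4 * 2 ^ l * (2 ^ i) powr (p / 2) * (4 powr (p / 2) * block_factor p alpha beta T B))"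
  unfolding sum_constant by (simp only: card_atMost) simp
 finally show ?thesis unfolding chaos_scale_def sum_distrib_left .
qed

text \<open>Lags of order \<open>i\<close> receive the share \<open>w * (2 ^ i) powr (- theta)\<close> of the level, and their tail decays
 geometrically in \<open>i\<close> up to a negative power of \<open>T\<close>.  Hence the bounds can be summed
 over the orders \<open>i\<close>.\<close>

definition class_tail :: "real => real => real => real => real => real => bool" where
 "class_tail beta eta theta w kappa C \<longleftrightarrow> 0 <= C & (ALL T b i l B tau z. 4 <= T --> 2 ^ l <= T --> i <= l --> 2 ^ i <= B --> band b i -->
   i = 0 \<or> (ALL s t. b s t ~= 0 --> 2 * 2 ^ i <= t - s) --> 0 < z --> C * sqrt (2 ^ l * B) * T powr eta <= z -->
   \<P>(e in S. w * (2 ^ i) powr (- theta) * z <= \<bar>blk (band_term b i) tau l 0 e\<bar>)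
    <= C * (block_unit beta T l B z * ((2 ^ i) powr (- (alpha * p * (1 - beta) / 8)) + T powr (- (eta / 10))) + T powr (- kappa)))"

lemma class_tail_exists:
 assumes beta: "0 < beta" "beta < 1" and eta: "0 < eta" and theta: "0 < theta" "theta <= eta / 10" "theta * p <= alpha * p * (1 - beta) / 4"
  and w: "0 < w" and kappa: "0 < kappa"
 shows "EX C. class_tail beta eta theta w kappa C"
proof -
 define eta1 where "eta1 = eta / 10"
 have eta1: "0 < eta1" "eta = 10 * eta1" using eta by (auto simp: eta1_def)
 define nu where "nu = alpha * p * (1 - beta) / 8"
 have nu: "0 < nu" using alpha p beta by (simp add: nu_def)
 have kappa1: "0 < kappa + 1" using kappa by simp
 obtain c Cb where Cb: "band_tail eta1 theta (kappa + 1) c Cb" using band_tail_exists[OF eta1(1) theta(1) kappa1] by blast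
 obtain Cc where Cc: "cell_tail eta1 (kappa + 1) Cc" using cell_tail_exists[OF eta1(1) kappa1] by blast
 obtain K where K: "1 <= K" "!!i T. 2 ^ i <= (T::real) ==> real (i + 3) <= K * T powr eta1" using index_le_powr[OF eta1(1)] by blast
 have c: "0 < c" "c <= 1" "0 <= Cb" "0 <= Cc" using Cb Cc by (auto simp: band_tail_def cell_tail_def)
 define G where "G = 1 / (1 - 2 powr (- nu) :: real)"
 have "(2::real) powr (- nu) <= 2 powr 0" using nu by (intro powr_mono) auto
 then have G: "0 <= G" by (simp add: G_def)
 define y where "y = K^2 / (c * w)"
 have y: "0 < y" using K c w by (simp add: y_def)
 define C5 where "C5 = Cc * y powr p * K * (4 * 4 powr (p / 2))"
 have C5: "0 <= C5" using c K by (simp add: C5_def)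
 define a1 a2 where "a1 = Cb * w powr (- (p / 2)) * G" and "a2 = Cc * (c * w) powr (- (p / 2))"
 have nn: "0 <= a1" "0 <= a2" "0 <= Cb / w" "0 <= Cc * y" using c G w y by (auto simp: a1_def a2_def)
 define C where "C = a1 + a2 + C5 + Cb + Cc + 1 + Cb / w + Cc * y"
 have C: "0 <= C" "1 <= C" "a1 + a2 <= C" "C5 <= C" "Cb + Cc <= C" "Cb / w <= C" "Cc * y <= C" using c(3,4) C5 nn by (auto simp: C_def)
 have "class_tail beta eta theta w kappa C"
  unfolding class_tail_def
 proof (intro conjI allI impI C(1))
  fix T :: real and b :: "int => int => real" and i l :: nat and B :: real and tau :: int and z :: real
  assume T4: "4 <= T" and l: "2 ^ l <= T" and il: "i <= l" and iB: "2 ^ i <= B" and b: "band b i"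
   and lag: "i = 0 \<or> (ALL s t. b s t ~= 0 --> 2 * 2 ^ i <= t - s)" and z: "0 < z" and gap: "C * sqrt (2 ^ l * B) * T powr eta <= z"
  have T: "1 <= T" using T4 by simp
  let ?zi = "w * (2 ^ i) powr (- theta) * z"
  let ?A = "%j. (sqrt (2 ^ i * 2 ^ j) * (2 ^ j) powr (- alpha) * (2 ^ j) powr theta / ?zi) powr (p / 2)" and ?D = "((real (i + 3))^2 * T powr eta1 / (c * ?zi)) powr p" and ?P = "\<P>(e in S. ?zi <= \<bar>blk (band_term b i) tau l 0 e\<bar>)"
  let ?U = "block_unit beta T l B z"
  have U0: "0 <= ?U" by (rule block_unit_nonneg)
  have iT: "2 ^ i <= T" using il by (intro order_trans[OF power_increasing l]) auto
  have zi: "0 < ?zi" using w z by simp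
  have zi_ge: "w * T powr (- theta) * z <= ?zi" using w z theta iT by (intro mult_right_mono mult_left_mono powr_mono2') auto
  have il2: "(2::real) ^ i <= 2 ^ l" using il by (intro power_increasing) auto
  have ri: "sqrt (2 ^ i * 2 ^ l) <= sqrt (2 ^ l * B)" "2 ^ i <= sqrt (2 ^ l * B)"
  proof -
   show "sqrt (2 ^ i * 2 ^ l) <= sqrt (2 ^ l * B)" using iB by (simp add: mult.commute)
   show "2 ^ i <= sqrt (2 ^ l * B)" using il2 iB by (intro real_le_rsqrt) (auto simp: power2_eq_square intro!: mult_mono)
  qed
  have Zfac: "T powr a * R <= T powr (- theta) * z" if "R <= C * sqrt (2 ^ l * B)" "a + theta <= eta" "0 <= R" for a R
  proof -
   have "T powr a * R = T powr (- theta) * (T powr (a + theta) * R)" by (simp add: mult.assoc[symmetric] flip: powr_add)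
   also have "... <= T powr (- theta) * (T powr eta * (C * sqrt (2 ^ l * B)))" using that T by (intro mult_left_mono mult_mono powr_mono) auto
   also have "... <= T powr (- theta) * z" using gap by (intro mult_left_mono) (auto simp: mult_ac)
   finally show ?thesis .
  qed
  have g1: "Cb * sqrt (2 ^ i * 2 ^ l) * T powr (eta1 + theta) <= ?zi"
  proof -
   have "T powr (eta1 + theta) * (Cb / w * sqrt (2 ^ i * 2 ^ l)) <= T powr (- theta) * z"
   proof (rule Zfac)
    show "Cb / w * sqrt (2 ^ i * 2 ^ l) <= C * sqrt (2 ^ l * B)" using C(6) nn(3) ri C(1) by (intro mult_mono) auto
    show "eta1 + theta + theta <= eta" using theta eta1 by simp
   qed (use c w in auto)
   then have "w * (T powr (eta1 + theta) * (Cb / w * sqrt (2 ^ i * 2 ^ l))) <= w * (T powr (- theta) * z)" using w by (intro mult_left_mono) auto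
   also have "... = w * T powr (- theta) * z" by (simp only: mult.assoc)
   also note zi_ge
   finally show ?thesis using w by (simp add: mult_ac)
  qed
  have K3: "real (i + 3) <= K * T powr eta1" by (rule K(2)[OF iT])
  have K3s: "(real (i + 3))^2 <= K^2 * T powr (2 * eta1)"
  proof -
   have "(real (i + 3))^2 <= (K * T powr eta1)^2" using K3 by (intro power_mono) auto
   also have "... = K^2 * (T powr eta1 * T powr eta1)" by (simp add: power_mult_distrib power2_eq_square)
   also have "T powr eta1 * T powr eta1 = T powr (2 * eta1)" unfolding powr_add[symmetric] by simp
   finally show ?thesis .
  qed
  have g2: "Cc * (real (i + 3))^2 * 2 ^ i * T powr (2 * eta1) <= c * ?zi"
  proof -
   have "T powr (4 * eta1) * (Cc * y * 2 ^ i) <= T powr (- theta) * z"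
   proof (rule Zfac)
    show "Cc * y * 2 ^ i <= C * sqrt (2 ^ l * B)" using C(7) nn(4) ri C(1) by (intro mult_mono) auto
    show "4 * eta1 + theta <= eta" using theta eta1 by simp
   qed (use nn in auto)
   then have "c * w * (T powr (4 * eta1) * (Cc * y * 2 ^ i)) <= c * w * (T powr (- theta) * z)" using c w by (intro mult_left_mono) auto
   also have "... <= c * ?zi" using mult_left_mono[OF zi_ge, of c] c by (simp only: mult.assoc)
   finally have "c * w * (T powr (4 * eta1) * (Cc * y * 2 ^ i)) <= c * ?zi" .
   moreover have "c * w * (T powr (4 * eta1) * (Cc * y * 2 ^ i)) = Cc * (K^2 * T powr (2 * eta1)) * 2 ^ i * T powr (2 * eta1)"
   proof -
    have "c * w * y = K^2" using c w by (simp add: y_def)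
    moreover have "T powr (4 * eta1) = T powr (2 * eta1) * T powr (2 * eta1)" unfolding powr_add[symmetric] by simp
    moreover have "c * w * (t * t * (Cc * y * R)) = Cc * (c * w * y * t) * R * t" for t R by (simp only: mult_ac)
    ultimately show ?thesis by (simp only:)
   qed
   moreover have "Cc * (real (i + 3))^2 * 2 ^ i * T powr (2 * eta1) <= Cc * (K^2 * T powr (2 * eta1)) * 2 ^ i * T powr (2 * eta1)"
    using K3s c by (intro mult_right_mono mult_left_mono) auto
   ultimately show ?thesis by linarith
  qed
  have m1: "?P
    <= Cb * (SUM j:{i..l}. 2 ^ (l - j) * ?A j)
     + (SUM k<2 ^ (l - i). \<P>(e in S. c * ?zi <= \<bar>blk (band_term b i) (tau + int k * 2 ^ i) i 0 e\<bar>))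
     + Cb * T powr (- (kappa + 1))"
   using Cb[unfolded band_tail_def, THEN conjunct2, THEN conjunct2, THEN conjunct2, rule_format, OF T l il b zi g1] .
  have n4: "(2 ^ j :: real) powr (- (alpha * p * (1 - beta) / 4)) = (2 ^ j) powr (- nu) * (2 ^ j) powr (- nu)" for j
   unfolding powr_add[symmetric] by (rule arg_cong2[where f="(powr)", OF refl]) (simp add: nu_def)
  have p1: "(SUM j:{i..l}. 2 ^ (l - j) * ?A j)
    <= w powr (- (p / 2)) * G * (?U * (2 ^ i) powr (- nu))"
  proof -
   have "2 ^ (l - j) * ?A j
     <= w powr (- (p / 2)) * ?U * ((2 ^ i) powr (- nu) * (2 ^ j) powr (- nu))" if j: "j : {i..l}" for j
   proof -
    have jT: "2 ^ j <= T" using j by (intro order_trans[OF power_increasing l]) auto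
    have "2 ^ (l - j) * ?A j
      <= w powr (- (p / 2)) * ?U * (2 ^ j) powr (- (alpha * p * (1 - beta) / 4))"
     using j theta by (intro scale_term_le[OF _ _ jT iB z w]) auto
    also have "... <= w powr (- (p / 2)) * ?U * ((2 ^ i) powr (- nu) * (2 ^ j) powr (- nu))"
     unfolding n4 using j nu U0 by (intro mult_left_mono mult_right_mono powr_mono2' power_increasing mult_nonneg_nonneg) auto
    finally show ?thesis .
   qed
   then have "(SUM j:{i..l}. 2 ^ (l - j) * ?A j)
     <= (SUM j:{i..l}. w powr (- (p / 2)) * ?U * ((2 ^ i) powr (- nu) * (2 ^ j) powr (- nu)))" by (rule sum_mono)
   also have "... = w powr (- (p / 2)) * (?U * (2 ^ i) powr (- nu)) * (SUM j:{i..l}. (2 ^ j) powr (- nu))" by (simp add: sum_distrib_left mult_ac)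
   also have "... <= w powr (- (p / 2)) * (?U * (2 ^ i) powr (- nu)) * G"
    unfolding G_def using U0 by (intro mult_left_mono sum_pow2_powr_le nu mult_nonneg_nonneg) auto
   finally show ?thesis by (simp only: mult_ac)
  qed
  have cell: "\<P>(e in S. c * ?zi <= \<bar>blk (band_term b i) tau' i 0 e\<bar>)
    <= Cc * (2 ^ i * (2 ^ i) powr (- alpha) / (c * ?zi)) powr (p / 2)
     + Cc * ?D * chaos_scale i + Cc * T powr (- (kappa + 1))" for tau'
  proof -
   have "(2::real) ^ (i + 2) <= T^2" using mult_mono[OF iT T4] T by (simp add: power_add power2_eq_square)
   moreover have "0 < c * ?zi" using c zi by simp
   ultimately show ?thesis using Cc[unfolded cell_tail_def, THEN conjunct2, rule_format, OF T _ b _ _ g2] lag by blast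
  qed
  have q1: "2 ^ (l - i) * (2 ^ i * (2 ^ i) powr (- alpha) / (c * ?zi)) powr (p / 2) <= (c * w) powr (- (p / 2)) * (?U * (2 ^ i) powr (- nu))"
  proof -
   have th1: "1 <= (2 ^ i :: real) powr theta" using theta by (intro ge_one_powr_ge_zero) auto
   have "2 ^ i * (2 ^ i) powr (- alpha) * 1 <= 2 ^ i * (2 ^ i :: real) powr (- alpha) * (2 ^ i) powr theta" by (intro mult_left_mono th1) auto
   then have "(2 ^ i * (2 ^ i) powr (- alpha) / (c * ?zi)) powr (p / 2) <= (sqrt (2 ^ i * 2 ^ i) * (2 ^ i) powr (- alpha) * (2 ^ i) powr theta / ((c * w) * (2 ^ i) powr (- theta) * z)) powr (p / 2)"
    using c w z p by (intro powr_mono2) (auto simp: mult.assoc intro!: divide_right_mono)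
   then have "2 ^ (l - i) * (2 ^ i * (2 ^ i) powr (- alpha) / (c * ?zi)) powr (p / 2) <= 2 ^ (l - i) * (sqrt (2 ^ i * 2 ^ i) * (2 ^ i) powr (- alpha) * (2 ^ i) powr theta / ((c * w) * (2 ^ i) powr (- theta) * z)) powr (p / 2)"
    by (intro mult_left_mono) auto
   also have "... <= (c * w) powr (- (p / 2)) * ?U * (2 ^ i) powr (- (alpha * p * (1 - beta) / 4))"
    using c w theta by (intro scale_term_le[OF _ il iT iB z]) auto
   also have "... <= (c * w) powr (- (p / 2)) * ?U * (2 ^ i) powr (- nu)"
    using nu U0 by (intro mult_left_mono powr_mono mult_nonneg_nonneg) (auto simp: nu_def)
   finally show ?thesis by (simp only: mult.assoc)
  qed
  have q2: "Cc * ?D * (2 ^ (l - i) * chaos_scale i) <= C5 * (?U * T powr (- eta1))"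
  proof -
   have "(real (i + 3))^2 * T powr eta1 / (c * ?zi) <= (K^2 * T powr (2 * eta1)) * T powr eta1 / (c * (w * T powr (- theta) * z))"
    using K3s zi_ge c w z T by (intro frac_le mult_right_mono mult_left_mono) auto
   also have "... = y * (T powr (3 * eta1 + theta) / z)"
   proof -
    have "T powr (3 * eta1 + theta) = T powr (2 * eta1) * T powr eta1 * T powr theta" by (simp flip: powr_add)
    then show ?thesis using c w z T by (simp add: y_def powr_minus field_simps)
   qed
   finally have "?D <= (y * (T powr (3 * eta1 + theta) / z)) powr p" using p c zi by (intro powr_mono2) auto
   also have "... = y powr p * (T powr (p * (3 * eta1 + theta)) * (z powr (- (p / 2)) * z powr (- (p / 2))))"
   proof -
    have "z powr (- (p / 2)) * z powr (- (p / 2)) = 1 / z powr p" unfolding powr_add[symmetric] by (simp add: powr_minus_divide)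
    moreover have "(T powr (3 * eta1 + theta) / z) powr p = T powr (p * (3 * eta1 + theta)) * (1 / z powr p)"
     using z by (simp add: powr_divide powr_powr mult.commute)
    ultimately show ?thesis by (simp only: powr_mult)
   qed
   finally have e1: "?D <= y powr p * (T powr (p * (3 * eta1 + theta)) * (z powr (- (p / 2)) * z powr (- (p / 2))))" .
   have e2: "(2 ^ i) powr (p / 2) * z powr (- (p / 2)) <= T powr (- (eta * (p / 2)))"
   proof -
    have "2 ^ i * T powr eta <= C * sqrt (2 ^ l * B) * T powr eta" using mult_mono[OF C(2) ri(2)] C(1) by (intro mult_right_mono) auto
    also note gap
    finally have "(2 ^ i * T powr eta) powr (p / 2) <= z powr (p / 2)" using p by (intro powr_mono2) auto
    then have "(2 ^ i) powr (p / 2) * T powr (eta * (p / 2)) <= z powr (p / 2)" by (simp add: powr_mult powr_powr)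
    then show ?thesis using z T by (simp add: powr_minus field_simps)
   qed
   have ex: "T powr (p * (3 * eta1 + theta)) * T powr (- (eta * (p / 2))) * T powr eta1 <= T powr (- eta1)"
   proof -
    have "p * (3 * eta1 + theta) <= p * (4 * eta1)" using p theta eta1 by (intro mult_left_mono) auto
    moreover have "4 * eta1 <= p * eta1" using p eta1 by (intro mult_right_mono) auto
    moreover have "p * (3 * eta1 + theta) + - (eta * (p / 2)) + eta1 = (p * (3 * eta1 + theta) - p * (4 * eta1)) + (4 * eta1 - p * eta1) - 3 * eta1"
     unfolding eta1(2) by (simp add: algebra_simps)
    ultimately have "p * (3 * eta1 + theta) + - (eta * (p / 2)) + eta1 <= - eta1" using eta1(1) by linarith
    then show ?thesis unfolding powr_add[symmetric] using T by (intro powr_mono) auto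
   qed
   let ?m = "4 * 4 powr (p / 2)"
   define F where "F = 2 ^ l * block_factor p alpha beta T B"
   have F0: "0 <= F" using block_factor_ge(3)[of p alpha beta T B] by (simp add: F_def)
   have "2 ^ (l - i) * chaos_scale i <= real (i + 3) * (4 * 2 ^ l * (2 ^ i) powr (p / 2) * (4 powr (p / 2) * block_factor p alpha beta T B))"
    by (rule chaos_scale_le[OF il iB beta])
   also have "... = real (i + 3) * ((2 ^ i) powr (p / 2) * F) * ?m" by (simp only: F_def mult_ac)
   also have "... <= (K * T powr eta1) * ((2 ^ i) powr (p / 2) * F) * ?m" using K3 F0 by (intro mult_right_mono mult_nonneg_nonneg) auto
   finally have e3: "2 ^ (l - i) * chaos_scale i <= (K * T powr eta1) * ((2 ^ i) powr (p / 2) * F) * ?m" .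
   have "Cc * ?D * (2 ^ (l - i) * chaos_scale i)
     <= Cc * (y powr p * (T powr (p * (3 * eta1 + theta)) * (z powr (- (p / 2)) * z powr (- (p / 2))))) * ((K * T powr eta1) * ((2 ^ i) powr (p / 2) * F) * ?m)"
    using c chaos_scale_nonneg[of i] by (intro mult_mono[OF mult_left_mono[OF e1 c(4)] e3]) auto
   also have "... = C5 * (z powr (- (p / 2)) * F) * (T powr (p * (3 * eta1 + theta)) * ((2 ^ i) powr (p / 2) * z powr (- (p / 2))) * T powr eta1)"
    by (simp only: C5_def mult_ac)
   also have "... <= C5 * (z powr (- (p / 2)) * F) * (T powr (p * (3 * eta1 + theta)) * T powr (- (eta * (p / 2))) * T powr eta1)"
    using e2 C5 F0 by (intro mult_left_mono mult_right_mono mult_nonneg_nonneg) auto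
   also have "... <= C5 * (z powr (- (p / 2)) * F) * T powr (- eta1)" using C5 F0 by (intro mult_left_mono ex mult_nonneg_nonneg) auto
   finally show ?thesis by (simp only: block_unit_def F_def mult_ac)
  qed
  have Tkappa: "T * T powr (- (kappa + 1)) = T powr (- kappa)"
  proof -
   have "T powr 1 * T powr (- (kappa + 1)) = T powr (- kappa)" unfolding powr_add[symmetric] by simp
   then show ?thesis using T by simp
  qed
  have liT: "(2::real) ^ (l - i) <= T" by (rule order_trans[OF power_increasing l]) auto
  have q3: "2 ^ (l - i) * (Cc * T powr (- (kappa + 1))) <= Cc * T powr (- kappa)"
   using mult_right_mono[OF liT, of "Cc * T powr (- (kappa + 1))"] c Tkappa by (simp add: mult_ac)
  have q4: "Cb * T powr (- (kappa + 1)) <= Cb * T powr (- kappa)" using T c by (intro mult_left_mono powr_mono) auto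
  have p2: "(SUM k<2 ^ (l - i). \<P>(e in S. c * ?zi <= \<bar>blk (band_term b i) (tau + int k * 2 ^ i) i 0 e\<bar>))
    <= Cc * (c * w) powr (- (p / 2)) * (?U * (2 ^ i) powr (- nu)) + C5 * (?U * T powr (- eta1)) + Cc * T powr (- kappa)"
  proof -
   let ?x = "Cc * (2 ^ i * (2 ^ i) powr (- alpha) / (c * ?zi)) powr (p / 2)"
   let ?y = "Cc * ?D * chaos_scale i"
   have "(SUM k<2 ^ (l - i). \<P>(e in S. c * ?zi <= \<bar>blk (band_term b i) (tau + int k * 2 ^ i) i 0 e\<bar>))
     <= (SUM k<(2::nat) ^ (l - i). ?x + ?y + Cc * T powr (- (kappa + 1)))" by (intro sum_mono cell)
   also have "... = 2 ^ (l - i) * ?x + 2 ^ (l - i) * ?y + 2 ^ (l - i) * (Cc * T powr (- (kappa + 1)))" by (simp add: distrib_left)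
   also have "2 ^ (l - i) * ?x <= Cc * (c * w) powr (- (p / 2)) * (?U * (2 ^ i) powr (- nu))"
    using mult_left_mono[OF q1, of Cc] c by (simp only: mult_ac)
   also have "2 ^ (l - i) * ?y = Cc * ?D * (2 ^ (l - i) * chaos_scale i)" by (simp only: mult_ac)
   finally show ?thesis using q2 q3 by linarith
  qed
  let ?a = "?U * (2 ^ i) powr (- nu)" and ?b = "?U * T powr (- eta1)" and ?t = "T powr (- kappa)"
  have "?P
    <= Cb * (w powr (- (p / 2)) * G * ?a) + (Cc * (c * w) powr (- (p / 2)) * ?a + C5 * ?b + Cc * ?t) + Cb * ?t"
   using m1 p2 q4 mult_left_mono[OF p1 c(3)] by linarith
  also have "... = (Cb * w powr (- (p / 2)) * G + Cc * (c * w) powr (- (p / 2))) * ?a + C5 * ?b + (Cb + Cc) * ?t" by (simp only: algebra_simps)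
  also have "... <= C * ?a + C * ?b + C * ?t" using U0 by (intro add_mono mult_right_mono C(3-5)[unfolded a1_def a2_def]) auto
  finally show "?P
    <= C * (?U * ((2 ^ i) powr (- (alpha * p * (1 - beta) / 8)) + T powr (- (eta / 10))) + T powr (- kappa))"
   by (simp only: nu_def eta1_def algebra_simps)
 qed
 then show ?thesis by blast
qed

text \<open>The dyadic order of a lag: \<open>0\<close> for lags below \<open>4\<close>, and \<open>i\<close> for lags in
 \<open>[2 * 2 ^ i, 4 * 2 ^ i)\<close>.\<close>

definition lag_order :: "int => nat" where
 "lag_order d = (LEAST i. d < 4 * 2 ^ i)"

lemma lag_order:
 shows "d < 4 * 2 ^ lag_order d" "0 < lag_order d ==> 2 * 2 ^ lag_order d <= d"
proof -
 have "d < 4 * 2 ^ nat d"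
 proof (cases "0 <= d")
  case True
  then have "d = int (nat d)" by simp
  also have "... < 2 ^ nat d" by (rule of_nat_less_two_power)
  finally have "d < 2 ^ nat d" .
  then show ?thesis using zero_le_power[of "2::int" "nat d"] by linarith
 qed simp
 then show "d < 4 * 2 ^ lag_order d" unfolding lag_order_def by (rule LeastI)
 assume "0 < lag_order d"
 then obtain k where k: "lag_order d = Suc k" by (cases "lag_order d") auto
 then have "\<not> d < 4 * 2 ^ k" using not_less_Least[of k "%i. d < 4 * 2 ^ i"] by (simp add: lag_order_def)
 then show "2 * 2 ^ lag_order d <= d" by (simp add: k)
qed

text \<open>The tail of a centered quadratic form over a block of length \<open>2 ^ l\<close>, at levels above the
 standard deviation by a power of \<open>T\<close>.\<close>

definition block_tail :: "real => real => real => real => bool" where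
 "block_tail beta eta kappa C \<longleftrightarrow> 0 <= C & (ALL T a l B tau I z. 4 <= T --> 2 ^ l <= T --> 1 <= B --> B <= 2 ^ l -->
   (ALL s t. \<bar>a s t\<bar> <= 1 & (a s t ~= 0 --> s <= t & t - s <= int B)) --> finite I --> {tau - int B..<tau + 2 ^ l} \<subseteq> I -->
   0 < z --> C * sqrt (2 ^ l * real B) * T powr eta <= z -->
   \<P>(e in S. z <= \<bar>qform X a I {tau..<tau + 2 ^ l} e - (LINT e|S. qform X a I {tau..<tau + 2 ^ l} e)\<bar>)
    <= C * (block_unit beta T l (real B) z + T powr (- kappa)))"

lemma block_tail_exists:
 assumes beta: "0 < beta" "beta < 1" and eta: "0 < eta" and kappa: "0 < kappa"
 shows "EX C. block_tail beta eta kappa C"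
proof -
 define nu where "nu = alpha * p * (1 - beta) / 8"
 have nu: "0 < nu" using alpha p beta by (simp add: nu_def)
 define theta where "theta = min (eta / 10) (2 * nu / p)"
 have theta: "0 < theta" "theta <= eta / 10" using eta nu p by (auto simp: theta_def)
 have thetap: "theta * p <= alpha * p * (1 - beta) / 4"
 proof -
  have "theta * p <= (2 * nu / p) * p" using p by (intro mult_right_mono) (auto simp: theta_def)
  then show ?thesis using p by (simp add: nu_def)
 qed
 define w where "w = 1 - (2::real) powr (- theta)"
 have "(2::real) powr (- theta) < 2 powr 0" using theta by (intro powr_less_mono) auto
 then have w: "0 < w" by (simp add: w_def)
 have kappa1: "0 < kappa + 1" using kappa by simp
 obtain Cx where Cx: "class_tail beta eta theta w (kappa + 1) Cx" using class_tail_exists[OF beta eta theta thetap w kappa1] by blast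
 have Cx0: "0 <= Cx" using Cx by (simp add: class_tail_def)
 have eta10: "0 < eta / 10" using eta by simp
 obtain K where K: "1 <= K" "!!i T. 2 ^ i <= (T::real) ==> real (i + 3) <= K * T powr (eta / 10)" using index_le_powr[OF eta10] by blast
 define G where "G = 1 / (1 - 2 powr (- nu) :: real)"
 have "(2::real) powr (- nu) <= 2 powr 0" using nu by (intro powr_mono) auto
 then have G: "0 <= G" by (simp add: G_def)
 define C where "C = Cx * (G + K) + Cx"
 have C: "0 <= C" "Cx * (G + K) <= C" "Cx <= C" using Cx0 G K by (auto simp: C_def)
 have "block_tail beta eta kappa C"
  unfolding block_tail_def
 proof (intro conjI allI impI C(1))
  fix T :: real and a :: "int => int => real" and l B :: nat and tau :: int and I :: "int set" and z :: real
  assume T4: "4 <= T" and l: "2 ^ l <= T" and B: "1 <= B" "B <= 2 ^ l"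
   and a: "ALL s t. \<bar>a s t\<bar> <= 1 & (a s t ~= 0 --> s <= t & t - s <= int B)"
   and I: "finite I" "{tau - int B..<tau + 2 ^ l} \<subseteq> I"
   and z: "0 < z" and gap: "C * sqrt (2 ^ l * real B) * T powr eta <= z"
  define J where "J = {tau..<tau + 2 ^ l}"
  define I' where "I' = {tau - 4 * 2 ^ l..<tau + 2 ^ l}"
  define N where "N = {i:{..l}. 2 ^ i <= B}"
  define b where "b = (%i s t. if lag_order (t - s) = i then a s t else 0)"
  have fin: "finite I'" "finite J" "finite N" by (auto simp: I'_def J_def N_def)
  have a1: "\<bar>a s t\<bar> <= 1" "a s t ~= 0 ==> s <= t & t - s <= int B" for s t using a by auto
  have bi: "band (b i) i" for i
   unfolding band_def b_def using a1 lag_order(1) by (auto simp: algebra_simps) (smt (verit))+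
  have bl: "i = 0 \<or> (ALL s t. b i s t ~= 0 --> 2 * 2 ^ i <= t - s)" for i using lag_order(2) by (auto simp: b_def split: if_splits)
  have ord: "lag_order (t - s) : N" if nz: "a s t ~= 0" for s t
  proof -
   have "2 ^ lag_order (t - s) <= int B"
   proof (cases "lag_order (t - s) = 0")
    case False
    then have "2 * 2 ^ lag_order (t - s) <= t - s" using lag_order(2)[of "t - s"] by simp
    also have "t - s <= int B" using a1(2)[OF nz] by simp
    finally have "2 * 2 ^ lag_order (t - s) <= int B" .
    moreover have "(2::int) ^ lag_order (t - s) <= 2 * 2 ^ lag_order (t - s)" by simp
    ultimately show ?thesis by (rule order_trans[rotated])
   qed (use B in simp)
   then have le: "2 ^ lag_order (t - s) <= B" by (metis of_nat_le_iff of_nat_numeral of_nat_power)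
   then have "(2::nat) ^ lag_order (t - s) <= 2 ^ l" using B(2) by (rule order_trans)
   then have "lag_order (t - s) <= l" by simp
   with le show ?thesis by (simp add: N_def)
  qed
  have asum: "a s t = (SUM i:N. b i s t)" for s t
  proof (cases "a s t = 0")
   case False
   then show ?thesis using fin ord[OF False] by (simp add: b_def)
  next
   case True
   then have "b i s t = 0" for i by (simp add: b_def)
   then show ?thesis using True by simp
  qed
  have qI: "qform X a I J = qform X a I' J"
  proof -
   have "(2::int) ^ l \<ge> int B" using B(2) by (metis of_nat_le_iff of_nat_numeral of_nat_power)
   then have "tau - 4 * 2 ^ l <= tau - int B" by linarith
   then have sub: "{tau - int B..<tau + 2 ^ l} \<subseteq> I'" by (auto simp: I'_def)
   have z0: "a s t * X s e * X t e = 0" if "t : J" "s ~: {tau - int B..<tau + 2 ^ l}" for s t e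
    using a1(2)[of s t] that by (cases "a s t = 0") (auto simp: J_def)
   have "qform X a Q J = qform X a {tau - int B..<tau + 2 ^ l} J" if "finite Q" "{tau - int B..<tau + 2 ^ l} \<subseteq> Q" for Q
    unfolding qform_def[abs_def] using z0 that by (intro ext sum.cong refl sum.mono_neutral_right) auto
   from this[OF I] this[OF fin(1) sub] show ?thesis by simp
  qed
  have qsum: "qform X a I' J e = (SUM i:N. qform X (b i) I' J e)" for e
  proof -
   have "qform X a I' J e = (SUM t:J. SUM s:I'. SUM i:N. b i s t * X s e * X t e)"
    unfolding qform_def by (subst asum) (simp only: sum_distrib_right)
   also have "... = (SUM t:J. SUM i:N. SUM s:I'. b i s t * X s e * X t e)" by (intro sum.cong refl sum.swap)
   also have "... = (SUM i:N. SUM t:J. SUM s:I'. b i s t * X s e * X t e)" by (rule sum.swap)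
   finally show ?thesis by (simp only: qform_def)
  qed
  have il: "i <= l" if "i : N" for i using that by (simp add: N_def)
  have centered: "qform X a I J e - (LINT e|S. qform X a I J e) = (SUM i:N. blk (band_term (b i) i) tau l 0 e)" for e
  proof -
   have "(LINT e|S. qform X a I' J e) = (SUM i:N. (LINT e|S. qform X (b i) I' J e))"
    unfolding qsum by (rule LINT_sum) (rule qform_integrable[OF fin(1,2)])
   then have "qform X a I J e - (LINT e|S. qform X a I J e) = (SUM i:N. qform X (b i) I' J e - (LINT e|S. qform X (b i) I' J e))"
    unfolding qI by (simp add: sum_subtractf qsum)
   also have "... = (SUM i:N. blk (band_term (b i) i) tau l 0 e)"
    using blk_band_term[OF bi il, where tau=tau and d=0 and e=e] by (intro sum.cong refl) (simp add: I'_def J_def)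
   finally show ?thesis .
  qed
  have bm: "blk (band_term (b i) i) tau l 0 : borel_measurable S" if "i : N" for i
  proof -
   have "qform X (b i) I' J : borel_measurable S" by (rule qform_measurable[OF X])
   moreover have "blk (band_term (b i) i) tau l 0 = (%e. qform X (b i) I' J e - (LINT e|S. qform X (b i) I' J e))"
    unfolding I'_def J_def by (rule ext) (rule blk_band_term[OF bi il[OF that]])
   ultimately show ?thesis by (simp only:) (rule borel_measurable_diff[OF _ borel_measurable_const])
  qed
  have wsum: "(SUM i:N. w * (2 ^ i) powr (- theta)) <= 1"
  proof -
   have "w * (SUM i:N. (2 ^ i) powr (- theta)) <= w * (1 / w)"
    unfolding w_def using w[unfolded w_def] by (intro mult_left_mono sum_pow2_powr_le[OF theta(1) fin(3)]) auto
   then show ?thesis using w by (simp add: sum_distrib_left)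
  qed
  let ?U = "block_unit beta T l (real B) z"
  have U0: "0 <= ?U" by (rule block_unit_nonneg)
  have gap': "Cx * sqrt (2 ^ l * real B) * T powr eta <= z"
   using gap mult_right_mono[OF mult_right_mono[OF C(3), of "sqrt (2 ^ l * real B)"], of "T powr eta"] by simp
  have each: "\<P>(e in S. w * (2 ^ i) powr (- theta) * z <= \<bar>blk (band_term (b i) i) tau l 0 e\<bar>)
    <= Cx * (?U * ((2 ^ i) powr (- nu) + T powr (- (eta / 10))) + T powr (- (kappa + 1)))" if i: "i : N" for i
  proof -
   have "2 ^ i <= B" using i by (simp add: N_def)
   then have iB: "2 ^ i <= real B" by (metis of_nat_le_iff of_nat_numeral of_nat_power)
   show ?thesis using Cx[unfolded class_tail_def, THEN conjunct2, rule_format, OF T4 l il[OF i] iB bi _ z gap'] bl unfolding nu_def by blast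
  qed
  have T: "1 <= T" using T4 by simp
  have cardN: "real (card N) <= real (l + 1)"
  proof -
   have "card N <= card {..l}" by (rule card_mono) (auto simp: N_def)
   then show ?thesis by simp
  qed
  have n1: "real (card N) * T powr (- (eta / 10)) <= K"
  proof -
   have "real (card N) <= K * T powr (eta / 10)" using cardN K(2)[OF l] by simp
   then have "real (card N) * T powr (- (eta / 10)) <= K * T powr (eta / 10) * T powr (- (eta / 10))" by (intro mult_right_mono) auto
   also have "... = K" using T by (simp add: mult.assoc flip: powr_add)
   finally show ?thesis .
  qed
  have n2: "real (card N) * T powr (- (kappa + 1)) <= T powr (- kappa)"
  proof -
   have "l + 1 <= 2 ^ l" by (induction l) auto
   then have "real (l + 1) <= 2 ^ l" by (metis of_nat_le_iff of_nat_numeral of_nat_power)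
   then have "real (card N) <= T powr 1" using cardN l T by simp
   then have "real (card N) * T powr (- (kappa + 1)) <= T powr 1 * T powr (- (kappa + 1))" by (intro mult_right_mono) auto
   also have "... = T powr (- kappa)" unfolding powr_add[symmetric] by simp
   finally show ?thesis .
  qed
  have "\<P>(e in S. z <= \<bar>SUM i:N. blk (band_term (b i) i) tau l 0 e\<bar>)
    <= (SUM i:N. \<P>(e in S. w * (2 ^ i) powr (- theta) * z <= \<bar>blk (band_term (b i) i) tau l 0 e\<bar>))"
   by (rule prob_le_sum_weighted[OF fin(3) bm wsum z])
  also have "... <= (SUM i:N. Cx * (?U * ((2 ^ i) powr (- nu) + T powr (- (eta / 10))) + T powr (- (kappa + 1))))" by (rule sum_mono) (rule each)
  also have "... = Cx * (?U * ((SUM i:N. (2 ^ i) powr (- nu)) + real (card N) * T powr (- (eta / 10))) + real (card N) * T powr (- (kappa + 1)))"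
   by (simp add: sum_distrib_left[symmetric] sum.distrib)
  also have "... <= Cx * (?U * (G + K) + T powr (- kappa))" using Cx0 U0 sum_pow2_powr_le[OF nu fin(3)] n1 n2 unfolding G_def[symmetric]
   by (intro mult_left_mono add_mono) auto
  also have "... = (Cx * (G + K)) * ?U + Cx * T powr (- kappa)" by (simp only: algebra_simps)
  also have "... <= C * ?U + C * T powr (- kappa)" using U0 by (intro add_mono mult_right_mono C(2,3)) auto
  finally show "\<P>(e in S. z <= \<bar>qform X a I {tau..<tau + 2 ^ l} e - (LINT e|S. qform X a I {tau..<tau + 2 ^ l} e)\<bar>)
    <= C * (?U + T powr (- kappa))"
   unfolding centered[unfolded J_def, symmetric] distrib_left .
 qed
 then show ?thesis by blast
qed

end

section \<open>Independent blocks and truncation\<close>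

lemma exp_le_quadratic:
 fixes u :: real
 assumes "u <= 1"
 shows "exp u <= 1 + u + u^2"
proof (cases "0 <= u")
 case True then show ?thesis using assms by (rule exp_bound)
next
 case False
 then have u: "0 < 1 - u" by simp
 have "1 - u <= exp (- u)" using exp_ge_add_one_self[of "- u"] by simp
 then have "exp u * (1 - u) <= exp u * exp (- u)" by (intro mult_left_mono) auto
 also have "... = 1" by (simp add: exp_minus)
 also have "1 <= (1 + u + u^2) * (1 - u)"
 proof -
  have "u ^ 3 <= 0" using False by (simp add: power_le_zero_eq)
  then show ?thesis by (simp add: algebra_simps power2_eq_square power3_eq_cube)
 qed
 finally show ?thesis using u by (simp add: mult_le_cancel_right)
qed

context innovations
begin

text \<open>Truncation from above keeps the mean nonpositive and makes the exponential moment finite.\<close>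

lemma bernstein_truncated:
 fixes N :: nat
 assumes Ym [measurable]: "!!k. Y k : borel_measurable S"
  and Y: "!!k. k < N ==> Lq_le S 2 (Y k) (v k)" and mean: "!!k. k < N ==> (LINT e|S. Y k e) = 0"
  and dep: "!!k. k < N ==> depends_on (W k) (Y k)" and W: "disjoint_family_on W {..<N}"
  and V: "(SUM k<N. (v k)^2) <= V" "0 < V" and z: "0 < z" and y: "0 <= y" "z * y <= 2 * V"
 shows "\<P>(e in S. z <= (SUM k<N. min (Y k e) y)) <= exp (- (z^2 / (4 * V)))"
proof -
 define h where "h = z / (2 * V)"
 have h: "0 < h" "h * y <= 1" using z V y by (auto simp: h_def field_simps)
 let ?T = "%n e. SUM k<n. min (Y k e) y"
 have one: "(\<integral>\<^sup>+ e. ennreal (exp (h * min (Y k e) y)) \<partial>S) <= ennreal (exp (h^2 * (v k)^2))" if k: "k < N" for k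
 proof -
  have iY: "integrable S (Y k)" by (rule S.Lq_le_integrable(1)[OF Y[OF k]]) simp
  note i2 = Lq_le_integrable_powr[OF Y[OF k]]
  have sq: "\<bar>Y k e\<bar> powr 2 = (Y k e)^2" for e by (cases "Y k e = 0") auto
  have int: "integrable S (%e. 1 + h * Y k e + h^2 * (Y k e)^2)" using iY i2(1) unfolding sq by auto
  have pt: "exp (h * min (Y k e) y) <= 1 + h * Y k e + h^2 * (Y k e)^2" for e
  proof -
   have le: "h * min (Y k e) y <= h * Y k e" using h by (intro mult_left_mono) auto
   have "h * min (Y k e) y <= h * y" using h by (intro mult_left_mono) auto
   from exp_le_quadratic[OF order_trans[OF this h(2)]]
   have "exp (h * min (Y k e) y) <= 1 + h * min (Y k e) y + (h * min (Y k e) y)^2" .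
   moreover have "(min (Y k e) y)^2 <= (Y k e)^2" using y by (auto simp: min_def intro: power_mono)
   then have "(h * min (Y k e) y)^2 <= h^2 * (Y k e)^2" by (simp add: power_mult_distrib mult_left_mono)
   ultimately show ?thesis using le by linarith
  qed
  have "(\<integral>\<^sup>+ e. ennreal (exp (h * min (Y k e) y)) \<partial>S) <= (\<integral>\<^sup>+ e. ennreal (1 + h * Y k e + h^2 * (Y k e)^2) \<partial>S)"
   by (intro nn_integral_mono ennreal_leI pt)
  also have "... = ennreal (LINT e|S. 1 + h * Y k e + h^2 * (Y k e)^2)"
   by (rule nn_integral_eq_integral[OF int]) (intro AE_I2 order_trans[OF exp_ge_zero pt])
  also have "(LINT e|S. 1 + h * Y k e + h^2 * (Y k e)^2) = 1 + h^2 * (LINT e|S. (Y k e)^2)"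
   using iY i2(1) mean[OF k] unfolding sq by (simp add: S.prob_space)
  also have "... <= 1 + h^2 * (v k)^2" using i2(2) Lq_le_nonneg[OF Y[OF k]] unfolding sq by (intro add_left_mono mult_left_mono) auto
  also have "... <= exp (h^2 * (v k)^2)" by (rule exp_ge_add_one_self)
  finally show ?thesis by (simp add: ennreal_leI)
 qed
 have all: "n <= N ==> (\<integral>\<^sup>+ e. ennreal (exp (h * ?T n e)) \<partial>S) <= ennreal (exp (h^2 * (SUM k<n. (v k)^2)))" for n
 proof (induction n)
  case 0 then show ?case by (simp add: S.emeasure_space_1)
 next
  case (Suc n)
  then have n: "n < N" by simp
  have d1: "depends_on (\<Union>k<n. W k) (%e. ennreal (exp (h * ?T n e)))"
  proof (intro depends_on_compose[where h="%x. ennreal (exp (h * x))"] depends_on_sum)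
   fix k assume "k : {..<n}"
   with n have "depends_on (W k) (Y k)" "W k \<subseteq> (\<Union>k<n. W k)" using dep by auto
   then show "depends_on (\<Union>k<n. W k) (%e. min (Y k e) y)" by (intro depends_on_compose[where h="%x. min x y"]) (rule depends_on_mono)
  qed
  have d2: "depends_on (W n) (%e. ennreal (exp (h * min (Y n e) y)))"
   by (rule depends_on_compose[where h="%x. ennreal (exp (h * min x y))", OF dep[OF n]])
  have "W k Int W n = {}" if "k < n" for k using disjoint_family_onD[OF W, of k n] that n by auto
  then have dis: "(\<Union>k<n. W k) Int W n = {}" by blast
  have "(\<integral>\<^sup>+ e. ennreal (exp (h * ?T (Suc n) e)) \<partial>S) = (\<integral>\<^sup>+ e. ennreal (exp (h * ?T n e)) * ennreal (exp (h * min (Y n e) y)) \<partial>S)"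
   by (simp add: distrib_left exp_add ennreal_mult)
  also have "... = (\<integral>\<^sup>+ e. ennreal (exp (h * ?T n e)) \<partial>S) * (\<integral>\<^sup>+ e. ennreal (exp (h * min (Y n e) y)) \<partial>S)"
  proof (rule nn_integral_mult_indep[OF _ _ d1 d2 dis])
   have me: "(%e. ennreal (exp (h * f e))) : borel_measurable S" if "f : borel_measurable S" for f using that by measurable
   show "(%e. ennreal (exp (h * ?T n e))) : borel_measurable S" by (rule me) measurable
   show "(%e. ennreal (exp (h * min (Y n e) y))) : borel_measurable S" by (rule me) measurable
  qed
  also have "... <= ennreal (exp (h^2 * (SUM k<n. (v k)^2))) * ennreal (exp (h^2 * (v n)^2))" using Suc one[OF n] by (intro mult_mono) auto
  finally show ?case by (simp add: distrib_left exp_add ennreal_mult)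
 qed
 let ?E = "{e:space S. z <= ?T N e}"
 have "emeasure S ?E = (\<integral>\<^sup>+ e. indicator ?E e \<partial>S)" by (subst nn_integral_indicator) measurable
 also have "... <= (\<integral>\<^sup>+ e. ennreal (exp (- (h * z))) * ennreal (exp (h * ?T N e)) \<partial>S)"
 proof (rule nn_integral_mono)
  fix e
  show "indicator ?E e <= ennreal (exp (- (h * z))) * ennreal (exp (h * ?T N e))"
  proof (cases "e : ?E")
   case True
   then have "h * z <= h * ?T N e" using h by (intro mult_left_mono) auto
   then have "1 <= exp (- (h * z)) * exp (h * ?T N e)" by (simp flip: exp_add)
   then show ?thesis using True by (simp add: ennreal_mult[symmetric] ennreal_leI flip: ennreal_1)
  qed simp
 qed
 also have "... = ennreal (exp (- (h * z))) * (\<integral>\<^sup>+ e. ennreal (exp (h * ?T N e)) \<partial>S)" by (rule nn_integral_cmult) measurable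
 also have "... <= ennreal (exp (- (h * z))) * ennreal (exp (h^2 * V))"
  using V(1) by (intro mult_left_mono order_trans[OF all[OF order_refl]] ennreal_leI) (auto intro: mult_left_mono)
 also have "... = ennreal (exp (- (z^2 / (4 * V))))"
 proof -
  have "- (h * z) + h^2 * V = - (z^2 / (4 * V))" using V by (simp add: h_def field_simps power2_eq_square)
  then show ?thesis by (simp add: ennreal_mult[symmetric] flip: exp_add)
 qed
 finally show ?thesis by (simp add: S.emeasure_eq_measure)
qed

text \<open>A sum of independent variables is large only if the sum of the truncated variables is, or if
 many variables exceed the truncation level, or if one of them is huge: fewer than \<open>J\<close> exceedances
 below \<open>x / (16 * J)\<close> add up to less than \<open>x / 16\<close>, which is \<open>7 * x / 16 - 3 * x / 8\<close>.\<close>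

lemma independent_sum_tail:
 fixes N :: nat
 assumes Y: "!!k. k < N ==> Lq_le S 2 (Y k) (v k)" and mean: "!!k. k < N ==> (LINT e|S. Y k e) = 0"
  and dep: "!!k. k < N ==> depends_on (W k) (Y k)" and W: "disjoint_family_on W {..<N}"
  and V: "(SUM k<N. (v k)^2) <= V" "0 < V" and x: "0 < x" and y: "0 < y" "3 * x / 8 * y <= 2 * V" and J: "1 <= J"
 shows "\<P>(e in S. 7 * x / 16 <= \<bar>SUM k<N. Y k e\<bar>) <= 2 * (exp (- ((3 * x / 8)^2 / (4 * V)))
   + (SUM k<N. \<P>(e in S. y <= \<bar>Y k e\<bar>)) ^ J + (SUM k<N. \<P>(e in S. x / (16 * real J) <= \<bar>Y k e\<bar>)))"
proof -
 define Z where "Z = (%k. if k < N then Y k else (%_. 0))"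
 have Zm [measurable]: "Z k : borel_measurable S" for k using Y by (auto simp: Z_def dest: Lq_le_measurable)
 let ?p = "%k. \<P>(e in S. y <= \<bar>Z k e\<bar>)" and ?h = "%k. \<P>(e in S. x / (16 * real J) <= \<bar>Z k e\<bar>)"
 have main: "\<P>(e in S. 7 * x / 16 <= (SUM k<N. \<sigma> * Z k e)) <= exp (- ((3 * x / 8)^2 / (4 * V))) + (SUM k<N. ?p k) ^ J + (SUM k<N. ?h k)"
  if \<sigma>: "\<sigma> = 1 \<or> \<sigma> = - 1" for \<sigma> :: real
 proof -
  let ?A = "{e:space S. 3 * x / 8 <= (SUM k<N. min (\<sigma> * Z k e) y)}"
  let ?B = "{e:space S. real J <= (SUM k<N. of_bool (y <= \<bar>Z k e\<bar>))}"
  let ?C = "%k. {e:space S. x / (16 * real J) <= \<bar>Z k e\<bar>}"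
  have abs: "\<bar>\<sigma> * u\<bar> = \<bar>u\<bar>" for u using \<sigma> by auto
  have A: "S.prob ?A <= exp (- ((3 * x / 8)^2 / (4 * V)))"
  proof (rule bernstein_truncated[OF _ _ _ _ W V])
   fix k assume k: "k < N"
   show "Lq_le S 2 (%e. \<sigma> * Z k e) (v k)" using Lq_le_cmult[OF Y[OF k], of \<sigma>] \<sigma> k by (auto simp: Z_def)
   show "(LINT e|S. \<sigma> * Z k e) = 0" using mean[OF k] k by (simp add: Z_def)
   show "depends_on (W k) (%e. \<sigma> * Z k e)" using k by (intro depends_on_compose[where h="%x. \<sigma> * x"]) (simp add: Z_def dep)
  qed (use x y in auto)
  have B: "S.prob ?B <= (SUM k<N. ?p k) ^ J"
  proof (rule prob_many_le[OF _ _ W])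
   fix k assume "k < N"
   then show "depends_on (W k) (%e. y <= \<bar>Z k e\<bar>)" by (intro depends_on_compose[where h="%x. y <= \<bar>x\<bar>"]) (simp add: Z_def dep)
  qed measurable
  have sub: "{e:space S. 7 * x / 16 <= (SUM k<N. \<sigma> * Z k e)} \<subseteq> (?A Un ?B) Un (\<Union>k<N. ?C k)"
  proof (rule subsetI, rule ccontr)
   fix e assume e: "e : {e:space S. 7 * x / 16 <= (SUM k<N. \<sigma> * Z k e)}" and no: "e ~: (?A Un ?B) Un (\<Union>k<N. ?C k)"
   let ?w = "x / (16 * real J)"
   have pt: "\<sigma> * Z k e <= min (\<sigma> * Z k e) y + ?w * of_bool (y <= \<bar>Z k e\<bar>)" if "k < N" for k
   proof -
    have "\<bar>Z k e\<bar> < ?w" using no e that by (fastforce simp: not_le)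
    then have "\<sigma> * Z k e < ?w" using abs[of "Z k e"] by linarith
    moreover have "0 <= ?w" using x by simp
    ultimately show ?thesis using abs[of "Z k e"] y by (auto simp: min_def)
   qed
   have "(SUM k<N. \<sigma> * Z k e) <= (SUM k<N. min (\<sigma> * Z k e) y) + ?w * (SUM k<N. of_bool (y <= \<bar>Z k e\<bar>))"
    unfolding sum_distrib_left sum.distrib[symmetric] using pt by (intro sum_mono) auto
   also have "... < 3 * x / 8 + ?w * real J" using no e x J by (intro add_less_le_mono mult_left_mono) auto
   also have "... = 7 * x / 16" using J by (simp add: field_simps)
   finally show False using e by simp
  qed
  have "\<P>(e in S. 7 * x / 16 <= (SUM k<N. \<sigma> * Z k e)) <= S.prob ((?A Un ?B) Un (\<Union>k<N. ?C k))"
   by (rule S.finite_measure_mono[OF sub]) measurable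
  also have "... <= S.prob (?A Un ?B) + S.prob (\<Union>k<N. ?C k)" by (rule measure_Un_le) measurable
  also have "... <= (S.prob ?A + S.prob ?B) + (SUM k<N. ?h k)" by (intro add_mono measure_Un_le S.finite_measure_subadditive_finite) auto
  finally show ?thesis using A B by linarith
 qed
 have "\<P>(e in S. 7 * x / 16 <= \<bar>SUM k<N. Z k e\<bar>)
   <= S.prob ({e:space S. 7 * x / 16 <= (SUM k<N. 1 * Z k e)} Un {e:space S. 7 * x / 16 <= (SUM k<N. (- 1) * Z k e)})"
  by (rule S.finite_measure_mono) (auto simp: sum_negf)
 also have "... <= \<P>(e in S. 7 * x / 16 <= (SUM k<N. 1 * Z k e)) + \<P>(e in S. 7 * x / 16 <= (SUM k<N. (- 1) * Z k e))"
  by (rule measure_Un_le) measurable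
 also have "... <= 2 * (exp (- ((3 * x / 8)^2 / (4 * V))) + (SUM k<N. ?p k) ^ J + (SUM k<N. ?h k))" using main[of 1] main[of "- 1"] by simp
 finally have res: "\<P>(e in S. 7 * x / 16 <= \<bar>SUM k<N. Z k e\<bar>)
   <= 2 * (exp (- ((3 * x / 8)^2 / (4 * V))) + (SUM k<N. ?p k) ^ J + (SUM k<N. ?h k))" .
 have e1: "(SUM k<N. Z k e) = (SUM k<N. Y k e)" for e by (intro sum.cong) (auto simp: Z_def)
 have e2: "(SUM k<N. \<P>(e in S. u <= \<bar>Z k e\<bar>)) = (SUM k<N. \<P>(e in S. u <= \<bar>Y k e\<bar>))" for u
  by (intro sum.cong) (auto simp: Z_def)
 show ?thesis using res unfolding e1 e2 .
qed

lemma proj_sum: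
 assumes "finite I" "!!k. k : I ==> integrable S (f k)"
 shows "AE e in S. proj i (%e. SUM k:I. f k e) e = (SUM k:I. proj i (f k) e)"
proof -
 have "AE e in S. cexp A (%e. SUM k:I. f k e) e = (SUM k:I. cexp A (f k) e)" for A by (rule cexp_sum[OF assms(1)]) (rule assms(2))
 from this[of "{i..}"] this[of "{i + 1..}"] show ?thesis
  unfolding proj_def by eventually_elim (simp add: sum_subtractf)
qed

text \<open>Subtracting the average over the past before \<open>c\<close> removes exactly the martingale differences from
 \<open>c\<close> on.\<close>

lemma proj_forget:
 assumes V: "integrable S V"
 shows "AE e in S. proj i (%e. V e - cexp {c..} V e) e = (if i < c then proj i V e else 0)"
proof -
 have "AE e in S. cexp {j..} (%e. V e - cexp {c..} V e) e = cexp {j..} V e - cexp {max j c..} V e" for j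
 proof -
  have "AE e in S. cexp {j..} (cexp {c..} V) e = cexp {max j c..} V e"
  proof -
   have "{j..} Int {c..} = {max j c..}" by auto
   then show ?thesis using cexp_cexp[OF V, where A="{j..}" and B="{c..}"] by (simp only:)
  qed
  then show ?thesis using cexp_diff[OF V integrable_cexp[OF V, of "{c..}"], of "{j..}"] by eventually_elim simp
 qed
 from this[of i] this[of "i + 1"] show ?thesis
  unfolding proj_def by eventually_elim (auto simp: max_def)
qed

end

context dependent_process
begin

text \<open>The \<open>k\<close>-th block collects the terms whose later index lies in it; the earlier index may precede it by
 the bandwidth.\<close>

definition block_form :: "(int => int => real) => nat => nat => nat => (int => 'e) => real" where
 "block_form a B l k = qform X a {1 + int k * 2 ^ l - int B..<1 + int k * 2 ^ l + 2 ^ l} {1 + int k * 2 ^ l..<1 + int k * 2 ^ l + 2 ^ l}"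

text \<open>Only the innovations of the block and of the one before it are kept, so that any two blocks whose
 numbers differ by at least \<open>2\<close> are independent.\<close>

definition recent_form :: "(int => int => real) => nat => nat => nat => (int => 'e) => real" where
 "recent_form a B l k = cexp {1 + int k * 2 ^ l - 2 ^ l..} (block_form a B l k)"

lemma block_form_integrable: "integrable S (block_form a B l k)"
 unfolding block_form_def by (rule qform_integrable) auto

lemma sum_block_form:
 assumes a: "banded a B" and Q: "finite Q" "finite I" "(UN k:Q. {1 + int k * 2 ^ l - int B..<1 + int k * 2 ^ l + 2 ^ l}) \<subseteq> I"
 shows "(SUM k:Q. block_form a B l k e) = qform X a I (UN k:Q. {1 + int k * 2 ^ l..<1 + int k * 2 ^ l + 2 ^ l}) e"
proof -
 let ?J = "%k. {1 + int k * 2 ^ l..<1 + int k * 2 ^ l + 2 ^ l}"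
 have dis: "?J k Int ?J k' = {}" if "k ~= k'" for k k'
 proof -
  have "?J k Int ?J k' = {}" if "k < k'" for k k'
  proof -
   have "int k * 2 ^ l + 2 ^ l <= int k' * 2 ^ l" using mult_right_mono[of "int k + 1" "int k'" "2 ^ l"] that by (simp add: distrib_right)
   then show ?thesis by auto
  qed
  from this[of k k'] this[of k' k] that show ?thesis by (cases "k < k'") auto
 qed
 have "block_form a B l k e = (SUM t:?J k. SUM s:I. a s t * X s e * X t e)" if k: "k : Q" for k
  unfolding block_form_def qform_def
 proof (rule sum.cong[OF refl], rule sum.mono_neutral_left[OF Q(2)])
  fix t assume t: "t : ?J k"
  show "{1 + int k * 2 ^ l - int B..<1 + int k * 2 ^ l + 2 ^ l} \<subseteq> I" using Q(3) k by auto
  show "ALL s:I - {1 + int k * 2 ^ l - int B..<1 + int k * 2 ^ l + 2 ^ l}. a s t * X s e * X t e = 0"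
  proof
   fix s assume "s : I - {1 + int k * 2 ^ l - int B..<1 + int k * 2 ^ l + 2 ^ l}"
   then have "a s t = 0" using t a[unfolded banded_def, rule_format, of s t] by (cases "a s t = 0") auto
   then show "a s t * X s e * X t e = 0" by simp
  qed
 qed
 then show ?thesis unfolding qform_def by (subst sum.UNION_disjoint) (use Q(1) dis in auto)
qed

text \<open>The total error of restricting every block to recent innovations.  A martingale difference
 at \<open>i\<close> sees only the blocks that begin well after \<open>i\<close>, so the errors of different blocks add up
 like orthogonal variables.\<close>

lemma recent_error_le:
 assumes a: "banded a B" and m: "B + m <= 2 ^ l"
 shows "Lq_le S (p / 2) (%e. SUM k<N. block_form a B l k e - recent_form a B l k e)
  (2 * sqrt Kq * sqrt Kp * A * sqrt (real B + 1) * tail_sum delta m * sqrt (real N * 2 ^ l + real B))"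
proof -
 have q: "2 <= p / 2" "1 <= p / 2" "0 <= p / 2" using p by auto
 let ?V = "block_form a B l" and ?c = "%k. 1 + int k * 2 ^ l - 2 ^ l"
 let ?F = "%e. SUM k<N. ?V k e - recent_form a B l k e"
 define delta' where "delta' = (%k. if m <= k then delta k else 0)"
 have d: "0 <= delta' k" "summable delta'" "tail_sum delta' 0 = tail_sum delta m" for k
 proof -
  show s: "summable delta'" by (rule summable_comparison_test'[OF delta_summable, of 0]) (auto simp: delta'_def delta_nonneg)
  have "(\<Sum>k. delta' k) = (\<Sum>k. delta' (k + m)) + (SUM k<m. delta' k)" by (rule suminf_split_initial_segment[OF s])
  moreover have "(SUM k<m. delta' k) = 0" "delta' (k + m) = delta (k + m)" for k by (auto simp: delta'_def)
  ultimately show "tail_sum delta' 0 = tail_sum delta m" by (simp add: tail_sum_def)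
 qed (auto simp: delta'_def delta_nonneg)
 have lag: "lag_coeff delta t i <= lag_coeff delta' t i" if "i + int m <= t" for t i using that by (auto simp: lag_coeff_def delta'_def nat_le_iff)
 define I J where "I = {1 - int B..<1 + int N * 2 ^ l}" and "J = {1..<1 + int N * 2 ^ l}"
 have fin: "finite I" "finite J" by (auto simp: I_def J_def)
 let ?c2 = "sqrt (real (card I)) + sqrt (real (card J))" and ?l = "%i. (SUM s:I. lag_coeff delta' s i) + (SUM t:J. lag_coeff delta' t i)"
 have blk: "1 + int k * 2 ^ l + 2 ^ l <= 1 + int N * 2 ^ l" if "k < N" for k
  using mult_right_mono[of "int k + 1" "int N" "2 ^ l"] that by (simp add: distrib_right)
 have iV: "integrable S (?V k)" for k by (rule block_form_integrable)
 have iR: "integrable S (recent_form a B l k)" for k unfolding recent_form_def by (rule integrable_cexp[OF iV])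
 define C where "C = sqrt Kp * sqrt (real B + 1) * A"
 have C0: "0 <= C" using Kp_pos A by (simp add: C_def)
 have Vex: "EX b. Lq_le S (p / 2) (?V k) b" for k unfolding block_form_def by (rule qform_ex[OF X2 _ _ q(2)]) auto
 have "EX b. Lq_le S (p / 2) (%e. ?V k e - recent_form a B l k e) b" for k
  using Vex[of k] Lq_le_diff[OF _ Lq_le_cexp[OF _ q(2)] q(2)] unfolding recent_form_def by blast
 then have "EX b. Lq_le S (p / 2) ?F b" by (intro Lq_le_sum_ex q(2)) auto
 then obtain b where b: "Lq_le S (p / 2) ?F b" ..
 have "Lq_le S (p / 2) (%e. ?F e - cexp {1 + int N * 2 ^ l..} ?F e)
   (sqrt (Kq * (C * (tail_sum delta' 0 * ?c2))^2))"
 proof (rule martingale_le[OF q(1) Kq b])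
  fix i
  define Q where "Q = {k:{..<N}. i < ?c k}"
  define I' J' where "I' = {s:I. i + int m <= s}" and "J' = (UN k:Q. {1 + int k * 2 ^ l..<1 + int k * 2 ^ l + 2 ^ l})"
  have Q: "finite Q" by (simp add: Q_def)
  have fin': "finite I'" "finite J'" using fin Q by (auto simp: I'_def J'_def)
  have Bm: "int B + int m <= 2 ^ l" using m by (metis of_nat_add of_nat_le_iff of_nat_numeral of_nat_power)
  have J': "J' \<subseteq> J" "t : J' ==> i + int m <= t" for t
  proof -
   show "J' \<subseteq> J"
   proof
    fix t assume "t : J'"
    then obtain k where k: "k < N" "1 + int k * 2 ^ l <= t" "t < 1 + int k * 2 ^ l + 2 ^ l" by (auto simp: J'_def Q_def)
    have "0 <= int k * 2 ^ l" by simp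
    with k blk[OF k(1)] show "t : J" unfolding J_def atLeastLessThan_iff by linarith
   qed
   show "t : J' ==> i + int m <= t" using Bm by (auto simp: J'_def Q_def)
  qed
  have cover: "(UN k:Q. {1 + int k * 2 ^ l - int B..<1 + int k * 2 ^ l + 2 ^ l}) \<subseteq> I'"
  proof
   fix s assume "s : (UN k:Q. {1 + int k * 2 ^ l - int B..<1 + int k * 2 ^ l + 2 ^ l})"
   then obtain k where k: "k < N" "i < ?c k" and s: "1 + int k * 2 ^ l - int B <= s" "s < 1 + int k * 2 ^ l + 2 ^ l" by (auto simp: Q_def)
   have "0 <= int k * 2 ^ l" by simp
   with k s Bm blk[OF k(1)] show "s : I'" unfolding I'_def I_def mem_Collect_eq atLeastLessThan_iff by linarith
  qed
  have "resample_le (p / 2) (qform X a I' J') i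
    (sqrt Kp * sqrt (real B + 1) * tail_sum delta 0 * ((SUM s:I'. lag_coeff delta s i) + (SUM t:J'. lag_coeff delta t i)))"
   by (rule qform_resample[OF X2 banded_sparse[OF a fin'] q(2) Kp2])
  then have "resample_le (p / 2) (qform X a I' J') i (C * ?l i)"
  proof (rule resample_le_mono[OF _ mult_mono[OF _ add_mono] q(3)])
   show "sqrt Kp * sqrt (real B + 1) * tail_sum delta 0 <= C" using tail0 Kp_pos unfolding C_def by (intro mult_left_mono) auto
   have "(SUM s:I'. lag_coeff delta s i) <= (SUM s:I'. lag_coeff delta' s i)" by (intro sum_mono lag) (simp add: I'_def)
   also have "... <= (SUM s:I. lag_coeff delta' s i)" using fin by (intro sum_mono2 lag_coeff_nonneg d) (auto simp: I'_def)
   finally show "(SUM s:I'. lag_coeff delta s i) <= (SUM s:I. lag_coeff delta' s i)" .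
   have "(SUM s:J'. lag_coeff delta s i) <= (SUM s:J'. lag_coeff delta' s i)" by (intro sum_mono lag J'(2))
   also have "... <= (SUM s:J. lag_coeff delta' s i)" using fin J'(1) by (intro sum_mono2 lag_coeff_nonneg d) auto
   finally show "(SUM s:J'. lag_coeff delta s i) <= (SUM s:J. lag_coeff delta' s i)" .
  qed (use C0 in \<open>auto intro!: add_nonneg_nonneg sum_nonneg lag_coeff_nonneg delta_nonneg\<close>)
  from proj_le[OF this qform_integrable[OF fin'] q(2)]
  have P: "Lq_le S (p / 2) (proj i (qform X a I' J')) (C * ?l i)" .
  have eq: "qform X a I' J' = (%e. SUM k:Q. ?V k e)"
   unfolding J'_def by (rule ext) (rule sum_block_form[OF a Q fin'(1) cover, symmetric])
  have a1: "AE e in S. proj i ?F e = (SUM k<N. proj i (%e. ?V k e - recent_form a B l k e) e)" by (rule proj_sum) (auto intro: iV iR)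
  have a2: "AE e in S. ALL k:{..<N}. proj i (%e. ?V k e - recent_form a B l k e) e = (if i < ?c k then proj i (?V k) e else 0)"
   unfolding recent_form_def by (rule AE_finite_allI[OF finite_lessThan]) (rule proj_forget[OF iV])
  have a3: "AE e in S. proj i (%e. SUM k:Q. ?V k e) e = (SUM k:Q. proj i (?V k) e)" by (rule proj_sum[OF Q iV])
  have ae: "AE e in S. proj i ?F e = proj i (qform X a I' J') e"
   unfolding eq using a1 a2 a3
  proof eventually_elim
   case (elim e)
   have "(SUM k<N. proj i (%e. ?V k e - recent_form a B l k e) e) = (SUM k<N. if i < ?c k then proj i (?V k) e else 0)"
    using elim(2) by (intro sum.cong) auto
   also have "... = (SUM k:Q. proj i (?V k) e)" unfolding Q_def by (rule sum.inter_filter[symmetric]) simp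
   finally show ?case using elim(1,3) by simp
  qed
  show "Lq_le S (p / 2) (proj i ?F) (C * ?l i)" by (rule Lq_le_cong_AE[OF P measurable_proj[OF Lq_le_measurable[OF b]] ae q(3)])
 next
  show "(SUM i:{1 + int N * 2 ^ l - int n..<1 + int N * 2 ^ l}. (C * ?l i)^2)
    <= (C * (tail_sum delta' 0 * ?c2))^2" for n
   by (rule qform_resample_square_sum[OF d(1,2) _ fin C0]) auto
 qed
 moreover have "cexp {1 + int N * 2 ^ l..} ?F e = 0" if e: "e : space S" for e
 proof -
  have dep: "depends_on {..<1 + int N * 2 ^ l} ?F"
  proof (rule depends_on_sum)
   fix k assume "k : {..<N}"
   then have V: "depends_on {..<1 + int N * 2 ^ l} (?V k)"
    unfolding block_form_def using blk[of k] by (intro qform_depends[OF X]) auto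
   show "depends_on {..<1 + int N * 2 ^ l} (%e. ?V k e - recent_form a B l k e)"
    unfolding recent_form_def by (intro depends_on_compose2[where h="(-)"] cexp_depends_inherit V)
  qed
  have "(LINT e|S. ?F e) = 0" using iV iR integral_cexp[OF iV] by (subst LINT_sum) (auto simp: recent_form_def)
  then show ?thesis by (subst cexp_indep[OF dep _ e]) auto
 qed
 ultimately have "Lq_le S (p / 2) ?F (sqrt (Kq * (C * (tail_sum delta' 0 * ?c2))^2))"
  using b by (elim Lq_le_cong_AE[OF _ _ AE_I2 q(3)]) (auto dest: Lq_le_measurable)
 moreover have "sqrt (Kq * (C * (tail_sum delta' 0 * ?c2))^2)
   <= 2 * sqrt Kq * sqrt Kp * A * sqrt (real B + 1) * tail_sum delta m * sqrt (real N * 2 ^ l + real B)"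
 proof -
  have "card I = N * 2 ^ l + B" "card J = N * 2 ^ l" by (simp_all add: I_def J_def nat_add_distrib nat_mult_distrib nat_power_eq)
  then have "?c2 <= 2 * sqrt (real N * 2 ^ l + real B)" by simp
  then have "sqrt Kq * (C * (tail_sum delta m * ?c2)) <= sqrt Kq * (C * (tail_sum delta m * (2 * sqrt (real N * 2 ^ l + real B))))"
   using Kq_pos C0 tail_pow2_0 by (intro mult_left_mono) auto
  moreover have "sqrt (Kq * y^2) = sqrt Kq * y" if "0 <= y" for y using that by (simp add: real_sqrt_mult)
  then have "sqrt (Kq * (C * (tail_sum delta' 0 * ?c2))^2)
    = sqrt Kq * (C * (tail_sum delta m * ?c2))"
   unfolding d(3) using C0 tail_pow2_0 by simp
  ultimately show ?thesis by (simp add: C_def mult_ac)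
 qed
 ultimately show ?thesis by (rule Lq_le_mono[OF _ _ q(3)])
qed

end

section \<open>Assembling the blocks\<close>

context dependent_process
begin

definition C6 where "C6 = 8 * sqrt Kq * sqrt Kp * A^2 * 2 powr alpha"

lemma C6_nonneg: "0 <= C6" using Kp_pos Kq_pos by (simp add: C6_def)

lemma tail_half:
 assumes "1 <= l" shows "tail_sum delta (2 ^ (l - 1)) <= A * 2 powr alpha * (2 ^ l) powr (- alpha)"
proof -
 have "(2::real) ^ l = 2 * 2 ^ (l - 1)" using assms by (simp flip: power_Suc)
 then have "(2 ^ (l - 1)) powr (- alpha) = 2 powr alpha * (2 ^ l :: real) powr (- alpha)" by (simp add: powr_mult powr_minus)
 then show ?thesis using tail_pow2[of "l - 1"] by (simp add: mult_ac)
qed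

lemma block_moments:
 assumes a: "banded a B" and B: "1 <= B" "2 * B <= 2 ^ l"
 shows "Lq_le S (p / 2) (%e. block_form a B l k e - (LINT e|S. block_form a B l k e)) (C6 * sqrt (2 ^ l * real B))"
  and "Lq_le S (p / 2) (%e. block_form a B l k e - recent_form a B l k e) (C6 * sqrt (2 ^ l * real B) * (2 ^ l) powr (- alpha))"
  and "Lq_le S (p / 2) (%e. SUM k<N. block_form a B l k e - recent_form a B l k e)
   (C6 * sqrt (real B * (real N * 2 ^ l + real B)) * (2 ^ l) powr (- alpha))"
proof -
 have q: "2 <= p / 2" "0 <= p / 2" using p by auto
 have l1: "1 <= l" using B by (cases l) auto
 have l2: "(2::nat) ^ l = 2 * 2 ^ (l - 1)" using l1 by (simp flip: power_Suc)
 then have Bm: "B <= 2 ^ (l - 1)" "B + 2 ^ (l - 1) <= 2 ^ l" using B by auto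
 let ?I = "{1 + int k * 2 ^ l - int B..<1 + int k * 2 ^ l + 2 ^ l}" and ?J = "{1 + int k * 2 ^ l..<1 + int k * 2 ^ l + 2 ^ l}"
 have sp: "sparse_coeffs a ?I ?J (real B + 1)" by (rule banded_sparse[OF a]) auto
 have "2 * real B <= 2 ^ l" using B(2) by (metis of_nat_le_iff of_nat_mult of_nat_numeral of_nat_power)
 then have "sqrt (real (card ?I)) <= sqrt (4 * 2 ^ l)" by (simp add: nat_add_distrib nat_power_eq)
 then have c: "sqrt (real (card ?I)) + sqrt (real (card ?J)) <= 3 * sqrt (2 ^ l)" by (simp add: real_sqrt_mult nat_power_eq)
 have "sqrt (real B + 1) <= sqrt (4 * real B)" using B(1) by simp
 then have b: "sqrt (real B + 1) <= 2 * sqrt (real B)" by (simp add: real_sqrt_mult)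
 have A0: "0 < A" using A by simp
 have th: "0 <= tail_sum delta m" for m by (rule tail_pow2_0)
 have le: "sqrt Kq * (sqrt Kp * sqrt (real B + 1) * tail_sum delta 0 * (t * (sqrt (real (card ?I)) + sqrt (real (card ?J)))))
   <= C6 * sqrt (2 ^ l * real B) * rho" if t: "0 <= t" "t <= A * 2 powr alpha * rho" "0 <= rho" for t rho
 proof -
  have "sqrt (real B + 1) * (tail_sum delta 0 * (t * (sqrt (real (card ?I)) + sqrt (real (card ?J)))))
    <= (2 * sqrt (real B)) * (A * ((A * 2 powr alpha * rho) * (3 * sqrt (2 ^ l))))"
   using t b c th tail0 A0 by (intro mult_mono b c mult_nonneg_nonneg add_nonneg_nonneg) auto
  also have "... <= (8 * A^2 * 2 powr alpha) * (sqrt (2 ^ l * real B) * rho)" using t A0 by (simp add: real_sqrt_mult power2_eq_square)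
  finally have "sqrt Kq * sqrt Kp * (sqrt (real B + 1) * (tail_sum delta 0 * (t * (sqrt (real (card ?I)) + sqrt (real (card ?J))))))
    <= sqrt Kq * sqrt Kp * ((8 * A^2 * 2 powr alpha) * (sqrt (2 ^ l * real B) * rho))" using Kq_pos Kp_pos by (intro mult_left_mono) auto
  then show ?thesis by (simp only: C6_def mult_ac)
 qed
 have "1 <= 2 powr alpha" using alpha by (intro ge_one_powr_ge_zero) auto
 then have "A <= A * 2 powr alpha" using A0 by simp
 then have "tail_sum delta 0 <= A * 2 powr alpha * 1" using tail0 by simp
 from Lq_le_mono[OF qform_centered_le[OF X2 sp q(1) Kp2 Kq] le[OF th this] q(2)]
 show "Lq_le S (p / 2) (%e. block_form a B l k e - (LINT e|S. block_form a B l k e)) (C6 * sqrt (2 ^ l * real B))"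
  unfolding block_form_def by simp
 have gap: "1 + int k * 2 ^ l - 2 ^ l + int (2 ^ (l - 1)) <= t" if "t : ?I Un ?J" for t
 proof -
  have "int B + int (2 ^ (l - 1)) <= 2 ^ l" using Bm(2) by (metis of_nat_add of_nat_le_iff of_nat_numeral of_nat_power)
  then show ?thesis using that by auto
 qed
 from Lq_le_mono[OF qform_error_le[OF X2 sp q(1) Kp2 Kq gap] le[OF th tail_half[OF l1]] q(2)]
 show "Lq_le S (p / 2) (%e. block_form a B l k e - recent_form a B l k e) (C6 * sqrt (2 ^ l * real B) * (2 ^ l) powr (- alpha))"
  unfolding block_form_def recent_form_def by simp
 show "Lq_le S (p / 2) (%e. SUM k<N. block_form a B l k e - recent_form a B l k e)
   (C6 * sqrt (real B * (real N * 2 ^ l + real B)) * (2 ^ l) powr (- alpha))"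
 proof (rule Lq_le_mono[OF recent_error_le[OF a Bm(2)] _ q(2)])
  have "sqrt (real B + 1) * tail_sum delta (2 ^ (l - 1)) * sqrt (real N * 2 ^ l + real B)
    <= (2 * sqrt (real B)) * (A * 2 powr alpha * (2 ^ l) powr (- alpha)) * sqrt (real N * 2 ^ l + real B)"
   using b tail_half[OF l1] th by (intro mult_mono mult_right_mono mult_nonneg_nonneg) auto
  from mult_left_mono[OF this, of "2 * sqrt Kq * sqrt Kp * A"]
  have "2 * sqrt Kq * sqrt Kp * A * (sqrt (real B + 1) * tail_sum delta (2 ^ (l - 1)) * sqrt (real N * 2 ^ l + real B))
    <= 2 * sqrt Kq * sqrt Kp * A * ((2 * sqrt (real B)) * (A * 2 powr alpha * (2 ^ l) powr (- alpha)) * sqrt (real N * 2 ^ l + real B))"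
   using Kp_pos Kq_pos A0 by simp
  also have "... = (1 / 2) * (C6 * sqrt (real B * (real N * 2 ^ l + real B)) * (2 ^ l) powr (- alpha))"
   by (simp add: C6_def real_sqrt_mult power2_eq_square)
  also have "... <= C6 * sqrt (real B * (real N * 2 ^ l + real B)) * (2 ^ l) powr (- alpha)" using C6_nonneg by simp
  finally show "2 * sqrt Kq * sqrt Kp * A * sqrt (real B + 1) * tail_sum delta (2 ^ (l - 1)) * sqrt (real N * 2 ^ l + real B)
    <= C6 * sqrt (real B * (real N * 2 ^ l + real B)) * (2 ^ l) powr (- alpha)" by (simp only: mult.assoc)
 qed
qed

text \<open>The factor \<open>24\<close> is \<open>4\<close> (the constant of \<open>mart_step_4\<close>) times \<open>6 / 5\<close> (for \<open>B + 1 \<le> 6 * B / 5\<close>)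
 times \<open>5\<close> (for the squared sum of the roots of the two cardinalities).\<close>

lemma block_variance:
 assumes a: "banded a B" and B: "8 <= B" "2 * B <= 2 ^ l" and X4: "causal_family 4 X delta4" and t4: "tail_sum delta4 0 <= \<Theta>"
 shows "Lq_le S 2 (%e. block_form a B l k e - (LINT e|S. block_form a B l k e)) (sqrt (24 * real B * 2 ^ l * \<Theta> ^ 4))"
proof -
 have X4': "causal_family (2 * 2) X delta4" and K4: "mart_step S (2 * 2) 4" using X4 S.mart_step_4 by simp_all
 let ?I = "{1 + int k * 2 ^ l - int B..<1 + int k * 2 ^ l + 2 ^ l}" and ?J = "{1 + int k * 2 ^ l..<1 + int k * 2 ^ l + 2 ^ l}"
 have sp: "sparse_coeffs a ?I ?J (real B + 1)" by (rule banded_sparse[OF a]) auto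
 let ?u = "real (card ?I)" and ?w = "real (card ?J)" and ?t = "tail_sum delta4 0"
 have t0: "0 <= ?t" using causal_family_delta[OF X4] by (intro tail_sum_nonneg) auto
 have Bl: "2 * real B <= 2 ^ l" using B(2) by (metis of_nat_le_iff of_nat_mult of_nat_numeral of_nat_power)
 have card: "?u = real B + 2 ^ l" "?w = 2 ^ l" by (simp_all add: nat_add_distrib nat_power_eq)
 let ?b = "sqrt 1 * (sqrt 4 * sqrt (real B + 1) * ?t * (?t * (sqrt ?u + sqrt ?w)))"
 have "?b <= sqrt (24 * real B * 2 ^ l * \<Theta> ^ 4)"
 proof (rule real_le_rsqrt)
  have "0 <= (sqrt ?u - sqrt ?w)^2" by simp
  then have "(sqrt ?u + sqrt ?w)^2 <= 2 * (?u + ?w)" unfolding power2_sum power2_diff by simp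
  also have "... <= 5 * 2 ^ l" using Bl by (simp add: card)
  finally have s: "(sqrt ?u + sqrt ?w)^2 <= 5 * 2 ^ l" .
  have t: "?t ^ 4 <= \<Theta> ^ 4" using t4 t0 by (intro power_mono)
  have "?b^2 = 4 * (real B + 1) * ((sqrt ?u + sqrt ?w)^2 * ?t ^ 4)" by (simp add: power_mult_distrib power4_eq_xxxx power2_eq_square)
  also have "... <= 4 * (6 / 5 * real B) * ((5 * 2 ^ l) * \<Theta> ^ 4)" using s t t0 B(1) by (intro mult_mono mult_left_mono) auto
  also have "... = 24 * real B * 2 ^ l * \<Theta> ^ 4" by simp
  finally show "?b^2 <= 24 * real B * 2 ^ l * \<Theta> ^ 4" .
 qed
 from Lq_le_mono[OF qform_centered_le[OF X4' sp order_refl K4 S.mart_step_2] this] show ?thesis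
  unfolding block_form_def by simp
qed

text \<open>The power-law term of the bound without its logarithm and its constant.\<close>

definition tail_unit :: "real => real => real => real => real" where
 "tail_unit beta T B x = x powr (- (p / 2)) *
   ((T * B) powr (p / 4) * T powr (- alpha * beta * p / 2) + T * B powr (p / 2 - 1 - alpha * beta * p / 2) + T)"

lemma moment_le_tail_unit:
 assumes T: "1 <= T" "T powr beta <= L" "0 <= B" and x: "0 < x" and c: "0 <= c" "0 < d" and u: "0 <= u" and n: "1 <= n" "n * u <= T * B"
 shows "n * (c * sqrt u * L powr (- alpha) / (x / d)) powr (p / 2) <= (c * d) powr (p / 2) * tail_unit beta T B x"
proof -
 have L: "L powr (- alpha * (p / 2)) <= T powr (- alpha * beta * p / 2)"
 proof -
  have "L powr (- alpha * (p / 2)) <= (T powr beta) powr (- alpha * (p / 2))" using T alpha p by (intro powr_mono2') auto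
  also have "... = T powr (- alpha * beta * p / 2)" by (simp add: powr_powr mult_ac)
  finally show ?thesis .
 qed
 have nu: "n * u powr (p / 4) <= (T * B) powr (p / 4)"
 proof -
  have "n powr 1 <= n powr (p / 4)" using n p by (intro powr_mono) auto
  then have "n * u powr (p / 4) <= n powr (p / 4) * u powr (p / 4)" using n by (intro mult_right_mono) auto
  also have "... = (n * u) powr (p / 4)" by (rule powr_mult[symmetric])
  also have "... <= (T * B) powr (p / 4)" using n u p by (intro powr_mono2) auto
  finally show ?thesis .
 qed
 have "c * sqrt u * L powr (- alpha) / (x / d) = (c * d) * (u powr (1 / 2) * (L powr (- alpha) * (1 / x)))" using c x u by (simp add: powr_half_sqrt)
 then have "(c * sqrt u * L powr (- alpha) / (x / d)) powr (p / 2) = (c * d) powr (p / 2) * (u powr (p / 4) * (L powr (- alpha * (p / 2)) * x powr (- (p / 2))))"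
  using x by (simp only: powr_mult powr_powr) (simp add: powr_divide powr_minus_divide)
 then have "n * (c * sqrt u * L powr (- alpha) / (x / d)) powr (p / 2) = (c * d) powr (p / 2) * (x powr (- (p / 2)) * ((n * u powr (p / 4)) * L powr (- alpha * (p / 2))))"
  by (simp only: mult_ac)
 also have "... <= (c * d) powr (p / 2) * (x powr (- (p / 2)) * ((T * B) powr (p / 4) * T powr (- alpha * beta * p / 2)))"
  using nu L n by (intro mult_left_mono mult_mono) auto
 also have "... <= (c * d) powr (p / 2) * tail_unit beta T B x"
  unfolding tail_unit_def using T by (intro mult_left_mono) auto
 finally show ?thesis .
qed

lemma block_unit_le_tail_unit:
 assumes T: "1 <= T" "0 <= n" "n * 2 ^ l <= T" and x: "0 < x" and d: "0 < d"
 shows "n * block_unit beta T l B (x / d) <= d powr (p / 2) * tail_unit beta T B x"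
proof -
 have x': "(x / d) powr (- (p / 2)) = d powr (p / 2) * x powr (- (p / 2))" using x d by (simp add: powr_divide powr_minus field_simps)
 have f: "T * block_factor p alpha beta T B = (T * B) powr (p / 4) * T powr (- alpha * beta * p / 2) + T * B powr (p / 2 - 1 - alpha * beta * p / 2) + T"
 proof -
  have "T powr 1 * T powr (p / 4 - 1 - alpha * beta * p / 2) = T powr (p / 4) * T powr (- alpha * beta * p / 2)"
   unfolding powr_add[symmetric] by simp
  then have "T * (T powr (p / 4 - 1 - alpha * beta * p / 2) * B powr (p / 4)) = (T * B) powr (p / 4) * T powr (- alpha * beta * p / 2)"
   using T by (simp add: powr_mult)
  then show ?thesis by (simp add: block_factor_def distrib_left)
 qed
 have "n * block_unit beta T l B (x / d) = (n * 2 ^ l) * ((x / d) powr (- (p / 2)) * block_factor p alpha beta T B)"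
  by (simp only: block_unit_def mult_ac)
 also have "... <= T * ((x / d) powr (- (p / 2)) * block_factor p alpha beta T B)"
  using T block_factor_ge(3)[of p alpha beta T B] by (intro mult_right_mono) auto
 also have "... = d powr (p / 2) * (x powr (- (p / 2)) * (T * block_factor p alpha beta T B))" unfolding x' by (simp only: mult_ac)
 finally show ?thesis by (simp only: f tail_unit_def)
qed

text \<open>What is used of a large \<open>T\<close>, of the block length \<open>2 ^ l\<close> and of the level \<open>x\<close>.  In order: the
 sizes of the block, the level at least of the order of the standard deviation, the truncation level in
 Bernstein's range for the variance bound \<open>V\<close>, and the level above the standard deviation of one
 block by a power of \<open>T\<close>.\<close>

definition admissible :: "real => real => real => nat => nat => nat => real => bool" where
 "admissible beta C V T l B x \<longleftrightarrow> 4 <= T & real T powr beta <= 2 ^ l & 2 ^ l <= 2 * real T powr beta & 2 * 2 ^ l <= real T & 8 <= B & 2 * B <= 2 ^ l &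
   sqrt (real T * real B) <= x & 3 * x / 8 * (x * real T powr (- ((1 - beta) * (p / 4 - 1) / p))) <= 2 * V &
   C * sqrt (2 ^ l * real B) * real T powr ((1 - beta) / 4) <= x"

text \<open>The centered form is the error of averaging plus the sums over the even and over the odd blocks.
 The variances in one of these sums add up to at most \<open>24 * T * B * \<Theta> ^ 4\<close>; the larger
 constant \<open>54\<close> still leaves a Gaussian term that the threshold absorbs.\<close>

theorem quadratic_form_tail:
 assumes beta: "0 < beta" "beta < 1" and X4: "causal_family 4 X delta4" and t4: "tail_sum delta4 0 <= \<Theta>" and \<Theta>: "0 < \<Theta>"
 shows "\<exists>C\<ge>0. ALL T l B a x. admissible beta C (54 * real T * real B * \<Theta> ^ 4) T l B x --> banded a B --> (ALL s t. a s t ~= 0 --> 1 <= s & t <= int T) -->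
   \<P>(e in S. x <= \<bar>qform X a {1..int T} {1..int T} e - (LINT e|S. qform X a {1..int T} {1..int T} e)\<bar>)
    <= 4 * exp (- ((3 * x / 8)^2 / (4 * (54 * real T * real B * \<Theta> ^ 4)))) + C * (tail_unit beta (real T) (real B) x + real T powr (- p))"
proof -
 have q: "2 <= p / 2" "1 <= p / 2" "0 <= p / 2" "0 < p / 2" and p0: "0 < p" using p by auto
 \<comment> \<open>Truncation at \<open>x * T powr (- eta0)\<close>: lowering the level costs a factor \<open>T powr r\<close> in Markov's
  inequality, half of the exponent \<open>2 * r\<close> gained because one block is a small part of
  \<open>{1..T}\<close>.  Then \<open>J\<close> exceedances have probability at most \<open>T powr (- r * J)\<close>, up to a
  constant.\<close>
 define eta0 where "eta0 = (1 - beta) * (p / 4 - 1) / p"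
 define r where "r = (1 - beta) * (p / 4 - 1) / 2"
 have r: "0 < r" "eta0 * (p / 2) = r" using beta p by (auto simp: r_def eta0_def)
 define J where "J = nat \<lceil>p / r\<rceil> + 1"
 have J: "1 <= J" "p <= r * real J"
 proof -
  have "p / r <= real J" by (simp add: J_def) linarith
  then show "p <= r * real J" using r by (simp add: pos_divide_le_eq mult.commute)
 qed (simp add: J_def)
 have pos: "0 < (1 - beta) / 4" "0 < p + 1" using beta p by auto
 obtain Cb where Cb: "block_tail beta ((1 - beta) / 4) (p + 1) Cb" using block_tail_exists[OF beta pos] by blast
 have Cb0: "0 <= Cb" using Cb by (simp add: block_tail_def)
 define d where "d = 32 * real J"
 have d: "0 < d" "x / d + x / d = x / (16 * real J)" for x using J by (auto simp: d_def field_simps)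
 define D1 where "D1 = C6 powr (p / 2) * 2 powr (p / 4 - 1)"
 define D2 where "D2 = Cb * d powr (p / 2) + (C6 * d) powr (p / 2)"
 define C where "C = d * Cb + 4 * (D1 ^ J + D2 + Cb) + (2 * C6 * 8) powr (p / 2)"
 have D: "0 <= D1" "0 <= D2" using Cb0 by (auto simp: D1_def D2_def)
 have C: "0 <= C" "d * Cb <= C" "4 * (D2) + (2 * C6 * 8) powr (p / 2) <= C" "4 * (D1 ^ J + Cb) <= C" using D Cb0 d(1) unfolding C_def by auto
 show ?thesis
 proof (intro exI[of _ C] conjI allI impI C(1))
  fix T l B :: nat and a :: "int => int => real" and x :: real
  define V where "V = 54 * real T * real B * \<Theta> ^ 4"
  assume adm: "admissible beta C (54 * real T * real B * \<Theta> ^ 4) T l B x"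
   and a: "banded a B" and supp: "ALL s t. a s t ~= 0 --> 1 <= s & t <= int T"
  let ?u = "tail_unit beta (real T) (real B) x" and ?Q = "qform X a {1..int T} {1..int T}"
  note h = adm[unfolded admissible_def eta0_def[symmetric] V_def[symmetric]]
  have T4: "4 <= T" and TL: "real T powr beta <= 2 ^ l" "2 ^ l <= 2 * real T powr beta" "2 * 2 ^ l <= real T" and B: "8 <= B" "2 * B <= 2 ^ l"
   and xs: "sqrt (real T * real B) <= x" and xV: "3 * x / 8 * (x * real T powr (- eta0)) <= 2 * V"
   and xC: "C * sqrt (2 ^ l * real B) * real T powr ((1 - beta) / 4) <= x"
   by ((insert h, blast)+)
  have "(0::real) < 2 ^ l" by simp
  then have "2 ^ l <= real T" using TL(3) by linarith
  with T4 have T: "1 <= real T" "0 < real T" "4 <= real T" "2 ^ l <= real T" by simp_all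
  have B1: "1 <= B" "B <= 2 ^ l" using B by auto
  have "0 < sqrt (real T * real B)" using T B1 by simp
  then have x: "0 < x" using xs by (rule less_le_trans)
  have V: "0 < V" using T B1 \<Theta> by (simp add: V_def)
  define N where "N = T div (2 * 2 ^ l) + 1"
  have N: "1 <= N" "real N * 2 ^ l <= real T" "int T <= int (2 * N) * 2 ^ l"
  proof -
   have "T < N * (2 * 2 ^ l)" unfolding N_def using dividend_less_div_times[of "2 * 2 ^ l" T] by simp
   then have "T <= 2 * N * 2 ^ l" by simp
   then have "int T <= int (2 * N * 2 ^ l)" by (simp only: of_nat_le_iff)
   then show "int T <= int (2 * N) * 2 ^ l" by simp
   have "T div (2 * 2 ^ l) * (2 * 2 ^ l) <= T" by simp
   then have "real (T div (2 * 2 ^ l) * (2 * 2 ^ l)) <= real T" by (simp only: of_nat_le_iff)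
   then show "real N * 2 ^ l <= real T" using TL(3) by (simp add: N_def algebra_simps)
  qed (simp add: N_def)
  let ?F = "block_form a B l" and ?G = "recent_form a B l"
  define m where "m = (%k. LINT e|S. ?F k e)"
  define Y where "Y = (%c k e. ?G (2 * k + c) e - m (2 * k + c))"
  have iF: "integrable S (?F k)" for k by (rule block_form_integrable)
  have Fm [measurable]: "?F k : borel_measurable S" and Gm [measurable]: "?G k : borel_measurable S" for k
   using iF[of k] unfolding recent_form_def by (auto intro: measurable_cexp)
  have Gae: "AE e in S. ?G k e - m k = cexp {1 + int k * 2 ^ l - 2 ^ l..} (%e. ?F k e - m k) e" for k
  proof -
   have c: "cexp A (%_. m k) e = m k" for A e by (simp add: cexp_def S.prob_space)
   have "AE e in S. cexp A (%e. ?F k e - m k) e = cexp A (?F k) e - cexp A (%_. m k) e" for A by (rule cexp_diff[OF iF]) simp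
   from this[of "{1 + int k * 2 ^ l - 2 ^ l..}"] show ?thesis unfolding recent_form_def c by eventually_elim simp
  qed
  have Gq: "Lq_le S r' (%e. ?G k e - m k) b" if "Lq_le S r' (%e. ?F k e - m k) b" "1 <= r'" for r' k b
   by (rule Lq_le_cong_AE[OF Lq_le_cexp[OF that(1,2)] borel_measurable_diff[OF Gm borel_measurable_const] Gae]) (use that(2) in simp)
  have Yq: "Lq_le S (p / 2) (Y c k) (C6 * sqrt (2 ^ l * real B))" for c k
   unfolding Y_def m_def using Gq[unfolded m_def, OF block_moments(1)[OF a B1(1) B(2)] q(2)] .
  have Y2: "Lq_le S 2 (Y c k) (sqrt (24 * real B * 2 ^ l * \<Theta> ^ 4))" for c k
   unfolding Y_def m_def using Gq[unfolded m_def, OF block_variance[OF a B X4 t4]] by simp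
  have colour: "\<P>(e in S. 7 * x / 16 <= \<bar>SUM k<N. Y c k e\<bar>)
    <= 2 * (exp (- ((3 * x / 8)^2 / (4 * V))) + D1 ^ J * real T powr (- p) + (D2 * ?u + Cb * real T powr (- p)))" for c
  proof -
   define W where "W = (%k. {1 + int (2 * k + c) * 2 ^ l - 2 ^ l..<1 + int (2 * k + c) * 2 ^ l + 2 ^ l})"
   define y where "y = x * real T powr (- eta0)"
   have y: "0 < y" using x T by (simp add: y_def)
   have dep: "depends_on (W k) (Y c k)" for k
   proof -
    have "depends_on {..<1 + int (2 * k + c) * 2 ^ l + 2 ^ l} (?F (2 * k + c))"
     unfolding block_form_def by (rule qform_depends[OF X]) auto
    then have "depends_on ({1 + int (2 * k + c) * 2 ^ l - 2 ^ l..} Int {..<1 + int (2 * k + c) * 2 ^ l + 2 ^ l}) (?G (2 * k + c))"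
     unfolding recent_form_def by (intro depends_on_Int cexp_depends cexp_depends_inherit)
    moreover have "{1 + int (2 * k + c) * 2 ^ l - 2 ^ l..} Int {..<1 + int (2 * k + c) * 2 ^ l + 2 ^ l} = W k" by (auto simp: W_def)
    ultimately show ?thesis unfolding Y_def by (intro depends_on_compose[where h="%x. x - m (2 * k + c)"]) simp
   qed
   have dis: "disjoint_family_on W {..<N}"
   proof -
    have "W k Int W k' = {}" if "k < k'" for k k'
    proof -
     have "(int (2 * k + c) + 2) * 2 ^ l <= int (2 * k' + c) * 2 ^ l" using that by (intro mult_right_mono) auto
     then show ?thesis by (auto simp: W_def distrib_right)
    qed
    then show ?thesis unfolding disjoint_family_on_def by (metis Int_commute linorder_neqE_nat)
   qed
   have var: "(SUM k<N. (sqrt (24 * real B * 2 ^ l * \<Theta> ^ 4))^2) <= V"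
   proof -
    have "(SUM k<N. (sqrt (24 * real B * 2 ^ l * \<Theta> ^ 4))^2) = 24 * real B * \<Theta> ^ 4 * (real N * 2 ^ l)" using \<Theta> by simp
    also have "... <= 24 * real B * \<Theta> ^ 4 * real T" using N(2) \<Theta> by (intro mult_left_mono) auto
    also have "... <= V" using T \<Theta> by (simp add: V_def)
    finally show ?thesis .
   qed
   have mean: "(LINT e|S. Y c k e) = 0" for k using integral_cexp[OF iF] integrable_cexp[OF iF] by (simp add: Y_def recent_form_def m_def S.prob_space)
   have main: "\<P>(e in S. 7 * x / 16 <= \<bar>SUM k<N. Y c k e\<bar>) <= 2 * (exp (- ((3 * x / 8)^2 / (4 * V)))
     + (SUM k<N. \<P>(e in S. y <= \<bar>Y c k e\<bar>)) ^ J + (SUM k<N. \<P>(e in S. x / (16 * real J) <= \<bar>Y c k e\<bar>)))"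
    by (rule independent_sum_tail[OF Y2 mean dep dis var V x y xV[folded y_def] J(1)])
   have many: "(SUM k<N. \<P>(e in S. y <= \<bar>Y c k e\<bar>)) <= D1 * real T powr (- r)"
   proof -
    have yl: "C6 * sqrt (2 ^ l * real B) / y <= C6 * ((2 ^ l / real T) powr (1 / 2) * real T powr eta0)"
    proof -
     have "C6 * sqrt (2 ^ l * real B) / y <= C6 * sqrt (2 ^ l * real B) / (sqrt (real T * real B) * real T powr (- eta0))"
      unfolding y_def using xs C6_nonneg T B1 x by (intro divide_left_mono mult_right_mono mult_pos_pos) auto
     also have "... = C6 * ((2 ^ l / real T) powr (1 / 2) * real T powr eta0)"
      using T B1 by (simp add: powr_half_sqrt real_sqrt_mult real_sqrt_divide powr_minus field_simps)
     finally show ?thesis .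
    qed
    have each: "\<P>(e in S. y <= \<bar>Y c k e\<bar>) <= C6 powr (p / 2) * ((2 ^ l / real T) powr (p / 4) * real T powr r)" for k
    proof -
     have "\<P>(e in S. y <= \<bar>Y c k e\<bar>) <= (C6 * sqrt (2 ^ l * real B) / y) powr (p / 2)" by (rule S.Lq_le_Markov[OF Yq q(4) y])
     also have "... <= (C6 * ((2 ^ l / real T) powr (1 / 2) * real T powr eta0)) powr (p / 2)" using yl C6_nonneg y q by (intro powr_mono2) auto
     also have "... = C6 powr (p / 2) * ((2 ^ l / real T) powr (p / 4) * real T powr r)" by (simp only: powr_mult powr_powr r(2)) simp
     finally show ?thesis .
    qed
    have "(SUM k<N. \<P>(e in S. y <= \<bar>Y c k e\<bar>)) <= (SUM k<N. C6 powr (p / 2) * ((2 ^ l / real T) powr (p / 4) * real T powr r))"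
     by (intro sum_mono each)
    also have "... = C6 powr (p / 2) * ((real N * (2 ^ l / real T) powr (p / 4)) * real T powr r)" by simp
    also have "... <= C6 powr (p / 2) * ((2 powr (p / 4 - 1) * real T powr (- (2 * r))) * real T powr r)"
    proof (intro mult_left_mono mult_right_mono)
     have s: "(2 ^ l / real T) powr (p / 4) = (2 ^ l / real T) powr 1 * (2 ^ l / real T) powr (p / 4 - 1)" unfolding powr_add[symmetric] by simp
     have "real N * (2 ^ l / real T) powr (p / 4) = (real N * 2 ^ l / real T) * (2 ^ l / real T) powr (p / 4 - 1)"
      unfolding s using T by simp
     also have "... <= 1 * (2 * real T powr (beta - 1)) powr (p / 4 - 1)"
     proof (intro mult_mono powr_mono2)
      show "2 ^ l / real T <= 2 * real T powr (beta - 1)" using TL(2) T by (simp add: powr_diff divide_right_mono)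
     qed (use N T p in auto)
     also have "... = 2 powr (p / 4 - 1) * real T powr (- (2 * r))"
     proof -
      have "2 * ((1 - b) * w / 2) = (1 - b) * w" for b w :: real by simp
      then have "(b - 1) * w = - (2 * ((1 - b) * w / 2))" for b w :: real by (simp only: left_diff_distrib minus_diff_eq)
      then have "(beta - 1) * (p / 4 - 1) = - (2 * r)" unfolding r_def .
      then show ?thesis by (simp only: powr_mult powr_powr mult_1)
     qed
     finally show "real N * (2 ^ l / real T) powr (p / 4) <= 2 powr (p / 4 - 1) * real T powr (- (2 * r))" .
    qed auto
    also have "... = D1 * (real T powr (- (2 * r)) * real T powr r)" by (simp only: D1_def mult_ac)
    also have "real T powr (- (2 * r)) * real T powr r = real T powr (- r)" unfolding powr_add[symmetric] by simp
    finally show ?thesis .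
   qed
   have manyJ: "(SUM k<N. \<P>(e in S. y <= \<bar>Y c k e\<bar>)) ^ J <= D1 ^ J * real T powr (- p)"
   proof -
    have "(SUM k<N. \<P>(e in S. y <= \<bar>Y c k e\<bar>)) ^ J <= (D1 * real T powr (- r)) ^ J" using many by (intro power_mono sum_nonneg) auto
    also have "... = D1 ^ J * real T powr (- r * real J)" using T by (simp add: power_mult_distrib powr_power mult.commute)
    also have "... <= D1 ^ J * real T powr (- p)" using J(2) T D by (intro mult_left_mono powr_mono) auto
    finally show ?thesis .
   qed
   have huge: "(SUM k<N. \<P>(e in S. x / (16 * real J) <= \<bar>Y c k e\<bar>)) <= D2 * ?u + Cb * real T powr (- p)"
   proof -
    let ?R = "(C6 * sqrt (2 ^ l * real B) * (2 ^ l) powr (- alpha) / (x / d)) powr (p / 2)" and ?W = "block_unit beta (real T) l (real B) (x / d)"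
    have one: "\<P>(e in S. x / (16 * real J) <= \<bar>Y c k e\<bar>)
      <= Cb * (?W + real T powr (- (p + 1))) + ?R" for k
    proof -
     let ?k = "2 * k + c"
     have xd: "0 < x / d" using x d by simp
     have "\<P>(e in S. x / (16 * real J) <= \<bar>Y c k e\<bar>)
       <= S.prob ({e:space S. x / d <= \<bar>?F ?k e - m ?k\<bar>} Un {e:space S. x / d <= \<bar>?F ?k e - ?G ?k e\<bar>})"
      unfolding d(2)[symmetric] Y_def by (rule S.finite_measure_mono) auto
     also have "... <= \<P>(e in S. x / d <= \<bar>?F ?k e - m ?k\<bar>) + \<P>(e in S. x / d <= \<bar>?F ?k e - ?G ?k e\<bar>)"
      by (rule measure_Un_le) measurable
     also have "\<P>(e in S. x / d <= \<bar>?F ?k e - ?G ?k e\<bar>) <= ?R" by (rule S.Lq_le_Markov[OF block_moments(2)[OF a B1(1) B(2)] q(4) xd])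
     also have "\<P>(e in S. x / d <= \<bar>?F ?k e - m ?k\<bar>) <= Cb * (?W + real T powr (- (p + 1)))"
     proof -
      have "d * Cb * (sqrt (2 ^ l * real B) * real T powr ((1 - beta) / 4)) <= C * (sqrt (2 ^ l * real B) * real T powr ((1 - beta) / 4))"
       using C(2) by (intro mult_right_mono) auto
      then have "Cb * sqrt (2 ^ l * real B) * real T powr ((1 - beta) / 4) <= x / d" using xC d(1) by (simp add: pos_le_divide_eq mult_ac)
      then show ?thesis unfolding block_form_def m_def
       by (intro Cb[unfolded block_tail_def, THEN conjunct2, rule_format, OF T(3,4) B1 _ _ _ xd]) (use a[unfolded banded_def] in auto)
     qed
     finally show ?thesis by simp
    qed
    have "(SUM k<N. \<P>(e in S. x / (16 * real J) <= \<bar>Y c k e\<bar>))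
      <= (SUM k<N. Cb * (?W + real T powr (- (p + 1))) + ?R)"
     by (intro sum_mono one)
    also have "... = Cb * (real N * ?W + real N * real T powr (- (p + 1)))
      + real N * ?R" by (simp add: algebra_simps)
    also have "... <= Cb * (d powr (p / 2) * ?u + real T powr (- p)) + (C6 * d) powr (p / 2) * ?u"
    proof (intro add_mono mult_left_mono Cb0)
     show "real N * ?W <= d powr (p / 2) * ?u" using N by (intro block_unit_le_tail_unit T x d) auto
     have "1 <= (2::real) ^ l" by simp
     then have "real N * 1 <= real N * 2 ^ l" by (intro mult_left_mono) auto
     then have "real N <= real T powr 1" using N(2) T by simp
     then have "real N * real T powr (- (p + 1)) <= real T powr 1 * real T powr (- (p + 1))" by (intro mult_right_mono) auto
     also have "... = real T powr (- p)" unfolding powr_add[symmetric] by simp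
     finally show "real N * real T powr (- (p + 1)) <= real T powr (- p)" .
     have "real N * 2 ^ l * real B <= real T * real B" using N(2) by (intro mult_right_mono) auto
     then show "real N * ?R <= (C6 * d) powr (p / 2) * ?u" using N(1) by (intro moment_le_tail_unit T TL x C6_nonneg d) (auto simp: mult.assoc)
    qed
    also have "... = D2 * ?u + Cb * real T powr (- p)" by (simp add: D2_def algebra_simps)
    finally show ?thesis .
   qed
   show ?thesis by (rule order_trans[OF main]) (intro mult_left_mono add_mono manyJ huge order_refl, simp)
  qed
  let ?err = "%e. SUM k<2 * N. ?F k e - ?G k e"
  have x8: "0 < x / 8" using x by simp
  have err: "\<P>(e in S. x / 8 <= \<bar>?err e\<bar>) <= (2 * C6 * 8) powr (p / 2) * ?u"
  proof -
   have Bl: "real B <= 2 ^ l" using B1(2) by (metis of_nat_le_iff of_nat_numeral of_nat_power)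
   have "real (2 * N) * 2 ^ l + real B <= 4 * real T" using N(2) Bl T by simp
   from mult_left_mono[OF this, of "real B"] have "real B * (real (2 * N) * 2 ^ l + real B) <= 4 * (real T * real B)" by (simp add: mult_ac)
   then have "sqrt (real B * (real (2 * N) * 2 ^ l + real B)) <= sqrt (4 * (real T * real B))" by (rule real_sqrt_le_mono)
   then have s: "sqrt (real B * (real (2 * N) * 2 ^ l + real B)) <= 2 * sqrt (real T * real B)" by (simp add: real_sqrt_mult)
   have "C6 * sqrt (real B * (real (2 * N) * 2 ^ l + real B)) * (2 ^ l) powr (- alpha) <= C6 * (2 * sqrt (real T * real B)) * (2 ^ l) powr (- alpha)"
    using s C6_nonneg by (intro mult_left_mono mult_right_mono) auto
   from S.Lq_le_Markov[OF Lq_le_mono[OF block_moments(3)[OF a B1(1) B(2)] this q(3)] q(4) x8]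
   have "\<P>(e in S. x / 8 <= \<bar>?err e\<bar>) <= 1 * ((2 * C6) * sqrt (real T * real B) * (2 ^ l) powr (- alpha) / (x / 8)) powr (p / 2)"
    by (simp add: mult_ac)
   also have "... <= (2 * C6 * 8) powr (p / 2) * ?u" using C6_nonneg by (intro moment_le_tail_unit T TL x) auto
   finally show ?thesis .
  qed
  \<comment> \<open>The shares are \<open>x / 8\<close> for the error and \<open>7 * x / 16\<close> for each of the two colours.\<close>
  have dec: "?Q e - (LINT e|S. ?Q e)
    = ?err e + ((SUM k<N. Y 0 k e) + (SUM k<N. Y 1 k e))" for e
  proof -
   define U where "U = (\<Union>k<2 * N. {1 + int k * 2 ^ l..<1 + int k * 2 ^ l + 2 ^ l})"
   define I where "I = (\<Union>k<2 * N. {1 + int k * 2 ^ l - int B..<1 + int k * 2 ^ l + 2 ^ l})"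
   have fin: "finite U" "finite I" by (auto simp: U_def I_def)
   have sub: "{1..int T} \<subseteq> U" "U \<subseteq> I"
   proof
    fix t assume t: "t : {1..int T}"
    define k where "k = nat ((t - 1) div 2 ^ l)"
    have k: "int k = (t - 1) div 2 ^ l" using t by (simp add: k_def pos_imp_zdiv_nonneg_iff)
    have s: "t - 1 = int k * 2 ^ l + (t - 1) mod 2 ^ l" "0 <= (t - 1) mod 2 ^ l" "(t - 1) mod 2 ^ l < 2 ^ l"
     unfolding k by (simp_all only: div_mult_mod_eq) auto
    have "k < 2 * N"
    proof (rule ccontr)
     assume "\<not> k < 2 * N"
     then have "int (2 * N) * 2 ^ l <= int k * 2 ^ l" by (intro mult_right_mono) auto
     then show False using s N(3) t by (simp only: atLeastAtMost_iff) linarith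
    qed
    moreover have "t : {1 + int k * 2 ^ l..<1 + int k * 2 ^ l + 2 ^ l}" using s unfolding atLeastLessThan_iff by linarith
    ultimately show "t : U" unfolding U_def by blast
   qed (auto simp: U_def I_def)
   have z: "t ~: {1..int T} ==> a s t = 0" "s ~: {1..int T} ==> a s t = 0" for s t
    using a[unfolded banded_def, rule_format, of s t] supp[rule_format, of s t] by (cases "a s t = 0"; auto)+
   have Q: "?Q e = (SUM k<2 * N. ?F k e)" for e
   proof -
    have "(SUM k<2 * N. ?F k e) = qform X a I U e" unfolding U_def by (rule sum_block_form[OF a]) (auto simp: I_def)
    also have "... = qform X a I {1..int T} e" unfolding qform_def using sub fin by (intro sum.mono_neutral_right) (auto simp: z)
    also have "... = ?Q e" unfolding qform_def using sub fin by (intro sum.cong refl sum.mono_neutral_right) (auto simp: z)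
    finally show ?thesis by simp
   qed
   have "(LINT e|S. (SUM k<2 * N. ?F k e)) = (SUM k<2 * N. m k)" unfolding m_def by (rule LINT_sum) (rule iF)
   moreover have "(SUM k<N. Y 0 k e) + (SUM k<N. Y 1 k e) = (SUM k<2 * N. ?G k e - m k)" unfolding sum_lessThan_double by (simp add: Y_def sum.distrib)
   ultimately show ?thesis unfolding Q by (simp add: sum_subtractf)
  qed
  have Ym [measurable]: "(%e. SUM k<N. Y c k e) : borel_measurable S" for c unfolding Y_def by measurable
  have Em [measurable]: "?err : borel_measurable S" by measurable
  let ?t = "real T powr (- p)" and ?x = "exp (- ((3 * x / 8)^2 / (4 * V)))"
  have "\<P>(e in S. x <= \<bar>?err e + ((SUM k<N. Y 0 k e) + (SUM k<N. Y 1 k e))\<bar>)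
    <= S.prob ({e:space S. x / 8 <= \<bar>?err e\<bar>} Un ({e:space S. 7 * x / 16 <= \<bar>SUM k<N. Y 0 k e\<bar>} Un {e:space S. 7 * x / 16 <= \<bar>SUM k<N. Y 1 k e\<bar>}))"
  proof (rule S.finite_measure_mono, rule subsetI)
   fix e assume e: "e : {e:space S. x <= \<bar>?err e + ((SUM k<N. Y 0 k e) + (SUM k<N. Y 1 k e))\<bar>}"
   have "x <= \<bar>u + (v + w)\<bar> ==> x / 8 <= \<bar>u\<bar> \<or> 7 * x / 16 <= \<bar>v\<bar> \<or> 7 * x / 16 <= \<bar>w\<bar>" for u v w by linarith
   from this[of "?err e" "SUM k<N. Y 0 k e" "SUM k<N. Y 1 k e"] e
   show "e : {e:space S. x / 8 <= \<bar>?err e\<bar>} Un ({e:space S. 7 * x / 16 <= \<bar>SUM k<N. Y 0 k e\<bar>} Un {e:space S. 7 * x / 16 <= \<bar>SUM k<N. Y 1 k e\<bar>})" by blast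
  qed measurable
  also have "... <= \<P>(e in S. x / 8 <= \<bar>?err e\<bar>) + (\<P>(e in S. 7 * x / 16 <= \<bar>SUM k<N. Y 0 k e\<bar>) + \<P>(e in S. 7 * x / 16 <= \<bar>SUM k<N. Y 1 k e\<bar>))"
   by (intro order_trans[OF measure_Un_le] add_left_mono measure_Un_le) measurable
  also have "... <= 4 * ?x + (4 * D2 + (2 * C6 * 8) powr (p / 2)) * ?u + 4 * (D1 ^ J + Cb) * ?t"
   using err colour[of 0] colour[of 1] by (simp add: algebra_simps)
  also have "... <= 4 * ?x + C * ?u + C * ?t" using C(3,4) T by (intro add_mono order_refl mult_right_mono) (auto simp: tail_unit_def)
  finally show "\<P>(e in S. x <= \<bar>?Q e - (LINT e|S. ?Q e)\<bar>)
    <= 4 * exp (- ((3 * x / 8)^2 / (4 * (54 * real T * real B * \<Theta> ^ 4)))) + C * (?u + ?t)"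
   unfolding dec V_def by (simp only: distrib_left add.assoc)
 qed
qed

end

section \<open>Transfer to the observed process and choice of scales\<close>

lemma Lp_norm_finite_Lq_le:
 assumes "f : borel_measurable M" "Lp_norm M q f < \<infinity>" "0 < q"
 shows "Lq_le M q f (enn2real (Lp_norm M q f))"
proof -
 let ?I = "\<integral>\<^sup>+ x. ennreal (\<bar>f x\<bar> powr q) \<partial>M"
 have I: "?I ~= \<infinity>" "Lp_norm M q f = ennreal (enn2real ?I powr (1 / q))" using assms(2) by (auto simp: Lp_norm_def Let_def split: if_splits)
 have "(enn2real ?I powr (1 / q)) powr q = enn2real ?I" using assms(3) by (simp add: powr_powr)
 then show ?thesis using I assms(1) by (simp add: Lq_le_def top.not_eq_extremum)
qed

lemma Lq_le_Lp_norm: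
 assumes f: "Lq_le M q f c" and q: "0 < q"
 shows "Lp_norm M q f <= ennreal c"
proof -
 let ?I = "\<integral>\<^sup>+ x. ennreal (\<bar>f x\<bar> powr q) \<partial>M"
 have c: "0 <= c" "?I <= ennreal (c powr q)" using f by (auto simp: Lq_le_def)
 then have "?I < \<infinity>" by (auto intro: le_less_trans)
 moreover have "enn2real ?I powr (1 / q) <= (c powr q) powr (1 / q)" using c(2) q by (intro powr_mono2 enn2real_leI) auto
 then have "enn2real ?I powr (1 / q) <= c" using c(1) q by (simp add: powr_powr)
 ultimately show ?thesis by (auto simp: Lp_norm_def Let_def intro: ennreal_leI)
qed

context innovations
begin

definition causal_path :: "((nat => 'e) => real) => int => (int => 'e) => real" where
 "causal_path g t e = g (%k. e (t - int k))"

lemma causal_path_measurable: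
 assumes g: "g : borel_measurable (\<Pi>\<^sub>M i\<in>UNIV. D)"
 shows "causal_path g t : borel_measurable S"
proof -
 have "(%e. %k. e (t - int k)) : S \<rightarrow>\<^sub>M (\<Pi>\<^sub>M i\<in>(UNIV :: nat set). D)"
  unfolding S_def by (rule measurable_PiM_single') (auto simp: space_PiM)
 from measurable_compose[OF this g] show ?thesis by (simp add: causal_path_def[abs_def])
qed

lemma causal_path_depends: "depends_on {..t} (causal_path g t)"
 unfolding depends_on_def causal_path_def by (auto intro!: arg_cong[where f=g])

lemma distr_shift: "distr S S (%e j. e (j + i)) = S"
proof -
 have "distr (Pi\<^sub>M UNIV (%_. D)) (\<Pi>\<^sub>M j\<in>UNIV. (%_. D) (j + i)) (%omega. \<lambda>n\<in>UNIV. omega (n + i)) = (\<Pi>\<^sub>M j\<in>UNIV. (%_. D) (j + i))"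
  by (rule distr_PiM_reindex) (auto simp: prob_space_D inj_on_def)
 then show ?thesis by (simp add: S_def restrict_def)
qed

text \<open>By stationarity it is enough to resample the innovation at time \<open>0\<close>.\<close>

lemma causal_path_resample:
 assumes g: "g : borel_measurable (\<Pi>\<^sub>M i\<in>UNIV. D)"
  and d: "Lq_le SxS q (%x. causal_path g (int n) (fst x) - causal_path g (int n) (mix (- {0}) (fst x) (snd x))) d"
 shows "resample_le q (causal_path g (i + int n)) i d"
proof -
 have [measurable]: "causal_path g t : borel_measurable S" for t by (rule causal_path_measurable[OF g])
 let ?s = "%e j. e (j + i) :: 'e"
 let ?f = "%x. causal_path g (int n) (fst x) - causal_path g (int n) (mix (- {0}) (fst x) (snd x))"
 have s [measurable]: "?s : S \<rightarrow>\<^sub>M S" unfolding S_def by (rule measurable_PiM_single') (auto simp: space_PiM)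
 have "SxS = distr SxS SxS (%(x, y). (?s x, ?s y))" using pair_measure_distr[OF s s] by (simp add: distr_shift S.sigma_finite_measure_axioms)
 then have "Lq_le (distr SxS SxS (%(x, y). (?s x, ?s y))) q ?f d" using d by (simp only:)
 then have "Lq_le SxS q (%x. ?f ((%(x, y). (?s x, ?s y)) x)) d" by (subst (asm) Lq_le_distr) measurable
 moreover have "?f ((%(x, y). (?s x, ?s y)) x) = causal_path g (i + int n) (fst x) - causal_path g (i + int n) (mix (- {i}) (fst x) (snd x))" for x
 proof -
  have "causal_path g (int n) (?s e) = causal_path g (i + int n) e" for e by (simp add: causal_path_def algebra_simps)
  moreover have "mix (- {0}) (?s e) (?s e') = ?s (mix (- {i}) e e')" for e e' by (auto simp: mix_def)
  ultimately show ?thesis by (simp add: case_prod_unfold)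
 qed
 ultimately show ?thesis by (simp add: resample_le_def)
qed

end

locale iid_input = prob_space \<Omega> for \<Omega> :: "'a measure" +
 fixes N :: "'e measure" and eps eps' :: "int => 'a => 'e"
 assumes iid: "iid \<Omega> N eps" and copy: "independent_copy \<Omega> N eps eps'"
begin

definition law :: "'e measure" where "law = distr \<Omega> N (eps 0)"

lemma eps_measurable [measurable]: "eps t : \<Omega> \<rightarrow>\<^sub>M N" using iid unfolding iid_def indep_vars_def by auto

sublocale I: innovations law
 by (rule innovations.intro) (unfold law_def, rule prob_space_distr, rule eps_measurable)

abbreviation innov :: "'a => int => 'e" where "innov omega \<equiv> (%t. eps t omega)"
abbreviation innov' :: "'a => int => 'e" where "innov' omega \<equiv> (%t. eps' t omega)"

lemma sets_S: "sets I.S = sets (\<Pi>\<^sub>M t\<in>UNIV. N)"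
 unfolding I.S_def by (intro sets_PiM_cong) (auto simp: law_def)

lemma path_measurable [measurable]: "innov : \<Omega> \<rightarrow>\<^sub>M I.S"
 unfolding measurable_cong_sets[OF refl sets_S] by (rule measurable_PiM_single') (auto simp: measurable_space[OF eps_measurable])

lemma distr_path: "distr \<Omega> I.S innov = I.S"
proof -
 have "distr \<Omega> (\<Pi>\<^sub>M t\<in>UNIV. N) (%omega. \<lambda>t\<in>UNIV. eps t omega) = (\<Pi>\<^sub>M t\<in>UNIV. distr \<Omega> N (eps t))"
  using iid indep_vars_iff_distr_eq_PiM'[where I=UNIV and M'="%_. N" and X=eps] by (auto simp: iid_def)
 moreover have "distr \<Omega> N (eps t) = law" for t using iid by (auto simp: iid_def law_def)
 ultimately have "distr \<Omega> (\<Pi>\<^sub>M t\<in>UNIV. N) innov = I.S" by (simp add: I.S_def restrict_def)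
 moreover have "distr \<Omega> I.S innov = distr \<Omega> (\<Pi>\<^sub>M t\<in>UNIV. N) innov" by (rule distr_cong) (auto simp: sets_S)
 ultimately show ?thesis by simp
qed

lemma pair_measurable: "(%omega. (innov omega, innov' omega)) : \<Omega> \<rightarrow>\<^sub>M I.S \<Otimes>\<^sub>M I.S"
 and distr_pair: "distr \<Omega> (I.S \<Otimes>\<^sub>M I.S) (%omega. (innov omega, innov' omega)) = I.S \<Otimes>\<^sub>M I.S"
proof -
 let ?S = "\<Pi>\<^sub>M t\<in>(UNIV::int set). N"
 have c: "distr \<Omega> ?S innov' = distr \<Omega> ?S innov" "indep_var ?S innov ?S innov'" using copy by (auto simp: independent_copy_def Let_def)
 then have m: "innov : \<Omega> \<rightarrow>\<^sub>M ?S" "innov' : \<Omega> \<rightarrow>\<^sub>M ?S"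
  and j: "distr \<Omega> ?S innov \<Otimes>\<^sub>M distr \<Omega> ?S innov' = distr \<Omega> (?S \<Otimes>\<^sub>M ?S) (%omega. (innov omega, innov' omega))"
  unfolding indep_var_distribution_eq by auto
 have s2: "sets (I.S \<Otimes>\<^sub>M I.S) = sets (?S \<Otimes>\<^sub>M ?S)" by (intro sets_pair_measure_cong sets_S)
 show "(%omega. (innov omega, innov' omega)) : \<Omega> \<rightarrow>\<^sub>M I.S \<Otimes>\<^sub>M I.S"
  unfolding measurable_cong_sets[OF refl s2] using m by measurable
 have "distr \<Omega> ?S innov = I.S" using distr_path distr_cong[OF refl sets_S, of \<Omega> innov innov] by simp
 then have "I.S \<Otimes>\<^sub>M I.S = distr \<Omega> (?S \<Otimes>\<^sub>M ?S) (%omega. (innov omega, innov' omega))" using j c(1) by simp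
 also have "... = distr \<Omega> (I.S \<Otimes>\<^sub>M I.S) (%omega. (innov omega, innov' omega))" by (rule distr_cong) (auto simp: s2)
 finally show "distr \<Omega> (I.S \<Otimes>\<^sub>M I.S) (%omega. (innov omega, innov' omega)) = I.S \<Otimes>\<^sub>M I.S" ..
qed

lemma Lq_le_path: "f : borel_measurable I.S ==> Lq_le \<Omega> q (%omega. f (innov omega)) c \<longleftrightarrow> Lq_le I.S q f c"
 using Lq_le_distr[OF path_measurable, of f q c] by (simp add: distr_path)

lemma expectation_path: "f : borel_measurable I.S ==> expectation (%omega. f (innov omega)) = (LINT e|I.S. f e)" for f :: "_ => real"
 using integral_distr[OF path_measurable, of f] by (simp add: distr_path)

lemma prob_path:
 assumes [measurable]: "Measurable.pred I.S P"
 shows "prob {omega:space \<Omega>. P (innov omega)} = I.S.prob {e:space I.S. P e}"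
proof -
 have "I.S.prob {e:space I.S. P e} = measure (distr \<Omega> I.S innov) {e:space I.S. P e}" by (simp add: distr_path)
 also have "... = prob (innov -` {e:space I.S. P e} Int space \<Omega>)" by (rule measure_distr) measurable
 also have "innov -` {e:space I.S. P e} Int space \<Omega> = {omega:space \<Omega>. P (innov omega)}" using measurable_space[OF path_measurable] by auto
 finally show ?thesis ..
qed

lemma causal_eq: "causal g eps t omega = I.causal_path g t (innov omega)" by (simp add: causal_def I.causal_path_def)

text \<open>The dependence coefficients of the observed process bound those of its copy on the space of
 innovations.\<close>

lemma causal_path_family:
 assumes g: "g : borel_measurable (\<Pi>\<^sub>M i\<in>(UNIV :: nat set). N)" and q: "0 < q" and X: "!!t. EX b. Lq_le \<Omega> q (causal g eps t) b"
  and mean: "!!t. expectation (causal g eps t) = 0" and \<Theta>: "dep_Theta \<Omega> g eps eps' q 0 < \<infinity>"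
 shows "I.causal_family q (I.causal_path g) (%n. enn2real (dep_delta \<Omega> g eps eps' q n))"
  and "enn2real (dep_Theta \<Omega> g eps eps' q m) = tail_sum (%n. enn2real (dep_delta \<Omega> g eps eps' q n)) m"
  and "Lq_le \<Omega> q (%omega. causal g eps (int n) omega - causal g (eps(0 := eps' 0)) (int n) omega) (enn2real (dep_delta \<Omega> g eps eps' q n))"
proof -
 let ?d = "dep_delta \<Omega> g eps eps' q"
 have g': "g : borel_measurable (\<Pi>\<^sub>M i\<in>(UNIV :: nat set). law)"
  using g by (subst measurable_cong_sets[OF sets_PiM_cong refl]) (auto simp: law_def)
 note cm [measurable] = I.causal_path_measurable[OF g']
 have fin: "?d n < \<infinity>" for n
 proof -
  have "(SUM k:{n}. ?d k) <= (\<Sum>k. ?d k)" by (rule sum_le_suminf) auto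
  also have "... < \<infinity>" using \<Theta> unfolding dep_Theta_def by (simp only: add_0)
  finally show ?thesis by simp
 qed
 then have d: "ennreal (enn2real (?d n)) = ?d n" for n by simp
 have "(\<Sum>n. ennreal (enn2real (?d n))) ~= top" using \<Theta> unfolding d by (simp add: dep_Theta_def)
 then have sm: "summable (%n. enn2real (?d n))" by (rule summable_suminf_not_top[OF enn2real_nonneg, of ?d])
 have smm: "summable (%n. enn2real (?d (n + m)))" by (rule summable_ignore_initial_segment[OF sm])
 have "dep_Theta \<Omega> g eps eps' q m = (\<Sum>n. ennreal (enn2real (?d (n + m))))"
  unfolding d by (simp add: dep_Theta_def add.commute)
 also have "... = ennreal (\<Sum>n. enn2real (?d (n + m)))" by (rule suminf_ennreal2[OF _ smm]) simp
 finally show "enn2real (dep_Theta \<Omega> g eps eps' q m) = tail_sum (%n. enn2real (?d n)) m" using suminf_nonneg[OF smm] by (simp add: tail_sum_def)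
 let ?f = "%n x. I.causal_path g (int n) (fst x) - I.causal_path g (int n) (mix (- {0}) (fst x) (snd x))"
 have eq: "causal g eps (int n) omega - causal g (eps(0 := eps' 0)) (int n) omega = ?f n (innov omega, innov' omega)" for n omega
  by (auto simp: causal_def I.causal_path_def mix_def intro!: arg_cong[where f=g])
 have fm: "?f n : borel_measurable (I.S \<Otimes>\<^sub>M I.S)" for n by measurable
 have m: "(%omega. ?f n (innov omega, innov' omega)) : borel_measurable \<Omega>" for n by (rule measurable_compose[OF pair_measurable fm])
 have L: "Lq_le \<Omega> q (%omega. ?f n (innov omega, innov' omega)) (enn2real (?d n))" for n
  using Lp_norm_finite_Lq_le[OF m _ q, of n] fin[of n] unfolding dep_delta_def eq by simp
 then show "Lq_le \<Omega> q (%omega. causal g eps (int n) omega - causal g (eps(0 := eps' 0)) (int n) omega) (enn2real (?d n))" unfolding eq .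
 have LS: "Lq_le (I.S \<Otimes>\<^sub>M I.S) q (?f n) (enn2real (?d n))" for n
  using Lq_le_distr[OF pair_measurable fm, of q n "enn2real (?d n)"] L unfolding distr_pair by simp
 show "I.causal_family q (I.causal_path g) (%n. enn2real (?d n))"
  unfolding I.causal_family_def
 proof (intro conjI allI impI sm)
  fix t
  obtain b where "Lq_le \<Omega> q (causal g eps t) b" using X by blast
  then show "EX b. Lq_le I.S q (I.causal_path g t) b" using Lq_le_path[OF cm] unfolding causal_eq[abs_def] by blast
  show "I.depends_on {..t} (I.causal_path g t)" by (rule I.causal_path_depends)
  show "(LINT e|I.S. I.causal_path g t e) = 0" using mean[of t] expectation_path[OF cm] unfolding causal_eq[abs_def] by simp
  fix i assume "i <= t"
  then show "I.resample_le q (I.causal_path g t) i (enn2real (?d (nat (t - i))))" using I.causal_path_resample[OF g' LS, of i "nat (t - i)"] by simp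
 qed simp
qed

end

lemma powr_dominated:
 assumes "a < (b::real)"
 shows "\<forall>\<^sub>F T in sequentially. c * real T powr a <= real T powr b"
proof -
 have "\<forall>\<^sub>F T in sequentially. c <= real T powr (b - a)"
 proof (rule eventually_sequentiallyI)
  fix T assume "nat \<lceil>(\<bar>c\<bar> + 1) powr (1 / (b - a))\<rceil> <= T"
  then have "(\<bar>c\<bar> + 1) powr (1 / (b - a)) <= real T" by linarith
  then have "((\<bar>c\<bar> + 1) powr (1 / (b - a))) powr (b - a) <= real T powr (b - a)" using assms by (intro powr_mono2) auto
  then show "c <= real T powr (b - a)" using assms by (simp add: powr_powr)
 qed
 then show ?thesis
 proof eventually_elim
  case (elim T)
  then have "c * real T powr a <= real T powr (b - a) * real T powr a" by (intro mult_right_mono) auto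
  then show ?case by (simp flip: powr_add)
 qed
qed

lemma ex_power2_between:
 assumes "1 <= (y::real)"
 shows "EX l. y <= 2 ^ l & 2 ^ l <= 2 * y"
proof -
 define l where "l = (LEAST l. y <= 2 ^ l)"
 have "EX l. y <= 2 ^ l" using real_arch_pow[of 2 y] by (auto intro: less_imp_le)
 then have l: "y <= 2 ^ l" unfolding l_def by (rule LeastI_ex)
 have "2 ^ l <= 2 * y"
 proof (cases l)
  case (Suc k)
  then have "\<not> y <= 2 ^ k" using not_less_Least[of k "%l. y <= 2 ^ l"] by (simp add: l_def)
  then show ?thesis using Suc by simp
 qed (use assms in simp)
 with l show ?thesis by blast
qed

context dependent_process
begin

text \<open>For large \<open>T\<close> a dyadic block length between \<open>T powr beta\<close> and \<open>2 * T powr beta\<close> fits between the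
 bandwidth and \<open>T\<close>.  The Gaussian exponent equals \<open>c\<^sup>2 * M * ln B / (384 * \<Theta> ^ 4)\<close> with the constant \<open>c\<close> of
 the threshold, and \<open>p > 4\<close> makes \<open>c\<close> at least \<open>8 * (5 / 2) * \<Theta>\<^sup>2\<close>.\<close>

lemma eventually_admissible:
 fixes B :: "nat => nat" and M \<gamma> beta \<Theta> C :: real
 defines "x \<equiv> threshold \<Theta> p M B"
 assumes M: "1 < M" and B: "filterlim B at_top at_top" "(%T. real (B T)) : O(%T. real T powr \<gamma>)"
  and \<gamma>: "0 < \<gamma>" "\<gamma> < beta" "beta < 1" and \<Theta>: "0 < \<Theta>" and C: "0 <= C"
 shows "EX K. \<forall>\<^sub>F T in sequentially. (EX l. admissible beta C (54 * real T * real (B T) * \<Theta> ^ 4) T l (B T) (x T)) &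
   exp (- ((3 * x T / 8)^2 / (4 * (54 * real T * real (B T) * \<Theta> ^ 4)))) <= real (B T) powr (- M) &
   real T powr (- p) <= K * tail_unit beta (real T) (real (B T)) (x T)"
proof -
 define c where "c = (p + 4) * exp (p / 4) * \<Theta>^2"
 have c: "0 < c" "400 * \<Theta> ^ 4 <= c^2"
 proof -
  show "0 < c" using p \<Theta> by (simp add: c_def)
  have "5 / 2 <= exp (1::real)" using exp_lower_Taylor_quadratic[of "1::real"] by simp
  also have "... <= exp (p / 4)" using p by simp
  finally have "8 * (5 / 2) <= (p + 4) * exp (p / 4)" using p by (intro mult_mono) auto
  then have "20 * \<Theta>^2 <= c" unfolding c_def by (intro mult_right_mono) auto
  then have "(20 * \<Theta>^2)^2 <= c^2" by (intro power_mono) auto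
  then show "400 * \<Theta> ^ 4 <= c^2" by (simp add: power_mult_distrib flip: power_mult)
 qed
 define h where "h = (1 - beta) * (p / 4 - 1) / p"
 have h: "0 < h" using \<gamma> p by (simp add: h_def)
 obtain c0 where c0: "0 < c0" "\<forall>\<^sub>F T in sequentially. norm (real (B T)) <= c0 * norm (real T powr \<gamma>)"
  using landau_o.bigE[OF B(2)] by blast
 define k where "k = 3 / 2 * c^2 * M * (2 / h) / (108 * \<Theta> ^ 4)"
 have "\<forall>\<^sub>F T in sequentially. 4 * real T powr beta <= real T powr 1" by (rule powr_dominated) (rule \<gamma>(3))
 moreover have "\<forall>\<^sub>F T in sequentially. (2 * c0) * real T powr \<gamma> <= real T powr beta" by (rule powr_dominated) (rule \<gamma>(2))
 moreover have "\<forall>\<^sub>F T in sequentially. k * real T powr (- (h / 2)) <= real T powr 0" by (rule powr_dominated) (use h in simp)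
 moreover have "\<forall>\<^sub>F T in sequentially. (2 * C^2) * real T powr ((1 + beta) / 2) <= real T powr 1" by (rule powr_dominated) (use \<gamma> in simp)
 moreover have "\<forall>\<^sub>F T in sequentially. nat \<lceil>exp (1 / (4 * c^2))\<rceil> + 8 <= B T" using B(1) by (simp add: filterlim_at_top)
 moreover note c0(2) eventually_ge_at_top[of "4::nat"]
 ultimately have "\<forall>\<^sub>F T in sequentially. (EX l. admissible beta C (54 * real T * real (B T) * \<Theta> ^ 4) T l (B T) (x T)) &
   exp (- ((3 * x T / 8)^2 / (4 * (54 * real T * real (B T) * \<Theta> ^ 4)))) <= real (B T) powr (- M) &
   real T powr (- p) <= (2 * c * sqrt M) powr (p / 2) * tail_unit beta (real T) (real (B T)) (x T)"
 proof eventually_elim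
  case (elim T)
  define t b where "t = real T" and "b = real (B T)"
  have t: "4 <= t" using elim(7) by (simp add: t_def)
  have B8: "8 <= B T" using elim(5) by simp
  then have b8: "8 <= b" by (simp add: b_def)
  have "exp (1 / (4 * c^2)) <= b" using elim(5) unfolding b_def by linarith
  then have "1 / (4 * c^2) <= ln b" using b8 by (simp add: ln_ge_iff)
  then have lb: "1 <= 4 * c^2 * ln b" using c by (simp add: pos_divide_le_eq mult_ac)
  have lb0: "0 < ln b" using b8 by simp
  have tb: "2 * b <= t powr beta" "4 * t powr beta <= t" using elim(1,2,6) t by (simp_all add: t_def b_def)
  have "b <= t" using tb b8 by linarith
  then have lnt: "ln b <= ln t" using b8 by simp
  have "1 <= t powr beta" using tb b8 by linarith
  from ex_power2_between[OF this] obtain l where l: "t powr beta <= 2 ^ l" "2 ^ l <= 2 * t powr beta" by blast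
  have xT: "x T = 2 * c * sqrt (t * M * b * ln b)" by (simp add: x_def threshold_def Let_def c_def t_def b_def)
  have x0: "0 < x T" unfolding xT using c t M b8 lb0 by simp
  have x2: "(x T)^2 = 4 * c^2 * (t * M * b * ln b)" unfolding xT using t M b8 lb0 by (simp add: power_mult_distrib)
  have xs: "sqrt (t * b) <= x T"
  proof (rule real_le_lsqrt)
   have "1 * 1 <= M * (4 * c^2 * ln b)" using M lb by (intro mult_mono) auto
   then have "(t * b) * 1 <= (t * b) * (M * (4 * c^2 * ln b))" using t b8 by (intro mult_left_mono) auto
   then show "t * b <= (x T)^2" unfolding x2 by (simp only: mult_ac mult_1_right)
  qed (use x0 in simp)
  have a6: "3 * x T / 8 * (x T * t powr (- h)) <= 2 * (54 * t * b * \<Theta> ^ 4)"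
  proof -
   have "ln t <= t powr (h / 2) / (h / 2)" using t h by (intro ln_powr_bound) auto
   then have "ln b * t powr (- h) <= t powr (h / 2) / (h / 2) * t powr (- h)" using lnt by (intro mult_right_mono) auto
   also have "... = 2 / h * (t powr (h / 2) * t powr (- h))" by simp
   also have "t powr (h / 2) * t powr (- h) = t powr (- (h / 2))" unfolding powr_add[symmetric] by simp
   finally have le: "ln b * t powr (- h) <= 2 / h * t powr (- (h / 2))" .
   have k1: "k * t powr (- (h / 2)) <= 1" using elim(3) t by (simp add: t_def)
   have "3 * x T / 8 * (x T * t powr (- h)) = 3 / 8 * (x T)^2 * t powr (- h)" by (simp add: power2_eq_square)
   also have "... = 3 / 2 * c^2 * M * (t * b) * (ln b * t powr (- h))" unfolding x2 by simp
   also have "... <= 3 / 2 * c^2 * M * (t * b) * (2 / h * t powr (- (h / 2)))" using le t b8 M by (intro mult_left_mono) auto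
   also have "... = (t * b) * (108 * \<Theta> ^ 4) * (k * t powr (- (h / 2)))" using \<Theta> by (simp add: k_def)
   also have "... <= (t * b) * (108 * \<Theta> ^ 4) * 1" using k1 t b8 \<Theta> by (intro mult_left_mono) auto
   finally show ?thesis by simp
  qed
  have a7: "C * sqrt (2 ^ l * b) * t powr ((1 - beta) / 4) <= x T"
  proof -
   have "(C * sqrt (2 ^ l * b) * t powr ((1 - beta) / 4))^2 = C^2 * (2 ^ l * b) * (t powr ((1 - beta) / 4) * t powr ((1 - beta) / 4))"
    using b8 by (simp add: power_mult_distrib power2_eq_square)
   also have "... <= C^2 * ((2 * t powr beta) * b) * (t powr ((1 - beta) / 4) * t powr ((1 - beta) / 4))"
    using l b8 by (intro mult_right_mono mult_left_mono) auto
   also have "... = b * ((2 * C^2) * (t powr beta * (t powr ((1 - beta) / 4) * t powr ((1 - beta) / 4))))" by (simp only: mult_ac)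
   also have "t powr beta * (t powr ((1 - beta) / 4) * t powr ((1 - beta) / 4)) = t powr ((1 + beta) / 2)"
    unfolding powr_add[symmetric] by (rule arg_cong2[where f="(powr)", OF refl]) (simp add: field_simps)
   also have "b * ((2 * C^2) * t powr ((1 + beta) / 2)) <= b * t" using elim(4) t b8 by (intro mult_left_mono) (auto simp: t_def)
   finally have "C * sqrt (2 ^ l * b) * t powr ((1 - beta) / 4) <= sqrt (t * b)" by (intro real_le_rsqrt) (simp add: mult.commute)
   then show ?thesis using xs by simp
  qed
  have adm: "admissible beta C (54 * real T * real (B T) * \<Theta> ^ 4) T l (B T) (x T)"
  proof -
   have "2 * 2 ^ l <= t" using l tb by linarith
   moreover have "2 * b <= 2 ^ l" using l tb by linarith
   then have "2 * B T <= 2 ^ l" unfolding b_def by (metis of_nat_le_iff of_nat_mult of_nat_numeral of_nat_power)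
   ultimately show ?thesis unfolding admissible_def using elim(7) l B8 xs a6 a7 by (simp add: t_def b_def h_def)
  qed
  have ex: "exp (- ((3 * x T / 8)^2 / (4 * (54 * real T * real (B T) * \<Theta> ^ 4)))) <= real (B T) powr (- M)"
  proof -
   have "(3 * x T / 8)^2 / (4 * (54 * t * b * \<Theta> ^ 4)) = c^2 * (M * ln b) / (384 * \<Theta> ^ 4)"
   proof -
    have "(3 * x T / 8)^2 = 9 / 64 * (x T)^2" by (simp add: power_mult_distrib power_divide)
    then show ?thesis using t b8 \<Theta> unfolding x2 by (simp add: field_simps)
   qed
   moreover have "M * ln b <= c^2 * (M * ln b) / (384 * \<Theta> ^ 4)"
   proof -
    have "384 * \<Theta> ^ 4 <= c^2" using c(2) \<Theta> by (intro order_trans[OF _ c(2)]) simp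
    then have "(M * ln b) * (384 * \<Theta> ^ 4) <= (M * ln b) * c^2" using M lb0 by (intro mult_left_mono) auto
    then show ?thesis using \<Theta> by (simp add: pos_le_divide_eq mult_ac)
   qed
   ultimately have "exp (- ((3 * x T / 8)^2 / (4 * (54 * t * b * \<Theta> ^ 4)))) <= exp (- M * ln b)" by simp
   then show ?thesis using b8 by (simp add: powr_def t_def b_def)
  qed
  have "real T powr (- p) <= (2 * c * sqrt M) powr (p / 2) * tail_unit beta (real T) (real (B T)) (x T)"
  proof -
   have "ln b <= t" using lnt ln_bound[of t] t by simp
   then have "t * M * b * ln b <= t * M * t * t" using \<open>b \<le> t\<close> t M b8 lb0 by (intro mult_mono) auto
   also have "... <= M * (t^2)^2" using t M by (simp add: power2_eq_square)
   finally have "sqrt (t * M * b * ln b) <= sqrt (M * (t^2)^2)" by (rule real_sqrt_le_mono)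
   also have "... = sqrt M * t^2" by (simp only: real_sqrt_mult real_sqrt_abs) simp
   finally have xle: "x T <= (2 * c * sqrt M) * t^2" unfolding xT using c by simp
   have t2: "(t^2) powr (p / 2) = t powr p" using t by (simp add: powr_powr flip: powr_numeral)
   have "(x T) powr (p / 2) <= ((2 * c * sqrt M) * t^2) powr (p / 2)" using xle x0 p by (intro powr_mono2) auto
   also have "... = (2 * c * sqrt M) powr (p / 2) * t powr p" by (simp only: powr_mult t2)
   finally have "t powr (- p) <= (2 * c * sqrt M) powr (p / 2) * (x T) powr (- (p / 2))" using x0 t by (simp add: powr_minus field_simps)
   also have "... <= (2 * c * sqrt M) powr (p / 2) * tail_unit beta t b (x T)"
   proof -
    have "x T powr (- (p / 2)) * 1 <= tail_unit beta t b (x T)"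
     unfolding tail_unit_def using t b8 by (intro mult_left_mono) (auto intro: add_increasing)
    then show ?thesis by (intro mult_left_mono) auto
   qed
   finally show ?thesis by (simp add: t_def b_def)
  qed
  with adm ex show ?case by blast
 qed
 then show ?thesis by blast
qed

lemma tail_bound_eq:
 "x ~= 0 ==> tail_bound C p M alpha beta B x T = ereal (C * ln (real T) * tail_unit beta (real T) (real (B T)) x + C * real (B T) powr (- M))"
 by (simp add: tail_bound_def tail_unit_def)

text \<open>If \<open>\<Theta> = 0\<close>, the threshold vanishes and the bound is infinite.  The finitely many small \<open>T\<close> are
 covered by the term \<open>B powr (- M)\<close> with a large constant.\<close>

theorem banded_form_tail:
 fixes B :: "nat => nat"
 assumes X4: "causal_family 4 X delta4" and t4: "tail_sum delta4 0 = \<Theta>"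
  and M: "1 < M" and B0: "!!T. 0 < B T" and B: "filterlim B at_top at_top" "(%T. real (B T)) : O(%T. real T powr \<gamma>)"
  and \<gamma>: "0 < \<gamma>" "\<gamma> < beta" "beta < 1"
 shows "EX C>0. \<forall>T\<ge>2. ALL a. banded a (B T) --> (ALL s t. a s t ~= 0 --> 1 <= s & t <= int T) -->
   ereal (\<P>(e in S. threshold \<Theta> p M B T <= \<bar>qform X a {1..int T} {1..int T} e - (LINT e|S. qform X a {1..int T} {1..int T} e)\<bar>))
    <= tail_bound C p M alpha beta B (threshold \<Theta> p M B T) T"
proof (cases "0 < \<Theta>")
 case False
 have "0 <= \<Theta>" unfolding t4[symmetric] using causal_family_delta[OF X4] by (intro tail_sum_nonneg) auto
 then have "threshold \<Theta> p M B T = 0" for T using False by (simp add: threshold_def Let_def)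
 then show ?thesis by (intro exI[of _ 1]) (simp add: tail_bound_def)
next
 case \<Theta>: True
 let ?x = "threshold \<Theta> p M B"
 have beta: "0 < beta" "beta < 1" using \<gamma> by auto
 obtain C where C: "0 <= C" and core: "!!T l B a x. admissible beta C (54 * real T * real B * \<Theta> ^ 4) T l B x ==> banded a B ==> (ALL s t. a s t ~= 0 --> 1 <= s & t <= int T) ==>
   \<P>(e in S. x <= \<bar>qform X a {1..int T} {1..int T} e - (LINT e|S. qform X a {1..int T} {1..int T} e)\<bar>)
    <= 4 * exp (- ((3 * x / 8)^2 / (4 * (54 * real T * real B * \<Theta> ^ 4)))) + C * (tail_unit beta (real T) (real B) x + real T powr (- p))"
  using quadratic_form_tail[OF beta X4 eq_refl[OF t4] \<Theta>] by blast
 obtain K T0 where K: "!!T. T0 <= T ==> (EX l. admissible beta C (54 * real T * real (B T) * \<Theta> ^ 4) T l (B T) (?x T)) &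
   exp (- ((3 * ?x T / 8)^2 / (4 * (54 * real T * real (B T) * \<Theta> ^ 4)))) <= real (B T) powr (- M) &
   real T powr (- p) <= K * tail_unit beta (real T) (real (B T)) (?x T)"
  using eventually_admissible[OF M B \<gamma> \<Theta> C] unfolding eventually_sequentially by blast
 define C' where "C' = C * (1 + \<bar>K\<bar>) / ln 2 + 4 + (SUM T<T0. real (B T) powr M)"
 have C'0: "0 <= C * (1 + \<bar>K\<bar>) / ln 2" "0 <= (SUM T<T0. real (B T) powr M)" using C by (auto intro: sum_nonneg)
 then have C': "0 < C'" "4 <= C'" "C * (1 + \<bar>K\<bar>) / ln 2 <= C'" "(SUM T<T0. real (B T) powr M) <= C'" by (auto simp: C'_def)
 show ?thesis
 proof (intro exI[of _ C'] conjI allI impI C'(1))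
  fix T and a :: "int => int => real"
  assume T: "2 <= T" and a: "banded a (B T)" and supp: "ALL s t. a s t ~= 0 --> 1 <= s & t <= int T"
  let ?P = "\<P>(e in S. ?x T <= \<bar>qform X a {1..int T} {1..int T} e - (LINT e|S. qform X a {1..int T} {1..int T} e)\<bar>)"
  let ?u = "tail_unit beta (real T) (real (B T)) (?x T)" and ?b = "real (B T) powr (- M)"
  have u0: "0 <= ?u" by (simp add: tail_unit_def)
  have l2: "0 < ln (2::real)" "ln 2 <= ln (real T)" using T by auto
  have "?P <= C' * ln (real T) * ?u + C' * ?b"
  proof (cases "T0 <= T")
   case True
   note K = K[OF True]
   then obtain l where "admissible beta C (54 * real T * real (B T) * \<Theta> ^ 4) T l (B T) (?x T)" by blast
   from core[OF this a supp] K have "?P <= 4 * ?b + C * (?u + K * ?u)"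
    using mult_left_mono[OF add_left_mono[of "real T powr (- p)" "K * ?u" ?u] C] by linarith
   also have "C * (?u + K * ?u) <= C * ((1 + \<bar>K\<bar>) * ?u)"
   proof -
    have "K * ?u <= \<bar>K\<bar> * ?u" using u0 by (intro mult_right_mono) auto
    then show ?thesis using C by (intro mult_left_mono) (auto simp: algebra_simps)
   qed
   also have "C * ((1 + \<bar>K\<bar>) * ?u) = (C * (1 + \<bar>K\<bar>) / ln 2) * ln 2 * ?u" using l2 by simp
   also have "... <= C' * ln (real T) * ?u" using l2 u0 C' C'0 by (intro mult_right_mono mult_mono) auto
   also have "4 * ?b <= C' * ?b" using C' by (intro mult_right_mono) auto
   finally show ?thesis by simp
  next
   case False
   have "?P <= 1" by simp
   also have "1 = real (B T) powr M * ?b" using B0[of T] by (simp flip: powr_add)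
   also have "real (B T) powr M <= C'" using False by (intro order_trans[OF member_le_sum C'(4)]) auto
   then have "real (B T) powr M * ?b <= C' * ?b" by (intro mult_right_mono) auto
   also have "0 <= C' * ln (real T) * ?u" using C' order_trans[OF less_imp_le l2(2)] l2(1) by (intro mult_nonneg_nonneg u0) auto
   then have "C' * ?b <= C' * ln (real T) * ?u + C' * ?b" by simp
   finally show ?thesis .
  qed
  then show "ereal ?P <= tail_bound C' p M alpha beta B (?x T) T" by (cases "?x T = 0") (simp_all add: tail_bound_eq, simp add: tail_bound_def)
 qed
qed

end

theorem theorem10:
 fixes \<Omega> :: "'a measure" and N :: "'e measure"
  and \<epsilon> \<epsilon>' :: "int \<Rightarrow> 'a \<Rightarrow> 'e"
  and g :: "(nat \<Rightarrow> 'e) \<Rightarrow> real"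
  and p \<alpha> M \<gamma> \<beta> :: real
  and B :: "nat \<Rightarrow> nat"
 defines "X \<equiv> causal g \<epsilon>"
 defines "\<Theta> \<equiv> dep_Theta \<Omega> g \<epsilon> \<epsilon>'"
 defines "x \<equiv> threshold (enn2real (\<Theta> 4 0)) p M B"
 assumes "prob_space \<Omega>"
  and "iid \<Omega> N \<epsilon>" and "iid \<Omega> N \<epsilon>'" and "independent_copy \<Omega> N \<epsilon> \<epsilon>'"
  and "g \<in> borel_measurable (\<Pi>\<^sub>M i\<in>(UNIV :: nat set). N)"
  and "p > 4"
  and "\<And>t. in_Lp \<Omega> p (X t)"
  and "\<And>t. prob_space.expectation \<Omega> (X t) = 0"
  and "\<Theta> p 0 < \<infinity>"
  and "\<alpha> > 0" and "(\<lambda>m. enn2real (\<Theta> p m)) \<in> O(\<lambda>m. real m powr (- \<alpha>))"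
  and "M > 1"
  and "\<And>T. B T > 0"
  and "filterlim B at_top at_top"
  and "0 < \<gamma>" and "\<gamma> < 1" and "(\<lambda>T. real (B T)) \<in> O(\<lambda>T. real T powr \<gamma>)"
  and "\<gamma> < \<beta>" and "\<beta> < 1"
 shows "\<exists>C>0. \<forall>a. banded_coeffs B a \<longrightarrow>
      (\<forall>T\<ge>2. ereal (measure \<Omega> {\<omega> \<in> space \<Omega>. \<bar>centered \<Omega> (quad_form (a T) X T) \<omega>\<bar> \<ge> x T})
          \<le> tail_bound C p M \<alpha> \<beta> B (x T) T)"
proof -
 note p = \<open>p > 4\<close>
 interpret prob_space \<Omega> by fact
 interpret iid_input \<Omega> N \<epsilon> \<epsilon>' by (intro iid_input.intro iid_input_axioms.intro assms(4,5,7))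
 have p0: "0 < p" "1 <= p" "2 < p" "2 < p / 2" using p by auto
 have LX: "Lq_le \<Omega> p (causal g \<epsilon> t) (enn2real (Lp_norm \<Omega> p (causal g \<epsilon> t)))" for t
  using assms(10)[of t] p0(1) unfolding X_def in_Lp_def by (intro Lp_norm_finite_Lq_le) auto
 have mean: "expectation (causal g \<epsilon> t) = 0" for t using assms(11) unfolding X_def .
 have \<Theta>p: "dep_Theta \<Omega> g \<epsilon> \<epsilon>' p 0 < \<infinity>" using assms(12) unfolding \<Theta>_def .
 define \<delta> \<delta>4 where "\<delta> = (%n. enn2real (dep_delta \<Omega> g \<epsilon> \<epsilon>' p n))" and "\<delta>4 = (%n. enn2real (dep_delta \<Omega> g \<epsilon> \<epsilon>' 4 n))"
 have ex: "\<exists>b. Lq_le \<Omega> p (causal g \<epsilon> t) b" for t using LX by blast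
 note fam = causal_path_family[OF assms(8) p0(1) ex mean \<Theta>p, folded \<delta>_def]
 have Xp: "I.causal_family p (I.causal_path g) \<delta>" by (rule fam(1))
 note dn = I.causal_family_delta[OF Xp]
 have ex4: "\<exists>b. Lq_le \<Omega> 4 (causal g \<epsilon> t) b" for t using Lq_le_exponent_mono[OF LX, of 4] p by force
 have \<Theta>4: "dep_Theta \<Omega> g \<epsilon> \<epsilon>' 4 0 < \<infinity>"
 proof -
  have le: "dep_delta \<Omega> g \<epsilon> \<epsilon>' 4 n <= ennreal (\<delta> n)" for n
   using Lq_le_Lp_norm[OF Lq_le_exponent_mono[OF fam(3), of 4]] p by (simp add: \<delta>_def dep_delta_def)
  have "(\<Sum>n. dep_delta \<Omega> g \<epsilon> \<epsilon>' 4 n) <= (\<Sum>n. ennreal (\<delta> n))" by (intro suminf_le summableI le)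
  also have "\<dots> < \<infinity>" using dn by (simp add: suminf_ennreal2)
  finally show ?thesis by (simp add: dep_Theta_def)
 qed
 note fam4 = causal_path_family[OF assms(8) _ ex4 mean \<Theta>4, simplified, folded \<delta>4_def]
 have X4: "I.causal_family 4 (I.causal_path g) \<delta>4" and t4: "tail_sum \<delta>4 0 = enn2real (\<Theta> 4 0)"
  using fam4(1) fam4(2)[of 0] by (simp_all add: \<Theta>_def)
 obtain Kp where Kp: "mart_step I.S p Kp" using I.S.mart_step_exists[OF p0(3)] by blast
 obtain Kq where Kq: "mart_step I.S (p / 2) Kq" using I.S.mart_step_exists[OF p0(4)] by blast
 have tail: "(%m. tail_sum \<delta> m) \<in> O(%m. real m powr (- \<alpha>))" using assms(14) fam(2) by (simp add: \<Theta>_def)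
 obtain c m0 where c: "0 < c" "!!m. m0 <= m ==> norm (tail_sum \<delta> m) <= c * norm (real m powr (- \<alpha>))"
  using landau_o.bigE[OF tail] unfolding eventually_sequentially by blast
 have t0: "0 <= tail_sum \<delta> m" for m by (rule tail_sum_nonneg[OF dn])
 define A where "A = 1 + c + tail_sum \<delta> 0 * (1 + real m0 powr \<alpha>)"
 have A: "1 <= A" "c <= A" "tail_sum \<delta> 0 <= A" "tail_sum \<delta> 0 * real m0 powr \<alpha> <= A"
  using c(1) t0[of 0] by (auto simp: A_def distrib_left)
 have tail_le: "tail_sum \<delta> m <= A * real m powr (- \<alpha>)" if m: "1 <= m" for m
 proof (cases "m0 <= m")
  case True
  have "tail_sum \<delta> m <= c * real m powr (- \<alpha>)" using c(2)[OF True] by simp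
  also have "\<dots> <= A * real m powr (- \<alpha>)" by (intro mult_right_mono A) auto
  finally show ?thesis .
 next
  case False
  have "tail_sum \<delta> m * real m powr \<alpha> <= tail_sum \<delta> 0 * real m0 powr \<alpha>"
   using False \<open>\<alpha> > 0\<close> t0 by (intro mult_mono powr_mono2 tail_sum_antimono[OF dn]) auto
  then have "tail_sum \<delta> m * real m powr \<alpha> <= A" using A(4) by simp
  then show ?thesis using m by (simp add: powr_minus pos_le_divide_eq flip: divide_inverse)
 qed
 interpret P: dependent_process law "I.causal_path g" \<delta> p \<alpha> A Kp Kq
  by (intro dependent_process.intro dependent_process_axioms.intro I.innovations_axioms p assms(13) A(1,3) Xp Kp Kq tail_le)
 obtain C where C: "0 < C" and main: "!!T a. 2 <= T ==> P.banded a (B T) ==> (\<forall>s t. a s t \<noteq> 0 --> 1 <= s \<and> t <= int T) ==>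
   ereal (I.S.prob {e\<in>space I.S. threshold (enn2real (\<Theta> 4 0)) p M B T <=
     \<bar>I.qform (I.causal_path g) a {1..int T} {1..int T} e - (\<integral>e. I.qform (I.causal_path g) a {1..int T} {1..int T} e \<partial>I.S)\<bar>})
    <= tail_bound C p M \<alpha> \<beta> B (threshold (enn2real (\<Theta> 4 0)) p M B T) T"
  using P.banded_form_tail[OF X4 t4 assms(15-17,20,18,21,22)] by blast
 show ?thesis
 proof (intro exI[of _ C] conjI allI impI C)
  fix a and T :: nat assume a: "banded_coeffs B a" and T: "2 <= T"
  define b where "b = (%s t. if 1 <= s \<and> s <= t \<and> t <= int T then a T (nat s) (nat t) else 0)"
  have b: "P.banded b (B T)"
   unfolding P.banded_def
  proof (intro allI)
   fix s t
   show "\<bar>b s t\<bar> <= 1 \<and> (b s t \<noteq> 0 --> s <= t \<and> t - s <= int (B T))"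
   proof (cases "1 <= s \<and> s <= t \<and> t <= int T")
    case True
    then have "nat s \<in> {1..T}" "nat t \<in> {1..T}" by auto
    from a[unfolded banded_coeffs_def, rule_format, OF this] True show ?thesis by (auto simp: b_def)
   next
    case False
    then have "b s t = 0" unfolding b_def by (rule if_not_P)
    then show ?thesis by simp
   qed
  qed
  let ?q = "I.qform (I.causal_path g) b {1..int T} {1..int T}"
  have qm [measurable]: "?q \<in> borel_measurable I.S" by (rule I.qform_measurable[OF Xp])
  have q: "quad_form (a T) X T \<omega> = ?q (innov \<omega>)" for \<omega>
  proof -
   let ?Y = "%t. I.causal_path g t (innov \<omega>)"
   have "?q (innov \<omega>) = (\<Sum>t\<in>int ` {1..T}. \<Sum>s\<in>int ` {1..T}. b s t * ?Y s * ?Y t)"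
    by (simp add: I.qform_def image_int_atLeastAtMost)
   also have "\<dots> = (\<Sum>t\<in>{1..T}. \<Sum>s\<in>{1..T}. b (int s) (int t) * ?Y (int s) * ?Y (int t))"
    by (simp add: sum.reindex)
   also have "\<dots> = (\<Sum>t\<in>{1..T}. \<Sum>s\<in>{1..t}. a T s t * ?Y (int s) * ?Y (int t))"
    by (intro sum.cong refl sum.mono_neutral_cong_right) (auto simp: b_def)
   finally show ?thesis by (simp add: quad_form_def X_def causal_eq)
  qed
  have "centered \<Omega> (quad_form (a T) X T) \<omega> = ?q (innov \<omega>) - (\<integral>e. ?q e \<partial>I.S)" for \<omega>
   unfolding centered_def q[abs_def] expectation_path[OF qm] ..
  then have "measure \<Omega> {\<omega> \<in> space \<Omega>. \<bar>centered \<Omega> (quad_form (a T) X T) \<omega>\<bar> \<ge> x T} = I.S.prob {e\<in>space I.S. x T <= \<bar>?q e - (\<integral>e. ?q e \<partial>I.S)\<bar>}"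
   using prob_path[of "%e. x T <= \<bar>?q e - (\<integral>e. ?q e \<partial>I.S)\<bar>"] by simp
  then show "ereal (measure \<Omega> {\<omega> \<in> space \<Omega>. \<bar>centered \<Omega> (quad_form (a T) X T) \<omega>\<bar> \<ge> x T}) <= tail_bound C p M \<alpha> \<beta> B (x T) T"
   using main[OF T b] unfolding x_def by (simp add: b_def)
 qed
qed

end
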